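(* Let $\mathcal P$ be an operad in $\mathbb F_2$-vector spaces, $\star\in\mathcal P(2)^{\mathfrak S_2}$ a commutative operation, and $M$ an unstable module. Set $$K_{\mathcal P}^\star(M):=S(\mathcal P,M)/\big(\{Sq_0\mathfrak t+\star(\mathfrak t,\mathfrak t):\mathfrak t\in S(\mathcal P,M)\}\big)_{\mathcal P,\mathcal U}.$$ Then $K_{\mathcal P}^\star(M)$ is a $\star$-unstable $\mathcal P$-algebra. Moreover, $M\mapsto K_{\mathcal P}^\star(M)$ gives a functor $\mathcal U\to\mathcal K_{\mathcal P}^\star$ which is left adjoint to the forgetful functor $\mathcal K_{\mathcal P}^\star\to\mathcal U$.
   Context: Base field $\mathbb F=\mathbb F_2$. $\mathcal A$ is the mod 2 Steenrod algebra ($Sq^0=1$). $\mathcal U$ is the category of unstable modules: graded left $\mathcal A$-modules $M$ with $Sq^ix=0$ for $i>|x|$; $Sq_0x:=Sq^{|x|}x$ for homogeneous $x$, extended additively. Tensor products in $\mathcal U$ carry the action $Sq^i(x\otimes y)=\sum_{k+l=i}Sq^kx\otimes Sq^ly$. Operads are symmetric operads in $\mathbb F$-vector spaces, regarded as concentrated in degree $0$. $S(\mathcal P,M)=\bigoplus_{n\ge0}\mathcal P(n)\otimes_{\mathfrak S_n}M^{\otimes n}$, which is an unstable module if $M$ is one; a $\mathcal P$-algebra in $\mathcal U$ is an algebra over the monad $S(\mathcal P,-)$ on $\mathcal U$, and $\mathcal P_{\mathrm{alg}}^{\mathcal U}$ denotes their category. A $\star$-unstable $\mathcal P$-algebra is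 a $\mathcal P$-algebra $N$ in $\mathcal U$ with $Sq_0x=\star(x,x)$ for all $x\in N$; $\mathcal K_{\mathcal P}^\star$ is the full subcategory of $\mathcal P_{\mathrm{alg}}^{\mathcal U}$ they form. A $\mathcal P$-ideal $I$ of a $\mathcal P$-algebra $A$ is a subspace with $\mu(a_1,\dots,a_n)\in I$ whenever $\mu\in\mathcal P(n)$, $a_1,\dots,a_n\in A$, $a_n\in I$. A $\mathcal P$-ideal in $\mathcal U$ is a $\mathcal P$-ideal stable under the action of $\mathcal A$. $(X)_{\mathcal P,\mathcal U}$ is the smallest $\mathcal P$-ideal in $\mathcal U$ containing $X$. *)

theory Defs
  imports
    "HOL-Algebra.Module"
    "HOL-Algebra.AbelCoset"
    "HOL-Combinatorics.Permutations"
    "HOL-Library.FuncSet"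
    "HOL-Library.Poly_Mapping"
    "HOL-Library.Z2"
begin

section \<open>Vector spaces over the field with two elements\<close>

text \<open>Vector spaces are modules in the sense of HOL-Algebra over the ring \<open>F2\<close>; the
  multiplicative fields of a module record carry no meaning and are left undefined below.\<close>

definition F2 :: "bit ring" where
  "F2 = \<lparr>carrier = UNIV, monoid.mult = (*), one = 1, zero = 0, add = (+)\<rparr>"

text \<open>Maps are extensional (equal to \<open>undefined\<close> outside the carrier), so that
  equality of functions is equality of morphisms.\<close>

definition linear_maps :: "(bit, 'a, 'm) module_scheme \<Rightarrow> (bit, 'b, 'n) module_scheme \<Rightarrow> ('a \<Rightarrow> 'b) set" where
  "linear_maps V W = {f \<in> carrier V \<rightarrow>\<^sub>E carrier W.
     (\<forall>x\<in>carrier V. \<forall>y\<in>carrier V. f (x \<oplus>\<^bsub>V\<^esub> y) = f x \<oplus>\<^bsub>W\<^esub> f y) \<and>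
     (\<forall>c. \<forall>x\<in>carrier V. f (c \<odot>\<^bsub>V\<^esub> x) = c \<odot>\<^bsub>W\<^esub> f x)}"

definition lin_span :: "(bit, 'a, 'm) module_scheme \<Rightarrow> 'a set \<Rightarrow> 'a set" where
  "lin_span V X = \<Inter>{W. submodule W F2 V \<and> X \<subseteq> W}"

definition free_space :: "'b set \<Rightarrow> (bit, 'b \<Rightarrow>\<^sub>0 bit) module" where
  "free_space B = \<lparr>carrier = {F. Poly_Mapping.keys F \<subseteq> B},
     monoid.mult = undefined, one = undefined, zero = 0, add = (+),
     smult = (\<lambda>c. Poly_Mapping.map ((*) c))\<rparr>"

definition lin_ext :: "(bit, 'v, 'm) module_scheme \<Rightarrow> ('b \<Rightarrow> 'v) \<Rightarrow> ('b \<Rightarrow>\<^sub>0 bit) \<Rightarrow> 'v" where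
  "lin_ext V f F = (\<Oplus>\<^bsub>V\<^esub>b\<in>Poly_Mapping.keys F. Poly_Mapping.lookup F b \<odot>\<^bsub>V\<^esub> f b)"

text \<open>Elements of a quotient are cosets. A map out of a quotient is defined by
  applying \<open>the_elem\<close> to the image of a coset under a map that is constant on it.\<close>

definition quot_space :: "(bit, 'a, 'm) module_scheme \<Rightarrow> 'a set \<Rightarrow> (bit, 'a set) module" where
  "quot_space V W = \<lparr>carrier = a_rcosets\<^bsub>V\<^esub> W,
     monoid.mult = undefined, one = undefined, zero = W, add = set_add V,
     smult = (\<lambda>c X. the_elem ((\<lambda>x. W +>\<^bsub>V\<^esub> (c \<odot>\<^bsub>V\<^esub> x)) ` X))\<rparr>"


section \<open>Unstable modules over the mod 2 Steenrod algebra\<close>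

text \<open>\<open>hdeg M d\<close> is the subspace of homogeneous elements of degree \<open>d\<close>. Instability for
  \<open>Sq\<^sup>0 = 1\<close> kills negative degrees, so degrees are natural numbers.\<close>

record 'a umodule = "(bit, 'a) module" +
  hdeg :: "nat \<Rightarrow> 'a set"
  Sq :: "nat \<Rightarrow> 'a \<Rightarrow> 'a"

definition is_decomposition :: "('a, 'm) umodule_scheme \<Rightarrow> 'a \<Rightarrow> (nat \<Rightarrow> 'a) \<Rightarrow> bool" where
  "is_decomposition M x c \<longleftrightarrow> (\<forall>d. c d \<in> hdeg M d) \<and> finite {d. c d \<noteq> \<zero>\<^bsub>M\<^esub>} \<and>
     x = (\<Oplus>\<^bsub>M\<^esub>d\<in>{d. c d \<noteq> \<zero>\<^bsub>M\<^esub>}. c d)"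

text \<open>The Steenrod algebra is the algebra on generators \<open>Sq\<^sup>i\<close> subject to \<open>Sq\<^sup>0 = 1\<close> and the
  Adem relations; a left module over it is a vector space with linear operators \<open>Sq\<^sup>i\<close>
  satisfying these relations.\<close>

locale unstable_module = module F2 M for M :: "('a, 'm) umodule_scheme" (structure) +
  assumes hdeg_submodule: "submodule (hdeg M d) F2 M"
    and grading: "x \<in> carrier M \<Longrightarrow> \<exists>!c. is_decomposition M x c"
    and Sq_linear: "restrict (Sq M i) (carrier M) \<in> linear_maps M M"
    and Sq_degree: "x \<in> hdeg M d \<Longrightarrow> Sq M i x \<in> hdeg M (d + i)"
    and Sq_zero: "x \<in> carrier M \<Longrightarrow> Sq M 0 x = x"
    and Adem: "\<lbrakk>0 < a; a < 2 * b; x \<in> carrier M\<rbrakk> \<Longrightarrow>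
      Sq M a (Sq M b x) =
        (\<Oplus>\<^bsub>M\<^esub>j\<in>{0..a div 2}. of_nat ((b - j - 1) choose (a - 2 * j)) \<odot>\<^bsub>M\<^esub> Sq M (a + b - j) (Sq M j x))"
    and unstable: "\<lbrakk>x \<in> hdeg M d; d < i\<rbrakk> \<Longrightarrow> Sq M i x = \<zero>\<^bsub>M\<^esub>"

definition U_hom :: "('a, 'm) umodule_scheme \<Rightarrow> ('b, 'n) umodule_scheme \<Rightarrow> ('a \<Rightarrow> 'b) set" where
  "U_hom M N = {f \<in> linear_maps M N.
     (\<forall>d. \<forall>x\<in>hdeg M d. f x \<in> hdeg N d) \<and>
     (\<forall>i. \<forall>x\<in>carrier M. f (Sq M i x) = Sq N i (f x))}"

definition homog_component :: "('a, 'm) umodule_scheme \<Rightarrow> nat \<Rightarrow> 'a \<Rightarrow> 'a" where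
  "homog_component M d x = (THE c. is_decomposition M x c) d"

definition Sq0 :: "('a, 'm) umodule_scheme \<Rightarrow> 'a \<Rightarrow> 'a" where
  "Sq0 M x = (\<Oplus>\<^bsub>M\<^esub>d\<in>{d. homog_component M d x \<noteq> \<zero>\<^bsub>M\<^esub>}. Sq M d (homog_component M d x))"


section \<open>Symmetric operads\<close>

text \<open>\<open>opact P n \<sigma> \<mu>\<close> is the right action \<open>\<mu> \<cdot> \<sigma>\<close>, and
  \<open>opcomp P [k\<^sub>1,\<dots>,k\<^sub>n] \<mu> [\<nu>\<^sub>1,\<dots>,\<nu>\<^sub>n]\<close> is \<open>\<gamma>(\<mu>; \<nu>\<^sub>1,\<dots>,\<nu>\<^sub>n)\<close>
  for \<open>\<mu>\<close> of arity \<open>n\<close> and \<open>\<nu>\<^sub>i\<close> of arity \<open>k\<^sub>i\<close>. The arities are arguments because the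
  carriers of the spaces \<open>ops P n\<close> may overlap.\<close>

record 'p operad_data =
  ops :: "nat \<Rightarrow> (bit, 'p) module"
  opact :: "nat \<Rightarrow> (nat \<Rightarrow> nat) \<Rightarrow> 'p \<Rightarrow> 'p"
  opunit :: 'p
  opcomp :: "nat list \<Rightarrow> 'p \<Rightarrow> 'p list \<Rightarrow> 'p"

text \<open>\<open>idx_blocks [k\<^sub>1,\<dots>,k\<^sub>n]\<close> cuts \<open>[0..<k\<^sub>1 + \<dots> + k\<^sub>n]\<close> into consecutive blocks of lengths \<open>k\<^sub>i\<close>.
  Write \<open>xs \<cdot> \<sigma>\<close> for \<open>permute_list \<sigma> xs\<close>, which is \<open>[x\<^bsub>\<sigma> 0\<^esub>, x\<^bsub>\<sigma> 1\<^esub>, \<dots>]\<close> and a right action.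
  If \<open>xss\<close> has block lengths \<open>ks\<close>, then
  \<open>concat xss \<cdot> block_perm \<sigma> ks = concat (xss \<cdot> \<sigma>)\<close>, and
  \<open>concat xss \<cdot> sum_perm [\<tau>\<^sub>1,\<dots>,\<tau>\<^sub>n] ks = concat [xs\<^sub>1 \<cdot> \<tau>\<^sub>1, \<dots>, xs\<^sub>n \<cdot> \<tau>\<^sub>n]\<close>.\<close>

definition idx_blocks :: "nat list \<Rightarrow> nat list list" where
  "idx_blocks ks = map (\<lambda>i. [sum_list (take i ks)..<sum_list (take (Suc i) ks)]) [0..<length ks]"

definition list_perm :: "nat list \<Rightarrow> nat \<Rightarrow> nat" where
  "list_perm L = (\<lambda>i. if i < length L then L ! i else i)"

definition block_perm :: "(nat \<Rightarrow> nat) \<Rightarrow> nat list \<Rightarrow> nat \<Rightarrow> nat" where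
  "block_perm \<sigma> ks = list_perm (concat (permute_list \<sigma> (idx_blocks ks)))"

definition sum_perm :: "(nat \<Rightarrow> nat) list \<Rightarrow> nat list \<Rightarrow> nat \<Rightarrow> nat" where
  "sum_perm \<tau>s ks = list_perm (concat (map2 permute_list \<tau>s (idx_blocks ks)))"

definition op_list :: "'p operad_data \<Rightarrow> nat list \<Rightarrow> 'p list \<Rightarrow> bool" where
  "op_list P ks \<nu>s \<longleftrightarrow> list_all2 (\<lambda>k \<nu>. \<nu> \<in> carrier (ops P k)) ks \<nu>s"

text \<open>The equivariance axioms are those of the endomorphism operad, where
  \<open>(\<mu> \<cdot> \<sigma>)(xs \<cdot> \<sigma>) = \<mu>(xs)\<close>.\<close>

locale operad =
  fixes P :: "'p operad_data"
  assumes ops_module: "module F2 (ops P n)"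
    and opact_linear: "\<sigma> permutes {..<n} \<Longrightarrow>
      restrict (opact P n \<sigma>) (carrier (ops P n)) \<in> linear_maps (ops P n) (ops P n)"
    and opact_id: "\<mu> \<in> carrier (ops P n) \<Longrightarrow> opact P n id \<mu> = \<mu>"
    and opact_comp: "\<lbrakk>\<sigma> permutes {..<n}; \<tau> permutes {..<n}; \<mu> \<in> carrier (ops P n)\<rbrakk> \<Longrightarrow>
      opact P n (\<sigma> \<circ> \<tau>) \<mu> = opact P n \<tau> (opact P n \<sigma> \<mu>)"
    and opunit_closed: "opunit P \<in> carrier (ops P 1)"
    and opcomp_linear_left: "op_list P ks \<nu>s \<Longrightarrow>
      (\<lambda>\<mu>\<in>carrier (ops P (length ks)). opcomp P ks \<mu> \<nu>s)
        \<in> linear_maps (ops P (length ks)) (ops P (sum_list ks))"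
    and opcomp_linear_slot: "\<lbrakk>\<mu> \<in> carrier (ops P (length ks)); op_list P ks \<nu>s; i < length ks\<rbrakk> \<Longrightarrow>
      (\<lambda>\<nu>\<in>carrier (ops P (ks ! i)). opcomp P ks \<mu> (\<nu>s[i := \<nu>]))
        \<in> linear_maps (ops P (ks ! i)) (ops P (sum_list ks))"
    and unit_left: "\<mu> \<in> carrier (ops P n) \<Longrightarrow> opcomp P [n] (opunit P) [\<mu>] = \<mu>"
    and unit_right: "\<mu> \<in> carrier (ops P n) \<Longrightarrow>
      opcomp P (replicate n 1) \<mu> (replicate n (opunit P)) = \<mu>"
    and assoc: "\<lbrakk>\<mu> \<in> carrier (ops P (length ks)); op_list P ks \<nu>s;
        map length jss = ks; list_all2 (op_list P) jss \<xi>ss\<rbrakk> \<Longrightarrow>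
      opcomp P (concat jss) (opcomp P ks \<mu> \<nu>s) (concat \<xi>ss) =
      opcomp P (map sum_list jss) \<mu>
        (map (\<lambda>(js, \<nu>, \<xi>s). opcomp P js \<nu> \<xi>s) (zip jss (zip \<nu>s \<xi>ss)))"
    and equivariance_outer: "\<lbrakk>\<sigma> permutes {..<length ks}; \<mu> \<in> carrier (ops P (length ks)); op_list P ks \<nu>s\<rbrakk> \<Longrightarrow>
      opcomp P (permute_list \<sigma> ks) (opact P (length ks) \<sigma> \<mu>) (permute_list \<sigma> \<nu>s) =
      opact P (sum_list ks) (block_perm \<sigma> ks) (opcomp P ks \<mu> \<nu>s)"
    and equivariance_inner: "\<lbrakk>\<mu> \<in> carrier (ops P (length ks)); op_list P ks \<nu>s;
        list_all2 (\<lambda>\<tau> k. \<tau> permutes {..<k}) \<tau>s ks\<rbrakk> \<Longrightarrow>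
      opcomp P ks \<mu> (map (\<lambda>(k, \<tau>, \<nu>). opact P k \<tau> \<nu>) (zip ks (zip \<tau>s \<nu>s))) =
      opact P (sum_list ks) (sum_perm \<tau>s ks) (opcomp P ks \<mu> \<nu>s)"

definition op_invariants :: "'p operad_data \<Rightarrow> nat \<Rightarrow> 'p set" where
  "op_invariants P n = {\<mu> \<in> carrier (ops P n). \<forall>\<sigma>. \<sigma> permutes {..<n} \<longrightarrow> opact P n \<sigma> \<mu> = \<mu>}"


section \<open>The monad \<open>S(P, -)\<close>\<close>

text \<open>The direct sum of the spaces \<open>P(n) \<otimes>\<^bsub>S\<^sub>n\<^esub> M\<^sup>\<otimes>\<^sup>n\<close> is built in one step: the free vector
  space on the symbols \<open>(\<mu>, [x\<^sub>1,\<dots>,x\<^sub>n])\<close> with \<open>\<mu> \<in> P(n)\<close>, whose arity \<open>n\<close> is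
  the length of the list, modulo the relations of the tensor product and
  \<open>\<mu>\<sigma> \<otimes> x = \<mu> \<otimes> \<sigma>x\<close>, where \<open>\<sigma>x = (x\<^bsub>\<sigma>\<^sup>-\<^sup>1(1)\<^esub>, \<dots>, x\<^bsub>\<sigma>\<^sup>-\<^sup>1(n)\<^esub>)\<close>.\<close>

type_synonym ('p, 'a) schur = "(('p \<times> 'a list) \<Rightarrow>\<^sub>0 bit) set"

definition symbols :: "'p operad_data \<Rightarrow> ('a, 'm) umodule_scheme \<Rightarrow> ('p \<times> 'a list) set" where
  "symbols P M = {(\<mu>, xs). set xs \<subseteq> carrier M \<and> \<mu> \<in> carrier (ops P (length xs))}"

abbreviation symb :: "'p \<Rightarrow> 'a list \<Rightarrow> ('p \<times> 'a list) \<Rightarrow>\<^sub>0 bit" where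
  "symb \<mu> xs \<equiv> Poly_Mapping.single (\<mu>, xs) 1"

definition schur_relators :: "'p operad_data \<Rightarrow> ('a, 'm) umodule_scheme \<Rightarrow> (('p \<times> 'a list) \<Rightarrow>\<^sub>0 bit) set" where
  "schur_relators P M =
     {symb (\<mu> \<oplus>\<^bsub>ops P (length xs)\<^esub> \<nu>) xs - symb \<mu> xs - symb \<nu> xs | \<mu> \<nu> xs.
        (\<mu>, xs) \<in> symbols P M \<and> (\<nu>, xs) \<in> symbols P M} \<union>
     {symb (c \<odot>\<^bsub>ops P (length xs)\<^esub> \<mu>) xs - Poly_Mapping.single (\<mu>, xs) c | c \<mu> xs.
        (\<mu>, xs) \<in> symbols P M} \<union>
     {symb \<mu> (xs @ (x \<oplus>\<^bsub>M\<^esub> y) # ys) - symb \<mu> (xs @ x # ys) - symb \<mu> (xs @ y # ys) | \<mu> xs x y ys.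
        (\<mu>, xs @ x # ys) \<in> symbols P M \<and> y \<in> carrier M} \<union>
     {symb \<mu> (xs @ (c \<odot>\<^bsub>M\<^esub> x) # ys) - Poly_Mapping.single (\<mu>, xs @ x # ys) c | c \<mu> xs x ys.
        (\<mu>, xs @ x # ys) \<in> symbols P M} \<union>
     {symb (opact P (length xs) \<sigma> \<mu>) xs - symb \<mu> (permute_list (inv_into UNIV \<sigma>) xs) | \<sigma> \<mu> xs.
        (\<mu>, xs) \<in> symbols P M \<and> \<sigma> permutes {..<length xs}}"

definition schur_null :: "'p operad_data \<Rightarrow> ('a, 'm) umodule_scheme \<Rightarrow> (('p \<times> 'a list) \<Rightarrow>\<^sub>0 bit) set" where
  "schur_null P M = lin_span (free_space (symbols P M)) (schur_relators P M)"

definition schur_space :: "'p operad_data \<Rightarrow> ('a, 'm) umodule_scheme \<Rightarrow> (bit, ('p, 'a) schur) module" where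
  "schur_space P M = quot_space (free_space (symbols P M)) (schur_null P M)"

definition schur_class :: "'p operad_data \<Rightarrow> ('a, 'm) umodule_scheme \<Rightarrow> (('p \<times> 'a list) \<Rightarrow>\<^sub>0 bit) \<Rightarrow> ('p, 'a) schur" where
  "schur_class P M F = schur_null P M +>\<^bsub>free_space (symbols P M)\<^esub> F"

definition schur_gen :: "'p operad_data \<Rightarrow> ('a, 'm) umodule_scheme \<Rightarrow> 'p \<Rightarrow> 'a list \<Rightarrow> ('p, 'a) schur" where
  "schur_gen P M \<mu> xs = schur_class P M (symb \<mu> xs)"

text \<open>The linear map on \<open>S(P, M)\<close> with prescribed values on the classes of symbols.\<close>

definition schur_lift :: "'p operad_data \<Rightarrow> ('a, 'm) umodule_scheme \<Rightarrow> (bit, 'v, 'n) module_scheme \<Rightarrow>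
    ('p \<Rightarrow> 'a list \<Rightarrow> 'v) \<Rightarrow> ('p, 'a) schur \<Rightarrow> 'v" where
  "schur_lift P M V f = (\<lambda>t\<in>carrier (schur_space P M). the_elem (lin_ext V (\<lambda>(\<mu>, xs). f \<mu> xs) ` t))"

definition schur_hdeg :: "'p operad_data \<Rightarrow> ('a, 'm) umodule_scheme \<Rightarrow> nat \<Rightarrow> ('p, 'a) schur set" where
  "schur_hdeg P M d = lin_span (schur_space P M)
     {schur_gen P M \<mu> xs | \<mu> xs ds. (\<mu>, xs) \<in> symbols P M \<and>
        list_all2 (\<lambda>x e. x \<in> hdeg M e) xs ds \<and> sum_list ds = d}"

text \<open>The Cartan formula, iterated over the factors of \<open>M\<^sup>\<otimes>\<^sup>n\<close>; for \<open>n = 0\<close> it gives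
  \<open>Sq\<^sup>0 = 1\<close> and \<open>Sq\<^sup>i = 0\<close> for \<open>i > 0\<close>.\<close>

definition schur_Sq :: "'p operad_data \<Rightarrow> ('a, 'm) umodule_scheme \<Rightarrow> nat \<Rightarrow> ('p, 'a) schur \<Rightarrow> ('p, 'a) schur" where
  "schur_Sq P M i = schur_lift P M (schur_space P M) (\<lambda>\<mu> xs.
     \<Oplus>\<^bsub>schur_space P M\<^esub>ks\<in>{ks. length ks = length xs \<and> sum_list ks = i}.
       schur_gen P M \<mu> (map2 (Sq M) ks xs))"

definition schur :: "'p operad_data \<Rightarrow> ('a, 'm) umodule_scheme \<Rightarrow> ('p, 'a) schur umodule" where
  "schur P M = module.extend (schur_space P M) (umodule.fields (schur_hdeg P M) (schur_Sq P M))"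

definition schur_map :: "'p operad_data \<Rightarrow> ('a, 'm) umodule_scheme \<Rightarrow> ('b, 'n) umodule_scheme \<Rightarrow>
    ('a \<Rightarrow> 'b) \<Rightarrow> ('p, 'a) schur \<Rightarrow> ('p, 'b) schur" where
  "schur_map P M N f = schur_lift P M (schur_space P N) (\<lambda>\<mu> xs. schur_gen P N \<mu> (map f xs))"

definition schur_unit :: "'p operad_data \<Rightarrow> ('a, 'm) umodule_scheme \<Rightarrow> 'a \<Rightarrow> ('p, 'a) schur" where
  "schur_unit P M = (\<lambda>x\<in>carrier M. schur_gen P M (opunit P) [x])"

text \<open>\<open>plug P \<mu> [F\<^sub>1,\<dots>,F\<^sub>n]\<close> is the multilinear extension of
  \<open>(\<nu>\<^sub>1, xs\<^sub>1), \<dots>, (\<nu>\<^sub>n, xs\<^sub>n) \<mapsto> (\<gamma>(\<mu>; \<nu>\<^sub>1,\<dots>,\<nu>\<^sub>n), xs\<^sub>1 @ \<dots> @ xs\<^sub>n)\<close>.\<close>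

definition plug :: "'p operad_data \<Rightarrow> 'p \<Rightarrow> (('p \<times> 'a list) \<Rightarrow>\<^sub>0 bit) list \<Rightarrow> ('p \<times> 'a list) \<Rightarrow>\<^sub>0 bit" where
  "plug P \<mu> Fs = (\<Sum>bs\<in>listset (map Poly_Mapping.keys Fs).
     Poly_Mapping.single
       (opcomp P (map (length \<circ> snd) bs) \<mu> (map fst bs), concat (map snd bs))
       (prod_list (map2 Poly_Mapping.lookup Fs bs)))"

text \<open>The multiplication \<open>S(P, S(P, M)) \<rightarrow> S(P, M)\<close> of the monad; \<open>listset ts\<close> is the set of
  all lists of representatives of the cosets in \<open>ts\<close>.\<close>

definition schur_mult :: "'p operad_data \<Rightarrow> ('a, 'm) umodule_scheme \<Rightarrow> ('p, ('p, 'a) schur) schur \<Rightarrow> ('p, 'a) schur" where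
  "schur_mult P M = schur_lift P (schur P M) (schur_space P M)
     (\<lambda>\<mu> ts. the_elem ((\<lambda>Fs. schur_class P M (plug P \<mu> Fs)) ` listset ts))"


section \<open>Algebras over an operad in unstable modules\<close>

record ('p, 'a) palgebra = "'a umodule" +
  struct_map :: "('p, 'a) schur \<Rightarrow> 'a"

locale U_palgebra = unstable_module N for P :: "'p operad_data" and N :: "('p, 'a) palgebra" +
  assumes struct_hom: "struct_map N \<in> U_hom (schur P N) N"
    and struct_unit: "x \<in> carrier N \<Longrightarrow> struct_map N (schur_unit P N x) = x"
    and struct_mult: "T \<in> carrier (schur P (schur P N)) \<Longrightarrow>
      struct_map N (schur_mult P N T) = struct_map N (schur_map P (schur P N) N (struct_map N) T)"

definition palg_op :: "'p operad_data \<Rightarrow> ('p, 'a) palgebra \<Rightarrow> 'p \<Rightarrow> 'a list \<Rightarrow> 'a" where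
  "palg_op P N \<mu> xs = struct_map N (schur_gen P N \<mu> xs)"

definition palg_hom :: "'p operad_data \<Rightarrow> ('p, 'a) palgebra \<Rightarrow> ('p, 'b) palgebra \<Rightarrow> ('a \<Rightarrow> 'b) set" where
  "palg_hom P N N' = {f \<in> U_hom N N'.
     \<forall>t\<in>carrier (schur P N). f (struct_map N t) = struct_map N' (schur_map P N N' f t)}"

text \<open>\<open>\<K>\<^sub>P\<^sup>\<star>\<close> is the full subcategory on these objects: its morphisms are those of \<open>palg_hom\<close>.\<close>

locale star_unstable_palgebra = U_palgebra P N
  for P :: "'p operad_data" and star :: 'p and N :: "('p, 'a) palgebra" +
  assumes star_unstable: "x \<in> carrier N \<Longrightarrow> Sq0 N x = palg_op P N star [x, x]"

definition forget :: "('p, 'a) palgebra \<Rightarrow> 'a umodule" where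
  "forget N = umodule.truncate N"

definition free_palgebra :: "'p operad_data \<Rightarrow> ('a, 'm) umodule_scheme \<Rightarrow> ('p, ('p, 'a) schur) palgebra" where
  "free_palgebra P M = umodule.extend (schur P M) (palgebra.fields (schur_mult P M))"


section \<open>Ideals and quotients\<close>

definition P_ideal :: "'p operad_data \<Rightarrow> ('p, 'a) palgebra \<Rightarrow> 'a set \<Rightarrow> bool" where
  "P_ideal P A I \<longleftrightarrow> submodule I F2 A \<and>
     (\<forall>\<mu> as a. \<mu> \<in> carrier (ops P (Suc (length as))) \<and> set as \<subseteq> carrier A \<and> a \<in> I \<longrightarrow>
        palg_op P A \<mu> (as @ [a]) \<in> I)"

definition U_P_ideal :: "'p operad_data \<Rightarrow> ('p, 'a) palgebra \<Rightarrow> 'a set \<Rightarrow> bool" where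
  "U_P_ideal P A I \<longleftrightarrow> P_ideal P A I \<and> (\<forall>i. \<forall>x\<in>I. Sq A i x \<in> I)"

definition gen_U_P_ideal :: "'p operad_data \<Rightarrow> ('p, 'a) palgebra \<Rightarrow> 'a set \<Rightarrow> 'a set" where
  "gen_U_P_ideal P A X = \<Inter>{I. U_P_ideal P A I \<and> X \<subseteq> I}"

definition quot_umodule :: "('a, 'm) umodule_scheme \<Rightarrow> 'a set \<Rightarrow> 'a set umodule" where
  "quot_umodule A I = module.extend (quot_space A I) (umodule.fields
     (\<lambda>d. (\<lambda>x. I +>\<^bsub>A\<^esub> x) ` hdeg A d)
     (\<lambda>i X. the_elem ((\<lambda>x. I +>\<^bsub>A\<^esub> (Sq A i x)) ` X)))"

definition quot_proj :: "('a, 'm) umodule_scheme \<Rightarrow> 'a set \<Rightarrow> 'a \<Rightarrow> 'a set" where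
  "quot_proj A I = (\<lambda>x\<in>carrier A. I +>\<^bsub>A\<^esub> x)"

text \<open>The structure map of the quotient is determined by the projection \<open>\<pi>\<close> being a
  morphism: its value at \<open>T\<close> is \<open>\<pi> (\<theta> s)\<close> for any \<open>s\<close> with \<open>S(P, \<pi>) s = T\<close>.\<close>

definition quot_palgebra :: "'p operad_data \<Rightarrow> ('p, 'a) palgebra \<Rightarrow> 'a set \<Rightarrow> ('p, 'a set) palgebra" where
  "quot_palgebra P A I = umodule.extend (quot_umodule A I) (palgebra.fields
     (\<lambda>T\<in>carrier (schur P (quot_umodule A I)).
        the_elem {quot_proj A I (struct_map A s) | s. s \<in> carrier (schur P A) \<and>
          schur_map P A (quot_umodule A I) (quot_proj A I) s = T}))"


section \<open>The functor \<open>K\<^sub>P\<^sup>\<star>\<close>\<close>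

definition star_ideal :: "'p operad_data \<Rightarrow> 'p \<Rightarrow> ('a, 'm) umodule_scheme \<Rightarrow> ('p, 'a) schur set" where
  "star_ideal P star M = (let A = free_palgebra P M in
     gen_U_P_ideal P A {Sq0 A t \<oplus>\<^bsub>A\<^esub> palg_op P A star [t, t] | t. t \<in> carrier A})"

definition K_obj :: "'p operad_data \<Rightarrow> 'p \<Rightarrow> ('a, 'm) umodule_scheme \<Rightarrow> ('p, ('p, 'a) schur set) palgebra" where
  "K_obj P star M = quot_palgebra P (free_palgebra P M) (star_ideal P star M)"

definition K_proj :: "'p operad_data \<Rightarrow> 'p \<Rightarrow> ('a, 'm) umodule_scheme \<Rightarrow> ('p, 'a) schur \<Rightarrow> ('p, 'a) schur set" where
  "K_proj P star M = quot_proj (free_palgebra P M) (star_ideal P star M)"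

text \<open>The map induced by \<open>S(P, f)\<close>.\<close>

definition K_map :: "'p operad_data \<Rightarrow> 'p \<Rightarrow> ('a, 'm) umodule_scheme \<Rightarrow> ('b, 'n) umodule_scheme \<Rightarrow>
    ('a \<Rightarrow> 'b) \<Rightarrow> ('p, 'a) schur set \<Rightarrow> ('p, 'b) schur set" where
  "K_map P star M M' f = (\<lambda>X\<in>carrier (K_obj P star M).
     the_elem ((\<lambda>t. K_proj P star M' (schur_map P M M' f t)) ` X))"

text \<open>The adjunction map sending \<open>g : K\<^sub>P\<^sup>\<star>(M) \<rightarrow> N\<close> to its restriction along
  \<open>M \<rightarrow> S(P, M) \<rightarrow> K\<^sub>P\<^sup>\<star>(M)\<close>.\<close>

definition K_adjunct :: "'p operad_data \<Rightarrow> 'p \<Rightarrow> ('a, 'm) umodule_scheme \<Rightarrow>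
    (('p, 'a) schur set \<Rightarrow> 'c) \<Rightarrow> 'a \<Rightarrow> 'c" where
  "K_adjunct P star M g = (\<lambda>x\<in>carrier M. g (K_proj P star M (schur_unit P M x)))"

end

theory Submission
  imports "HOL-Computational_Algebra.Formal_Power_Series" Defs
begin

text \<open>The Adem relations hold on a graded space iff the total squares satisfy the identity of
  Bullett and Macdonald, an identity of generating functions that is multiplicative; it therefore
  passes from \<open>M\<close> to its tensor powers, which makes \<open>S(P, M)\<close> an unstable module. Since \<open>\<star>\<close> is
  commutative, \<open>t \<mapsto> Sq\<^sub>0 t + \<star>(t, t)\<close> is additive, so the ideal it generates is homogeneous and the
  quotient of the free algebra is graded. Morphisms from the free algebra to a \<open>\<star>\<close>-unstable algebra
  commute with \<open>Sq\<^sub>0\<close> and \<open>\<star>\<close>, hence kill the ideal, and the adjunction follows from the universal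
  properties of the free algebra and of the quotient.\<close>

section \<open>Vector spaces over the field with two elements\<close>

text \<open>Verifying the Adem relations directly on a tensor product would entangle their binomial
  coefficients with the Cartan formula. Generating functions avoid this, at the price of showing
  that in each total degree n two families of relations among the words Sq^i Sq^(n-i) span the same
  rows. One inclusion is a residue computation. For the other, the Adem rows have pivots at the
  positions i with 3i < 2n; elimination leaves a row on the admissible positions, and test vectors
  orthogonal to all rows must show that it vanishes. They come from invariant theory: the identity
  is a symmetry in two variables s, t (here t = 1), and suitable products of the Dickson invariants
  of degrees 2 and 3 obey it, one for each admissible position. The other obstacle is that all
  objects are quotients of free spaces on symbols, so every map starts from representatives.
  Compatible functions of an operation and a list of arguments stand in for the monad: algebras,
  morphisms and the associativity square are compared on lists of generators, one slot at a
  time.\<close>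

lemma F2_simps [simp]:
  "carrier F2 = UNIV" "x \<otimes>\<^bsub>F2\<^esub> y = x * y" "\<one>\<^bsub>F2\<^esub> = 1" "\<zero>\<^bsub>F2\<^esub> = 0" "x \<oplus>\<^bsub>F2\<^esub> y = x + y"
  by (simp_all add: F2_def)

lemma F2_cring: "cring F2"
proof (intro cringI abelian_groupI comm_monoidI)
  show "\<exists>y\<in>carrier F2. y \<oplus>\<^bsub>F2\<^esub> x = \<zero>\<^bsub>F2\<^esub>" for x
    by (rule bexI[of _ x]) (auto simp: bit_eq_iff)
qed (auto simp: algebra_simps)

lemma bit_cases [case_names zero one]:
  fixes c :: bit
  obtains "c = 0" | "c = 1"
  by (cases c) auto

text \<open>The only scalars are 0 and 1, so each module axiom that mentions them reduces to
  addition; distributivity over 1 + 1 = 0 is the rule that every vector is its own negative.\<close>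

lemma f2_moduleI:
  assumes zero: "\<zero>\<^bsub>V\<^esub> \<in> carrier V"
    and add: "\<And>x y. \<lbrakk>x \<in> carrier V; y \<in> carrier V\<rbrakk> \<Longrightarrow> x \<oplus>\<^bsub>V\<^esub> y \<in> carrier V"
    and assoc: "\<And>x y z. \<lbrakk>x \<in> carrier V; y \<in> carrier V; z \<in> carrier V\<rbrakk> \<Longrightarrow>
      (x \<oplus>\<^bsub>V\<^esub> y) \<oplus>\<^bsub>V\<^esub> z = x \<oplus>\<^bsub>V\<^esub> (y \<oplus>\<^bsub>V\<^esub> z)"
    and comm: "\<And>x y. \<lbrakk>x \<in> carrier V; y \<in> carrier V\<rbrakk> \<Longrightarrow> x \<oplus>\<^bsub>V\<^esub> y = y \<oplus>\<^bsub>V\<^esub> x"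
    and lzero: "\<And>x. x \<in> carrier V \<Longrightarrow> \<zero>\<^bsub>V\<^esub> \<oplus>\<^bsub>V\<^esub> x = x"
    and self: "\<And>x. x \<in> carrier V \<Longrightarrow> x \<oplus>\<^bsub>V\<^esub> x = \<zero>\<^bsub>V\<^esub>"
    and smult0: "\<And>x. x \<in> carrier V \<Longrightarrow> 0 \<odot>\<^bsub>V\<^esub> x = \<zero>\<^bsub>V\<^esub>"
    and smult1: "\<And>x. x \<in> carrier V \<Longrightarrow> 1 \<odot>\<^bsub>V\<^esub> x = x"
  shows "module F2 V"
proof (rule moduleI)
  show "abelian_group V"
    by (rule abelian_groupI) (auto intro: assms)
  have lz2: "x \<oplus>\<^bsub>V\<^esub> \<zero>\<^bsub>V\<^esub> = x" if "x \<in> carrier V" for x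
    using that comm lzero zero by metis
  fix a b :: bit and x y
  assume "x \<in> carrier V"
  then show "(a \<oplus>\<^bsub>F2\<^esub> b) \<odot>\<^bsub>V\<^esub> x = a \<odot>\<^bsub>V\<^esub> x \<oplus>\<^bsub>V\<^esub> b \<odot>\<^bsub>V\<^esub> x"
    by (cases a rule: bit_cases; cases b rule: bit_cases) (simp_all add: zero smult0 smult1 self lzero lz2)
next
  fix a b :: bit and x y
  assume xy: "x \<in> carrier V" "y \<in> carrier V"
  show "a \<odot>\<^bsub>V\<^esub> x \<in> carrier V"
    using xy by (cases a rule: bit_cases) (simp_all add: zero smult0 smult1)
  show "a \<odot>\<^bsub>V\<^esub> (x \<oplus>\<^bsub>V\<^esub> y) = a \<odot>\<^bsub>V\<^esub> x \<oplus>\<^bsub>V\<^esub> a \<odot>\<^bsub>V\<^esub> y"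
    using xy by (cases a rule: bit_cases) (simp_all add: zero add lzero smult0 smult1)
  show "(a \<otimes>\<^bsub>F2\<^esub> b) \<odot>\<^bsub>V\<^esub> x = a \<odot>\<^bsub>V\<^esub> (b \<odot>\<^bsub>V\<^esub> x)"
    using xy by (cases a rule: bit_cases; cases b rule: bit_cases) (simp_all add: zero smult0 smult1)
qed (use F2_cring in \<open>simp_all add: smult1\<close>)

lemma f2_closed:
  assumes "module F2 V"
  shows "\<zero>\<^bsub>V\<^esub> \<in> carrier V"
    and "\<lbrakk>x \<in> carrier V; y \<in> carrier V\<rbrakk> \<Longrightarrow> x \<oplus>\<^bsub>V\<^esub> y \<in> carrier V"
    and "x \<in> carrier V \<Longrightarrow> c \<odot>\<^bsub>V\<^esub> x \<in> carrier V"
proof -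
  interpret module F2 V by fact
  show "\<zero>\<^bsub>V\<^esub> \<in> carrier V" "\<lbrakk>x \<in> carrier V; y \<in> carrier V\<rbrakk> \<Longrightarrow> x \<oplus>\<^bsub>V\<^esub> y \<in> carrier V"
    "x \<in> carrier V \<Longrightarrow> c \<odot>\<^bsub>V\<^esub> x \<in> carrier V" by auto
qed

lemma f2_smult:
  assumes "module F2 V" and "x \<in> carrier V"
  shows "c \<odot>\<^bsub>V\<^esub> x = (if c = 1 then x else \<zero>\<^bsub>V\<^esub>)"
proof -
  interpret module F2 V by fact
  show ?thesis using assms(2) smult_one[of x] smult_l_null[of x] by (cases c rule: bit_cases) auto
qed

lemma f2_self:
  assumes "module F2 V" and "x \<in> carrier V"
  shows "x \<oplus>\<^bsub>V\<^esub> x = \<zero>\<^bsub>V\<^esub>"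
proof -
  interpret module F2 V by fact
  have "(1 + 1 :: bit) \<odot>\<^bsub>V\<^esub> x = 1 \<odot>\<^bsub>V\<^esub> x \<oplus>\<^bsub>V\<^esub> 1 \<odot>\<^bsub>V\<^esub> x"
    using smult_l_distr[of 1 1 x] assms(2) by simp
  moreover have "(1 + 1 :: bit) = 0" by simp
  ultimately show ?thesis
    using assms by (simp add: f2_smult)
qed

lemma f2_add:
  assumes "module F2 V"
  shows "\<lbrakk>x \<in> carrier V; y \<in> carrier V\<rbrakk> \<Longrightarrow> x \<oplus>\<^bsub>V\<^esub> y = y \<oplus>\<^bsub>V\<^esub> x"
    and "\<lbrakk>x \<in> carrier V; y \<in> carrier V; z \<in> carrier V\<rbrakk> \<Longrightarrow> (x \<oplus>\<^bsub>V\<^esub> y) \<oplus>\<^bsub>V\<^esub> z = x \<oplus>\<^bsub>V\<^esub> (y \<oplus>\<^bsub>V\<^esub> z)"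
    and "\<lbrakk>x \<in> carrier V; y \<in> carrier V; z \<in> carrier V\<rbrakk> \<Longrightarrow> x \<oplus>\<^bsub>V\<^esub> (y \<oplus>\<^bsub>V\<^esub> z) = y \<oplus>\<^bsub>V\<^esub> (x \<oplus>\<^bsub>V\<^esub> z)"
proof -
  interpret module F2 V by fact
  show "\<lbrakk>x \<in> carrier V; y \<in> carrier V\<rbrakk> \<Longrightarrow> x \<oplus>\<^bsub>V\<^esub> y = y \<oplus>\<^bsub>V\<^esub> x"
    "\<lbrakk>x \<in> carrier V; y \<in> carrier V; z \<in> carrier V\<rbrakk> \<Longrightarrow> (x \<oplus>\<^bsub>V\<^esub> y) \<oplus>\<^bsub>V\<^esub> z = x \<oplus>\<^bsub>V\<^esub> (y \<oplus>\<^bsub>V\<^esub> z)"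
    "\<lbrakk>x \<in> carrier V; y \<in> carrier V; z \<in> carrier V\<rbrakk> \<Longrightarrow> x \<oplus>\<^bsub>V\<^esub> (y \<oplus>\<^bsub>V\<^esub> z) = y \<oplus>\<^bsub>V\<^esub> (x \<oplus>\<^bsub>V\<^esub> z)"
    by (simp_all add: a_ac)
qed

lemma f2_zero:
  assumes "module F2 V" and "x \<in> carrier V"
  shows "\<zero>\<^bsub>V\<^esub> \<oplus>\<^bsub>V\<^esub> x = x" "x \<oplus>\<^bsub>V\<^esub> \<zero>\<^bsub>V\<^esub> = x"
proof -
  interpret module F2 V by fact
  show "\<zero>\<^bsub>V\<^esub> \<oplus>\<^bsub>V\<^esub> x = x" "x \<oplus>\<^bsub>V\<^esub> \<zero>\<^bsub>V\<^esub> = x" using assms(2) by auto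
qed

lemma f2_self_left:
  assumes "module F2 V" and "x \<in> carrier V" "y \<in> carrier V"
  shows "x \<oplus>\<^bsub>V\<^esub> (x \<oplus>\<^bsub>V\<^esub> y) = y"
  using assms by (simp add: f2_add(2)[symmetric] f2_self f2_zero)

lemmas f2_simps = f2_closed f2_smult f2_self f2_self_left f2_add f2_zero

lemma f2_eq_iff:
  assumes "module F2 V" and "x \<in> carrier V" "y \<in> carrier V"
  shows "x \<oplus>\<^bsub>V\<^esub> y = \<zero>\<^bsub>V\<^esub> \<longleftrightarrow> x = y"
proof
  assume "x \<oplus>\<^bsub>V\<^esub> y = \<zero>\<^bsub>V\<^esub>"
  then have "x \<oplus>\<^bsub>V\<^esub> (x \<oplus>\<^bsub>V\<^esub> y) = x \<oplus>\<^bsub>V\<^esub> \<zero>\<^bsub>V\<^esub>" by simp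
  then show "x = y" unfolding f2_self_left[OF assms] using assms by (simp add: f2_zero)
qed (use assms in \<open>simp add: f2_self\<close>)

lemma f2_minus:
  assumes "module F2 V" and "x \<in> carrier V"
  shows "\<ominus>\<^bsub>V\<^esub> x = x"
proof -
  interpret module F2 V by fact
  show ?thesis by (rule minus_equality) (use assms in \<open>auto simp: f2_self\<close>)
qed

section \<open>Subspaces and spans in characteristic two\<close>

lemma f2_module_cong:
  assumes "module F2 V" "carrier W = carrier V" "add W = add V" "zero W = zero V" "smult W = smult V"
  shows "module F2 W"
  by (rule f2_moduleI) (use assms in \<open>simp_all add: f2_simps\<close>)

text \<open>Negation is the identity and a scalar multiple is either the vector or zero, so the
  remaining closure conditions come for free.\<close>

lemma submodule_f2_iff:
  assumes "module F2 V"
  shows "submodule H F2 V \<longleftrightarrow> H \<subseteq> carrier V \<and> \<zero>\<^bsub>V\<^esub> \<in> H \<and> (\<forall>x\<in>H. \<forall>y\<in>H. x \<oplus>\<^bsub>V\<^esub> y \<in> H)"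
    (is "?L \<longleftrightarrow> ?R")
proof
  interpret module F2 V by fact
  assume ?L
  then show ?R
    using submoduleE[OF \<open>?L\<close>] subgroup.one_closed[OF submodule.axioms(1)[OF \<open>?L\<close>]] by auto
next
  interpret module F2 V by fact
  assume ?R
  then show ?L
  proof (intro submoduleI)
    fix a and x assume "x \<in> H"
    with \<open>?R\<close> have "x \<in> carrier V" by auto
    with \<open>?R\<close> \<open>x \<in> H\<close> show "\<ominus>\<^bsub>V\<^esub> x \<in> H" "a \<odot>\<^bsub>V\<^esub> x \<in> H"
      by (simp_all add: f2_minus[OF assms] f2_smult[OF assms])
  qed auto
qed

lemma submodule_f2D:
  assumes "module F2 V" "submodule H F2 V"
  shows "H \<subseteq> carrier V" "\<zero>\<^bsub>V\<^esub> \<in> H" "\<lbrakk>x \<in> H; y \<in> H\<rbrakk> \<Longrightarrow> x \<oplus>\<^bsub>V\<^esub> y \<in> H"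
  using assms by (auto simp: submodule_f2_iff)

lemma submodule_cong:
  assumes "module F2 V" "carrier W = carrier V" "add W = add V" "zero W = zero V" "smult W = smult V"
  shows "submodule H F2 W \<longleftrightarrow> submodule H F2 V"
  using assms f2_module_cong[OF assms] by (simp add: submodule_f2_iff)

lemma submodule_zero:
  assumes "module F2 V"
  shows "submodule {\<zero>\<^bsub>V\<^esub>} F2 V"
  using assms by (simp add: submodule_f2_iff f2_simps)

lemma submodule_carrier:
  assumes "module F2 V"
  shows "submodule (carrier V) F2 V"
  using assms by (simp add: submodule_f2_iff f2_simps)

lemma lin_span_submodule:
  assumes "module F2 V" "X \<subseteq> carrier V"
  shows "submodule (lin_span V X) F2 V"
  using assms submodule_carrier[OF assms(1)]
  by (auto simp: submodule_f2_iff lin_span_def)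

lemma lin_span_base: "x \<in> X \<Longrightarrow> x \<in> lin_span V X"
  by (auto simp: lin_span_def)

lemma lin_span_least: "submodule H F2 V \<Longrightarrow> X \<subseteq> H \<Longrightarrow> lin_span V X \<subseteq> H"
  by (auto simp: lin_span_def)

lemma lin_span_closed:
  assumes "module F2 V" "X \<subseteq> carrier V"
  shows "lin_span V X \<subseteq> carrier V"
  using lin_span_least[OF submodule_carrier[OF assms(1)] assms(2)] .

text \<open>The vectors of the carrier that satisfy \<open>Q\<close> form a subspace containing
  \<open>X\<close>, and the span is the intersection of all such subspaces.\<close>

lemma lin_span_induct [consumes 3, case_names zero base add]:
  assumes V: "module F2 V" and X: "X \<subseteq> carrier V" and x: "x \<in> lin_span V X"
    and zero: "Q \<zero>\<^bsub>V\<^esub>"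
    and base: "\<And>x. x \<in> X \<Longrightarrow> Q x"
    and add: "\<And>x y. \<lbrakk>x \<in> carrier V; y \<in> carrier V; Q x; Q y\<rbrakk> \<Longrightarrow> Q (x \<oplus>\<^bsub>V\<^esub> y)"
  shows "Q x"
proof -
  have "submodule {x \<in> carrier V. Q x} F2 V"
    using V zero add by (auto simp: submodule_f2_iff f2_simps)
  then have "lin_span V X \<subseteq> {x \<in> carrier V. Q x}"
    using X base by (intro lin_span_least) auto
  then show ?thesis using x by auto
qed

lemma lin_span_cong:
  assumes "module F2 V" "carrier W = carrier V" "add W = add V" "zero W = zero V" "smult W = smult V"
  shows "lin_span W X = lin_span V X"
  unfolding lin_span_def submodule_cong[OF assms] ..

text \<open>Over two elements additivity is linearity. Unlike \<open>linear_maps\<close> this says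
  nothing about values outside the carrier, so lambda terms and composites qualify as they
  stand.\<close>

definition f2_map :: "(bit, 'a, 'm) module_scheme \<Rightarrow> (bit, 'b, 'n) module_scheme \<Rightarrow> ('a \<Rightarrow> 'b) \<Rightarrow> bool" where
  "f2_map V W f \<longleftrightarrow> (\<forall>x\<in>carrier V. f x \<in> carrier W) \<and>
     (\<forall>x\<in>carrier V. \<forall>y\<in>carrier V. f (x \<oplus>\<^bsub>V\<^esub> y) = f x \<oplus>\<^bsub>W\<^esub> f y)"

lemma f2_mapI:
  assumes "\<And>x. x \<in> carrier V \<Longrightarrow> f x \<in> carrier W"
    and "\<And>x y. \<lbrakk>x \<in> carrier V; y \<in> carrier V\<rbrakk> \<Longrightarrow> f (x \<oplus>\<^bsub>V\<^esub> y) = f x \<oplus>\<^bsub>W\<^esub> f y"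
  shows "f2_map V W f"
  using assms by (simp add: f2_map_def)

lemma f2_mapD:
  assumes "f2_map V W f"
  shows "x \<in> carrier V \<Longrightarrow> f x \<in> carrier W"
    and "\<lbrakk>x \<in> carrier V; y \<in> carrier V\<rbrakk> \<Longrightarrow> f (x \<oplus>\<^bsub>V\<^esub> y) = f x \<oplus>\<^bsub>W\<^esub> f y"
  using assms by (simp_all add: f2_map_def)

lemma f2_map_zero:
  assumes "f2_map V W f" "module F2 V" "module F2 W"
  shows "f \<zero>\<^bsub>V\<^esub> = \<zero>\<^bsub>W\<^esub>"
proof -
  have z: "\<zero>\<^bsub>V\<^esub> \<in> carrier V" using assms(2) by (simp add: f2_closed)
  have "f \<zero>\<^bsub>V\<^esub> = f \<zero>\<^bsub>V\<^esub> \<oplus>\<^bsub>W\<^esub> f \<zero>\<^bsub>V\<^esub>"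
    using f2_mapD(2)[OF assms(1) z z] assms(2) z by (simp add: f2_zero)
  then show ?thesis
    using f2_mapD(1)[OF assms(1) z] assms(3) by (simp add: f2_self)
qed

lemma f2_map_comp:
  assumes "f2_map V W f" "f2_map W Z g"
  shows "f2_map V Z (\<lambda>x. g (f x))"
  using assms by (simp add: f2_map_def)

lemma f2_map_cong:
  assumes "f2_map V W f" "\<And>x. x \<in> carrier V \<Longrightarrow> g x = f x" "module F2 V"
  shows "f2_map V W g"
  using assms by (simp add: f2_map_def f2_simps)

text \<open>An additive map respects the scalars 0 and 1, which leaves extensionality as the only
  further condition.\<close>

lemma linear_maps_iff:
  assumes "module F2 V" "module F2 W"
  shows "f \<in> linear_maps V W \<longleftrightarrow> f2_map V W f \<and> f \<in> extensional (carrier V)"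
proof -
  have "f (c \<odot>\<^bsub>V\<^esub> x) = c \<odot>\<^bsub>W\<^esub> f x" if "f2_map V W f" "x \<in> carrier V" for c x
    using that f2_mapD[OF that(1)] f2_map_zero[OF that(1) assms] assms by (simp add: f2_smult)
  then show ?thesis
    unfolding linear_maps_def PiE_def f2_map_def by auto
qed

lemma f2_map_span:
  assumes f: "f2_map V W f" and V: "module F2 V" and W: "module F2 W" and H: "submodule H F2 W"
    and X: "X \<subseteq> carrier V" "f ` X \<subseteq> H" and x: "x \<in> lin_span V X"
  shows "f x \<in> H"
  using V X(1) x
  by (induction rule: lin_span_induct)
     (use X f2_map_zero[OF f V W] f2_mapD[OF f] submodule_f2D[OF W H] in auto)

lemma f2_map_eq_on_span:
  assumes f: "f2_map V W f" and g: "f2_map V W g" and V: "module F2 V" and W: "module F2 W"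
    and X: "X \<subseteq> carrier V" "\<And>x. x \<in> X \<Longrightarrow> f x = g x" and x: "x \<in> lin_span V X"
  shows "f x = g x"
  using V X(1) x
  by (induction rule: lin_span_induct)
     (use X f2_map_zero[OF f V W] f2_map_zero[OF g V W] f2_mapD[OF f] f2_mapD[OF g] in auto)

subsection \<open>Finite sums\<close>

lemma f2_finsum_simps:
  assumes "module F2 V"
  shows "finsum V f {} = \<zero>\<^bsub>V\<^esub>"
    and "infinite A \<Longrightarrow> finsum V f A = \<zero>\<^bsub>V\<^esub>"
    and "\<lbrakk>finite A; a \<notin> A; f a \<in> carrier V; \<And>x. x \<in> A \<Longrightarrow> f x \<in> carrier V\<rbrakk> \<Longrightarrow>
      finsum V f (insert a A) = f a \<oplus>\<^bsub>V\<^esub> finsum V f A"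
    and "(\<And>x. x \<in> A \<Longrightarrow> f x = \<zero>\<^bsub>V\<^esub>) \<Longrightarrow> finsum V f A = \<zero>\<^bsub>V\<^esub>"
    and "(\<And>x. x \<in> A \<Longrightarrow> f x \<in> carrier V) \<Longrightarrow> finsum V f A \<in> carrier V"
    and "\<lbrakk>\<And>x. x \<in> A \<Longrightarrow> f x \<in> carrier V; \<And>x. x \<in> A \<Longrightarrow> g x \<in> carrier V\<rbrakk> \<Longrightarrow>
      finsum V (\<lambda>x. f x \<oplus>\<^bsub>V\<^esub> g x) A = finsum V f A \<oplus>\<^bsub>V\<^esub> finsum V g A"
proof -
  interpret module F2 V by fact
  show "finsum V f {} = \<zero>\<^bsub>V\<^esub>" by simp
  show "infinite A \<Longrightarrow> finsum V f A = \<zero>\<^bsub>V\<^esub>" by (simp add: finsum_infinite)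
  show "\<lbrakk>finite A; a \<notin> A; f a \<in> carrier V; \<And>x. x \<in> A \<Longrightarrow> f x \<in> carrier V\<rbrakk> \<Longrightarrow>
      finsum V f (insert a A) = f a \<oplus>\<^bsub>V\<^esub> finsum V f A" by (subst finsum_insert) auto
  show "(\<And>x. x \<in> A \<Longrightarrow> f x = \<zero>\<^bsub>V\<^esub>) \<Longrightarrow> finsum V f A = \<zero>\<^bsub>V\<^esub>"
    by (rule add.finprod_one_eqI)
  show "(\<And>x. x \<in> A \<Longrightarrow> f x \<in> carrier V) \<Longrightarrow> finsum V f A \<in> carrier V"
    by (rule finsum_closed) auto
  show "\<lbrakk>\<And>x. x \<in> A \<Longrightarrow> f x \<in> carrier V; \<And>x. x \<in> A \<Longrightarrow> g x \<in> carrier V\<rbrakk> \<Longrightarrow>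
      finsum V (\<lambda>x. f x \<oplus>\<^bsub>V\<^esub> g x) A = finsum V f A \<oplus>\<^bsub>V\<^esub> finsum V g A"
    by (rule finsum_addf) auto
qed

lemma f2_finsum_cong:
  assumes "module F2 V" "A = B" "\<And>x. x \<in> B \<Longrightarrow> f x = g x" "\<And>x. x \<in> B \<Longrightarrow> g x \<in> carrier V"
  shows "finsum V f A = finsum V g B"
proof -
  interpret module F2 V by fact
  show ?thesis using assms(2-) by (intro finsum_cong') auto
qed

text \<open>A sum reads only the carrier, the addition and the zero of a record. Sums in a space and
  in its extensions by further fields are identified in this way.\<close>

lemma finsum_record_cong:
  assumes "carrier W = carrier V" "add W = add V" "zero W = zero V"
  shows "finsum W f A = finsum V f A"
  using assms by (simp add: finsum_def finprod_def)

lemma f2_finsum_union: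
  assumes "module F2 V" "finite A" "finite B" "A \<inter> B = {}" "\<And>x. x \<in> A \<union> B \<Longrightarrow> f x \<in> carrier V"
  shows "finsum V f (A \<union> B) = finsum V f A \<oplus>\<^bsub>V\<^esub> finsum V f B"
proof -
  interpret module F2 V by fact
  show ?thesis using assms(2-) by (intro finsum_Un_disjoint) auto
qed

lemma f2_finsum_reindex:
  assumes "module F2 V" "bij_betw h A B" "\<And>x. x \<in> B \<Longrightarrow> f x \<in> carrier V"
  shows "finsum V f B = finsum V (\<lambda>x. f (h x)) A"
proof -
  interpret module F2 V by fact
  show ?thesis
    using finsum_reindex[of f h A] assms(2,3) by (auto simp: bij_betw_def)
qed

lemma f2_finsum_mono_neutral:
  assumes "module F2 V" "finite B" "A \<subseteq> B" "\<And>x. x \<in> B - A \<Longrightarrow> f x = \<zero>\<^bsub>V\<^esub>"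
    "\<And>x. x \<in> A \<Longrightarrow> f x \<in> carrier V"
  shows "finsum V f A = finsum V f B"
proof -
  interpret module F2 V by fact
  have "f x \<in> carrier V" if "x \<in> B" for x
    using assms(4)[of x] assms(5)[of x] that by (cases "x \<in> A") auto
  then show ?thesis
    using assms(2-) by (intro add.finprod_mono_neutral_cong_left) auto
qed

lemma f2_finsum_single:
  assumes "module F2 V" "finite A" "a \<in> A" "f a \<in> carrier V" "\<And>x. \<lbrakk>x \<in> A; x \<noteq> a\<rbrakk> \<Longrightarrow> f x = \<zero>\<^bsub>V\<^esub>"
  shows "finsum V f A = f a"
proof -
  have "finsum V f {a} = finsum V f A"
    by (rule f2_finsum_mono_neutral) (use assms in auto)
  moreover have "finsum V f {a} = f a"
    using f2_finsum_simps(3)[OF assms(1), of "{}" a f] assms by (simp add: f2_finsum_simps f2_zero)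
  ultimately show ?thesis by simp
qed

lemma f2_map_finsum:
  assumes h: "f2_map V W h" and V: "module F2 V" and W: "module F2 W"
    and f: "\<And>x. x \<in> A \<Longrightarrow> f x \<in> carrier V"
  shows "h (finsum V f A) = finsum W (\<lambda>x. h (f x)) A"
proof (cases "finite A")
  case True
  then show ?thesis using f
    by (induction A)
       (simp_all add: f2_finsum_simps V W f2_map_zero[OF h V W] f2_mapD[OF h])
qed (simp add: f2_finsum_simps V W f2_map_zero[OF h V W])

lemma f2_finsum_submodule:
  assumes V: "module F2 V" and H: "submodule H F2 V" and f: "\<And>x. x \<in> A \<Longrightarrow> f x \<in> H"
  shows "finsum V f A \<in> H"
proof (cases "finite A")
  case True
  then show ?thesis using f
  proof (induction A)
    case (insert a A)
    then have "\<And>x. x \<in> insert a A \<Longrightarrow> f x \<in> carrier V" using submodule_f2D[OF V H] by auto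
    then show ?case using insert submodule_f2D[OF V H] by (simp add: f2_finsum_simps V)
  qed (simp add: f2_finsum_simps V submodule_f2D[OF V H])
qed (simp add: f2_finsum_simps V submodule_f2D[OF V H])

lemma f2_finsum_Sigma:
  assumes V: "module F2 V" and A: "finite A" and B: "\<And>a. a \<in> A \<Longrightarrow> finite (B a)"
    and f: "\<And>a b. \<lbrakk>a \<in> A; b \<in> B a\<rbrakk> \<Longrightarrow> f a b \<in> carrier V"
  shows "finsum V (\<lambda>a. finsum V (f a) (B a)) A = finsum V (\<lambda>(a, b). f a b) (Sigma A B)"
  using A B f
proof (induction A)
  case (insert a A)
  have cl: "finsum V (f x) (B x) \<in> carrier V" if "x \<in> insert a A" for x
    using that insert.prems V by (auto intro!: f2_finsum_simps)
  have "Sigma (insert a A) B = Pair a ` B a \<union> Sigma A B" by auto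
  then have "finsum V (\<lambda>(a, b). f a b) (Sigma (insert a A) B) =
      finsum V (\<lambda>(a, b). f a b) (Pair a ` B a) \<oplus>\<^bsub>V\<^esub> finsum V (\<lambda>(a, b). f a b) (Sigma A B)"
    using insert.hyps insert.prems by (auto intro!: f2_finsum_union V)
  also have "finsum V (\<lambda>(a, b). f a b) (Pair a ` B a) = finsum V (f a) (B a)"
    by (subst f2_finsum_reindex[OF V, of "Pair a" "B a"])
       (use insert.prems in \<open>auto simp: bij_betw_def inj_on_def\<close>)
  finally show ?case
    using insert cl V by (simp add: f2_finsum_simps)
qed (simp add: f2_finsum_simps V)

lemma f2_finsum_swap:
  assumes V: "module F2 V" and A: "finite A" and B: "finite B"
    and f: "\<And>a b. \<lbrakk>a \<in> A; b \<in> B\<rbrakk> \<Longrightarrow> f a b \<in> carrier V"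
  shows "finsum V (\<lambda>a. finsum V (f a) B) A = finsum V (\<lambda>b. finsum V (\<lambda>a. f a b) A) B"
proof -
  have "finsum V (\<lambda>a. finsum V (f a) B) A = finsum V (\<lambda>(a, b). f a b) (A \<times> B)"
    using assms by (intro f2_finsum_Sigma) auto
  also have "\<dots> = finsum V (\<lambda>(b, a). f a b) (B \<times> A)"
    by (subst f2_finsum_reindex[OF V, of "\<lambda>(b, a). (a, b)" "B \<times> A"])
       (use f in \<open>auto simp: bij_betw_def inj_on_def intro!: f2_finsum_cong V\<close>)
  also have "\<dots> = finsum V (\<lambda>b. finsum V (\<lambda>a. f a b) A) B"
    using assms by (intro f2_finsum_Sigma[symmetric]) auto
  finally show ?thesis .
qed


section \<open>Adem relations and the Bullett--Macdonald identity\<close>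

text \<open>The Adem relations in degree \<open>n\<close> are linear relations between the operations
  \<open>Sq\<^sup>i Sq\<^bsup>n-i\<^esup>\<close> and are encoded by their rows of coefficients. The row \<open>bm_row n c\<close> is the
  coefficient of \<open>s\<^sup>c\<close> in the identity of Bullett and Macdonald
  \<open>\<Sum>\<^sub>i (s\<^sup>2 + s)\<^sup>i Sq\<^sup>i Sq\<^bsup>n-i\<^esup> = \<Sum>\<^sub>i (1 + s)\<^sup>i s\<^bsup>2(n-i)\<^esup> Sq\<^sup>i Sq\<^bsup>n-i\<^esup>\<close>.\<close>

declare add_bit_eq_xor [simp del] mult_bit_eq_and [simp del] power_bit_unfold [simp del]

abbreviation bmU :: "bit fps" where "bmU \<equiv> fps_X * (1 + fps_X)"

definition bm_left :: "nat \<Rightarrow> nat \<Rightarrow> nat \<Rightarrow> bit" where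
  "bm_left n c i = fps_nth (bmU ^ i) c"

definition bm_right :: "nat \<Rightarrow> nat \<Rightarrow> nat \<Rightarrow> bit" where
  "bm_right n c i = fps_nth ((1 + fps_X) ^ i * fps_X ^ (2 * (n - i))) c"

definition bm_row :: "nat \<Rightarrow> nat \<Rightarrow> nat \<Rightarrow> bit" where
  "bm_row n c i = (if i \<le> n then bm_left n c i + bm_right n c i else 0)"

text \<open>The Adem relation for Sq^a Sq^b with b = n - a, its terms indexed by the outer exponent
  i. The usual summation index is j = n - i, so b - j - 1 becomes i - a - 1 and a - 2j becomes a -
  2(n - i).\<close>

definition adem_row :: "nat \<Rightarrow> nat \<Rightarrow> nat \<Rightarrow> bit" where
  "adem_row n a i = (if i = a then 1
     else if i \<le> n \<and> 2 * (n - i) \<le> a then of_nat ((i - a - 1) choose (a - 2 * (n - i))) else 0)"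

lemma bit_add_self [simp]: "(x :: bit) + x = 0"
  by (cases x rule: bit_cases) auto

text \<open>The series \<open>(1 + X)\<^bsup>-(k+1)\<^esup>\<close>; signs do not matter in characteristic 2.\<close>

definition neg_binom :: "nat \<Rightarrow> bit fps" where
  "neg_binom k = Abs_fps (\<lambda>j. of_nat ((k + j) choose j))"

lemma bit_plus_one_mult_nth:
  "fps_nth ((1 + fps_X) * (F :: bit fps)) j = fps_nth F j + (if j = 0 then 0 else fps_nth F (j - 1))"
  by (simp add: distrib_right)

lemma neg_binom_0: "(1 + fps_X) * neg_binom 0 = 1"
  by (rule fps_ext) (simp add: bit_plus_one_mult_nth neg_binom_def)

text \<open>Pascal's rule: multiplication by 1 + X produces the same binomial coefficient twice, and
  the pair cancels modulo 2.\<close>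

lemma neg_binom_Suc: "(1 + fps_X) * neg_binom (Suc k) = neg_binom k"
proof (rule fps_ext)
  fix j
  show "fps_nth ((1 + fps_X) * neg_binom (Suc k)) j = fps_nth (neg_binom k) j"
  proof (cases j)
    case (Suc l)
    have "of_nat (Suc (Suc (k + l)) choose Suc l) + of_nat (Suc (k + l) choose l) =
      (of_nat (Suc (k + l) choose Suc l) :: bit) + (of_nat (Suc (k + l) choose l) + of_nat (Suc (k + l) choose l))"
      by (subst binomial_Suc_Suc) (simp only: of_nat_add ac_simps)
    then show ?thesis using Suc by (simp add: bit_plus_one_mult_nth neg_binom_def)
  qed (simp add: bit_plus_one_mult_nth neg_binom_def)
qed

text \<open>The product is (1 + X) to the power i - a - 1; the two cases are the negative and the
  nonnegative exponents.\<close>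

lemma neg_binom_power:
  "(1 + fps_X) ^ i * neg_binom a = (if i \<le> a then neg_binom (a - i) else (1 + fps_X) ^ (i - Suc a))"
proof (induction i)
  case (Suc i)
  have "(1 + fps_X) ^ Suc i * neg_binom a = (1 + fps_X) * ((1 + fps_X) ^ i * neg_binom a)"
    by (simp add: mult.assoc)
  also have "\<dots> = (if Suc i \<le> a then neg_binom (a - Suc i) else (1 + fps_X) ^ (Suc i - Suc a))"
  proof (cases "Suc i \<le> a")
    case True
    then have "a - i = Suc (a - Suc i)" by simp
    then show ?thesis using Suc True by (simp add: neg_binom_Suc)
  next
    case False
    show ?thesis
    proof (cases "i = a")
      case True
      then show ?thesis using Suc by (simp add: neg_binom_0)
    next
      case False
      then have "i - a = Suc (i - Suc a)" using \<open>\<not> Suc i \<le> a\<close> by simp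
      then show ?thesis using Suc False \<open>\<not> Suc i \<le> a\<close> by simp
    qed
  qed
  finally show ?case .
qed simp

text \<open>Pascal's rule splits the central coefficient into two neighbours, which are equal by
  symmetry.\<close>

lemma even_central_binomial: "0 < k \<Longrightarrow> of_nat ((k + k) choose k) = (0 :: bit)"
proof -
  assume "0 < k"
  then obtain l where k: "k = Suc l" by (cases k) auto
  have "(k + k) choose k = (k + l choose l) + (k + l choose k)"
    unfolding k by simp
  also have "(k + l choose l) = (k + l choose k)"
    using binomial_symmetric[of k "k + l"] by simp
  finally show ?thesis by simp
qed

lemma one_plus_X_power_nth: "fps_nth ((1 + fps_X :: bit fps) ^ m) k = of_nat (m choose k)"
proof (induction m arbitrary: k)
  case (Suc m)
  show ?case
  proof (cases k)
    case 0
    then show ?thesis using Suc by (simp add: bit_plus_one_mult_nth)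
  next
    case (Suc l)
    then show ?thesis
      unfolding power_Suc bit_plus_one_mult_nth using Suc.IH by (simp add: add.commute)
  qed
qed (simp add: binomial_eq_0)

text \<open>Extraction of the coefficient of \<open>U\<^sup>a\<close> for \<open>U = X (1 + X)\<close>: the differential of \<open>U\<close>
  is that of \<open>X\<close>, so this is the residue of \<open>F / U\<^bsup>a+1\<^esup>\<close>.\<close>

lemma neg_binom_central: "0 < k \<Longrightarrow> fps_nth (neg_binom k) k = 0"
  using even_central_binomial by (simp add: neg_binom_def)

definition bm_extract :: "nat \<Rightarrow> bit fps \<Rightarrow> bit" where
  "bm_extract a F = (\<Sum>c\<le>a. fps_nth F c * fps_nth (neg_binom a) (a - c))"

lemma bm_extract_eq: "bm_extract a F = fps_nth (F * neg_binom a) a"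
  by (simp add: bm_extract_def fps_mult_nth atLeast0AtMost)

text \<open>This is the residue of U^(i-a-1) dU. For i < a the coefficient found is a central
  binomial coefficient, hence even; for i > a the power of X is too high; i = a leaves the constant
  term 1.\<close>

lemma bm_extract_left: "bm_extract a (bmU ^ i) = (if i = a then 1 else 0)"
proof -
  have "bmU ^ i * neg_binom a = fps_X ^ i * ((1 + fps_X) ^ i * neg_binom a)"
    by (simp add: power_mult_distrib mult.assoc)
  then have *: "bm_extract a (bmU ^ i) =
      (if a < i then 0 else fps_nth ((1 + fps_X) ^ i * neg_binom a) (a - i))"
    by (simp only: bm_extract_eq fps_X_power_mult_nth)
  show ?thesis
  proof (cases "i < a")
    case True
    then show ?thesis
      by (simp add: * neg_binom_power neg_binom_central)
  next
    case False
    then show ?thesis by (auto simp: * neg_binom_power neg_binom_def one_plus_X_power_nth)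
  qed
qed

lemma bm_extract_right:
  assumes "3 * a < 2 * n" "i \<le> n"
  shows "bm_extract a ((1 + fps_X) ^ i * fps_X ^ (2 * (n - i))) =
    (if 2 * (n - i) \<le> a then of_nat ((i - a - 1) choose (a - 2 * (n - i))) else 0)"
proof -
  have *: "(1 + fps_X) ^ i * fps_X ^ (2 * (n - i)) * neg_binom a =
      fps_X ^ (2 * (n - i)) * ((1 + fps_X) ^ i * neg_binom a)"
    by (simp add: mult.assoc mult.left_commute)
  \<comment> \<open>The bound 3a < 2n, that is a < 2b, enters here: 2(n - i) \<le> a gives 2i \<ge>
    2n - a > 2a. The exponent i - a - 1 is then nonnegative and the series is an honest binomial
    expansion.\<close>
  moreover have "a < i" if "2 * (n - i) \<le> a" using assms that by linarith
  moreover have "fps_nth ((1 + fps_X) ^ i * neg_binom a) k = of_nat ((i - a - 1) choose k)" if "a < i" for k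
    using that by (simp add: neg_binom_power one_plus_X_power_nth)
  ultimately show ?thesis
    unfolding bm_extract_eq * by (auto simp: fps_X_power_mult_nth)
qed

text \<open>Taking the residue at U^a on both sides of the identity isolates the term i = a on the
  left and yields the Adem binomials on the right. Every Adem row is thus an explicit combination of
  Bullett-Macdonald rows.\<close>

lemma adem_row_eq_bm:
  assumes "3 * a < 2 * n" "i \<le> n"
  shows "adem_row n a i = (\<Sum>c\<le>a. fps_nth (neg_binom a) (a - c) * bm_row n c i)"
proof -
  have "(\<Sum>c\<le>a. fps_nth (neg_binom a) (a - c) * bm_row n c i) =
      bm_extract a (bmU ^ i) + bm_extract a ((1 + fps_X) ^ i * fps_X ^ (2 * (n - i)))"
    using assms(2)
    by (simp add: bm_row_def bm_left_def bm_right_def bm_extract_def sum.distrib[symmetric]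
        distrib_left mult.commute)
  also have "\<dots> = adem_row n a i"
    using assms by (auto simp: bm_extract_left bm_extract_right adem_row_def)
  finally show ?thesis by simp
qed

section \<open>Elimination by Adem rows and orthogonality to Dickson vectors\<close>

definition row_pair :: "nat \<Rightarrow> (nat \<Rightarrow> bit) \<Rightarrow> (nat \<Rightarrow> bit) \<Rightarrow> bit" where
  "row_pair n r v = (\<Sum>i\<le>n. r i * v i)"

text \<open>With coefficients 0 and 1 a span consists of sums of generators, so it suffices to add
  one row at a time. The condition 3a < 2n is a < 2b for b = n - a. The value a = 0 is included for
  n > 0; its row is the relation Sq^0 Sq^n = Sq^n Sq^0.\<close>

inductive_set adem_span :: "nat \<Rightarrow> (nat \<Rightarrow> bit) set" for n where
  zero: "(\<lambda>i. 0) \<in> adem_span n"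
| add: "r \<in> adem_span n \<Longrightarrow> 3 * a < 2 * n \<Longrightarrow> (\<lambda>i. r i + adem_row n a i) \<in> adem_span n"

text \<open>Gaussian elimination: the Adem row for a is 1 at position a and 0 before it, so adding
  the row for k clears position k and leaves the earlier positions untouched. The bound on k says
  that the last row used, number k - 1, still satisfies 3(k - 1) < 2n.\<close>

lemma adem_eliminate:
  assumes "3 * k < 2 * n + 3"
  shows "\<exists>r'. (\<lambda>i. r i + r' i) \<in> adem_span n \<and> (\<forall>i<k. r' i = 0) \<and> (\<forall>i>n. r i = 0 \<longrightarrow> r' i = 0)"
  using assms
proof (induction k)
  case 0
  show ?case by (rule exI[of _ r]) (simp add: adem_span.zero)
next
  case (Suc k)
  then obtain r' where r': "(\<lambda>i. r i + r' i) \<in> adem_span n" "\<forall>i<k. r' i = 0" "\<forall>i>n. r i = 0 \<longrightarrow> r' i = 0"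
    by auto
  show ?case
  proof (cases "r' k = 0")
    case True
    then show ?thesis using r' by (auto simp: less_Suc_eq)
  next
    case False
    then have r'k: "r' k = 1" by (cases "r' k" rule: bit_cases) auto
    have k: "3 * k < 2 * n" using Suc.prems by simp
    have "(\<lambda>i. r i + (r' i + adem_row n k i)) \<in> adem_span n"
      using adem_span.add[OF r'(1) k] by (simp add: add.assoc)
    moreover have "r' i + adem_row n k i = 0" if "i < Suc k" for i
    proof (cases "i = k")
      case True
      then show ?thesis using r'k by (simp add: adem_row_def)
    next
      case False
      then show ?thesis using that r' k by (auto simp: adem_row_def)
    qed
    moreover have "r' i + adem_row n k i = 0" if "i > n" "r i = 0" for i
      using that r' k by (auto simp: adem_row_def)
    ultimately show ?thesis by (intro exI[of _ "\<lambda>i. r' i + adem_row n k i"] conjI allI impI)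
  qed
qed

text \<open>The powers of \<open>s\<close> and \<open>t\<close> in the Dickson invariants of \<open>GL\<^sub>2(\<bbbF>\<^sub>2)\<close> provide
  enough vectors satisfying the Bullett--Macdonald identity: \<open>dickson_vec n k\<close> consists of the
  coefficients of \<open>U\<^bsup>2k\<^esup> (U + 1)\<^bsup>n-3k\<^esup>\<close> as a polynomial in \<open>U\<close>.\<close>

definition dickson_vec :: "nat \<Rightarrow> nat \<Rightarrow> nat \<Rightarrow> bit" where
  "dickson_vec n k i = (if 2 * k \<le> i then of_nat ((n - 3 * k) choose (i - 2 * k)) else 0)"

lemma dickson_sum:
  fixes F :: "nat \<Rightarrow> bit fps"
  assumes k: "3 * k \<le> n"
  shows "(\<Sum>i\<le>n. fps_const (dickson_vec n k i) * F i) =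
    (\<Sum>l\<le>n - 3 * k. of_nat ((n - 3 * k) choose l) * F (l + 2 * k))"
proof -
  have "(\<Sum>i\<le>n. fps_const (dickson_vec n k i) * F i) =
      (\<Sum>i\<in>{2 * k..n - k}. fps_const (dickson_vec n k i) * F i)"
    by (rule sum.mono_neutral_right) (use k in \<open>auto simp: dickson_vec_def binomial_eq_0\<close>)
  also have "\<dots> = (\<Sum>l\<in>{0..n - 3 * k}. fps_const (dickson_vec n k (l + 2 * k)) * F (l + 2 * k))"
    using sum.shift_bounds_cl_nat_ivl[of "\<lambda>i. fps_const (dickson_vec n k i) * F i" 0 "2 * k" "n - 3 * k"] k
    by simp
  also have "\<dots> = (\<Sum>l\<le>n - 3 * k. of_nat ((n - 3 * k) choose l) * F (l + 2 * k))"
    by (simp add: dickson_vec_def atLeast0AtMost fps_of_nat)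
  finally show ?thesis .
qed

text \<open>The left row substitutes U = s(1 + s) into U^(2k) (U + 1)^(n-3k), the right row
  substitutes U = (1 + s)/s^2 and multiplies by s^(2n). Both give (s(1 + s))^(2k) (1 + s +
  s^2)^(n-3k), so the two pairings cancel.\<close>

lemma row_pair_bm_dickson:
  assumes k: "3 * k \<le> n"
  shows "row_pair n (bm_row n c) (dickson_vec n k) = 0"
proof -
  let ?m = "n - 3 * k" and ?X = "fps_X :: bit fps"
  have "(\<Sum>i\<le>n. fps_const (dickson_vec n k i) * bmU ^ i) =
      (\<Sum>l\<le>?m. of_nat (?m choose l) * bmU ^ (l + 2 * k))"
    by (rule dickson_sum[OF k])
  also have "\<dots> = bmU ^ (2 * k) * (bmU + 1) ^ ?m"
    by (simp add: binomial_ring sum_distrib_left power_add mult.commute mult.left_commute)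
  finally have L: "(\<Sum>i\<le>n. fps_const (dickson_vec n k i) * bmU ^ i) = bmU ^ (2 * k) * (bmU + 1) ^ ?m" .
  have "(\<Sum>i\<le>n. fps_const (dickson_vec n k i) * ((1 + ?X) ^ i * ?X ^ (2 * (n - i)))) =
      (\<Sum>l\<le>?m. of_nat (?m choose l) * ((1 + ?X) ^ (l + 2 * k) * ?X ^ (2 * (n - (l + 2 * k)))))"
    by (rule dickson_sum[OF k])
  also have "\<dots> = (\<Sum>l\<le>?m. bmU ^ (2 * k) * (of_nat (?m choose l) * (1 + ?X) ^ l * (?X\<^sup>2) ^ (?m - l)))"
  proof (rule sum.cong)
    fix l assume "l \<in> {..?m}"
    then have "2 * (n - (l + 2 * k)) = 2 * k + 2 * (?m - l)" using k by auto
    then show "of_nat (?m choose l) * ((1 + ?X) ^ (l + 2 * k) * ?X ^ (2 * (n - (l + 2 * k)))) =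
        bmU ^ (2 * k) * (of_nat (?m choose l) * (1 + ?X) ^ l * (?X\<^sup>2) ^ (?m - l))"
      by (simp add: power_add power_mult_distrib power_mult[symmetric] ac_simps)
  qed simp
  also have "\<dots> = bmU ^ (2 * k) * (1 + ?X + ?X\<^sup>2) ^ ?m"
    by (simp add: binomial_ring sum_distrib_left)
  also have "1 + ?X + ?X\<^sup>2 = bmU + 1"
    by (simp add: power2_eq_square algebra_simps)
  finally have R: "(\<Sum>i\<le>n. fps_const (dickson_vec n k i) * ((1 + ?X) ^ i * ?X ^ (2 * (n - i)))) =
      bmU ^ (2 * k) * (bmU + 1) ^ ?m" .
  have "row_pair n (bm_row n c) (dickson_vec n k) =
      fps_nth (\<Sum>i\<le>n. fps_const (dickson_vec n k i) * bmU ^ i) c +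
      fps_nth (\<Sum>i\<le>n. fps_const (dickson_vec n k i) * ((1 + ?X) ^ i * ?X ^ (2 * (n - i)))) c"
    by (simp add: row_pair_def bm_row_def bm_left_def bm_right_def fps_sum_nth sum.distrib[symmetric]
        distrib_left distrib_right mult.commute)
  then show ?thesis unfolding L R by simp
qed

lemma row_pair_adem_dickson:
  assumes k: "3 * k \<le> n" and a: "3 * a < 2 * n"
  shows "row_pair n (adem_row n a) (dickson_vec n k) = 0"
proof -
  have "row_pair n (adem_row n a) (dickson_vec n k) =
      (\<Sum>i\<le>n. \<Sum>c\<le>a. fps_nth (neg_binom a) (a - c) * (bm_row n c i * dickson_vec n k i))"
    by (simp add: row_pair_def adem_row_eq_bm[OF a] sum_distrib_right mult.assoc)
  also have "\<dots> = (\<Sum>c\<le>a. fps_nth (neg_binom a) (a - c) * row_pair n (bm_row n c) (dickson_vec n k))"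
    by (subst sum.swap) (simp add: row_pair_def sum_distrib_left)
  finally show ?thesis using row_pair_bm_dickson[OF k] by simp
qed

lemma row_pair_adem_span:
  assumes "r \<in> adem_span n" "3 * k \<le> n"
  shows "row_pair n r (dickson_vec n k) = 0"
  using assms(1)
proof induction
  case (add r a)
  then show ?case
    using row_pair_adem_dickson[OF assms(2), of a]
    by (simp add: row_pair_def distrib_right sum.distrib)
qed (simp add: row_pair_def)

text \<open>Triangularity: the Dickson vector for k = n - i ends at position i, with coefficient 1.
  Once the entries of \<open>r\<close> before i are known to vanish, its pairing with
  \<open>r\<close> is the entry at i. The admissible positions 2n \<le> 3i, i \<le> n correspond
  exactly to 3k \<le> n.\<close>

lemma admissible_row_zero:
  assumes r: "\<And>i. 3 * i < 2 * n \<Longrightarrow> r i = 0" "\<And>i. i > n \<Longrightarrow> r i = 0"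
    and p: "\<And>k. 3 * k \<le> n \<Longrightarrow> row_pair n r (dickson_vec n k) = 0"
  shows "r i = 0"
proof (induction i rule: less_induct)
  case (less i)
  show ?case
  proof (cases "3 * i < 2 * n \<or> i > n")
    case False
    let ?k = "n - i"
    have k: "3 * ?k \<le> n" and i: "i \<le> n" using False by linarith+
    have "row_pair n r (dickson_vec n ?k) = r i * dickson_vec n ?k i"
      unfolding row_pair_def
    proof (subst sum.remove[of _ i])
      have "r j * dickson_vec n ?k j = 0" if "j \<in> {..n} - {i}" for j
      proof (cases "j < i")
        case False
        then have "n - 3 * ?k < j - 2 * ?k" using that i k by auto
        then show ?thesis by (simp add: dickson_vec_def binomial_eq_0)
      qed (simp add: less)
      then have "(\<Sum>j\<in>{..n} - {i}. r j * dickson_vec n ?k j) = 0"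
        by (intro sum.neutral) auto
      then show "r i * dickson_vec n ?k i + (\<Sum>j\<in>{..n} - {i}. r j * dickson_vec n ?k j) =
          r i * dickson_vec n ?k i" by simp
    qed (use i in auto)
    moreover have "i - 2 * ?k = n - 3 * ?k" "2 * ?k \<le> i" using k i by auto
    then have "dickson_vec n ?k i = 1" by (simp add: dickson_vec_def)
    ultimately show ?thesis using p[OF k] by simp
  qed (use r in auto)
qed

text \<open>What elimination leaves of the row is orthogonal to all Dickson vectors, because the row
  itself and everything added to it are; being supported on admissible positions it
  vanishes.\<close>

lemma bm_row_in_adem_span: "bm_row n c \<in> adem_span n"
proof -
  \<comment> \<open>The ceiling of 2n/3: the positions below it are exactly the pivots 3i <
    2n.\<close>
  define k where "k = (2 * n + 2) div 3"
  have k: "i < k" if "3 * i < 2 * n" for i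
    unfolding k_def using that by auto
  have "3 * k < 2 * n + 3" unfolding k_def by auto
  then obtain r' where r': "(\<lambda>i. bm_row n c i + r' i) \<in> adem_span n" "\<forall>i<k. r' i = 0"
      "\<forall>i>n. bm_row n c i = 0 \<longrightarrow> r' i = 0"
    using adem_eliminate[of k n "bm_row n c"] by blast
  have "r' i = 0" for i
  proof (rule admissible_row_zero[of n])
    fix j assume j: "3 * j \<le> n"
    have "row_pair n (\<lambda>i. bm_row n c i + r' i) (dickson_vec n j) =
        row_pair n (bm_row n c) (dickson_vec n j) + row_pair n r' (dickson_vec n j)"
      by (simp add: row_pair_def distrib_right sum.distrib)
    then show "row_pair n r' (dickson_vec n j) = 0"
      using row_pair_adem_span[OF r'(1) j] row_pair_bm_dickson[OF j] by simp
  qed (use r' k in \<open>auto simp: bm_row_def\<close>)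
  then show ?thesis using r'(1) by simp
qed

section \<open>Rows applied to vectors: passing between the two forms of the relations\<close>

definition vec_pair :: "(bit, 'v, 'm) module_scheme \<Rightarrow> nat \<Rightarrow> (nat \<Rightarrow> bit) \<Rightarrow> (nat \<Rightarrow> 'v) \<Rightarrow> 'v" where
  "vec_pair V n r m = (\<Oplus>\<^bsub>V\<^esub>i\<in>{..n}. r i \<odot>\<^bsub>V\<^esub> m i)"

lemma vec_pair_add:
  assumes V: "module F2 V" and m: "\<And>i. i \<le> n \<Longrightarrow> m i \<in> carrier V"
  shows "vec_pair V n (\<lambda>i. r i + r' i) m = vec_pair V n r m \<oplus>\<^bsub>V\<^esub> vec_pair V n r' m"
proof -
  have distr: "(c + d) \<odot>\<^bsub>V\<^esub> x = c \<odot>\<^bsub>V\<^esub> x \<oplus>\<^bsub>V\<^esub> d \<odot>\<^bsub>V\<^esub> x" if "x \<in> carrier V" for c d x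
    using module.smult_l_distr[OF V, of c d x] that by simp
  have "vec_pair V n (\<lambda>i. r i + r' i) m = finsum V (\<lambda>i. r i \<odot>\<^bsub>V\<^esub> m i \<oplus>\<^bsub>V\<^esub> r' i \<odot>\<^bsub>V\<^esub> m i) {..n}"
    unfolding vec_pair_def by (rule f2_finsum_cong[OF V]) (use m V in \<open>simp_all add: distr f2_closed\<close>)
  also have "\<dots> = vec_pair V n r m \<oplus>\<^bsub>V\<^esub> vec_pair V n r' m"
    unfolding vec_pair_def by (rule f2_finsum_simps(6)[OF V]) (use m V in \<open>simp_all add: f2_closed\<close>)
  finally show ?thesis .
qed

lemma vec_pair_closed:
  assumes V: "module F2 V" and m: "\<And>i. i \<le> n \<Longrightarrow> m i \<in> carrier V"
  shows "vec_pair V n r m \<in> carrier V"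
  unfolding vec_pair_def by (rule f2_finsum_simps(5)[OF V]) (use m V in \<open>simp add: f2_closed\<close>)

lemma vec_pair_zero:
  assumes V: "module F2 V" and m: "\<And>i. i \<le> n \<Longrightarrow> m i \<in> carrier V"
  shows "vec_pair V n (\<lambda>i. 0) m = \<zero>\<^bsub>V\<^esub>"
  unfolding vec_pair_def by (rule f2_finsum_simps(4)[OF V]) (use m V in \<open>simp add: f2_smult\<close>)

text \<open>A row acts additively on a fixed family \<open>m\<close>, so the rows annihilating
  \<open>m\<close> are closed under sums; with the Adem rows they include everything in their
  span.\<close>

lemma adem_imp_bm:
  assumes V: "module F2 V" and m: "\<And>i. i \<le> n \<Longrightarrow> m i \<in> carrier V"
    and A: "\<And>a. 3 * a < 2 * n \<Longrightarrow> vec_pair V n (adem_row n a) m = \<zero>\<^bsub>V\<^esub>"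
  shows "vec_pair V n (bm_row n c) m = \<zero>\<^bsub>V\<^esub>"
  using bm_row_in_adem_span[of n c]
proof induction
  case (add r a)
  then show ?case using A V m by (simp add: vec_pair_add f2_simps)
next
  case zero
  show ?case by (rule vec_pair_zero[OF V]) (rule m)
qed

lemma bm_imp_adem:
  assumes V: "module F2 V" and m: "\<And>i. i \<le> n \<Longrightarrow> m i \<in> carrier V"
    and B: "\<And>c. vec_pair V n (bm_row n c) m = \<zero>\<^bsub>V\<^esub>"
    and a: "3 * a < 2 * n"
  shows "vec_pair V n (adem_row n a) m = \<zero>\<^bsub>V\<^esub>"
proof -
  have zero: "vec_pair V n (\<lambda>i. 0) m = \<zero>\<^bsub>V\<^esub>"
    by (rule vec_pair_zero[OF V]) (rule m)
  have smult: "vec_pair V n (\<lambda>i. l * bm_row n c i) m = \<zero>\<^bsub>V\<^esub>" for l c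
    using B[of c] zero by (cases l rule: bit_cases) simp_all
  have "vec_pair V n (\<lambda>i. \<Sum>c\<in>C. fps_nth (neg_binom a) (a - c) * bm_row n c i) m = \<zero>\<^bsub>V\<^esub>"
    if "finite C" for C
    using that
    by (induction C) (use V m in \<open>simp_all add: zero vec_pair_add smult f2_simps\<close>)
  from this[of "{..a}"]
  have "vec_pair V n (\<lambda>i. \<Sum>c\<le>a. fps_nth (neg_binom a) (a - c) * bm_row n c i) m = \<zero>\<^bsub>V\<^esub>" by simp
  moreover have "vec_pair V n (adem_row n a) m =
      vec_pair V n (\<lambda>i. \<Sum>c\<le>a. fps_nth (neg_binom a) (a - c) * bm_row n c i) m"
    unfolding vec_pair_def
    by (rule f2_finsum_cong) (use V m a in \<open>simp_all add: adem_row_eq_bm f2_closed\<close>)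
  ultimately show ?thesis by simp
qed

lemma vec_pair_adem:
  assumes V: "module F2 V" and m: "\<And>i. i \<le> a + b \<Longrightarrow> m i \<in> carrier V" and ab: "a < 2 * b"
  shows "vec_pair V (a + b) (adem_row (a + b) a) m = \<zero>\<^bsub>V\<^esub> \<longleftrightarrow>
    m a = (\<Oplus>\<^bsub>V\<^esub>j\<in>{0..a div 2}. of_nat ((b - j - 1) choose (a - 2 * j)) \<odot>\<^bsub>V\<^esub> m (a + b - j))"
proof -
  let ?S = "\<Oplus>\<^bsub>V\<^esub>j\<in>{0..a div 2}. of_nat ((b - j - 1) choose (a - 2 * j)) \<odot>\<^bsub>V\<^esub> m (a + b - j)"
  let ?f = "\<lambda>i. adem_row (a + b) a i \<odot>\<^bsub>V\<^esub> m i"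
  \<comment> \<open>The outer exponents on the right side of the Adem relation. They all exceed a,
    because j \<le> a/2 < b, so the leading term is not among them.\<close>
  define J where "J = (\<lambda>j. a + b - j) ` {0..a div 2}"
  have J: "a \<notin> J" "J \<subseteq> {..a + b}" "finite J" using ab by (auto simp: J_def)
  have "finsum V ?f (insert a J) = vec_pair V (a + b) (adem_row (a + b) a) m"
    unfolding vec_pair_def
  proof (rule f2_finsum_mono_neutral[OF V])
    fix i assume i: "i \<in> {..a + b} - insert a J"
    have "i \<in> J" if "2 * (a + b - i) \<le> a"
      unfolding J_def using i that by (intro image_eqI[of _ _ "a + b - i"]) auto
    with i have "adem_row (a + b) a i = 0" by (auto simp: adem_row_def)
    then show "?f i = \<zero>\<^bsub>V\<^esub>" using V m i by (simp add: f2_smult)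
  qed (use J m V in \<open>auto intro!: f2_closed\<close>)
  moreover have "finsum V ?f (insert a J) = ?f a \<oplus>\<^bsub>V\<^esub> finsum V ?f J"
    using J m V by (intro f2_finsum_simps(3)) (auto intro!: f2_closed)
  moreover have "finsum V ?f J = finsum V (\<lambda>j. ?f (a + b - j)) {0..a div 2}"
    using m V ab unfolding J_def
    by (intro f2_finsum_reindex) (auto simp: bij_betw_def inj_on_def intro!: f2_closed)
  moreover have "\<dots> = ?S"
  proof (rule f2_finsum_cong[OF V])
    fix j assume j: "j \<in> {0..a div 2}"
    then have "j < b" "2 * j \<le> a" using ab by auto
    then show "?f (a + b - j) = of_nat ((b - j - 1) choose (a - 2 * j)) \<odot>\<^bsub>V\<^esub> m (a + b - j)"
      by (auto simp: adem_row_def)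
  qed (use m V in \<open>auto intro!: f2_closed\<close>)
  moreover have "?f a = m a" using V m[of a] by (simp add: adem_row_def f2_smult)
  moreover have "?S \<in> carrier V" using m V by (auto intro!: f2_finsum_simps(5) f2_closed)
  ultimately show ?thesis using f2_eq_iff[OF V, of "m a" ?S] m[of a] by simp
qed


section \<open>Quotient spaces and free spaces\<close>

text \<open>Differences are sums in characteristic two, so membership in a coset is tested by adding
  the representative.\<close>

lemma f2_coset:
  assumes V: "module F2 V" and W: "submodule W F2 V" and x: "x \<in> carrier V"
  shows "W +>\<^bsub>V\<^esub> x = {y \<in> carrier V. x \<oplus>\<^bsub>V\<^esub> y \<in> W}"
proof (intro Set.set_eqI iffI)
  fix y assume "y \<in> W +>\<^bsub>V\<^esub> x"
  then obtain w where w: "w \<in> W" "y = w \<oplus>\<^bsub>V\<^esub> x" by (auto simp: a_r_coset_def')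
  then have "w \<in> carrier V" using submodule_f2D[OF V W] by auto
  then have "x \<oplus>\<^bsub>V\<^esub> y = w" using w x V by (simp add: f2_add f2_self_left f2_self f2_zero)
  then show "y \<in> {y \<in> carrier V. x \<oplus>\<^bsub>V\<^esub> y \<in> W}" using w x V \<open>w \<in> carrier V\<close> by (simp add: f2_closed)
next
  fix y assume y: "y \<in> {y \<in> carrier V. x \<oplus>\<^bsub>V\<^esub> y \<in> W}"
  then have "y = (x \<oplus>\<^bsub>V\<^esub> y) \<oplus>\<^bsub>V\<^esub> x" using x V by (simp add: f2_add f2_self_left f2_self f2_zero)
  then show "y \<in> W +>\<^bsub>V\<^esub> x" using y unfolding a_r_coset_def' by blast
qed

lemma f2_coset_eq:
  assumes V: "module F2 V" and W: "submodule W F2 V" and x: "x \<in> carrier V" and y: "y \<in> carrier V"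
  shows "W +>\<^bsub>V\<^esub> x = W +>\<^bsub>V\<^esub> y \<longleftrightarrow> x \<oplus>\<^bsub>V\<^esub> y \<in> W"
proof
  assume "W +>\<^bsub>V\<^esub> x = W +>\<^bsub>V\<^esub> y"
  moreover have "y \<in> W +>\<^bsub>V\<^esub> y"
    using y V submodule_f2D[OF V W] by (simp add: f2_coset[OF V W y] f2_self)
  ultimately have "y \<in> W +>\<^bsub>V\<^esub> x" by simp
  then show "x \<oplus>\<^bsub>V\<^esub> y \<in> W" by (simp add: f2_coset[OF V W x])
next
  assume xy: "x \<oplus>\<^bsub>V\<^esub> y \<in> W"
  have "x \<oplus>\<^bsub>V\<^esub> z \<in> W \<longleftrightarrow> y \<oplus>\<^bsub>V\<^esub> z \<in> W" if z: "z \<in> carrier V" for z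
  proof -
    have "x \<oplus>\<^bsub>V\<^esub> z = (x \<oplus>\<^bsub>V\<^esub> y) \<oplus>\<^bsub>V\<^esub> (y \<oplus>\<^bsub>V\<^esub> z)" "y \<oplus>\<^bsub>V\<^esub> z = (x \<oplus>\<^bsub>V\<^esub> y) \<oplus>\<^bsub>V\<^esub> (x \<oplus>\<^bsub>V\<^esub> z)"
      using x y z V by (simp_all add: f2_simps)
    then show ?thesis using xy submodule_f2D(3)[OF V W] by metis
  qed
  then show "W +>\<^bsub>V\<^esub> x = W +>\<^bsub>V\<^esub> y"
    using x y by (auto simp: f2_coset[OF V W])
qed

lemma f2_coset_mem:
  assumes V: "module F2 V" and W: "submodule W F2 V" and x: "x \<in> carrier V"
  shows "x \<in> W +>\<^bsub>V\<^esub> x"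
    and "y \<in> W +>\<^bsub>V\<^esub> x \<Longrightarrow> y \<in> carrier V"
    and "y \<in> W +>\<^bsub>V\<^esub> x \<Longrightarrow> W +>\<^bsub>V\<^esub> y = W +>\<^bsub>V\<^esub> x"
proof -
  show "x \<in> W +>\<^bsub>V\<^esub> x"
    using x V submodule_f2D[OF V W] by (simp add: f2_coset[OF V W x] f2_self)
  show y: "y \<in> carrier V" if "y \<in> W +>\<^bsub>V\<^esub> x" using that by (simp add: f2_coset[OF V W x])
  show "W +>\<^bsub>V\<^esub> y = W +>\<^bsub>V\<^esub> x" if "y \<in> W +>\<^bsub>V\<^esub> x"
    using that x y[OF that] f2_coset_eq[OF V W x, of y] by (simp add: f2_coset[OF V W x])
qed

text \<open>Maps out of quotients are defined by \<open>the_elem\<close> of the image of a coset. A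
  function that is constant on the coset has a singleton image, since the coset contains its
  representative.\<close>

lemma the_elem_coset:
  assumes V: "module F2 V" and W: "submodule W F2 V" and x: "x \<in> carrier V"
    and f: "\<And>y. \<lbrakk>y \<in> carrier V; W +>\<^bsub>V\<^esub> y = W +>\<^bsub>V\<^esub> x\<rbrakk> \<Longrightarrow> f y = f x"
  shows "the_elem (f ` (W +>\<^bsub>V\<^esub> x)) = f x"
proof -
  have "f y = f x" if "y \<in> W +>\<^bsub>V\<^esub> x" for y
    by (rule f) (rule f2_coset_mem(2,3)[OF V W x that])+
  then have "f ` (W +>\<^bsub>V\<^esub> x) = (\<lambda>_. f x) ` (W +>\<^bsub>V\<^esub> x)"
    by (rule image_cong[OF refl])
  also have "\<dots> = {f x}" by (rule image_constant) (rule f2_coset_mem(1)[OF V W x])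
  finally have "f ` (W +>\<^bsub>V\<^esub> x) = {f x}" .
  then show ?thesis by simp
qed

lemma quot_space_simps:
  "carrier (quot_space V W) = (\<lambda>x. W +>\<^bsub>V\<^esub> x) ` carrier V"
  "\<zero>\<^bsub>quot_space V W\<^esub> = W"
  by (auto simp: quot_space_def A_RCOSETS_def')

lemma f2_coset_zero:
  assumes V: "module F2 V" and W: "submodule W F2 V"
  shows "W +>\<^bsub>V\<^esub> \<zero>\<^bsub>V\<^esub> = W"
  using submodule_f2D[OF V W] V by (auto simp: f2_coset f2_closed W f2_zero)

lemma f2_coset_eq_zero:
  assumes V: "module F2 V" and W: "submodule W F2 V" and x: "x \<in> carrier V"
  shows "W +>\<^bsub>V\<^esub> x = W \<longleftrightarrow> x \<in> W"
  using f2_coset_eq[OF V W x f2_closed(1)[OF V]] V x by (simp add: f2_coset_zero[OF V W] f2_zero)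

lemma quot_space_add:
  assumes V: "module F2 V" and W: "submodule W F2 V" and x: "x \<in> carrier V" and y: "y \<in> carrier V"
  shows "(W +>\<^bsub>V\<^esub> x) \<oplus>\<^bsub>quot_space V W\<^esub> (W +>\<^bsub>V\<^esub> y) = W +>\<^bsub>V\<^esub> (x \<oplus>\<^bsub>V\<^esub> y)"
proof -
  have W0: "\<zero>\<^bsub>V\<^esub> \<in> W" "W \<subseteq> carrier V" using submodule_f2D[OF V W] by auto
  have "(W +>\<^bsub>V\<^esub> x) \<oplus>\<^bsub>quot_space V W\<^esub> (W +>\<^bsub>V\<^esub> y) =
      {w \<oplus>\<^bsub>V\<^esub> x \<oplus>\<^bsub>V\<^esub> (w' \<oplus>\<^bsub>V\<^esub> y) | w w'. w \<in> W \<and> w' \<in> W}"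
    by (auto simp: quot_space_def set_add_def set_mult_def a_r_coset_def')
  also have "\<dots> = {(w \<oplus>\<^bsub>V\<^esub> w') \<oplus>\<^bsub>V\<^esub> (x \<oplus>\<^bsub>V\<^esub> y) | w w'. w \<in> W \<and> w' \<in> W}"
  proof -
    have "w \<oplus>\<^bsub>V\<^esub> x \<oplus>\<^bsub>V\<^esub> (w' \<oplus>\<^bsub>V\<^esub> y) = (w \<oplus>\<^bsub>V\<^esub> w') \<oplus>\<^bsub>V\<^esub> (x \<oplus>\<^bsub>V\<^esub> y)" if "w \<in> W" "w' \<in> W" for w w'
      using that x y W0 subsetD[OF W0(2)] V by (simp add: f2_add f2_closed)
    then show ?thesis by (intro Collect_cong iff_exI) auto
  qed
  also have "\<dots> = W +>\<^bsub>V\<^esub> (x \<oplus>\<^bsub>V\<^esub> y)"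
  proof -
    have "(\<exists>w w'. u = (w \<oplus>\<^bsub>V\<^esub> w') \<oplus>\<^bsub>V\<^esub> z \<and> w \<in> W \<and> w' \<in> W) \<longleftrightarrow> (\<exists>w\<in>W. u = w \<oplus>\<^bsub>V\<^esub> z)" for u z
    proof
      assume "\<exists>w\<in>W. u = w \<oplus>\<^bsub>V\<^esub> z"
      then obtain w where w: "w \<in> W" "u = w \<oplus>\<^bsub>V\<^esub> z" by blast
      then have "w = w \<oplus>\<^bsub>V\<^esub> \<zero>\<^bsub>V\<^esub>" using W0 f2_zero(2)[OF V, of w] by auto
      then show "\<exists>w w'. u = (w \<oplus>\<^bsub>V\<^esub> w') \<oplus>\<^bsub>V\<^esub> z \<and> w \<in> W \<and> w' \<in> W" using w W0 by metis
    qed (use submodule_f2D[OF V W] in blast)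
    then show ?thesis unfolding a_r_coset_def' by auto
  qed
  finally show ?thesis .
qed

lemma quot_space_smult:
  assumes V: "module F2 V" and W: "submodule W F2 V" and x: "x \<in> carrier V"
  shows "c \<odot>\<^bsub>quot_space V W\<^esub> (W +>\<^bsub>V\<^esub> x) = W +>\<^bsub>V\<^esub> (c \<odot>\<^bsub>V\<^esub> x)"
  unfolding quot_space_def
  by (simp only: module.simps, rule the_elem_coset[OF V W x]) (use V x in \<open>simp add: f2_smult\<close>)

lemma quot_space_module:
  assumes V: "module F2 V" and W: "submodule W F2 V"
  shows "module F2 (quot_space V W)"
proof -
  have zero: "\<zero>\<^bsub>quot_space V W\<^esub> = W +>\<^bsub>V\<^esub> \<zero>\<^bsub>V\<^esub>"
    by (simp add: quot_space_simps f2_coset_zero[OF V W])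
  show ?thesis
    by (rule f2_moduleI)
       (use V in \<open>auto simp: quot_space_simps(1) zero quot_space_add[OF V W] quot_space_smult[OF V W]
          f2_closed f2_zero f2_self f2_add f2_smult intro!: image_eqI[OF refl]\<close>)
qed

lemma quot_space_proj:
  assumes V: "module F2 V" and W: "submodule W F2 V"
  shows "f2_map V (quot_space V W) (\<lambda>x. W +>\<^bsub>V\<^esub> x)"
  by (rule f2_mapI) (auto simp: quot_space_simps(1) quot_space_add[OF V W])

section \<open>Free vector spaces and linear extension\<close>

lemma bit_poly_add_self [simp]: "F + F = (0 :: 'b \<Rightarrow>\<^sub>0 bit)"
  by (rule poly_mapping_eqI) (simp only: lookup_add bit_add_self lookup_zero)

lemma bit_poly_diff: "F - G = F + (G :: 'b \<Rightarrow>\<^sub>0 bit)"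
  by (rule poly_mapping_eqI) (simp add: lookup_add lookup_minus)

lemma free_space_simps [simp]:
  "carrier (free_space B) = {F. Poly_Mapping.keys F \<subseteq> B}"
  "\<zero>\<^bsub>free_space B\<^esub> = 0"
  "F \<oplus>\<^bsub>free_space B\<^esub> G = F + G"
  by (simp_all add: free_space_def)

lemma free_space_module: "module F2 (free_space B)"
proof (rule f2_moduleI)
  fix F G
  assume F: "F \<in> carrier (free_space B)"
  show "0 \<odot>\<^bsub>free_space B\<^esub> F = \<zero>\<^bsub>free_space B\<^esub>" "1 \<odot>\<^bsub>free_space B\<^esub> F = F"
    by (auto intro!: poly_mapping_eqI simp: free_space_def Poly_Mapping.map.rep_eq when_def)
  assume "G \<in> carrier (free_space B)"
  with F show "F \<oplus>\<^bsub>free_space B\<^esub> G \<in> carrier (free_space B)"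
    using keys_add[of F G] by auto
qed (simp_all add: add.assoc add.commute)

lemma free_space_induct [consumes 1, case_names zero single add]:
  assumes "F \<in> carrier (free_space B)"
    and "Q 0" and "\<And>b. b \<in> B \<Longrightarrow> Q (Poly_Mapping.single b (1::bit))"
    and "\<And>F G. \<lbrakk>F \<in> carrier (free_space B); G \<in> carrier (free_space B); Q F; Q G\<rbrakk> \<Longrightarrow> Q (F + G)"
  shows "Q F"
proof -
  have "Q F" if "finite A" "Poly_Mapping.keys F = A" "A \<subseteq> B" for A F
    using that
  proof (induction A arbitrary: F)
    case (insert a A)
    \<comment> \<open>The coefficient at \<open>a\<close> is 1, so adding the basis vector removes
      \<open>a\<close> from the support; adding it once more returns \<open>F\<close>.\<close>
    let ?G = "F + Poly_Mapping.single a 1"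
    have "Poly_Mapping.lookup F a = 1" using insert.prems in_keys_iff[of a F] by auto
    then have "Poly_Mapping.keys ?G = A"
      using insert.hyps(2) insert.prems(1)
      by (auto simp: set_eq_iff in_keys_iff lookup_add lookup_single when_def)
    then have "Q ?G" "?G \<in> carrier (free_space B)" using insert by auto
    moreover have "Q (Poly_Mapping.single a 1)" "Poly_Mapping.single a 1 \<in> carrier (free_space B)"
      using insert.prems assms(3)[of a] by auto
    ultimately have "Q (?G + Poly_Mapping.single a 1)" by (blast intro: assms(4))
    then show ?case by (simp add: add.assoc)
  qed (simp add: assms(2))
  from this[of "Poly_Mapping.keys F" F] show ?thesis using assms(1) by simp
qed

lemma free_space_span: "carrier (free_space B) = lin_span (free_space B) ((\<lambda>b. Poly_Mapping.single b 1) ` B)"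
proof
  have sub: "(\<lambda>b. Poly_Mapping.single b 1) ` B \<subseteq> carrier (free_space B)" by auto
  note S = lin_span_submodule[OF free_space_module sub]
  show "carrier (free_space B) \<subseteq> lin_span (free_space B) ((\<lambda>b. Poly_Mapping.single b 1) ` B)"
  proof
    fix F :: "'a \<Rightarrow>\<^sub>0 bit" assume "F \<in> carrier (free_space B)"
    then show "F \<in> lin_span (free_space B) ((\<lambda>b. Poly_Mapping.single b 1) ` B)"
      by (induction rule: free_space_induct)
         (use submodule_f2D[OF free_space_module S] in \<open>auto intro: lin_span_base\<close>)
  qed
qed (rule lin_span_closed[OF free_space_module], auto)

text \<open>The support of a sum may be smaller than the union of the supports. Summing over a
  common finite superset makes the extensions of two vectors comparable term by term.\<close>

lemma lin_ext_superset:
  assumes V: "module F2 V" and f: "\<And>b. b \<in> B \<Longrightarrow> f b \<in> carrier V" and A: "finite A" "A \<subseteq> B"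
    and F: "Poly_Mapping.keys F \<subseteq> A"
  shows "lin_ext V f F = (\<Oplus>\<^bsub>V\<^esub>b\<in>A. Poly_Mapping.lookup F b \<odot>\<^bsub>V\<^esub> f b)"
proof -
  have fA: "f b \<in> carrier V" if "b \<in> A" for b using f A(2) that by blast
  show ?thesis
    unfolding lin_ext_def
    by (rule f2_finsum_mono_neutral[OF V A(1) F])
       (use V fA F in \<open>simp_all add: not_in_keys_iff_lookup_eq_zero f2_smult subset_iff f2_closed\<close>)
qed

lemma lin_ext_map:
  fixes B :: "'b set"
  assumes V: "module F2 V" and f: "\<And>b. b \<in> B \<Longrightarrow> f b \<in> carrier V"
  shows "f2_map (free_space B) V (lin_ext V f)"
proof (rule f2_mapI)
  fix F G :: "'b \<Rightarrow>\<^sub>0 bit"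
  assume F: "F \<in> carrier (free_space B)"
  show "lin_ext V f F \<in> carrier V"
    unfolding lin_ext_def using F f V by (auto intro!: f2_finsum_simps(5) f2_closed(3) simp: subset_iff)
  assume G: "G \<in> carrier (free_space B)"
  let ?A = "Poly_Mapping.keys F \<union> Poly_Mapping.keys G"
  have A: "finite ?A" "?A \<subseteq> B" using F G by auto
  have fA: "f b \<in> carrier V" if "b \<in> ?A" for b using f A that by auto
  have "lin_ext V f (F + G) = (\<Oplus>\<^bsub>V\<^esub>b\<in>?A. Poly_Mapping.lookup (F + G) b \<odot>\<^bsub>V\<^esub> f b)"
    using keys_add[of F G] f A by (intro lin_ext_superset[OF V, of B]) auto
  also have "\<dots> = (\<Oplus>\<^bsub>V\<^esub>b\<in>?A. Poly_Mapping.lookup F b \<odot>\<^bsub>V\<^esub> f b \<oplus>\<^bsub>V\<^esub> Poly_Mapping.lookup G b \<odot>\<^bsub>V\<^esub> f b)"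
    by (rule f2_finsum_cong[OF V]) (use module.smult_l_distr[OF V] fA V in \<open>simp_all add: lookup_add f2_closed\<close>)
  also have "\<dots> = (\<Oplus>\<^bsub>V\<^esub>b\<in>?A. Poly_Mapping.lookup F b \<odot>\<^bsub>V\<^esub> f b) \<oplus>\<^bsub>V\<^esub> (\<Oplus>\<^bsub>V\<^esub>b\<in>?A. Poly_Mapping.lookup G b \<odot>\<^bsub>V\<^esub> f b)"
    by (rule f2_finsum_simps(6)[OF V]) (use fA V in \<open>simp_all add: f2_closed\<close>)
  also have "(\<Oplus>\<^bsub>V\<^esub>b\<in>?A. Poly_Mapping.lookup F b \<odot>\<^bsub>V\<^esub> f b) = lin_ext V f F"
    using f A by (intro lin_ext_superset[OF V, of B, symmetric]) auto
  also have "(\<Oplus>\<^bsub>V\<^esub>b\<in>?A. Poly_Mapping.lookup G b \<odot>\<^bsub>V\<^esub> f b) = lin_ext V f G"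
    using f A by (intro lin_ext_superset[OF V, of B, symmetric]) auto
  finally show "lin_ext V f (F \<oplus>\<^bsub>free_space B\<^esub> G) = lin_ext V f F \<oplus>\<^bsub>V\<^esub> lin_ext V f G" by simp
qed

lemma lin_ext_single:
  assumes V: "module F2 V" and f: "f b \<in> carrier V"
  shows "lin_ext V f (Poly_Mapping.single b c) = c \<odot>\<^bsub>V\<^esub> f b"
proof -
  have "lin_ext V f (Poly_Mapping.single b c) = (\<Oplus>\<^bsub>V\<^esub>a\<in>{b}. Poly_Mapping.lookup (Poly_Mapping.single b c) a \<odot>\<^bsub>V\<^esub> f a)"
    using f by (intro lin_ext_superset[OF V, of "{b}"]) auto
  also have "\<dots> = c \<odot>\<^bsub>V\<^esub> f b"
    by (subst f2_finsum_single[OF V]) (use f V in \<open>auto simp: f2_closed\<close>)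
  finally show ?thesis .
qed


section \<open>The space \<open>S(P, M)\<close>\<close>

text \<open>A hybrid argument: the slots of a list are treated one after the other.\<close>

lemma list_all2_mem_subset:
  "list_all2 (\<lambda>z X. z \<in> g X) zs Zs \<Longrightarrow> (\<And>Z. Z \<in> set Zs \<Longrightarrow> g Z \<subseteq> C) \<Longrightarrow> set zs \<subseteq> C"
  by (induction rule: list_all2_induct) auto

lemma span_list_induct [consumes 3, case_names base zero add]:
  assumes V: "module F2 V" and X: "\<And>X. X \<in> set Xs \<Longrightarrow> X \<subseteq> carrier V"
    and zs: "list_all2 (\<lambda>z X. z \<in> lin_span V X) zs Xs"
    and base: "\<And>zs. list_all2 (\<in>) zs Xs \<Longrightarrow> Q zs"
    and zero: "\<And>xs ys. \<lbrakk>length xs + Suc (length ys) = length Xs; set xs \<subseteq> carrier V; set ys \<subseteq> carrier V\<rbrakk> \<Longrightarrow>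
      Q (xs @ \<zero>\<^bsub>V\<^esub> # ys)"
    and add: "\<And>xs x y ys. \<lbrakk>length xs + Suc (length ys) = length Xs; set xs \<subseteq> carrier V; set ys \<subseteq> carrier V;
      x \<in> carrier V; y \<in> carrier V; Q (xs @ x # ys); Q (xs @ y # ys)\<rbrakk> \<Longrightarrow> Q (xs @ (x \<oplus>\<^bsub>V\<^esub> y) # ys)"
  shows "Q zs"
proof -
  \<comment> \<open>The statement for the hybrid lists: the prefix \<open>ys\<close> already
    consists of generators, the entries of \<open>zs\<close> are still arbitrary elements of the
    spans. The induction on \<open>zs\<close> moves one entry at a time into the prefix.\<close>
  have "Q (ys @ zs)"
    if "list_all2 (\<lambda>z X. z \<in> lin_span V X) zs Zs" "list_all2 (\<in>) ys Ys" "Xs = Ys @ Zs" for ys Ys zs Zs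
    using that
  proof (induction zs Zs arbitrary: ys Ys rule: list_all2_induct)
    case Nil
    then show ?case using base by simp
  next
    case (Cons z zs Z Zs)
    have Z: "Z \<subseteq> carrier V" using X Cons.prems by auto
    have ys: "set ys \<subseteq> carrier V"
      by (rule list_all2_mem_subset[OF Cons.prems(1)]) (use X Cons.prems(2) in auto)
    have zs: "set zs \<subseteq> carrier V"
      by (rule list_all2_mem_subset[OF Cons.hyps(2)], rule lin_span_closed[OF V X])
         (use Cons.prems(2) in auto)
    have len: "length ys + Suc (length zs) = length Xs"
      using Cons.prems Cons.hyps by (auto dest!: list_all2_lengthD)
    have "Q (ys @ z # zs)"
      using V Z Cons.hyps(1)
    proof (induction rule: lin_span_induct)
      case (base x)
      have "Q ((ys @ [x]) @ zs)"
        by (rule Cons.IH[of _ "Ys @ [Z]"]) (use Cons.prems base in \<open>auto intro: list_all2_appendI\<close>)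
      then show ?case by simp
    qed (use zero add len ys zs in auto)
    then show ?case .
  qed
  from this[OF zs, of "[]" "[]"] show ?thesis by simp
qed

lemma span_list_induct1 [consumes 4, case_names base zero add]:
  assumes V: "module F2 V" and X: "X \<subseteq> carrier V" "carrier V = lin_span V X"
    and zs: "set zs \<subseteq> carrier V"
    and base: "\<And>ys. \<lbrakk>length ys = length zs; set ys \<subseteq> X\<rbrakk> \<Longrightarrow> Q ys"
    and zero: "\<And>xs ys. \<lbrakk>length xs + Suc (length ys) = length zs; set xs \<subseteq> carrier V; set ys \<subseteq> carrier V\<rbrakk> \<Longrightarrow>
      Q (xs @ \<zero>\<^bsub>V\<^esub> # ys)"
    and add: "\<And>xs x y ys. \<lbrakk>length xs + Suc (length ys) = length zs; set xs \<subseteq> carrier V; set ys \<subseteq> carrier V;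
      x \<in> carrier V; y \<in> carrier V; Q (xs @ x # ys); Q (xs @ y # ys)\<rbrakk> \<Longrightarrow> Q (xs @ (x \<oplus>\<^bsub>V\<^esub> y) # ys)"
  shows "Q zs"
proof (rule span_list_induct[OF V, of "replicate (length zs) X"])
  show "list_all2 (\<lambda>z X. z \<in> lin_span V X) zs (replicate (length zs) X)"
    using zs X(2) by (auto simp: list_all2_conv_all_nth)
  show "Q ys" if "list_all2 (\<in>) ys (replicate (length zs) X)" for ys
    using that by (intro base) (auto simp: list_all2_conv_all_nth set_conv_nth)
qed (use X(1) zero add in auto)

section \<open>Compatible functions and the universal property of S(P, M)\<close>

lemma symbols_iff: "(\<mu>, xs) \<in> symbols P M \<longleftrightarrow> set xs \<subseteq> carrier M \<and> \<mu> \<in> carrier (ops P (length xs))"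
  by (simp add: symbols_def)

text \<open>The functions of an operation and an argument list that descend to S(P, M). Scalars are
  covered by additivity. Equivariance is put as invariance under the simultaneous right action on
  operation and arguments, which avoids inverse permutations.\<close>

definition schur_compat ::
  "'p operad_data \<Rightarrow> ('a, 'm) umodule_scheme \<Rightarrow> (bit, 'v, 'n) module_scheme \<Rightarrow> ('p \<Rightarrow> 'a list \<Rightarrow> 'v) \<Rightarrow> bool"
  where "schur_compat P M V f \<longleftrightarrow>
    (\<forall>\<mu> xs. (\<mu>, xs) \<in> symbols P M \<longrightarrow> f \<mu> xs \<in> carrier V) \<and>
    (\<forall>\<mu> \<nu> xs. (\<mu>, xs) \<in> symbols P M \<longrightarrow> (\<nu>, xs) \<in> symbols P M \<longrightarrow>
      f (\<mu> \<oplus>\<^bsub>ops P (length xs)\<^esub> \<nu>) xs = f \<mu> xs \<oplus>\<^bsub>V\<^esub> f \<nu> xs) \<and>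
    (\<forall>\<mu> xs x y ys. (\<mu>, xs @ x # ys) \<in> symbols P M \<longrightarrow> y \<in> carrier M \<longrightarrow>
      f \<mu> (xs @ (x \<oplus>\<^bsub>M\<^esub> y) # ys) = f \<mu> (xs @ x # ys) \<oplus>\<^bsub>V\<^esub> f \<mu> (xs @ y # ys)) \<and>
    (\<forall>\<sigma> \<mu> xs. (\<mu>, xs) \<in> symbols P M \<longrightarrow> \<sigma> permutes {..<length xs} \<longrightarrow>
      f (opact P (length xs) \<sigma> \<mu>) (permute_list \<sigma> xs) = f \<mu> xs)"

lemma schur_compatI:
  assumes "\<And>\<mu> xs. (\<mu>, xs) \<in> symbols P M \<Longrightarrow> f \<mu> xs \<in> carrier V"
    and "\<And>\<mu> \<nu> xs. \<lbrakk>(\<mu>, xs) \<in> symbols P M; (\<nu>, xs) \<in> symbols P M\<rbrakk> \<Longrightarrow>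
      f (\<mu> \<oplus>\<^bsub>ops P (length xs)\<^esub> \<nu>) xs = f \<mu> xs \<oplus>\<^bsub>V\<^esub> f \<nu> xs"
    and "\<And>\<mu> xs x y ys. \<lbrakk>(\<mu>, xs @ x # ys) \<in> symbols P M; y \<in> carrier M\<rbrakk> \<Longrightarrow>
      f \<mu> (xs @ (x \<oplus>\<^bsub>M\<^esub> y) # ys) = f \<mu> (xs @ x # ys) \<oplus>\<^bsub>V\<^esub> f \<mu> (xs @ y # ys)"
    and "\<And>\<sigma> \<mu> xs. \<lbrakk>(\<mu>, xs) \<in> symbols P M; \<sigma> permutes {..<length xs}\<rbrakk> \<Longrightarrow>
      f (opact P (length xs) \<sigma> \<mu>) (permute_list \<sigma> xs) = f \<mu> xs"
  shows "schur_compat P M V f"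
  using assms by (simp add: schur_compat_def)

lemma schur_compatD:
  assumes "schur_compat P M V f"
  shows "(\<mu>, xs) \<in> symbols P M \<Longrightarrow> f \<mu> xs \<in> carrier V"
    and "\<lbrakk>(\<mu>, xs) \<in> symbols P M; (\<nu>, xs) \<in> symbols P M\<rbrakk> \<Longrightarrow>
      f (\<mu> \<oplus>\<^bsub>ops P (length xs)\<^esub> \<nu>) xs = f \<mu> xs \<oplus>\<^bsub>V\<^esub> f \<nu> xs"
    and "\<lbrakk>(\<mu>, xs @ x # ys) \<in> symbols P M; y \<in> carrier M\<rbrakk> \<Longrightarrow>
      f \<mu> (xs @ (x \<oplus>\<^bsub>M\<^esub> y) # ys) = f \<mu> (xs @ x # ys) \<oplus>\<^bsub>V\<^esub> f \<mu> (xs @ y # ys)"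
    and "\<lbrakk>(\<mu>, xs) \<in> symbols P M; \<sigma> permutes {..<length xs}\<rbrakk> \<Longrightarrow>
      f (opact P (length xs) \<sigma> \<mu>) (permute_list \<sigma> xs) = f \<mu> xs"
  using assms unfolding schur_compat_def by blast+

lemma schur_compat_slot:
  assumes f: "schur_compat P M V f" and M: "module F2 M"
    and s: "set xs \<subseteq> carrier M" "set ys \<subseteq> carrier M" "\<mu> \<in> carrier (ops P (Suc (length xs + length ys)))"
  shows "f2_map M V (\<lambda>x. f \<mu> (xs @ x # ys))"
  using schur_compatD(1,3)[OF f] s by (intro f2_mapI) (auto simp: symbols_iff)

lemma schur_compat_op:
  assumes f: "schur_compat P M V f" and xs: "set xs \<subseteq> carrier M"
  shows "f2_map (ops P (length xs)) V (\<lambda>\<mu>. f \<mu> xs)"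
  using schur_compatD(1,2)[OF f] xs by (intro f2_mapI) (auto simp: symbols_iff)

lemma schur_compat_zero:
  assumes f: "schur_compat P M V f" and M: "module F2 M" and V: "module F2 V"
    and s: "set xs \<subseteq> carrier M" "\<zero>\<^bsub>M\<^esub> \<in> set xs" "\<mu> \<in> carrier (ops P (length xs))"
  shows "f \<mu> xs = \<zero>\<^bsub>V\<^esub>"
proof -
  obtain ys zs where xs: "xs = ys @ \<zero>\<^bsub>M\<^esub> # zs" using s(2) split_list by metis
  then show ?thesis
    using f2_map_zero[OF schur_compat_slot[OF f M] M V, of ys zs \<mu>] s by simp
qed

lemma schur_compat_comp:
  assumes "schur_compat P M V f" "f2_map V W h"
  shows "schur_compat P M W (\<lambda>\<mu> xs. h (f \<mu> xs))"
proof (rule schur_compatI)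
  note f = schur_compatD[OF assms(1)] and h = f2_mapD[OF assms(2)]
  fix \<mu> \<nu> xs x y ys \<sigma>
  show "h (f \<mu> xs) \<in> carrier W" if "(\<mu>, xs) \<in> symbols P M"
    using that by (simp add: f h)
  show "h (f (\<mu> \<oplus>\<^bsub>ops P (length xs)\<^esub> \<nu>) xs) = h (f \<mu> xs) \<oplus>\<^bsub>W\<^esub> h (f \<nu> xs)"
    if "(\<mu>, xs) \<in> symbols P M" "(\<nu>, xs) \<in> symbols P M"
    using that by (simp add: f h)
  show "h (f \<mu> (xs @ (x \<oplus>\<^bsub>M\<^esub> y) # ys)) = h (f \<mu> (xs @ x # ys)) \<oplus>\<^bsub>W\<^esub> h (f \<mu> (xs @ y # ys))"
    if "(\<mu>, xs @ x # ys) \<in> symbols P M" "y \<in> carrier M"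
  proof -
    have "(\<mu>, xs @ y # ys) \<in> symbols P M" using that by (simp add: symbols_iff)
    then show ?thesis using that by (simp add: f h)
  qed
  show "h (f (opact P (length xs) \<sigma> \<mu>) (permute_list \<sigma> xs)) = h (f \<mu> xs)"
    if "(\<mu>, xs) \<in> symbols P M" "\<sigma> permutes {..<length xs}"
    using that by (simp add: f)
qed

lemma permute_list_inv:
  assumes "\<sigma> permutes {..<length xs}"
  shows "permute_list (inv_into UNIV \<sigma>) (permute_list \<sigma> xs) = xs"
    and "permute_list \<sigma> (permute_list (inv_into UNIV \<sigma>) xs) = xs"
proof -
  have i: "inv_into UNIV \<sigma> permutes {..<length xs}" using assms by (rule permutes_inv)
  show "permute_list (inv_into UNIV \<sigma>) (permute_list \<sigma> xs) = xs"
    using permute_list_compose[OF i, of \<sigma>] permutes_inv_o[OF assms] by simp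
  show "permute_list \<sigma> (permute_list (inv_into UNIV \<sigma>) xs) = xs"
    using permute_list_compose[OF assms, of "inv_into UNIV \<sigma>"] permutes_inv_o[OF assms] by simp
qed

text \<open>The relators move a permutation across as its inverse, whereas compatibility permutes
  operation and arguments together; applying the latter to the inversely permuted list gives the
  former.\<close>

lemma schur_compat_inv:
  assumes f: "schur_compat P M V f" and s: "(\<mu>, xs) \<in> symbols P M" "\<sigma> permutes {..<length xs}"
  shows "f (opact P (length xs) \<sigma> \<mu>) xs = f \<mu> (permute_list (inv_into UNIV \<sigma>) xs)"
  using schur_compatD(4)[OF f, of \<mu> "permute_list (inv_into UNIV \<sigma>) xs" \<sigma>] s permutes_inv[OF s(2)]
  by (simp add: permute_list_inv symbols_iff set_permute_list)

context operad
begin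

lemma opact_map:
  assumes "\<sigma> permutes {..<n}"
  shows "f2_map (ops P n) (ops P n) (opact P n \<sigma>)"
  using opact_linear[OF assms] linear_maps_iff[OF ops_module ops_module, of "restrict (opact P n \<sigma>) (carrier (ops P n))"]
  by (auto intro: f2_map_cong[OF _ _ ops_module])

lemma opact_closed [simp]: "\<lbrakk>\<sigma> permutes {..<n}; \<mu> \<in> carrier (ops P n)\<rbrakk> \<Longrightarrow> opact P n \<sigma> \<mu> \<in> carrier (ops P n)"
  by (rule f2_mapD(1)[OF opact_map])

lemma schur_relators_closed:
  fixes M :: "('a, 'm) umodule_scheme"
  assumes M: "module F2 M"
  shows "schur_relators P M \<subseteq> carrier (free_space (symbols P M))"
proof -
  have k: "Poly_Mapping.keys (F - G) \<subseteq> S" if "Poly_Mapping.keys F \<subseteq> S" "Poly_Mapping.keys G \<subseteq> S"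
    for F G :: "('p \<times> 'a list) \<Rightarrow>\<^sub>0 bit" and S
    using that keys_diff[of F G] by blast
  have s: "Poly_Mapping.keys (Poly_Mapping.single b (c::bit)) \<subseteq> S" if "b \<in> S" for b :: "'p \<times> 'a list" and c S
    using that by auto
  have p: "set (permute_list (inv_into UNIV \<sigma>) xs) = set xs" if "\<sigma> permutes {..<length xs}" for \<sigma> and xs :: "'a list"
    using set_permute_list[OF permutes_inv[OF that]] .
  show ?thesis
  proof
    fix R assume "R \<in> schur_relators P M"
    then show "R \<in> carrier (free_space (symbols P M))"
      unfolding schur_relators_def free_space_simps mem_Collect_eq Un_iff
      by (elim disjE exE conjE; simp only: mem_Collect_eq; intro k s)
         (use M ops_module in \<open>simp_all add: symbols_iff p f2_closed\<close>)
  qed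
qed

lemma schur_null_submodule:
  assumes M: "module F2 M"
  shows "submodule (schur_null P M) F2 (free_space (symbols P M))"
  unfolding schur_null_def by (rule lin_span_submodule[OF free_space_module schur_relators_closed[OF M]])

lemma schur_space_module:
  assumes M: "module F2 M"
  shows "module F2 (schur_space P M)"
  unfolding schur_space_def by (rule quot_space_module[OF free_space_module schur_null_submodule[OF M]])

lemma schur_class_map:
  assumes M: "module F2 M"
  shows "f2_map (free_space (symbols P M)) (schur_space P M) (schur_class P M)"
  using quot_space_proj[OF free_space_module schur_null_submodule[OF M]]
  unfolding schur_space_def schur_class_def .

lemma schur_carrier: "carrier (schur_space P M) = schur_class P M ` carrier (free_space (symbols P M))"
  by (auto simp: schur_space_def schur_class_def quot_space_simps)

lemma schur_class_eq:
  assumes M: "module F2 M" and "F \<in> carrier (free_space (symbols P M))" "G \<in> carrier (free_space (symbols P M))"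
  shows "schur_class P M F = schur_class P M G \<longleftrightarrow> F + G \<in> schur_null P M"
  using f2_coset_eq[OF free_space_module schur_null_submodule[OF M] assms(2,3)]
  by (simp add: schur_class_def)

lemma schur_relator_class:
  assumes M: "module F2 M" and "F - G \<in> schur_relators P M"
    "F \<in> carrier (free_space (symbols P M))" "G \<in> carrier (free_space (symbols P M))"
  shows "schur_class P M F = schur_class P M G"
  using assms by (simp add: schur_class_eq schur_null_def lin_span_base bit_poly_diff)

text \<open>The relators impose precisely these rules on classes of symbols. This is the universal
  compatible function: all others factor through it by \<open>schur_lift\<close>.\<close>

lemma schur_gen_compat:
  fixes M :: "('a, 'm) umodule_scheme"
  assumes M: "module F2 M"
  shows "schur_compat P M (schur_space P M) (schur_gen P M)"
proof (rule schur_compatI)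
  note add = f2_mapD(2)[OF schur_class_map[OF M], symmetric]
  note cl = f2_closed(2)[OF free_space_module]
  fix \<mu> \<nu> :: 'p and xs :: "'a list"
  assume s: "(\<mu>, xs) \<in> symbols P M"
  then show "schur_gen P M \<mu> xs \<in> carrier (schur_space P M)"
    unfolding schur_gen_def by (intro f2_mapD(1)[OF schur_class_map[OF M]]) simp
  assume s': "(\<nu>, xs) \<in> symbols P M"
  have "schur_class P M (symb (\<mu> \<oplus>\<^bsub>ops P (length xs)\<^esub> \<nu>) xs) = schur_class P M (symb \<mu> xs + symb \<nu> xs)"
  proof (rule schur_relator_class[OF M])
    show "symb (\<mu> \<oplus>\<^bsub>ops P (length xs)\<^esub> \<nu>) xs - (symb \<mu> xs + symb \<nu> xs) \<in> schur_relators P M"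
      unfolding schur_relators_def using s s' by (fastforce simp: diff_diff_add)
  qed (use s s' cl[of "symb \<mu> xs" _ "symb \<nu> xs"] in \<open>auto simp: symbols_iff f2_closed ops_module\<close>)
  then show "schur_gen P M (\<mu> \<oplus>\<^bsub>ops P (length xs)\<^esub> \<nu>) xs =
      schur_gen P M \<mu> xs \<oplus>\<^bsub>schur_space P M\<^esub> schur_gen P M \<nu> xs"
    using s s' by (simp add: schur_gen_def add)
next
  note add = f2_mapD(2)[OF schur_class_map[OF M], symmetric]
  note cl = f2_closed(2)[OF free_space_module]
  fix \<mu> :: 'p and xs ys :: "'a list" and x y
  assume s: "(\<mu>, xs @ x # ys) \<in> symbols P M" and y: "y \<in> carrier M"
  then have s': "(\<mu>, xs @ y # ys) \<in> symbols P M" by (auto simp: symbols_iff)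
  have "schur_class P M (symb \<mu> (xs @ (x \<oplus>\<^bsub>M\<^esub> y) # ys)) =
      schur_class P M (symb \<mu> (xs @ x # ys) + symb \<mu> (xs @ y # ys))"
  proof (rule schur_relator_class[OF M])
    show "symb \<mu> (xs @ (x \<oplus>\<^bsub>M\<^esub> y) # ys) - (symb \<mu> (xs @ x # ys) + symb \<mu> (xs @ y # ys)) \<in> schur_relators P M"
      unfolding schur_relators_def using s y by (fastforce simp: diff_diff_add)
  qed (use s s' cl[of "symb \<mu> (xs @ x # ys)" _ "symb \<mu> (xs @ y # ys)"] in \<open>auto simp: symbols_iff f2_closed M\<close>)
  then show "schur_gen P M \<mu> (xs @ (x \<oplus>\<^bsub>M\<^esub> y) # ys) =
      schur_gen P M \<mu> (xs @ x # ys) \<oplus>\<^bsub>schur_space P M\<^esub> schur_gen P M \<mu> (xs @ y # ys)"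
    using s s' by (simp add: schur_gen_def add)
next
  fix \<sigma> \<mu> and xs :: "'a list"
  assume s: "(\<mu>, xs) \<in> symbols P M" and \<sigma>: "\<sigma> permutes {..<length xs}"
  let ?ys = "permute_list \<sigma> xs"
  have ys: "(\<mu>, ?ys) \<in> symbols P M" using s \<sigma> by (simp add: symbols_iff set_permute_list)
  have *: "symb (opact P (length ?ys) \<sigma> \<mu>) ?ys - symb \<mu> (permute_list (inv_into UNIV \<sigma>) ?ys) \<in> schur_relators P M"
    unfolding schur_relators_def using ys \<sigma>
    by (intro UnI2 CollectI exI[of _ \<sigma>] exI[of _ \<mu>] exI[of _ ?ys]) simp
  show "schur_gen P M (opact P (length xs) \<sigma> \<mu>) ?ys = schur_gen P M \<mu> xs"
    unfolding schur_gen_def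
    by (rule schur_relator_class[OF M])
       (use * ys s \<sigma> in \<open>simp_all add: permute_list_inv symbols_iff\<close>)
qed

lemma schur_gen_closed [simp]:
  assumes "module F2 M" "set xs \<subseteq> carrier M" "\<mu> \<in> carrier (ops P (length xs))"
  shows "schur_gen P M \<mu> xs \<in> carrier (schur_space P M)"
  using schur_compatD(1)[OF schur_gen_compat[OF assms(1)]] assms by (simp add: symbols_iff)

abbreviation schur_gens :: "('a, 'm) umodule_scheme \<Rightarrow> ('p, 'a) schur set" where
  "schur_gens M \<equiv> {schur_gen P M \<mu> xs | \<mu> xs. (\<mu>, xs) \<in> symbols P M}"

lemma schur_gens_closed: "module F2 M \<Longrightarrow> schur_gens M \<subseteq> carrier (schur_space P M)"
  by (auto simp: symbols_iff)

lemma schur_span: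
  assumes M: "module F2 M"
  shows "carrier (schur_space P M) = lin_span (schur_space P M) (schur_gens M)"
proof
  show "carrier (schur_space P M) \<subseteq> lin_span (schur_space P M) (schur_gens M)"
  proof
    fix t assume "t \<in> carrier (schur_space P M)"
    then obtain F where F: "F \<in> carrier (free_space (symbols P M))" "t = schur_class P M F"
      unfolding schur_carrier by blast
    show "t \<in> lin_span (schur_space P M) (schur_gens M)"
      unfolding F(2)
      by (rule f2_map_span[OF schur_class_map[OF M] free_space_module schur_space_module[OF M]
            lin_span_submodule[OF schur_space_module[OF M] schur_gens_closed[OF M]],
            of "(\<lambda>b. Poly_Mapping.single b 1) ` symbols P M"])
         (use F(1) in \<open>auto intro!: lin_span_base exI simp: schur_gen_def free_space_span[symmetric]\<close>)
  qed
qed (rule lin_span_closed[OF schur_space_module[OF M] schur_gens_closed[OF M]])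

lemma schur_map_ext:
  assumes M: "module F2 M" and V: "module F2 V"
    and h: "f2_map (schur_space P M) V h" and k: "f2_map (schur_space P M) V k"
    and hk: "\<And>\<mu> xs. (\<mu>, xs) \<in> symbols P M \<Longrightarrow> h (schur_gen P M \<mu> xs) = k (schur_gen P M \<mu> xs)"
    and t: "t \<in> carrier (schur_space P M)"
  shows "h t = k t"
  by (rule f2_map_eq_on_span[OF h k schur_space_module[OF M] V schur_gens_closed[OF M] _
        t[unfolded schur_span[OF M]]]) (auto simp: hk)

lemma lin_ext_compat:
  assumes f: "schur_compat P M V f" and V: "module F2 V"
  shows "f2_map (free_space (symbols P M)) V (lin_ext V (\<lambda>(\<mu>, xs). f \<mu> xs))"
    and "(\<mu>, xs) \<in> symbols P M \<Longrightarrow> lin_ext V (\<lambda>(\<mu>, xs). f \<mu> xs) (Poly_Mapping.single (\<mu>, xs) c) = c \<odot>\<^bsub>V\<^esub> f \<mu> xs"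
  using lin_ext_map[OF V, of "symbols P M" "\<lambda>(\<mu>, xs). f \<mu> xs"] schur_compatD(1)[OF f]
    lin_ext_single[OF V, of "\<lambda>(\<mu>, xs). f \<mu> xs" "(\<mu>, xs)" c]
  by auto

text \<open>Each clause of compatibility cancels one family of relators. The two scalar families
  have no clause of their own; for c = 1 they are trivial, and for c = 0 they follow from
  additivity.\<close>

lemma lin_ext_relator:
  assumes f: "schur_compat P M V f" and V: "module F2 V" and M: "module F2 M"
    and R: "R \<in> schur_relators P M"
  shows "lin_ext V (\<lambda>(\<mu>, xs). f \<mu> xs) R = \<zero>\<^bsub>V\<^esub>"
proof -
  let ?L = "lin_ext V (\<lambda>(\<mu>, xs). f \<mu> xs)"
  note L = lin_ext_compat[OF f V]
  note add = f2_mapD(2)[OF L(1), simplified]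
  note cl = f2_closed(2)[OF free_space_module, of _ "symbols P M", simplified]
  have op: "f (\<mu> \<oplus>\<^bsub>ops P (length xs)\<^esub> \<nu>) xs = f \<mu> xs \<oplus>\<^bsub>V\<^esub> f \<nu> xs" "f \<mu> xs \<in> carrier V"
      "(\<mu> \<oplus>\<^bsub>ops P (length xs)\<^esub> \<nu>, xs) \<in> symbols P M"
    if "(\<mu>, xs) \<in> symbols P M" "(\<nu>, xs) \<in> symbols P M" for \<mu> \<nu> xs
    using that schur_compatD[OF f] by (auto simp: symbols_iff f2_closed ops_module)
  have slot: "f \<mu> (xs @ (x \<oplus>\<^bsub>M\<^esub> y) # ys) = f \<mu> (xs @ x # ys) \<oplus>\<^bsub>V\<^esub> f \<mu> (xs @ y # ys)"
      "(\<mu>, xs @ (x \<oplus>\<^bsub>M\<^esub> y) # ys) \<in> symbols P M" "(\<mu>, xs @ y # ys) \<in> symbols P M"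
    if "(\<mu>, xs @ x # ys) \<in> symbols P M" "y \<in> carrier M" for \<mu> xs x y ys
    using that schur_compatD[OF f] M by (auto simp: symbols_iff f2_closed)
  from R show ?thesis
    unfolding schur_relators_def
  proof (elim UnE CollectE exE conjE)
    fix \<mu> \<nu> xs
    assume "R = symb (\<mu> \<oplus>\<^bsub>ops P (length xs)\<^esub> \<nu>) xs - symb \<mu> xs - symb \<nu> xs"
      "(\<mu>, xs) \<in> symbols P M" "(\<nu>, xs) \<in> symbols P M"
    then show ?thesis using op[of \<mu> xs \<nu>] op[of \<nu> xs \<nu>] V
      by (simp add: bit_poly_diff add cl L(2) f2_simps)
  next
    fix c \<mu> xs
    assume "R = symb (c \<odot>\<^bsub>ops P (length xs)\<^esub> \<mu>) xs - Poly_Mapping.single (\<mu>, xs) c" and s: "(\<mu>, xs) \<in> symbols P M"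
    moreover have "f (c \<odot>\<^bsub>ops P (length xs)\<^esub> \<mu>) xs = c \<odot>\<^bsub>V\<^esub> f \<mu> xs"
      using schur_compat_op[OF f, of xs] f2_map_zero[OF schur_compat_op[OF f, of xs] ops_module V] s
        schur_compatD(1)[OF f s] V
      by (cases c rule: bit_cases) (auto simp: symbols_iff f2_smult ops_module)
    moreover have "(c \<odot>\<^bsub>ops P (length xs)\<^esub> \<mu>, xs) \<in> symbols P M"
      using s by (simp add: symbols_iff f2_closed ops_module)
    ultimately show ?thesis using V schur_compatD(1)[OF f s]
      by (simp add: bit_poly_diff add L(2) f2_self f2_closed f2_smult)
  next
    fix \<mu> xs x y ys
    assume "R = symb \<mu> (xs @ (x \<oplus>\<^bsub>M\<^esub> y) # ys) - symb \<mu> (xs @ x # ys) - symb \<mu> (xs @ y # ys)"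
      "(\<mu>, xs @ x # ys) \<in> symbols P M" "y \<in> carrier M"
    then show ?thesis using slot[of \<mu> xs x ys y] schur_compatD(1)[OF f] V
      by (simp add: bit_poly_diff add cl L(2) f2_simps)
  next
    fix c \<mu> xs x ys
    assume "R = symb \<mu> (xs @ (c \<odot>\<^bsub>M\<^esub> x) # ys) - Poly_Mapping.single (\<mu>, xs @ x # ys) c"
      and s: "(\<mu>, xs @ x # ys) \<in> symbols P M"
    moreover have "f \<mu> (xs @ (c \<odot>\<^bsub>M\<^esub> x) # ys) = c \<odot>\<^bsub>V\<^esub> f \<mu> (xs @ x # ys)"
      using schur_compat_zero[OF f M V, of "xs @ \<zero>\<^bsub>M\<^esub> # ys" \<mu>] s schur_compatD(1)[OF f s] V M
      by (cases c rule: bit_cases) (auto simp: symbols_iff f2_smult f2_closed)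
    moreover have "(\<mu>, xs @ (c \<odot>\<^bsub>M\<^esub> x) # ys) \<in> symbols P M"
      using s M by (simp add: symbols_iff f2_closed)
    ultimately show ?thesis using V schur_compatD(1)[OF f s]
      by (simp add: bit_poly_diff add L(2) f2_self f2_closed f2_smult)
  next
    fix \<sigma> \<mu> xs
    assume R: "R = symb (opact P (length xs) \<sigma> \<mu>) xs - symb \<mu> (permute_list (inv_into UNIV \<sigma>) xs)"
      and s: "(\<mu>, xs) \<in> symbols P M" and \<sigma>: "\<sigma> permutes {..<length xs}"
    have "(opact P (length xs) \<sigma> \<mu>, xs) \<in> symbols P M"
        "(\<mu>, permute_list (inv_into UNIV \<sigma>) xs) \<in> symbols P M"
      using s \<sigma> permutes_inv[OF \<sigma>] by (auto simp: symbols_iff)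
    then show ?thesis using R schur_compat_inv[OF f s \<sigma>] schur_compatD(1)[OF f] V
      by (simp add: bit_poly_diff add L(2) f2_self f2_smult)
  qed
qed

lemma lin_ext_null:
  assumes f: "schur_compat P M V f" and V: "module F2 V" and M: "module F2 M"
    and F: "F \<in> schur_null P M"
  shows "lin_ext V (\<lambda>(\<mu>, xs). f \<mu> xs) F = \<zero>\<^bsub>V\<^esub>"
proof -
  have "lin_ext V (\<lambda>(\<mu>, xs). f \<mu> xs) F \<in> {\<zero>\<^bsub>V\<^esub>}"
    by (rule f2_map_span[OF lin_ext_compat(1)[OF f V] free_space_module V submodule_zero[OF V]
          schur_relators_closed[OF M] _ F[unfolded schur_null_def]])
       (auto simp: lin_ext_relator[OF f V M])
  then show ?thesis by simp
qed

text \<open>Two representatives differ by a null element, which the linear extension kills, so the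
  extension is constant on the coset as \<open>the_elem\<close> demands.\<close>

lemma schur_lift_class:
  assumes f: "schur_compat P M V f" and V: "module F2 V" and M: "module F2 M"
    and F: "F \<in> carrier (free_space (symbols P M))"
  shows "schur_lift P M V f (schur_class P M F) = lin_ext V (\<lambda>(\<mu>, xs). f \<mu> xs) F"
proof -
  let ?L = "lin_ext V (\<lambda>(\<mu>, xs). f \<mu> xs)"
  note L = lin_ext_compat(1)[OF f V]
  have "the_elem (?L ` schur_class P M F) = ?L F"
    unfolding schur_class_def
  proof (rule the_elem_coset[OF free_space_module schur_null_submodule[OF M] F])
    fix G assume G: "G \<in> carrier (free_space (symbols P M))"
      and eq: "schur_null P M +>\<^bsub>free_space (symbols P M)\<^esub> G = schur_null P M +>\<^bsub>free_space (symbols P M)\<^esub> F"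
    have "G + F \<in> schur_null P M"
      using schur_class_eq[OF M G F] eq unfolding schur_class_def by blast
    then have "?L (G + F) = \<zero>\<^bsub>V\<^esub>" by (rule lin_ext_null[OF f V M])
    moreover have "?L (G + F) = ?L G \<oplus>\<^bsub>V\<^esub> ?L F" using f2_mapD(2)[OF L G F] by simp
    ultimately show "?L G = ?L F"
      using f2_eq_iff[OF V f2_mapD(1)[OF L G] f2_mapD(1)[OF L F]] by simp
  qed
  moreover have "schur_class P M F \<in> carrier (schur_space P M)" using F schur_carrier by blast
  ultimately show ?thesis by (simp add: schur_lift_def)
qed

lemma schur_lift_map:
  assumes f: "schur_compat P M V f" and V: "module F2 V" and M: "module F2 M"
  shows "f2_map (schur_space P M) V (schur_lift P M V f)"
proof (rule f2_mapI)
  note L = lin_ext_compat(1)[OF f V] and C = schur_class_map[OF M]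
  fix s t assume "s \<in> carrier (schur_space P M)"
  then obtain F where F: "F \<in> carrier (free_space (symbols P M))" "s = schur_class P M F"
    unfolding schur_carrier by blast
  then show "schur_lift P M V f s \<in> carrier V"
    using f2_mapD(1)[OF L] by (simp add: schur_lift_class[OF f V M])
  assume "t \<in> carrier (schur_space P M)"
  then obtain G where G: "G \<in> carrier (free_space (symbols P M))" "t = schur_class P M G"
    unfolding schur_carrier by blast
  have FG: "F \<oplus>\<^bsub>free_space (symbols P M)\<^esub> G \<in> carrier (free_space (symbols P M))"
    by (rule f2_closed(2)[OF free_space_module F(1) G(1)])
  show "schur_lift P M V f (s \<oplus>\<^bsub>schur_space P M\<^esub> t) = schur_lift P M V f s \<oplus>\<^bsub>V\<^esub> schur_lift P M V f t"
    unfolding F(2) G(2) f2_mapD(2)[OF C F(1) G(1), symmetric]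
    by (simp only: schur_lift_class[OF f V M] F(1) G(1) FG f2_mapD(2)[OF L])
qed

lemma schur_lift_gen:
  assumes f: "schur_compat P M V f" and V: "module F2 V" and M: "module F2 M"
    and s: "(\<mu>, xs) \<in> symbols P M"
  shows "schur_lift P M V f (schur_gen P M \<mu> xs) = f \<mu> xs"
  using schur_lift_class[OF f V M, of "symb \<mu> xs"] lin_ext_compat(2)[OF f V s, of 1] s
    schur_compatD(1)[OF f s] V
  by (simp add: schur_gen_def f2_smult)

lemma schur_lift_extensional: "schur_lift P M V f \<in> extensional (carrier (schur_space P M))"
  by (simp add: schur_lift_def)

end


section \<open>Compositions of a number and iterated Cartan formulas\<close>

lemmas f2_finsum_closed = f2_finsum_simps(5)
lemmas f2_finsum_zero = f2_finsum_simps(4)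
lemmas f2_finsum_add = f2_finsum_simps(6)

definition comps :: "nat \<Rightarrow> nat \<Rightarrow> nat list set" where
  "comps n i = {ks. length ks = n \<and> sum_list ks = i}"

lemma comps_iff: "ks \<in> comps n i \<longleftrightarrow> length ks = n \<and> sum_list ks = i"
  by (simp add: comps_def)

lemma finite_comps [simp]: "finite (comps n i)"
proof (rule finite_subset)
  show "comps n i \<subseteq> {ks. set ks \<subseteq> {..i} \<and> length ks = n}"
    using member_le_sum_list by (auto simp: comps_def)
qed (rule finite_lists_length_eq, simp)

lemma comps_0: "comps 0 i = (if i = 0 then {[]} else {})"
  by (auto simp: comps_def)

lemma comps_zero: "comps n 0 = {replicate n 0}"
  by (auto simp: comps_def sum_list_eq_0_iff list_eq_iff_nth_eq)

lemma finsum_comps_0: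
  assumes "module F2 V" "f [] \<in> carrier V"
  shows "finsum V f (comps 0 i) = (if i = 0 then f [] else \<zero>\<^bsub>V\<^esub>)"
  using assms f2_finsum_single[OF assms(1), of "{[]}" "[]" f] by (simp add: comps_0 f2_finsum_simps(1))

lemma finsum_comps_Suc:
  assumes V: "module F2 V" and f: "\<And>ks. length ks = Suc n \<Longrightarrow> f ks \<in> carrier V"
  shows "finsum V f (comps (Suc n) i) = finsum V (\<lambda>k. finsum V (\<lambda>ks. f (k # ks)) (comps n (i - k))) {..i}"
proof -
  have bij: "bij_betw (\<lambda>(k, ks). k # ks) (SIGMA k:{..i}. comps n (i - k)) (comps (Suc n) i)"
    by (rule bij_betw_byWitness[where f' = "\<lambda>ks. (hd ks, tl ks)"])
       (auto simp: comps_def length_Suc_conv)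
  have "finsum V f (comps (Suc n) i) = finsum V (\<lambda>p. f (case p of (k, ks) \<Rightarrow> k # ks)) (SIGMA k:{..i}. comps n (i - k))"
    by (rule f2_finsum_reindex[OF V bij]) (simp add: f comps_iff)
  also have "\<dots> = finsum V (\<lambda>(k, ks). f (k # ks)) (SIGMA k:{..i}. comps n (i - k))"
    by (rule f2_finsum_cong[OF V refl]) (auto simp: f comps_iff)
  also have "\<dots> = finsum V (\<lambda>k. finsum V (\<lambda>ks. f (k # ks)) (comps n (i - k))) {..i}"
    by (rule f2_finsum_Sigma[OF V, symmetric]) (simp_all add: f comps_iff)
  finally show ?thesis .
qed

text \<open>The family \<open>T\<close> is kept arbitrary because the same sum serves twice: with
  the squares it is the Cartan formula, with the homogeneous components it is the projection onto
  total degree i.\<close>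

definition cartan :: "(bit, 'v, 'm) module_scheme \<Rightarrow> ('p \<Rightarrow> 'b list \<Rightarrow> 'v) \<Rightarrow> (nat \<Rightarrow> 'a \<Rightarrow> 'b) \<Rightarrow>
    nat \<Rightarrow> 'p \<Rightarrow> 'a list \<Rightarrow> 'v" where
  "cartan V g T i \<mu> xs = finsum V (\<lambda>ks. g \<mu> (map2 T ks xs)) (comps (length xs) i)"

lemma map2_slot:
  assumes "length ks = length xs + Suc (length ys)"
  shows "map2 T ks (xs @ z # ys) =
    map2 T (take (length xs) ks) xs @ T (ks ! length xs) z # map2 T (drop (Suc (length xs)) ks) ys"
proof -
  have "ks = take (length xs) ks @ ks ! length xs # drop (Suc (length xs)) ks"
    using assms by (intro id_take_nth_drop) simp
  then have "zip ks (xs @ z # ys) = zip (take (length xs) ks @ ks ! length xs # drop (Suc (length xs)) ks) (xs @ z # ys)"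
    by simp
  also have "\<dots> = zip (take (length xs) ks) xs @ (ks ! length xs, z) # zip (drop (Suc (length xs)) ks) ys"
    using assms by (subst zip_append) simp_all
  finally show ?thesis by simp
qed

lemma map2_set_closed:
  assumes "\<And>k x. x \<in> A \<Longrightarrow> T k x \<in> B" "set xs \<subseteq> A"
  shows "set (map2 T ks xs) \<subseteq> B"
  using assms by (auto dest!: set_zip_rightD)

lemma permute_list_map2:
  assumes "\<sigma> permutes {..<length xs}" "length ks = length xs"
  shows "permute_list \<sigma> (map2 T ks xs) = map2 T (permute_list \<sigma> ks) (permute_list \<sigma> xs)"
proof -
  have "\<sigma> permutes {..<length (zip ks xs)}" using assms by simp
  then have "permute_list \<sigma> (map2 T ks xs) = map (\<lambda>(x, y). T x y) (permute_list \<sigma> (zip ks xs))"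
    by (rule permute_list_map)
  also have "permute_list \<sigma> (zip ks xs) = zip (permute_list \<sigma> ks) (permute_list \<sigma> xs)"
    using assms by (intro permute_list_zip[of _ "{..<length ks}"]) simp_all
  finally show ?thesis .
qed

lemma permute_comps_bij:
  assumes "\<sigma> permutes {..<n}"
  shows "bij_betw (permute_list \<sigma>) (comps n i) (comps n i)"
proof (rule bij_betw_byWitness[where f' = "permute_list (inv_into UNIV \<sigma>)"])
  have s: "sum_list (permute_list \<tau> ks) = sum_list ks" if "\<tau> permutes {..<length ks}" for \<tau> and ks :: "nat list"
    using mset_permute_list[OF that] by (metis sum_mset_sum_list)
  show "permute_list \<sigma> ` comps n i \<subseteq> comps n i"
    using s assms by (auto simp: comps_iff)
  show "permute_list (inv_into UNIV \<sigma>) ` comps n i \<subseteq> comps n i"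
    using s permutes_inv[OF assms] by (auto simp: comps_iff)
qed (use assms in \<open>auto simp: permute_list_inv comps_iff\<close>)

text \<open>Equivariance is a change of summation index, since permuting a composition of i again
  gives a composition of i. Additivity in a slot holds in each summand separately, where only one
  operator acts on that slot.\<close>

lemma cartan_compat:
  assumes M: "module F2 M" and N: "module F2 N" and V: "module F2 V"
    and g: "schur_compat P N V g" and T: "\<And>k. f2_map M N (T k)"
  shows "schur_compat P M V (cartan V g T i)"
proof (rule schur_compatI)
  note T' = f2_mapD[OF T]
  have set: "set (map2 T ks xs) \<subseteq> carrier N" if "set xs \<subseteq> carrier M" for ks xs
    using map2_set_closed[of "carrier M" T "carrier N", OF T'(1) that] .
  note set = set set[unfolded list.set_map]
  have cl: "g \<mu> (map2 T ks xs) \<in> carrier V"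
    if "length ks = length xs" "(\<mu>, xs) \<in> symbols P M" for \<mu> ks xs
    using that by (intro schur_compatD(1)[OF g]) (simp add: symbols_iff set)
  fix \<mu> \<nu> xs
  assume s: "(\<mu>, xs) \<in> symbols P M"
  show "cartan V g T i \<mu> xs \<in> carrier V"
    unfolding cartan_def by (rule f2_finsum_closed[OF V]) (simp add: cl comps_iff s)
  {
    assume s': "(\<nu>, xs) \<in> symbols P M"
    have "cartan V g T i (\<mu> \<oplus>\<^bsub>ops P (length xs)\<^esub> \<nu>) xs =
        finsum V (\<lambda>ks. g \<mu> (map2 T ks xs) \<oplus>\<^bsub>V\<^esub> g \<nu> (map2 T ks xs)) (comps (length xs) i)"
      unfolding cartan_def
    proof (rule f2_finsum_cong[OF V refl])
      fix ks assume "ks \<in> comps (length xs) i"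
      then have l: "length ks = length xs" by (simp add: comps_iff)
      then show "g (\<mu> \<oplus>\<^bsub>ops P (length xs)\<^esub> \<nu>) (map2 T ks xs) = g \<mu> (map2 T ks xs) \<oplus>\<^bsub>V\<^esub> g \<nu> (map2 T ks xs)"
        using schur_compatD(2)[OF g, of \<mu> "map2 T ks xs" \<nu>] s s' by (simp add: symbols_iff set)
      show "g \<mu> (map2 T ks xs) \<oplus>\<^bsub>V\<^esub> g \<nu> (map2 T ks xs) \<in> carrier V"
        using l s s' by (intro f2_closed(2)[OF V] cl)
    qed
    also have "\<dots> = cartan V g T i \<mu> xs \<oplus>\<^bsub>V\<^esub> cartan V g T i \<nu> xs"
      unfolding cartan_def by (rule f2_finsum_add[OF V]) (simp_all add: cl comps_iff s s')
    finally show "cartan V g T i (\<mu> \<oplus>\<^bsub>ops P (length xs)\<^esub> \<nu>) xs = cartan V g T i \<mu> xs \<oplus>\<^bsub>V\<^esub> cartan V g T i \<nu> xs" .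
  }
  fix \<sigma> assume \<sigma>: "\<sigma> permutes {..<length xs}"
  have "cartan V g T i (opact P (length xs) \<sigma> \<mu>) (permute_list \<sigma> xs) =
      finsum V (\<lambda>ks. g (opact P (length xs) \<sigma> \<mu>) (map2 T (permute_list \<sigma> ks) (permute_list \<sigma> xs))) (comps (length xs) i)"
    unfolding cartan_def length_permute_list
  proof (rule f2_finsum_reindex[OF V permute_comps_bij[OF \<sigma>]])
    fix ks assume "ks \<in> comps (length xs) i"
    then have l: "length ks = length xs" by (simp add: comps_iff)
    \<comment> \<open>Writing the index as a permuted list brings the term into the shape to which
      equivariance of \<open>g\<close> applies; it then equals an unpermuted term, which lies in the
      carrier.\<close>
    define js where "js = permute_list (inv_into UNIV \<sigma>) ks"
    have ks: "ks = permute_list \<sigma> js" unfolding js_def using \<sigma> l by (simp add: permute_list_inv)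
    have lj: "length js = length xs" unfolding js_def using l by simp
    have "g (opact P (length (map2 T js xs)) \<sigma> \<mu>) (permute_list \<sigma> (map2 T js xs)) = g \<mu> (map2 T js xs)"
      using s \<sigma> lj by (intro schur_compatD(4)[OF g]) (simp_all add: symbols_iff set)
    then show "g (opact P (length xs) \<sigma> \<mu>) (map2 T ks (permute_list \<sigma> xs)) \<in> carrier V"
      using cl[OF lj s] lj unfolding ks by (simp add: permute_list_map2[OF \<sigma> lj])
  qed
  also have "\<dots> = cartan V g T i \<mu> xs"
    unfolding cartan_def
  proof (rule f2_finsum_cong[OF V refl])
    fix ks assume "ks \<in> comps (length xs) i"
    then have l: "length ks = length xs" by (simp add: comps_iff)
    have "g (opact P (length (map2 T ks xs)) \<sigma> \<mu>) (permute_list \<sigma> (map2 T ks xs)) = g \<mu> (map2 T ks xs)"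
      using s \<sigma> l by (intro schur_compatD(4)[OF g]) (simp_all add: symbols_iff set)
    then show "g (opact P (length xs) \<sigma> \<mu>) (map2 T (permute_list \<sigma> ks) (permute_list \<sigma> xs)) = g \<mu> (map2 T ks xs)"
      using l by (simp add: permute_list_map2[OF \<sigma> l])
  qed (simp add: cl comps_iff s)
  finally show "cartan V g T i (opact P (length xs) \<sigma> \<mu>) (permute_list \<sigma> xs) = cartan V g T i \<mu> xs" .
next
  note T' = f2_mapD[OF T]
  have set: "set (map2 T ks xs) \<subseteq> carrier N" if "set xs \<subseteq> carrier M" for ks xs
    using map2_set_closed[of "carrier M" T "carrier N", OF T'(1) that] .
  note set = set set[unfolded list.set_map]
  fix \<mu> xs x y ys
  assume s: "(\<mu>, xs @ x # ys) \<in> symbols P M" and y: "y \<in> carrier M"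
  let ?n = "length xs + Suc (length ys)"
  define G where "G = (\<lambda>ks z. g \<mu> (map2 T ks (xs @ z # ys)))"
  have G: "f2_map M V (G ks)" if "ks \<in> comps ?n i" for ks
  proof -
    have l: "length ks = ?n" using that by (simp add: comps_iff)
    have "f2_map N V (\<lambda>z. g \<mu> (map2 T (take (length xs) ks) xs @ z # map2 T (drop (Suc (length xs)) ks) ys))"
      using s l by (intro schur_compat_slot[OF g N]) (simp_all add: symbols_iff set)
    from f2_map_comp[OF T this] show ?thesis
      unfolding G_def map2_slot[OF l] .
  qed
  have c: "cartan V g T i \<mu> (xs @ z # ys) = finsum V (\<lambda>ks. G ks z) (comps ?n i)" for z
    by (simp add: cartan_def G_def)
  have "finsum V (\<lambda>ks. G ks (x \<oplus>\<^bsub>M\<^esub> y)) (comps ?n i) = finsum V (\<lambda>ks. G ks x \<oplus>\<^bsub>V\<^esub> G ks y) (comps ?n i)"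
    by (rule f2_finsum_cong[OF V refl]) (use s y V f2_mapD[OF G] in \<open>simp_all add: symbols_iff f2_closed\<close>)
  also have "\<dots> = finsum V (\<lambda>ks. G ks x) (comps ?n i) \<oplus>\<^bsub>V\<^esub> finsum V (\<lambda>ks. G ks y) (comps ?n i)"
    by (rule f2_finsum_add[OF V]) (use s y f2_mapD[OF G] in \<open>simp_all add: symbols_iff\<close>)
  finally show "cartan V g T i \<mu> (xs @ (x \<oplus>\<^bsub>M\<^esub> y) # ys) =
      cartan V g T i \<mu> (xs @ x # ys) \<oplus>\<^bsub>V\<^esub> cartan V g T i \<mu> (xs @ y # ys)"
    unfolding c .
qed


section \<open>The Bullett--Macdonald identity for tensor products\<close>

text \<open>What remains of compatibility once the operation is fixed. Unlike compatibility it
  survives fixing the first entry of the list, so inductions on the number of tensor factors can use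
  it.\<close>

definition multi_additive :: "(bit, 'a, 'm) module_scheme \<Rightarrow> (bit, 'v, 'n) module_scheme \<Rightarrow> nat \<Rightarrow> ('a list \<Rightarrow> 'v) \<Rightarrow> bool"
  where "multi_additive M V n \<phi> \<longleftrightarrow>
    (\<forall>xs. length xs = n \<and> set xs \<subseteq> carrier M \<longrightarrow> \<phi> xs \<in> carrier V) \<and>
    (\<forall>xs ys. length xs + Suc (length ys) = n \<and> set xs \<subseteq> carrier M \<and> set ys \<subseteq> carrier M \<longrightarrow>
      f2_map M V (\<lambda>x. \<phi> (xs @ x # ys)))"

lemma multi_additiveD:
  assumes "multi_additive M V n \<phi>"
  shows "\<lbrakk>length xs = n; set xs \<subseteq> carrier M\<rbrakk> \<Longrightarrow> \<phi> xs \<in> carrier V"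
    and "\<lbrakk>length xs + Suc (length ys) = n; set xs \<subseteq> carrier M; set ys \<subseteq> carrier M\<rbrakk> \<Longrightarrow>
      f2_map M V (\<lambda>x. \<phi> (xs @ x # ys))"
  using assms by (simp_all add: multi_additive_def)

lemma multi_additive_Cons:
  assumes \<phi>: "multi_additive M V (Suc n) \<phi>" and x: "x \<in> carrier M"
  shows "multi_additive M V n (\<lambda>xs. \<phi> (x # xs))"
  unfolding multi_additive_def
proof (intro conjI allI impI; elim conjE)
  show "\<phi> (x # xs) \<in> carrier V" if "length xs = n" "set xs \<subseteq> carrier M" for xs
    using that x by (intro multi_additiveD(1)[OF \<phi>]) simp_all
  show "f2_map M V (\<lambda>z. \<phi> (x # xs @ z # ys))"
    if "length xs + Suc (length ys) = n" "set xs \<subseteq> carrier M" "set ys \<subseteq> carrier M" for xs ys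
    using multi_additiveD(2)[OF \<phi>, of "x # xs" ys] that x by simp
qed

lemma schur_compat_multi:
  assumes f: "schur_compat P M V f" and M: "module F2 M" and \<mu>: "\<mu> \<in> carrier (ops P n)"
  shows "multi_additive M V n (f \<mu>)"
  unfolding multi_additive_def
proof (intro conjI allI impI; elim conjE)
  show "f \<mu> xs \<in> carrier V" if "length xs = n" "set xs \<subseteq> carrier M" for xs
    using that \<mu> by (intro schur_compatD(1)[OF f]) (simp add: symbols_iff)
  show "f2_map M V (\<lambda>x. f \<mu> (xs @ x # ys))"
    if "length xs + Suc (length ys) = n" "set xs \<subseteq> carrier M" "set ys \<subseteq> carrier M" for xs ys
    using that \<mu> by (intro schur_compat_slot[OF f M]) auto
qed

lemma f2_map_smult:
  assumes "f2_map M V G" "module F2 M" "module F2 V" "x \<in> carrier M"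
  shows "G (c \<odot>\<^bsub>M\<^esub> x) = c \<odot>\<^bsub>V\<^esub> G x"
  using assms f2_map_zero[OF assms(1-3)] f2_mapD(1)[OF assms(1)] by (simp add: f2_smult)

lemma f2_map_vec_pair:
  assumes G: "f2_map M V G" and M: "module F2 M" and V: "module F2 V"
    and m: "\<And>i. i \<le> n \<Longrightarrow> m i \<in> carrier M"
  shows "G (vec_pair M n r m) = vec_pair V n r (\<lambda>i. G (m i))"
proof -
  have "G (vec_pair M n r m) = finsum V (\<lambda>i. G (r i \<odot>\<^bsub>M\<^esub> m i)) {..n}"
    unfolding vec_pair_def by (rule f2_map_finsum[OF G M V]) (simp add: m M f2_closed)
  also have "\<dots> = vec_pair V n r (\<lambda>i. G (m i))"
    unfolding vec_pair_def
    by (rule f2_finsum_cong[OF V refl]) (simp_all add: f2_map_smult[OF G M V] m f2_closed(3)[OF V] f2_mapD(1)[OF G])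
  finally show ?thesis .
qed

lemma f2_map_finsum_pointwise:
  assumes V: "module F2 V" and M: "module F2 M" and G: "\<And>a. a \<in> A \<Longrightarrow> f2_map M V (G a)"
  shows "f2_map M V (\<lambda>x. finsum V (\<lambda>a. G a x) A)"
proof (rule f2_mapI)
  fix x y assume x: "x \<in> carrier M"
  show "finsum V (\<lambda>a. G a x) A \<in> carrier V"
    by (rule f2_finsum_closed[OF V]) (rule f2_mapD(1)[OF G x])
  assume y: "y \<in> carrier M"
  have "finsum V (\<lambda>a. G a (x \<oplus>\<^bsub>M\<^esub> y)) A = finsum V (\<lambda>a. G a x \<oplus>\<^bsub>V\<^esub> G a y) A"
    by (rule f2_finsum_cong[OF V refl])
       (simp_all add: f2_mapD(2)[OF G x y] f2_closed(2)[OF V] f2_mapD(1)[OF G] x y)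
  also have "\<dots> = finsum V (\<lambda>a. G a x) A \<oplus>\<^bsub>V\<^esub> finsum V (\<lambda>a. G a y) A"
    by (rule f2_finsum_add[OF V]) (simp_all add: f2_mapD(1)[OF G] x y)
  finally show "finsum V (\<lambda>a. G a (x \<oplus>\<^bsub>M\<^esub> y)) A = finsum V (\<lambda>a. G a x) A \<oplus>\<^bsub>V\<^esub> finsum V (\<lambda>a. G a y) A" .
qed

lemma f2_map_scaled:
  assumes V: "module F2 V" and M: "module F2 M" and G: "f2_map M V G"
  shows "f2_map M V (\<lambda>x. c \<odot>\<^bsub>V\<^esub> G x)"
proof (rule f2_mapI)
  fix x y assume x: "x \<in> carrier M"
  show "c \<odot>\<^bsub>V\<^esub> G x \<in> carrier V" by (rule f2_closed(3)[OF V f2_mapD(1)[OF G x]])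
  assume y: "y \<in> carrier M"
  show "c \<odot>\<^bsub>V\<^esub> G (x \<oplus>\<^bsub>M\<^esub> y) = c \<odot>\<^bsub>V\<^esub> G x \<oplus>\<^bsub>V\<^esub> c \<odot>\<^bsub>V\<^esub> G y"
    unfolding f2_mapD(2)[OF G x y]
    by (rule module.smult_r_distr[OF V]) (simp_all add: f2_mapD(1)[OF G] x y)
qed

text \<open>The value of \<open>\<phi>\<close> on \<open>Sq\<^sup>a Sq\<^sup>b (x\<^sub>1 \<otimes> \<dots> \<otimes> x\<^sub>n)\<close>, for a family \<open>T\<close> of operators in place
  of the \<open>Sq\<^sup>i\<close>.\<close>

definition cartan2 :: "(bit, 'v, 'm) module_scheme \<Rightarrow> (nat \<Rightarrow> 'a \<Rightarrow> 'a) \<Rightarrow> ('a list \<Rightarrow> 'v) \<Rightarrow> 'a list \<Rightarrow> nat \<Rightarrow> nat \<Rightarrow> 'v"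
  where "cartan2 V T \<phi> xs a b =
    finsum V (\<lambda>ks. finsum V (\<lambda>js. \<phi> (map2 T js (map2 T ks xs))) (comps (length xs) a)) (comps (length xs) b)"

definition bm_sum :: "(bit, 'v, 'm) module_scheme \<Rightarrow> (nat \<Rightarrow> 'a \<Rightarrow> 'a) \<Rightarrow> (nat \<Rightarrow> nat \<Rightarrow> nat \<Rightarrow> bit) \<Rightarrow>
    ('a list \<Rightarrow> 'v) \<Rightarrow> 'a list \<Rightarrow> nat \<Rightarrow> nat \<Rightarrow> 'v"
  where "bm_sum V T w \<phi> xs n c = vec_pair V n (w n c) (\<lambda>i. cartan2 V T \<phi> xs i (n - i))"

text \<open>The weight at i in degree n is the coefficient sequence of a^i b^(n-i) for two fixed
  series, namely U and 1 on the left, 1 + s and s^2 on the right. Multiplicativity in both exponents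
  becomes a convolution in the power of s.\<close>

definition bm_multiplicative :: "(nat \<Rightarrow> nat \<Rightarrow> nat \<Rightarrow> bit) \<Rightarrow> bool" where
  "bm_multiplicative w \<longleftrightarrow> (\<forall>n n' i i' c. i \<le> n \<longrightarrow> i' \<le> n' \<longrightarrow>
     w (n + n') c (i + i') = (\<Sum>d\<le>c. w n d i * w n' (c - d) i'))"

lemma bm_left_multiplicative: "bm_multiplicative bm_left"
  unfolding bm_multiplicative_def bm_left_def
  by (simp only: power_add fps_mult_nth atLeast0AtMost simp_thms)

lemma bm_right_multiplicative: "bm_multiplicative bm_right"
  unfolding bm_multiplicative_def
proof (intro allI impI)
  fix n n' i i' c :: nat assume "i \<le> n" "i' \<le> n'"
  then have "2 * (n + n' - (i + i')) = 2 * (n - i) + 2 * (n' - i')" by simp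
  then have "(1 + fps_X) ^ (i + i') * fps_X ^ (2 * (n + n' - (i + i'))) =
      ((1 + fps_X) ^ i * fps_X ^ (2 * (n - i))) * ((1 + fps_X) ^ i' * fps_X ^ (2 * (n' - i')) :: bit fps)"
    by (simp only: power_add ac_simps)
  then show "bm_right (n + n') c (i + i') = (\<Sum>d\<le>c. bm_right n d i * bm_right n' (c - d) i')"
    unfolding bm_right_def by (simp only: fps_mult_nth atLeast0AtMost)
qed

context
  fixes M :: "(bit, 'a, 'm) module_scheme" and V :: "(bit, 'v, 'n) module_scheme" and T :: "nat \<Rightarrow> 'a \<Rightarrow> 'a"
  assumes M: "module F2 M" and V: "module F2 V" and T: "\<And>i. f2_map M M (T i)"
begin

private lemma T_closed: "x \<in> carrier M \<Longrightarrow> T i x \<in> carrier M"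
  by (rule f2_mapD(1)[OF T])

private lemma map2_T: "set xs \<subseteq> carrier M \<Longrightarrow> set (map2 T ks xs) \<subseteq> carrier M"
  by (rule map2_set_closed[of "carrier M"]) (rule T_closed)

private lemmas map2_T' = map2_T map2_T[unfolded list.set_map]

lemma cartan2_closed:
  assumes \<phi>: "multi_additive M V (length xs) \<phi>" and xs: "set xs \<subseteq> carrier M"
  shows "cartan2 V T \<phi> xs a b \<in> carrier V"
  unfolding cartan2_def
  by (intro f2_finsum_closed[OF V] multi_additiveD(1)[OF \<phi>] map2_T xs) (simp add: comps_iff)

lemma bm_sum_closed:
  assumes \<phi>: "multi_additive M V (length xs) \<phi>" and xs: "set xs \<subseteq> carrier M"
  shows "bm_sum V T w \<phi> xs n c \<in> carrier V"
  unfolding bm_sum_def by (rule vec_pair_closed[OF V]) (rule cartan2_closed[OF \<phi> xs])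

lemma cartan2_Nil:
  assumes "\<phi> [] \<in> carrier V"
  shows "cartan2 V T \<phi> [] a b = (if a = 0 \<and> b = 0 then \<phi> [] else \<zero>\<^bsub>V\<^esub>)"
proof -
  have "finsum V (\<lambda>js. \<phi> []) (comps 0 a) = (if a = 0 then \<phi> [] else \<zero>\<^bsub>V\<^esub>)"
    by (rule finsum_comps_0[OF V assms])
  then show ?thesis
    using finsum_comps_0[OF V, of "\<lambda>ks. if a = 0 then \<phi> [] else \<zero>\<^bsub>V\<^esub>" b] assms V
    by (cases "a = 0") (simp_all add: cartan2_def f2_closed)
qed

text \<open>The indices i and j are the outer and inner exponents on the first factor; the rest of a
  and b is distributed over the other factors.\<close>

lemma cartan2_Cons:
  assumes \<phi>: "multi_additive M V (Suc (length xs)) \<phi>" and x: "x \<in> carrier M" and xs: "set xs \<subseteq> carrier M"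
  shows "cartan2 V T \<phi> (x # xs) a b =
    finsum V (\<lambda>i. finsum V (\<lambda>j. cartan2 V T (\<lambda>l. \<phi> (T i (T j x) # l)) xs (a - i) (b - j)) {..b}) {..a}"
proof -
  let ?n = "length xs"
  let ?F = "\<lambda>i j js ks. \<phi> (T i (T j x) # map2 T js (map2 T ks xs))"
  have cl: "?F i j js ks \<in> carrier V" if "length js = ?n" "length ks = ?n" for i j js ks
    using that x xs by (intro multi_additiveD(1)[OF \<phi>]) (simp_all add: T_closed map2_T')
  have cl': "\<phi> (map2 T js (map2 T ks (x # xs))) \<in> carrier V" if "length js = Suc ?n" "length ks = Suc ?n" for js ks
    using that x xs by (intro multi_additiveD(1)[OF \<phi>] map2_T) simp_all
  have "cartan2 V T \<phi> (x # xs) a b =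
      finsum V (\<lambda>j. finsum V (\<lambda>ks. finsum V (\<lambda>js. \<phi> (map2 T js (map2 T (j # ks) (x # xs))))
        (comps (Suc ?n) a)) (comps ?n (b - j))) {..b}"
    unfolding cartan2_def list.size add_0_right add_Suc_right
    by (rule finsum_comps_Suc[OF V]) (intro f2_finsum_closed[OF V] cl', simp_all add: comps_iff)
  also have "\<dots> = finsum V (\<lambda>j. finsum V (\<lambda>ks. finsum V (\<lambda>i. finsum V (\<lambda>js. ?F i j js ks)
        (comps ?n (a - i))) {..a}) (comps ?n (b - j))) {..b}"
  proof (intro f2_finsum_cong[OF V refl] f2_finsum_closed[OF V])
    fix j ks assume ks: "ks \<in> comps ?n (b - j)"
    have "finsum V (\<lambda>js. \<phi> (map2 T js (map2 T (j # ks) (x # xs)))) (comps (Suc ?n) a) =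
        finsum V (\<lambda>i. finsum V (\<lambda>js. \<phi> (map2 T (i # js) (map2 T (j # ks) (x # xs)))) (comps ?n (a - i))) {..a}"
      by (rule finsum_comps_Suc[OF V], rule cl') (use ks in \<open>simp_all add: comps_iff\<close>)
    then show "finsum V (\<lambda>js. \<phi> (map2 T js (map2 T (j # ks) (x # xs)))) (comps (Suc ?n) a) =
        finsum V (\<lambda>i. finsum V (\<lambda>js. ?F i j js ks) (comps ?n (a - i))) {..a}" by simp
  qed (simp_all add: cl comps_iff)
  also have "\<dots> = finsum V (\<lambda>j. finsum V (\<lambda>i. finsum V (\<lambda>ks. finsum V (\<lambda>js. ?F i j js ks)
        (comps ?n (a - i))) (comps ?n (b - j))) {..a}) {..b}"
    by (intro f2_finsum_cong[OF V refl] f2_finsum_closed[OF V] f2_finsum_swap[OF V])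
       (simp_all add: cl comps_iff)
  also have "\<dots> = finsum V (\<lambda>i. finsum V (\<lambda>j. finsum V (\<lambda>ks. finsum V (\<lambda>js. ?F i j js ks)
        (comps ?n (a - i))) (comps ?n (b - j))) {..b}) {..a}"
    by (intro f2_finsum_closed[OF V] f2_finsum_swap[OF V]) (simp_all add: cl comps_iff)
  finally show ?thesis unfolding cartan2_def .
qed

lemma cartan2_additive:
  assumes \<phi>: "multi_additive M V (Suc (length xs)) \<phi>" and xs: "set xs \<subseteq> carrier M"
  shows "f2_map M V (\<lambda>x. cartan2 V T (\<lambda>l. \<phi> (x # l)) xs a b)"
  unfolding cartan2_def
proof (intro f2_map_finsum_pointwise[OF V M])
  fix ks js assume "ks \<in> comps (length xs) b" "js \<in> comps (length xs) a"
  then have "length (map2 T js (map2 T ks xs)) = length xs" by (simp add: comps_iff)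
  then show "f2_map M V (\<lambda>x. \<phi> (x # map2 T js (map2 T ks xs)))"
    using multi_additiveD(2)[OF \<phi>, of "[]" "map2 T js (map2 T ks xs)"] map2_T[OF map2_T[OF xs]] by simp
qed

lemma bm_sum_additive:
  assumes \<phi>: "multi_additive M V (Suc (length xs)) \<phi>" and xs: "set xs \<subseteq> carrier M"
  shows "f2_map M V (\<lambda>x. bm_sum V T w (\<lambda>l. \<phi> (x # l)) xs n c)"
  unfolding bm_sum_def vec_pair_def
  by (intro f2_map_finsum_pointwise[OF V M] f2_map_scaled[OF V M] cartan2_additive[OF \<phi> xs])

lemma smult_bit_sum:
  assumes "finite C" "v \<in> carrier V"
  shows "(\<Sum>d\<in>C. f d) \<odot>\<^bsub>V\<^esub> v = finsum V (\<lambda>d. f d \<odot>\<^bsub>V\<^esub> v) C"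
  using assms(1)
proof (induction C)
  case empty
  then show ?case using V assms(2) by (simp add: f2_smult f2_finsum_simps(1))
next
  case (insert d C)
  then show ?case
    using module.smult_l_distr[OF V, of "f d" "sum f C" v] assms(2) V
    by (simp add: f2_finsum_simps(3) f2_closed)
qed

text \<open>Multiplicativity of the generating function on a tensor product, coefficient by
  coefficient: m is the number of squares spent on the first factor and d the power of s belonging
  to it, while n - m and c - d belong to the remaining factors.\<close>

lemma bm_sum_Cons:
  assumes w: "bm_multiplicative w"
    and \<phi>: "multi_additive M V (Suc (length xs)) \<phi>" and x: "x \<in> carrier M" and xs: "set xs \<subseteq> carrier M"
  shows "bm_sum V T w \<phi> (x # xs) n c =
    finsum V (\<lambda>m. finsum V (\<lambda>d. vec_pair V m (w m d)
      (\<lambda>i. bm_sum V T w (\<lambda>l. \<phi> (T i (T (m - i) x) # l)) xs (n - m) (c - d))) {..c}) {..n}"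
proof -
  let ?C = "\<lambda>i j. cartan2 V T (\<lambda>l. \<phi> (T i (T j x) # l)) xs"
  have cl: "?C i j a b \<in> carrier V" for i j a b
    using x xs by (intro cartan2_closed multi_additive_Cons[OF \<phi>] T_closed)
  note [simp] = cl f2_closed(3)[OF V] f2_finsum_closed[OF V]
  have smult_sum: "k \<odot>\<^bsub>V\<^esub> finsum V f A = finsum V (\<lambda>a. k \<odot>\<^bsub>V\<^esub> f a) A"
    if "\<And>a. a \<in> A \<Longrightarrow> f a \<in> carrier V" for k f and A :: "nat set"
    by (rule f2_map_finsum[OF f2_map_scaled[OF V V, of "\<lambda>x. x"] V V]) (simp_all add: that f2_map_def)
  define f where "f = (\<lambda>i a b. w n c i \<odot>\<^bsub>V\<^esub> ?C a b (i - a) (n - i - b))"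
  define g where "g = (\<lambda>m a i. w n c (a + i) \<odot>\<^bsub>V\<^esub> ?C a (m - a) i (n - m - i))"
  have fg: "f i a b \<in> carrier V" "g i a b \<in> carrier V" for i a b by (simp_all add: f_def g_def)
  have "bm_sum V T w \<phi> (x # xs) n c = finsum V (\<lambda>i. finsum V (\<lambda>a. finsum V (f i a) {..n - i}) {..i}) {..n}"
    unfolding bm_sum_def vec_pair_def cartan2_Cons[OF \<phi> x xs] f_def
    by (intro f2_finsum_cong[OF V refl]) (simp_all add: smult_sum)
  also have "\<dots> = finsum V (\<lambda>i. finsum V (\<lambda>(a, b). f i a b) ({..i} \<times> {..n - i})) {..n}"
    by (intro f2_finsum_cong[OF V refl] f2_finsum_Sigma[OF V] f2_finsum_closed[OF V]) (auto simp: fg)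
  also have "\<dots> = finsum V (\<lambda>(i, a, b). f i a b) (SIGMA i:{..n}. {..i} \<times> {..n - i})"
    by (rule f2_finsum_Sigma[OF V]) (auto simp: fg)
  \<comment> \<open>In the triple (i, a, b), i is the whole outer exponent and a, b are the outer
    and inner exponents on the first factor. The new triple records m = a + b, then a, then the
    outer exponent i - a on the rest.\<close>
  also have "\<dots> = finsum V (\<lambda>p. (\<lambda>(i, a, b). f i a b) ((\<lambda>(m, a, i). (a + i, a, m - a)) p))
      (SIGMA m:{..n}. {..m} \<times> {..n - m})"
  proof (rule f2_finsum_reindex[OF V])
    show "bij_betw (\<lambda>(m, a, i). (a + i, a, m - a)) (SIGMA m:{..n}. {..m} \<times> {..n - m})
        (SIGMA i:{..n}. {..i} \<times> {..n - i})"
      by (rule bij_betw_byWitness[where f' = "\<lambda>(i, a, b). (a + b, a, i - a)"]) auto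
  qed (auto simp: fg)
  also have "\<dots> = finsum V (\<lambda>(m, a, i). g m a i) (SIGMA m:{..n}. {..m} \<times> {..n - m})"
    by (rule f2_finsum_cong[OF V refl]) (auto simp: f_def g_def add.commute)
  also have "\<dots> = finsum V (\<lambda>m. finsum V (\<lambda>(a, i). g m a i) ({..m} \<times> {..n - m})) {..n}"
    by (rule f2_finsum_Sigma[OF V, symmetric]) (auto simp: fg)
  also have "\<dots> = finsum V (\<lambda>m. finsum V (\<lambda>a. finsum V (g m a) {..n - m}) {..m}) {..n}"
    by (intro f2_finsum_cong[OF V refl] f2_finsum_Sigma[OF V, symmetric] f2_finsum_closed[OF V]) (auto simp: fg)
  also have "\<dots> = finsum V (\<lambda>m. finsum V (\<lambda>d. vec_pair V m (w m d)
      (\<lambda>a. bm_sum V T w (\<lambda>l. \<phi> (T a (T (m - a) x) # l)) xs (n - m) (c - d))) {..c}) {..n}"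
  proof (rule f2_finsum_cong[OF V refl])
    fix m assume m: "m \<in> {..n}"
    let ?h = "\<lambda>a i d. w m d a \<odot>\<^bsub>V\<^esub> (w (n - m) (c - d) i \<odot>\<^bsub>V\<^esub> ?C a (m - a) i (n - m - i))"
    have "finsum V (\<lambda>a. finsum V (g m a) {..n - m}) {..m} =
        finsum V (\<lambda>a. finsum V (\<lambda>i. finsum V (\<lambda>d. ?h a i d) {..c}) {..n - m}) {..m}"
    proof (intro f2_finsum_cong[OF V refl])
      fix a i assume a: "a \<in> {..m}" and i: "i \<in> {..n - m}"
      \<comment> \<open>Degree n splits as m + (n - m) and position a + i as a + i, so
        multiplicativity separates the two weights.\<close>
      have "w n c (a + i) = (\<Sum>d\<le>c. w m d a * w (n - m) (c - d) i)"
        using w a i m unfolding bm_multiplicative_def by (metis atMost_iff le_add_diff_inverse)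
      then have "g m a i = finsum V (\<lambda>d. (w m d a * w (n - m) (c - d) i) \<odot>\<^bsub>V\<^esub> ?C a (m - a) i (n - m - i)) {..c}"
        by (simp add: g_def smult_bit_sum)
      also have "\<dots> = finsum V (\<lambda>d. ?h a i d) {..c}"
        by (rule f2_finsum_cong[OF V refl]) (use module.smult_assoc1[OF V] in \<open>simp_all\<close>)
      finally show "g m a i = finsum V (\<lambda>d. ?h a i d) {..c}" .
    qed simp_all
    also have "\<dots> = finsum V (\<lambda>a. finsum V (\<lambda>d. finsum V (\<lambda>i. ?h a i d) {..n - m}) {..c}) {..m}"
      by (intro f2_finsum_cong[OF V refl] f2_finsum_swap[OF V]) simp_all
    also have "\<dots> = finsum V (\<lambda>d. finsum V (\<lambda>a. finsum V (\<lambda>i. ?h a i d) {..n - m}) {..m}) {..c}"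
      by (intro f2_finsum_swap[OF V]) simp_all
    also have "\<dots> = finsum V (\<lambda>d. vec_pair V m (w m d)
      (\<lambda>a. bm_sum V T w (\<lambda>l. \<phi> (T a (T (m - a) x) # l)) xs (n - m) (c - d))) {..c}"
      unfolding bm_sum_def vec_pair_def
      by (intro f2_finsum_cong[OF V refl]) (simp_all add: smult_sum)
    finally show "finsum V (\<lambda>a. finsum V (g m a) {..n - m}) {..m} = finsum V (\<lambda>d. vec_pair V m (w m d)
      (\<lambda>a. bm_sum V T w (\<lambda>l. \<phi> (T a (T (m - a) x) # l)) xs (n - m) (c - d))) {..c}" .
  next
    fix m
    have "bm_sum V T w (\<lambda>l. \<phi> (T a (T (m - a) x) # l)) xs (n - m) (c - d) \<in> carrier V" for a d
      using x xs by (intro bm_sum_closed multi_additive_Cons[OF \<phi>] T_closed)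
    then show "finsum V (\<lambda>d. vec_pair V m (w m d)
      (\<lambda>a. bm_sum V T w (\<lambda>l. \<phi> (T a (T (m - a) x) # l)) xs (n - m) (c - d))) {..c} \<in> carrier V"
      by (simp add: vec_pair_closed[OF V])
  qed
  finally show ?thesis .
qed

text \<open>The two weights are exchanged in stages. The induction hypothesis exchanges them on the
  tail for every fixed first entry; the resulting tail sum is additive in that entry, so the
  identity for \<open>x\<close> then exchanges them on the first factor.\<close>

lemma bm_sum_eq:
  assumes BM: "\<And>x n c. x \<in> carrier M \<Longrightarrow> vec_pair M n (bm_left n c) (\<lambda>i. T i (T (n - i) x)) =
      vec_pair M n (bm_right n c) (\<lambda>i. T i (T (n - i) x))"
    and "multi_additive M V (length xs) \<phi>" and "set xs \<subseteq> carrier M"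
  shows "bm_sum V T bm_left \<phi> xs n c = bm_sum V T bm_right \<phi> xs n c"
  using assms(2,3)
proof (induction xs arbitrary: \<phi> n c)
  case Nil
  then have cl: "\<phi> [] \<in> carrier V" by (intro multi_additiveD(1)[OF Nil(1)]) simp_all
  \<comment> \<open>On the empty tensor product only n = 0 contributes, and there both weights are
    the coefficients of the series 1.\<close>
  have "bm_left n c i \<odot>\<^bsub>V\<^esub> cartan2 V T \<phi> [] i (n - i) = bm_right n c i \<odot>\<^bsub>V\<^esub> cartan2 V T \<phi> [] i (n - i)"
    if "i \<le> n" for i
    using that cl V by (cases "i = 0 \<and> n = 0") (auto simp: cartan2_Nil bm_left_def bm_right_def f2_smult f2_closed)
  then show ?case
    unfolding bm_sum_def vec_pair_def
    by (intro f2_finsum_cong[OF V refl]) (simp_all add: cartan2_Nil cl f2_closed V)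
next
  case (Cons x xs)
  then have \<phi>: "multi_additive M V (Suc (length xs)) \<phi>" and x: "x \<in> carrier M" and xs: "set xs \<subseteq> carrier M"
    by simp_all
  have cl: "bm_sum V T w (\<lambda>l. \<phi> (y # l)) xs m d \<in> carrier V" if "y \<in> carrier M" for w y m d
    using that by (intro bm_sum_closed multi_additive_Cons[OF \<phi>] xs)
  have eq: "vec_pair V m (bm_left m d) (\<lambda>i. bm_sum V T bm_left (\<lambda>l. \<phi> (T i (T (m - i) x) # l)) xs (n - m) (c - d)) =
      vec_pair V m (bm_right m d) (\<lambda>i. bm_sum V T bm_right (\<lambda>l. \<phi> (T i (T (m - i) x) # l)) xs (n - m) (c - d))"
    for m d
  proof -
    have IH: "bm_sum V T bm_left (\<lambda>l. \<phi> (T i (T (m - i) x) # l)) xs (n - m) (c - d) =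
        bm_sum V T bm_right (\<lambda>l. \<phi> (T i (T (m - i) x) # l)) xs (n - m) (c - d)" for i
      using x xs by (intro Cons.IH multi_additive_Cons[OF \<phi>] T_closed)
    note G = bm_sum_additive[OF \<phi> xs, of bm_right "n - m" "c - d"]
    note vp = f2_map_vec_pair[OF G M V, of m "\<lambda>i. T i (T (m - i) x)"]
    show ?thesis
      unfolding IH using vp[of "bm_left m d"] vp[of "bm_right m d"] BM[OF x, of m d] T_closed x by simp
  qed
  show ?case
    unfolding bm_sum_Cons[OF bm_left_multiplicative \<phi> x xs] bm_sum_Cons[OF bm_right_multiplicative \<phi> x xs] eq ..
qed

end


section \<open>Unstable modules\<close>

lemma sum_list_map2_plus:
  "length xs = length ys \<Longrightarrow> sum_list (map2 (+) xs ys) = sum_list xs + (sum_list ys :: nat)"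
  by (induction xs ys rule: list_induct2) auto

text \<open>The definition sums over exactly the nonzero components. Any finite set of degrees
  outside which the components vanish gives the same sum, and such sets can be enlarged when
  elements are added.\<close>

lemma is_decomposition_iff:
  assumes M: "module F2 M" and H: "\<And>d. hdeg M d \<subseteq> carrier M"
  shows "is_decomposition M x c \<longleftrightarrow> (\<forall>d. c d \<in> hdeg M d) \<and>
    (\<exists>D. finite D \<and> (\<forall>d. d \<notin> D \<longrightarrow> c d = \<zero>\<^bsub>M\<^esub>) \<and> x = finsum M c D)"
proof
  assume "is_decomposition M x c"
  then show "(\<forall>d. c d \<in> hdeg M d) \<and> (\<exists>D. finite D \<and> (\<forall>d. d \<notin> D \<longrightarrow> c d = \<zero>\<^bsub>M\<^esub>) \<and> x = finsum M c D)"
    unfolding is_decomposition_def by (intro conjI exI[of _ "{d. c d \<noteq> \<zero>\<^bsub>M\<^esub>}"]) auto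
next
  assume R: "(\<forall>d. c d \<in> hdeg M d) \<and> (\<exists>D. finite D \<and> (\<forall>d. d \<notin> D \<longrightarrow> c d = \<zero>\<^bsub>M\<^esub>) \<and> x = finsum M c D)"
  then obtain D where D: "finite D" "\<And>d. d \<notin> D \<Longrightarrow> c d = \<zero>\<^bsub>M\<^esub>" "x = finsum M c D" by blast
  have sub: "{d. c d \<noteq> \<zero>\<^bsub>M\<^esub>} \<subseteq> D" using D(2) by auto
  have "finsum M c {d. c d \<noteq> \<zero>\<^bsub>M\<^esub>} = finsum M c D"
    by (rule f2_finsum_mono_neutral[OF M D(1) sub]) (use R H in auto)
  then show "is_decomposition M x c"
    unfolding is_decomposition_def using R D finite_subset[OF sub D(1)] by simp
qed

text \<open>Additive maps acting as Kronecker deltas on the homogeneous parts read off every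
  component, which forces uniqueness. Existence spreads from homogeneous elements over their span,
  with the supports joined at each sum.\<close>

lemma gradingI:
  assumes M: "module F2 M" and H: "\<And>d. submodule (hdeg M d) F2 M"
    and span: "carrier M \<subseteq> lin_span M (\<Union>d. hdeg M d)"
    and p: "\<And>d. f2_map M M (p d)"
    and pH: "\<And>d e x. x \<in> hdeg M e \<Longrightarrow> p d x = (if d = e then x else \<zero>\<^bsub>M\<^esub>)"
    and x: "x \<in> carrier M"
  shows "\<exists>!c. is_decomposition M x c"
proof
  have Hc: "hdeg M d \<subseteq> carrier M" for d using submodule_f2D(1)[OF M H] .
  note dec = is_decomposition_iff[of M, OF M Hc]
  have U: "(\<Union>d. hdeg M d) \<subseteq> carrier M" using Hc by auto
  have p_hdeg: "p d y \<in> hdeg M d" if "y \<in> carrier M" for d y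
  proof (rule f2_map_span[OF p M M H U])
    show "p d ` (\<Union>e. hdeg M e) \<subseteq> hdeg M d"
      using submodule_f2D(2)[OF M H] by (auto simp: pH)
  qed (use that span in auto)
  have "\<exists>D. finite D \<and> (\<forall>d. d \<notin> D \<longrightarrow> p d x = \<zero>\<^bsub>M\<^esub>) \<and> x = finsum M (\<lambda>d. p d x) D"
    using M U subsetD[OF span x]
  proof (induction rule: lin_span_induct)
    case zero
    show ?case by (rule exI[of _ "{}"]) (simp add: f2_map_zero[OF p M M] f2_finsum_simps(1)[OF M])
  next
    case (base y)
    then obtain e where e: "y \<in> hdeg M e" by blast
    have y: "y \<in> carrier M" using e Hc by blast
    have "finsum M (\<lambda>d. p d y) {e} = p e y"
      by (rule f2_finsum_single[OF M]) (use f2_mapD(1)[OF p y] in auto)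
    then show ?case by (intro exI[of _ "{e}"]) (simp add: pH[OF e])
  next
    case (add y z)
    then obtain D E where D: "finite D" "\<And>d. d \<notin> D \<Longrightarrow> p d y = \<zero>\<^bsub>M\<^esub>" "y = finsum M (\<lambda>d. p d y) D"
      and E: "finite E" "\<And>d. d \<notin> E \<Longrightarrow> p d z = \<zero>\<^bsub>M\<^esub>" "z = finsum M (\<lambda>d. p d z) E"
      by auto
    have py: "p d y \<in> carrier M" and pz: "p d z \<in> carrier M" for d
      using add f2_mapD(1)[OF p] by auto
    have "y = finsum M (\<lambda>d. p d y) (D \<union> E)"
      using f2_finsum_mono_neutral[OF M, of "D \<union> E" D "\<lambda>d. p d y"] D E py by auto
    moreover have "z = finsum M (\<lambda>d. p d z) (D \<union> E)"
      using f2_finsum_mono_neutral[OF M, of "D \<union> E" E "\<lambda>d. p d z"] D E pz by auto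
    moreover have "finsum M (\<lambda>d. p d y \<oplus>\<^bsub>M\<^esub> p d z) (D \<union> E) =
        finsum M (\<lambda>d. p d y) (D \<union> E) \<oplus>\<^bsub>M\<^esub> finsum M (\<lambda>d. p d z) (D \<union> E)"
      by (rule f2_finsum_add[OF M]) (simp_all add: py pz)
    moreover have "p d (y \<oplus>\<^bsub>M\<^esub> z) = p d y \<oplus>\<^bsub>M\<^esub> p d z" for d
      using f2_mapD(2)[OF p] add by simp
    ultimately have "y \<oplus>\<^bsub>M\<^esub> z = finsum M (\<lambda>d. p d (y \<oplus>\<^bsub>M\<^esub> z)) (D \<union> E)" by simp
    moreover have "p d (y \<oplus>\<^bsub>M\<^esub> z) = \<zero>\<^bsub>M\<^esub>" if "d \<notin> D \<union> E" for d
      using that D(2) E(2) f2_mapD(2)[OF p, of y z] add f2_closed(1)[OF M] f2_zero(1)[OF M] by simp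
    ultimately show ?case using D(1) E(1) by (intro exI[of _ "D \<union> E"]) simp
  qed
  then show "is_decomposition M x (\<lambda>d. p d x)"
    unfolding dec using p_hdeg x by simp
  fix c assume "is_decomposition M x c"
  then obtain D where c: "\<And>d. c d \<in> hdeg M d" and D: "finite D" "\<And>d. d \<notin> D \<Longrightarrow> c d = \<zero>\<^bsub>M\<^esub>" "x = finsum M c D"
    unfolding dec by blast
  have cc: "c d \<in> carrier M" for d using c Hc by blast
  show "c = (\<lambda>d. p d x)"
  proof
    fix e
    have "p e x = finsum M (\<lambda>d. p e (c d)) D"
      unfolding D(3) by (rule f2_map_finsum[OF p M M]) (rule cc)
    also have "\<dots> = finsum M (\<lambda>d. if e = d then c d else \<zero>\<^bsub>M\<^esub>) D"
      by (rule f2_finsum_cong[OF M refl]) (simp_all add: pH[OF c] cc f2_closed(1)[OF M])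
    also have "\<dots> = c e"
    proof (cases "e \<in> D")
      case True
      then show ?thesis
        using f2_finsum_single[OF M D(1), of e "\<lambda>d. if e = d then c d else \<zero>\<^bsub>M\<^esub>"] cc by simp
    next
      case False
      then have "finsum M (\<lambda>d. if e = d then c d else \<zero>\<^bsub>M\<^esub>) D = \<zero>\<^bsub>M\<^esub>"
        by (intro f2_finsum_zero[OF M]) auto
      then show ?thesis using D(2)[OF False] by simp
    qed
    finally show "c e = p e x" ..
  qed
qed

lemma vec_pair_bm_row:
  assumes M: "module F2 M" and m: "\<And>i. i \<le> n \<Longrightarrow> m i \<in> carrier M"
  shows "vec_pair M n (bm_row n c) m = \<zero>\<^bsub>M\<^esub> \<longleftrightarrow>
    vec_pair M n (bm_left n c) m = vec_pair M n (bm_right n c) m"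
proof -
  have "vec_pair M n (bm_row n c) m = vec_pair M n (\<lambda>i. bm_left n c i + bm_right n c i) m"
    unfolding vec_pair_def by (rule f2_finsum_cong[OF M refl]) (simp_all add: bm_row_def m f2_closed M)
  also have "\<dots> = vec_pair M n (bm_left n c) m \<oplus>\<^bsub>M\<^esub> vec_pair M n (bm_right n c) m"
    by (rule vec_pair_add[OF M m])
  finally show ?thesis
    using f2_eq_iff[OF M vec_pair_closed[OF M m] vec_pair_closed[OF M m]] by simp
qed

text \<open>The quadratic relations are requested in the Bullett-Macdonald form. Each coefficient is
  additive in x, so checking it on a generating set suffices; all coefficients together return the
  Adem relations in total degree a + b.\<close>

lemma unstable_moduleI:
  assumes M: "module F2 M" and H: "\<And>d. submodule (hdeg M d) F2 M"
    and span: "carrier M \<subseteq> lin_span M (\<Union>d. hdeg M d)"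
    and p: "\<And>d. f2_map M M (p d)"
    and pH: "\<And>d e x. x \<in> hdeg M e \<Longrightarrow> p d x = (if d = e then x else \<zero>\<^bsub>M\<^esub>)"
    and Sq: "\<And>i. f2_map M M (Sq M i)"
    and deg: "\<And>d i x. x \<in> hdeg M d \<Longrightarrow> Sq M i x \<in> hdeg M (d + i)"
    and unst: "\<And>d i x. \<lbrakk>x \<in> hdeg M d; d < i\<rbrakk> \<Longrightarrow> Sq M i x = \<zero>\<^bsub>M\<^esub>"
    and G: "G \<subseteq> carrier M" "carrier M \<subseteq> lin_span M G"
    and Sq_zero: "\<And>x. x \<in> G \<Longrightarrow> Sq M 0 x = x"
    and BM: "\<And>n c x. x \<in> G \<Longrightarrow> vec_pair M n (bm_left n c) (\<lambda>i. Sq M i (Sq M (n - i) x)) =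
      vec_pair M n (bm_right n c) (\<lambda>i. Sq M i (Sq M (n - i) x))"
  shows "unstable_module M"
proof (intro unstable_module.intro[OF M] unstable_module_axioms.intro)
  have SqSq: "f2_map M M (\<lambda>x. Sq M i (Sq M j x))" for i j
    by (rule f2_map_comp[OF Sq Sq])
  show "submodule (hdeg M d) F2 M" for d by (rule H)
  show "\<exists>!c. is_decomposition M x c" if "x \<in> carrier M" for x
    by (rule gradingI[OF M H span p pH that])
  show "restrict (Sq M i) (carrier M) \<in> linear_maps M M" for i
    unfolding linear_maps_iff[OF M M] by (auto intro: f2_map_cong[OF Sq _ M])
  show "Sq M i x \<in> hdeg M (d + i)" if "x \<in> hdeg M d" for x d i by (rule deg[OF that])
  show "Sq M i x = \<zero>\<^bsub>M\<^esub>" if "x \<in> hdeg M d" "d < i" for x d i by (rule unst[OF that])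
  show "Sq M 0 x = x" if "x \<in> carrier M" for x
    using f2_map_eq_on_span[OF Sq _ M M G(1), of "\<lambda>x. x" 0 x] Sq_zero that G(2) by (auto simp: f2_map_def)
  fix a b :: nat and x
  assume a: "0 < a" "a < 2 * b" and x: "x \<in> carrier M"
  let ?n = "a + b"
  let ?m = "\<lambda>x i. Sq M i (Sq M (?n - i) x)"
  have vp: "f2_map M M (\<lambda>x. vec_pair M ?n r (?m x))" for r
    unfolding vec_pair_def by (intro f2_map_finsum_pointwise[OF M M] f2_map_scaled[OF M M] SqSq)
  have m: "?m x i \<in> carrier M" for i by (rule f2_mapD(1)[OF SqSq x])
  have "vec_pair M ?n (bm_left ?n c) (?m x) = vec_pair M ?n (bm_right ?n c) (?m x)" for c
    by (rule f2_map_eq_on_span[OF vp vp M M G(1) BM]) (use x G(2) in auto)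
  then have "vec_pair M ?n (bm_row ?n c) (?m x) = \<zero>\<^bsub>M\<^esub>" for c
    using vec_pair_bm_row[OF M, of ?n "?m x" c] m by simp
  then have "vec_pair M ?n (adem_row ?n a) (?m x) = \<zero>\<^bsub>M\<^esub>"
    by (intro bm_imp_adem[OF M]) (use m a in auto)
  then have "?m x a = (\<Oplus>\<^bsub>M\<^esub>j\<in>{0..a div 2}. of_nat ((b - j - 1) choose (a - 2 * j)) \<odot>\<^bsub>M\<^esub> ?m x (a + b - j))"
    using vec_pair_adem[OF M, of a b "?m x"] m a by simp
  also have "\<dots> = (\<Oplus>\<^bsub>M\<^esub>j\<in>{0..a div 2}. of_nat ((b - j - 1) choose (a - 2 * j)) \<odot>\<^bsub>M\<^esub> Sq M (a + b - j) (Sq M j x))"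
    by (rule f2_finsum_cong[OF M refl])
       (use a f2_closed(3)[OF M f2_mapD(1)[OF SqSq x]] in simp_all)
  finally show "Sq M a (Sq M b x) = (\<Oplus>\<^bsub>M\<^esub>j\<in>{0..a div 2}.
      of_nat ((b - j - 1) choose (a - 2 * j)) \<odot>\<^bsub>M\<^esub> Sq M (a + b - j) (Sq M j x))" by simp
qed

section \<open>Homogeneous components, Sq_0 and the identity in a given unstable module\<close>

context unstable_module
begin

lemma f2: "module F2 M" by (rule module_axioms)

lemma Sq_map: "f2_map M M (Sq M i)"
  using Sq_linear[of i] unfolding linear_maps_iff[OF f2 f2] by (auto intro: f2_map_cong[OF _ _ f2])

lemma Sq_closed: "x \<in> carrier M \<Longrightarrow> Sq M i x \<in> carrier M"
  by (rule f2_mapD(1)[OF Sq_map])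

lemma hdeg_closed: "hdeg M d \<subseteq> carrier M"
  by (rule submodule_f2D(1)[OF f2 hdeg_submodule])

lemma hdeg_Union_closed: "(\<Union>d. hdeg M d) \<subseteq> carrier M"
  using hdeg_closed by blast

lemmas decomposition_iff = is_decomposition_iff[of M, OF f2 hdeg_closed]

lemma homog_decomposition: "x \<in> carrier M \<Longrightarrow> is_decomposition M x (\<lambda>d. homog_component M d x)"
  unfolding homog_component_def using theI'[OF grading] by simp

lemma homog_unique:
  assumes "is_decomposition M x c" "x \<in> carrier M"
  shows "homog_component M d x = c d"
proof -
  have "(THE c. is_decomposition M x c) = c"
    by (rule the1_equality) (rule grading[OF assms(2)], rule assms(1))
  then show ?thesis by (simp add: homog_component_def)
qed

lemma homog_closed: "x \<in> carrier M \<Longrightarrow> homog_component M d x \<in> hdeg M d"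
  using homog_decomposition unfolding is_decomposition_def by blast

lemma homog_finite: "x \<in> carrier M \<Longrightarrow> finite {d. homog_component M d x \<noteq> \<zero>\<^bsub>M\<^esub>}"
  using homog_decomposition unfolding is_decomposition_def by blast

lemma homog_hdeg:
  assumes x: "x \<in> hdeg M e"
  shows "homog_component M d x = (if d = e then x else \<zero>\<^bsub>M\<^esub>)"
proof (rule homog_unique)
  have xc: "x \<in> carrier M" using x hdeg_closed by blast
  show "x \<in> carrier M" by (rule xc)
  have "finsum M (\<lambda>d. if d = e then x else \<zero>\<^bsub>M\<^esub>) {e} = x"
    using f2_finsum_single[OF f2, of "{e}" e "\<lambda>d. if d = e then x else \<zero>\<^bsub>M\<^esub>"] xc by simp
  then show "is_decomposition M x (\<lambda>d. if d = e then x else \<zero>\<^bsub>M\<^esub>)"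
    unfolding decomposition_iff
    using x submodule_f2D(2)[OF f2 hdeg_submodule] by (intro conjI exI[of _ "{e}"]) auto
qed

lemma homog_sum:
  assumes x: "x \<in> carrier M" and D: "finite D" "\<And>d. d \<notin> D \<Longrightarrow> homog_component M d x = \<zero>\<^bsub>M\<^esub>"
  shows "x = finsum M (\<lambda>d. homog_component M d x) D"
proof -
  have "x = finsum M (\<lambda>d. homog_component M d x) {d. homog_component M d x \<noteq> \<zero>\<^bsub>M\<^esub>}"
    using homog_decomposition[OF x] unfolding is_decomposition_def by blast
  also have "\<dots> = finsum M (\<lambda>d. homog_component M d x) D"
    by (rule f2_finsum_mono_neutral[OF f2 D(1)]) (use D(2) homog_closed[OF x] hdeg_closed in auto)
  finally show ?thesis .
qed

lemma homog_map: "f2_map M M (homog_component M d)"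
proof (rule f2_mapI)
  fix x y assume x: "x \<in> carrier M"
  have hx: "homog_component M d x \<in> carrier M" if "x \<in> carrier M" for d x
    using homog_closed[OF that] hdeg_closed by blast
  show "homog_component M d x \<in> carrier M" by (rule hx[OF x])
  assume y: "y \<in> carrier M"
  let ?D = "{d. homog_component M d x \<noteq> \<zero>} \<union> {d. homog_component M d y \<noteq> \<zero>}"
  have D: "finite ?D" using homog_finite x y by simp
  have "x \<oplus> y = finsum M (\<lambda>d. homog_component M d x) ?D \<oplus> finsum M (\<lambda>d. homog_component M d y) ?D"
    using homog_sum[OF x D] homog_sum[OF y D] by simp
  also have "\<dots> = finsum M (\<lambda>d. homog_component M d x \<oplus> homog_component M d y) ?D"
    by (rule f2_finsum_add[OF f2, symmetric]) (simp_all add: hx x y)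
  finally have sum: "x \<oplus> y = finsum M (\<lambda>d. homog_component M d x \<oplus> homog_component M d y) ?D" .
  show "homog_component M d (x \<oplus> y) = homog_component M d x \<oplus> homog_component M d y"
  proof (rule homog_unique)
    show "is_decomposition M (x \<oplus> y) (\<lambda>d. homog_component M d x \<oplus> homog_component M d y)"
      unfolding decomposition_iff
    proof (intro conjI allI exI[of _ ?D] impI)
      show "homog_component M d x \<oplus> homog_component M d y \<in> hdeg M d" for d
        by (intro submodule_f2D(3)[OF f2 hdeg_submodule] homog_closed x y)
    qed (use sum D in auto)
  qed (simp add: x y)
qed

lemma homog_span: "carrier M \<subseteq> lin_span M (\<Union>d. hdeg M d)"
proof
  fix x assume x: "x \<in> carrier M"
  have "finsum M (\<lambda>d. homog_component M d x) {d. homog_component M d x \<noteq> \<zero>} \<in> lin_span M (\<Union>d. hdeg M d)"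
    by (rule f2_finsum_submodule[OF f2 lin_span_submodule[OF f2 hdeg_Union_closed]])
       (auto intro!: lin_span_base homog_closed[OF x])
  then show "x \<in> lin_span M (\<Union>d. hdeg M d)"
    using homog_sum[OF x homog_finite[OF x]] by simp
qed

text \<open>Degrees with zero component contribute zero, so the summation may run over any finite
  set containing the support. Two elements can then share one range, which makes additivity
  visible.\<close>

lemma Sq0_sum:
  assumes x: "x \<in> carrier M" and D: "finite D" "\<And>d. d \<notin> D \<Longrightarrow> homog_component M d x = \<zero>\<^bsub>M\<^esub>"
  shows "Sq0 M x = finsum M (\<lambda>d. Sq M d (homog_component M d x)) D"
  unfolding Sq0_def
proof (rule f2_finsum_mono_neutral[OF f2 D(1)])
  show "Sq M d (homog_component M d x) \<in> carrier M" for d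
    by (intro Sq_closed f2_mapD(1)[OF homog_map x])
  show "Sq M d (homog_component M d x) = \<zero>" if "d \<in> D - {d. homog_component M d x \<noteq> \<zero>}" for d
    using that f2_map_zero[OF Sq_map f2 f2] by simp
qed (use D(2) in blast)

lemma Sq0_map: "f2_map M M (Sq0 M)"
proof (rule f2_mapI)
  fix x y assume x: "x \<in> carrier M"
  have S: "f2_map M M (\<lambda>x. Sq M d (homog_component M d x))" for d
    by (rule f2_map_comp[OF homog_map Sq_map])
  note cl = f2_mapD(1)[OF S]
  show "Sq0 M x \<in> carrier M" unfolding Sq0_def by (rule f2_finsum_closed[OF f2]) (rule cl[OF x])
  assume y: "y \<in> carrier M"
  let ?D = "{d. homog_component M d x \<noteq> \<zero>} \<union> {d. homog_component M d y \<noteq> \<zero>}"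
  have D: "finite ?D" using homog_finite x y by simp
  have "Sq0 M (x \<oplus> y) = finsum M (\<lambda>d. Sq M d (homog_component M d (x \<oplus> y))) ?D"
    by (rule Sq0_sum[OF _ D]) (simp_all add: x y f2_mapD(2)[OF homog_map])
  also have "\<dots> = finsum M (\<lambda>d. Sq M d (homog_component M d x) \<oplus> Sq M d (homog_component M d y)) ?D"
    by (rule f2_finsum_cong[OF f2 refl]) (simp_all add: f2_mapD(2)[OF S] x y cl)
  also have "\<dots> = Sq0 M x \<oplus> Sq0 M y"
    using Sq0_sum[OF x D] Sq0_sum[OF y D] by (subst f2_finsum_add[OF f2]) (simp_all add: cl x y)
  finally show "Sq0 M (x \<oplus> y) = Sq0 M x \<oplus> Sq0 M y" .
qed

lemma Sq0_hdeg:
  assumes x: "x \<in> hdeg M d"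
  shows "Sq0 M x = Sq M d x"
proof -
  have xc: "x \<in> carrier M" using x hdeg_closed by blast
  have "Sq0 M x = finsum M (\<lambda>e. Sq M e (homog_component M e x)) {d}"
    by (rule Sq0_sum[OF xc]) (simp_all add: homog_hdeg[OF x])
  also have "\<dots> = Sq M d (homog_component M d x)"
    by (rule f2_finsum_single[OF f2]) (simp_all add: homog_hdeg[OF x] Sq_closed xc)
  finally show ?thesis by (simp add: homog_hdeg[OF x])
qed

lemma bullett_macdonald:
  assumes x: "x \<in> carrier M"
  shows "vec_pair M n (bm_left n c) (\<lambda>i. Sq M i (Sq M (n - i) x)) =
      vec_pair M n (bm_right n c) (\<lambda>i. Sq M i (Sq M (n - i) x))"
proof -
  let ?m = "\<lambda>i. Sq M i (Sq M (n - i) x)"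
  have m: "?m i \<in> carrier M" for i by (intro Sq_closed x)
  have "vec_pair M n (adem_row n a) ?m = \<zero>" if a: "3 * a < 2 * n" for a
  proof -
    define b where "b = n - a"
    have n: "n = a + b" and ab: "a < 2 * b" using a by (auto simp: b_def)
    have "?m a = (\<Oplus>j\<in>{0..a div 2}. of_nat ((b - j - 1) choose (a - 2 * j)) \<odot>\<^bsub>M\<^esub> ?m (a + b - j))"
    \<comment> \<open>The locale states the Adem relations for positive a only; the row for a = 0 is
      Sq^0 Sq^b = Sq^b Sq^0 and comes from Sq^0 = 1.\<close>
    proof (cases "a = 0")
      case True
      have "finsum M (\<lambda>j. of_nat ((b - j - 1) choose (0 - 2 * j)) \<odot>\<^bsub>M\<^esub> ?m (0 + b - j)) {0} = ?m b"
        using f2_finsum_single[OF f2, of "{0}" 0 "\<lambda>j. of_nat ((b - j - 1) choose (0 - 2 * j)) \<odot>\<^bsub>M\<^esub> ?m (0 + b - j)"] m[of b]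
        by (simp add: f2_smult[OF f2])
      then show ?thesis using True n x by (simp add: Sq_zero Sq_closed)
    next
      case False
      then have "?m a = (\<Oplus>j\<in>{0..a div 2}. of_nat ((b - j - 1) choose (a - 2 * j)) \<odot>\<^bsub>M\<^esub> Sq M (a + b - j) (Sq M j x))"
        using Adem[of a b x] ab x n by simp
      also have "\<dots> = (\<Oplus>j\<in>{0..a div 2}. of_nat ((b - j - 1) choose (a - 2 * j)) \<odot>\<^bsub>M\<^esub> ?m (a + b - j))"
        by (rule f2_finsum_cong[OF f2 refl])
           (use n ab x in \<open>simp_all add: f2_closed[OF f2] Sq_closed\<close>)
      finally show ?thesis .
    qed
    then show ?thesis
      using vec_pair_adem[OF f2, of a b ?m] m ab unfolding n[symmetric] by simp
  qed
  then have "vec_pair M n (bm_row n c) ?m = \<zero>"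
    by (intro adem_imp_bm[OF f2]) (simp_all add: m)
  then show ?thesis using vec_pair_bm_row[OF f2, of n ?m c] m by simp
qed

end


section \<open>The unstable module \<open>S(P, M)\<close>\<close>

lemma schur_simps [simp]:
  "carrier (schur P M) = carrier (schur_space P M)"
  "add (schur P M) = add (schur_space P M)"
  "zero (schur P M) = zero (schur_space P M)"
  "smult (schur P M) = smult (schur_space P M)"
  "hdeg (schur P M) = schur_hdeg P M"
  "Sq (schur P M) = schur_Sq P M"
  by (simp_all add: schur_def module.extend_def umodule.fields_def)

lemma schur_compat_cong_records:
  assumes "carrier V' = carrier V" "add V' = add V"
  shows "schur_compat P M V' f \<longleftrightarrow> schur_compat P M V f"
  using assms by (simp add: schur_compat_def)

lemma schur_finsum: "finsum (schur P M) f A = finsum (schur_space P M) f A"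
  by (rule finsum_record_cong) simp_all

context operad
begin

lemma schur_module:
  assumes "module F2 M"
  shows "module F2 (schur P M)"
  by (rule f2_module_cong[OF schur_space_module[OF assms]]) simp_all

lemma gen_compat:
  assumes "module F2 M"
  shows "schur_compat P M (schur P M) (schur_gen P M)"
  using schur_gen_compat[OF assms] by (simp add: schur_compat_cong_records[of "schur P M" "schur_space P M"])

lemma gen_closed:
  assumes "module F2 M" "set xs \<subseteq> carrier M" "\<mu> \<in> carrier (ops P (length xs))"
  shows "schur_gen P M \<mu> xs \<in> carrier (schur P M)"
  using schur_gen_closed[OF assms] by simp

lemma lift_map:
  assumes "schur_compat P M V f" "module F2 V" "module F2 M"
  shows "f2_map (schur P M) V (schur_lift P M V f)"
  using schur_lift_map[OF assms] by (simp add: f2_map_def)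

lemma schur_lin_span:
  assumes "module F2 M"
  shows "lin_span (schur P M) X = lin_span (schur_space P M) X"
  by (rule lin_span_cong[OF schur_space_module[OF assms]]) simp_all

lemma schur_generated:
  assumes "module F2 M"
  shows "schur_gens M \<subseteq> carrier (schur P M)" "carrier (schur P M) = lin_span (schur P M) (schur_gens M)"
  using schur_gens_closed[OF assms] schur_span[OF assms] schur_lin_span[OF assms] by simp_all

lemma schur_ext:
  assumes M: "module F2 M" and V: "module F2 V"
    and h: "f2_map (schur P M) V h" and k: "f2_map (schur P M) V k"
    and hk: "\<And>\<mu> xs. (\<mu>, xs) \<in> symbols P M \<Longrightarrow> h (schur_gen P M \<mu> xs) = k (schur_gen P M \<mu> xs)"
    and t: "t \<in> carrier (schur P M)"
  shows "h t = k t"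
  by (rule schur_map_ext[OF M V]) (use h k hk t in \<open>simp_all add: f2_map_def\<close>)

lemma schur_op:
  assumes M: "module F2 M" and T: "\<And>k. f2_map M M (T k)"
  shows "f2_map (schur P M) (schur P M)
      (schur_lift P M (schur_space P M) (cartan (schur_space P M) (schur_gen P M) T i))"
    and "(\<mu>, xs) \<in> symbols P M \<Longrightarrow>
      schur_lift P M (schur_space P M) (cartan (schur_space P M) (schur_gen P M) T i) (schur_gen P M \<mu> xs) =
      finsum (schur P M) (\<lambda>ks. schur_gen P M \<mu> (map2 T ks xs)) (comps (length xs) i)"
proof -
  note S = schur_space_module[OF M]
  note c = cartan_compat[OF M M S schur_gen_compat[OF M] T, where i = i]
  show "f2_map (schur P M) (schur P M)
      (schur_lift P M (schur_space P M) (cartan (schur_space P M) (schur_gen P M) T i))"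
    using schur_lift_map[OF c S M] by (simp add: f2_map_def)
  show "schur_lift P M (schur_space P M) (cartan (schur_space P M) (schur_gen P M) T i) (schur_gen P M \<mu> xs) =
      finsum (schur P M) (\<lambda>ks. schur_gen P M \<mu> (map2 T ks xs)) (comps (length xs) i)" if "(\<mu>, xs) \<in> symbols P M"
    using schur_lift_gen[OF c S M that] by (simp add: cartan_def schur_finsum)
qed

lemma schur_Sq_eq: "Sq (schur P M) i = schur_lift P M (schur_space P M) (cartan (schur_space P M) (schur_gen P M) (Sq M) i)"
  by (simp only: schur_simps schur_Sq_def cartan_def[abs_def] comps_def)

end

section \<open>Grading and squares on S(P, M)\<close>

locale operad_unstable = operad P + unstable_module M
  for P :: "'p operad_data" and M :: "('a, 'm) umodule_scheme"
begin

abbreviation "gen \<equiv> schur_gen P M"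
abbreviation "S \<equiv> schur P M"

lemma S_f2: "module F2 S"
  by (rule schur_module[OF f2])

lemma S_Sq_map: "f2_map S S (Sq S i)"
  unfolding schur_Sq_eq by (rule schur_op(1)[OF f2 Sq_map])

lemma S_Sq_gen:
  assumes "(\<mu>, xs) \<in> symbols P M"
  shows "Sq S i (gen \<mu> xs) = finsum S (\<lambda>ks. gen \<mu> (map2 (Sq M) ks xs)) (comps (length xs) i)"
  unfolding schur_Sq_eq by (rule schur_op(2)[OF f2 Sq_map assms])

definition hgens :: "nat \<Rightarrow> ('p, 'a) schur set" where
  "hgens d = {gen \<mu> xs | \<mu> xs ds. (\<mu>, xs) \<in> symbols P M \<and>
     list_all2 (\<lambda>x e. x \<in> hdeg M e) xs ds \<and> sum_list ds = d}"

lemma hgens_closed: "hgens d \<subseteq> carrier S"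
  using gen_closed[OF f2] by (auto simp: hgens_def symbols_iff)

lemma S_hdeg: "hdeg S d = lin_span S (hgens d)"
  by (simp add: schur_hdeg_def hgens_def schur_lin_span[OF f2])

lemma S_hdeg_submodule: "submodule (hdeg S d) F2 S"
  unfolding S_hdeg by (rule lin_span_submodule[OF S_f2 hgens_closed])

lemma hdeg_list_closed: "list_all2 (\<lambda>x e. x \<in> hdeg M e) xs ds \<Longrightarrow> set xs \<subseteq> carrier M"
  using hdeg_closed by (intro list_all2_mem_subset[where g = "hdeg M"])

lemma gen_hdeg:
  assumes "\<mu> \<in> carrier (ops P (length xs))" "list_all2 (\<lambda>x e. x \<in> hdeg M e) xs ds"
  shows "gen \<mu> xs \<in> hdeg S (sum_list ds)"
  unfolding S_hdeg using assms hdeg_list_closed[OF assms(2)]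
  by (intro lin_span_base) (auto simp: hgens_def symbols_iff)

text \<open>A symbol is additive in each argument, so its arguments may be expanded into homogeneous
  ones; a symbol with homogeneous arguments is homogeneous of the total degree.\<close>

lemma S_homog_span: "carrier S \<subseteq> lin_span S (\<Union>d. hdeg S d)"
proof -
  have U: "(\<Union>d. hdeg S d) \<subseteq> carrier S" using submodule_f2D(1)[OF S_f2 S_hdeg_submodule] by blast
  note L = lin_span_submodule[OF S_f2 U]
  have "gen \<mu> xs \<in> lin_span S (\<Union>d. hdeg S d)" if "(\<mu>, xs) \<in> symbols P M" for \<mu> xs
  proof -
    have \<mu>: "\<mu> \<in> carrier (ops P (length xs))" and xs: "set xs \<subseteq> carrier M"
      using that by (simp_all add: symbols_iff)
    note multi = schur_compat_multi[OF gen_compat[OF f2] f2 \<mu>]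
    have eq: "carrier M = lin_span M (\<Union>d. hdeg M d)"
      using homog_span lin_span_closed[OF f2 hdeg_Union_closed] by blast
    show ?thesis
      using f2 hdeg_Union_closed eq xs
    proof (induction rule: span_list_induct1)
      case (base ys)
      have "\<exists>ds. list_all2 (\<lambda>x e. x \<in> hdeg M e) ys ds"
        using base(2) by (induction ys) (auto simp: list_all2_Cons1)
      then obtain ds where "list_all2 (\<lambda>x e. x \<in> hdeg M e) ys ds" by blast
      then show ?case using gen_hdeg[of \<mu> ys ds] \<mu> base(1) by (auto intro: lin_span_base)
    next
      case (zero xs ys)
      then show ?case
        using f2_map_zero[OF multi_additiveD(2)[OF multi] f2 S_f2, of xs ys] submodule_f2D(2)[OF S_f2 L] by simp
    next
      case (add xs x y ys)
      then show ?case
        using f2_mapD(2)[OF multi_additiveD(2)[OF multi], of xs ys x y] submodule_f2D(3)[OF S_f2 L] by simp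
    qed
  qed
  then have "lin_span S (schur_gens M) \<subseteq> lin_span S (\<Union>d. hdeg S d)"
    by (intro lin_span_least[OF L]) auto
  then show ?thesis using schur_generated(2)[OF f2] by simp
qed

lemma gen_zero:
  assumes "\<mu> \<in> carrier (ops P (length xs))" "set xs \<subseteq> carrier M" "\<zero>\<^bsub>M\<^esub> \<in> set xs"
  shows "gen \<mu> xs = \<zero>\<^bsub>S\<^esub>"
  by (rule schur_compat_zero[OF gen_compat[OF f2] f2 S_f2 assms(2,3,1)])

lemma S_hdeg_Sq:
  assumes "t \<in> hdeg S d"
  shows "Sq S i t \<in> hdeg S (d + i)"
proof (rule f2_map_span[OF S_Sq_map S_f2 S_f2 S_hdeg_submodule hgens_closed _ assms[unfolded S_hdeg]])
  show "Sq S i ` hgens d \<subseteq> hdeg S (d + i)"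
  proof (clarsimp simp only: image_subset_iff hgens_def mem_Collect_eq)
    fix \<mu> xs ds
    assume s: "(\<mu>, xs) \<in> symbols P M" and ds: "list_all2 (\<lambda>x e. x \<in> hdeg M e) xs ds"
    show "Sq S i (gen \<mu> xs) \<in> hdeg S (sum_list ds + i)"
      unfolding S_Sq_gen[OF s]
    proof (rule f2_finsum_submodule[OF S_f2 S_hdeg_submodule])
      fix ks assume "ks \<in> comps (length xs) i"
      then have l: "length ks = length xs" and i: "i = sum_list ks" by (auto simp: comps_iff)
      have "list_all2 (\<lambda>x e. x \<in> hdeg M e) (map2 (Sq M) ks xs) (map2 (+) ds ks)"
        using ds l Sq_degree by (auto simp: list_all2_conv_all_nth)
      moreover have "sum_list (map2 (+) ds ks) = sum_list ds + sum_list ks"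
        using sum_list_map2_plus[of ds ks] list_all2_lengthD[OF ds] l by simp
      ultimately show "gen \<mu> (map2 (Sq M) ks xs) \<in> hdeg S (sum_list ds + i)"
        using gen_hdeg[of \<mu> "map2 (Sq M) ks xs" "map2 (+) ds ks"] s l i by (simp add: symbols_iff)
    qed
  qed
qed

end

section \<open>Instability, degree projections and the Adem relations on S(P, M)\<close>

context operad_unstable
begin

text \<open>Pigeonhole: if the exponents add up to more than the degrees, some exponent exceeds the
  degree of its argument, and instability of M puts a zero into that slot.\<close>

lemma gen_Sq_zero:
  assumes \<mu>: "\<mu> \<in> carrier (ops P (length xs))" and ds: "list_all2 (\<lambda>x e. x \<in> hdeg M e) xs ds"
    and l: "length ks = length xs" and less: "sum_list ds < sum_list ks"
  shows "gen \<mu> (map2 (Sq M) ks xs) = \<zero>\<^bsub>S\<^esub>"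
proof -
  have len: "length ds = length xs" using list_all2_lengthD[OF ds] by simp
  have "\<exists>j<length xs. ds ! j < ks ! j"
  proof (rule ccontr)
    assume neg: "\<not> ?thesis"
    have "ks ! j \<le> ds ! j" if "j < length xs" for j
      using neg that not_less by blast
    then have "sum_list ks \<le> sum_list ds"
      using l len by (intro sum_list_mono2) simp_all
    then show False using less by simp
  qed
  then obtain j where j: "j < length xs" "ds ! j < ks ! j" by blast
  have "xs ! j \<in> hdeg M (ds ! j)" using ds j(1) by (simp add: list_all2_conv_all_nth)
  then have "map2 (Sq M) ks xs ! j = \<zero>\<^bsub>M\<^esub>" using unstable j l by simp
  then have "\<zero>\<^bsub>M\<^esub> \<in> set (map2 (Sq M) ks xs)"
    using j(1) l by (metis length_map length_zip min.idem nth_mem)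
  moreover have "set (map2 (Sq M) ks xs) \<subseteq> carrier M"
    by (rule map2_set_closed[OF _ hdeg_list_closed[OF ds]]) (rule Sq_closed)
  ultimately show ?thesis using \<mu> l by (intro gen_zero) simp_all
qed

lemma S_unstable:
  assumes t: "t \<in> hdeg S d" and i: "d < i"
  shows "Sq S i t = \<zero>\<^bsub>S\<^esub>"
proof -
  have "Sq S i t \<in> {\<zero>\<^bsub>S\<^esub>}"
  proof (rule f2_map_span[OF S_Sq_map S_f2 S_f2 submodule_zero[OF S_f2] hgens_closed _ t[unfolded S_hdeg]])
    show "Sq S i ` hgens d \<subseteq> {\<zero>\<^bsub>S\<^esub>}"
    proof
      fix u assume "u \<in> Sq S i ` hgens d"
      then obtain \<mu> xs ds where u: "u = Sq S i (gen \<mu> xs)" and s: "(\<mu>, xs) \<in> symbols P M"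
        and ds: "list_all2 (\<lambda>x e. x \<in> hdeg M e) xs ds" and d: "sum_list ds = d"
        unfolding hgens_def by blast
      have "finsum S (\<lambda>ks. gen \<mu> (map2 (Sq M) ks xs)) (comps (length xs) i) = \<zero>\<^bsub>S\<^esub>"
      proof (rule f2_finsum_zero[OF S_f2])
        fix ks assume "ks \<in> comps (length xs) i"
        then show "gen \<mu> (map2 (Sq M) ks xs) = \<zero>\<^bsub>S\<^esub>"
          using s ds d i by (intro gen_Sq_zero[OF _ ds]) (simp_all add: symbols_iff comps_iff)
      qed
      then show "u \<in> {\<zero>\<^bsub>S\<^esub>}" using u S_Sq_gen[OF s] by simp
    qed
  qed
  then show ?thesis by blast
qed

lemma S_Sq_zero:
  assumes s: "(\<mu>, xs) \<in> symbols P M"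
  shows "Sq S 0 (gen \<mu> xs) = gen \<mu> xs"
proof -
  have xs: "set xs \<subseteq> carrier M" using s by (simp add: symbols_iff)
  then have "map2 (Sq M) (replicate (length xs) 0) xs = xs"
    by (induction xs) (simp_all add: Sq_zero)
  then show ?thesis
    using f2_finsum_single[OF S_f2, of "{replicate (length xs) 0}" "replicate (length xs) 0"
        "\<lambda>ks. gen \<mu> (map2 (Sq M) ks xs)"] gen_closed[OF f2 xs] s
    by (simp only: S_Sq_gen[OF s] comps_zero symbols_iff) simp
qed

text \<open>The degree d component of a tensor is the sum of the tensors of components over all ways
  to distribute d. This is the Cartan sum for the family of component maps, so its compatibility is
  already established.\<close>

definition S_proj :: "nat \<Rightarrow> ('p, 'a) schur \<Rightarrow> ('p, 'a) schur" where
  "S_proj d = schur_lift P M (schur_space P M) (cartan (schur_space P M) gen (homog_component M) d)"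

lemma S_proj_map: "f2_map S S (S_proj d)"
  unfolding S_proj_def by (rule schur_op(1)[OF f2 homog_map])

text \<open>Only the distribution \<open>ds\<close> can contribute; any other asks some argument for
  a component in a wrong degree and so has a zero entry.\<close>

lemma S_proj_gen:
  assumes s: "(\<mu>, xs) \<in> symbols P M" and ds: "list_all2 (\<lambda>x e. x \<in> hdeg M e) xs ds"
  shows "S_proj d (gen \<mu> xs) = (if d = sum_list ds then gen \<mu> xs else \<zero>\<^bsub>S\<^esub>)"
proof -
  let ?f = "\<lambda>ks. gen \<mu> (map2 (homog_component M) ks xs)"
  have len: "length ds = length xs" using list_all2_lengthD[OF ds] by simp
  have \<mu>: "\<mu> \<in> carrier (ops P (length xs))" and xs: "set xs \<subseteq> carrier M" using s by (simp_all add: symbols_iff)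
  have cl: "set (map2 (homog_component M) ks xs) \<subseteq> carrier M" for ks
    by (rule map2_set_closed[OF _ xs]) (rule f2_mapD(1)[OF homog_map])
  have same: "map2 (homog_component M) ds xs = xs"
    using ds len by (intro nth_equalityI) (auto simp: list_all2_conv_all_nth homog_hdeg)
  have other: "?f ks = \<zero>\<^bsub>S\<^esub>" if l: "length ks = length xs" and ne: "ks \<noteq> ds" for ks
  proof -
    obtain j where j: "j < length xs" "ks ! j \<noteq> ds ! j"
      using ne l len by (metis nth_equalityI)
    have "xs ! j \<in> hdeg M (ds ! j)" using ds j(1) by (simp add: list_all2_conv_all_nth)
    then have "map2 (homog_component M) ks xs ! j = \<zero>\<^bsub>M\<^esub>" using j l by (simp add: homog_hdeg)
    then have "\<zero>\<^bsub>M\<^esub> \<in> set (map2 (homog_component M) ks xs)"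
      using j(1) l by (metis length_map length_zip min.idem nth_mem)
    then show ?thesis using \<mu> l cl by (intro gen_zero) simp_all
  qed
  have "S_proj d (gen \<mu> xs) = finsum S ?f (comps (length xs) d)"
    unfolding S_proj_def by (rule schur_op(2)[OF f2 homog_map s])
  also have "\<dots> = (if d = sum_list ds then gen \<mu> xs else \<zero>\<^bsub>S\<^esub>)"
  proof (cases "d = sum_list ds")
    case True
    have "finsum S ?f (comps (length xs) d) = ?f ds"
      by (rule f2_finsum_single[OF S_f2])
         (use True len same other gen_closed[OF f2 xs \<mu>] in \<open>simp_all add: comps_iff\<close>)
    then show ?thesis using True same by simp
  next
    case False
    then have "finsum S ?f (comps (length xs) d) = \<zero>\<^bsub>S\<^esub>"
      using other by (intro f2_finsum_zero[OF S_f2]) (auto simp: comps_iff)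
    then show ?thesis using False by simp
  qed
  finally show ?thesis .
qed

lemma S_proj_hdeg:
  assumes t: "t \<in> hdeg S e"
  shows "S_proj d t = (if d = e then t else \<zero>\<^bsub>S\<^esub>)"
proof (rule f2_map_eq_on_span[OF S_proj_map _ S_f2 S_f2 hgens_closed _ t[unfolded S_hdeg]])
  show "f2_map S S (\<lambda>t. if d = e then t else \<zero>\<^bsub>S\<^esub>)"
    using f2_closed[OF S_f2] f2_zero[OF S_f2] by (intro f2_mapI) simp_all
  show "S_proj d u = (if d = e then u else \<zero>\<^bsub>S\<^esub>)" if "u \<in> hgens e" for u
    using that S_proj_gen unfolding hgens_def by auto
qed

lemma S_SqSq_gen:
  assumes s: "(\<mu>, xs) \<in> symbols P M"
  shows "Sq S a (Sq S b (gen \<mu> xs)) = cartan2 S (Sq M) (gen \<mu>) xs a b"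
proof -
  have \<mu>: "\<mu> \<in> carrier (ops P (length xs))" and xs: "set xs \<subseteq> carrier M" using s by (simp_all add: symbols_iff)
  have cl: "set (map2 (Sq M) ks ys) \<subseteq> carrier M" if "set ys \<subseteq> carrier M" for ks ys
    by (rule map2_set_closed[OF _ that]) (rule Sq_closed)
  have sy: "(\<mu>, map2 (Sq M) ks xs) \<in> symbols P M" if "ks \<in> comps (length xs) b" for ks
    using that \<mu> cl[OF xs, of ks] unfolding symbols_iff comps_iff by simp
  have gy: "gen \<mu> (map2 (Sq M) ks xs) \<in> carrier S" if "ks \<in> comps (length xs) b" for ks
    using sy[OF that] unfolding symbols_iff by (intro gen_closed[OF f2]) simp_all
  have "Sq S a (Sq S b (gen \<mu> xs)) =
      finsum S (\<lambda>ks. Sq S a (gen \<mu> (map2 (Sq M) ks xs))) (comps (length xs) b)"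
    unfolding S_Sq_gen[OF s, of b] by (rule f2_map_finsum[OF S_Sq_map S_f2 S_f2]) (rule gy)
  also have "\<dots> = cartan2 S (Sq M) (gen \<mu>) xs a b"
    unfolding cartan2_def
  proof (rule f2_finsum_cong[OF S_f2 refl])
    fix ks assume ks: "ks \<in> comps (length xs) b"
    show "Sq S a (gen \<mu> (map2 (Sq M) ks xs)) =
        finsum S (\<lambda>js. gen \<mu> (map2 (Sq M) js (map2 (Sq M) ks xs))) (comps (length xs) a)"
      unfolding S_Sq_gen[OF sy[OF ks]] using ks by (simp add: comps_iff)
    then show "finsum S (\<lambda>js. gen \<mu> (map2 (Sq M) js (map2 (Sq M) ks xs))) (comps (length xs) a) \<in> carrier S"
      using f2_mapD(1)[OF S_Sq_map gy[OF ks], of a] by simp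
  qed
  finally show ?thesis .
qed

text \<open>On a symbol, composing two squares is the twofold Cartan sum over its arguments, and for
  these sums the identity was carried from M to lists of any length.\<close>

theorem schur_unstable: "unstable_module S"
proof (rule unstable_moduleI[where p = S_proj and G = "schur_gens M"])
  fix n c and x assume "x \<in> schur_gens M"
  then obtain \<mu> xs where x: "x = gen \<mu> xs" and s: "(\<mu>, xs) \<in> symbols P M" by blast
  have \<mu>: "\<mu> \<in> carrier (ops P (length xs))" and xs: "set xs \<subseteq> carrier M" using s by (simp_all add: symbols_iff)
  show "Sq S 0 x = x" unfolding x by (rule S_Sq_zero[OF s])
  show "vec_pair S n (bm_left n c) (\<lambda>i. Sq S i (Sq S (n - i) x)) =
      vec_pair S n (bm_right n c) (\<lambda>i. Sq S i (Sq S (n - i) x))"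
    unfolding x S_SqSq_gen[OF s]
    using bm_sum_eq[OF f2 S_f2 Sq_map bullett_macdonald schur_compat_multi[OF gen_compat[OF f2] f2 \<mu>] xs, of n c]
    unfolding bm_sum_def .
next
  show "module F2 S" by (rule S_f2)
  show "submodule (hdeg S d) F2 S" for d by (rule S_hdeg_submodule)
  show "carrier S \<subseteq> lin_span S (\<Union>d. hdeg S d)" by (rule S_homog_span)
  show "f2_map S S (S_proj d)" for d by (rule S_proj_map)
  show "S_proj d x = (if d = e then x else \<zero>\<^bsub>S\<^esub>)" if "x \<in> hdeg S e" for d e x by (rule S_proj_hdeg[OF that])
  show "f2_map S S (Sq S i)" for i by (rule S_Sq_map)
  show "Sq S i x \<in> hdeg S (d + i)" if "x \<in> hdeg S d" for d i x by (rule S_hdeg_Sq[OF that])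
  show "Sq S i x = \<zero>\<^bsub>S\<^esub>" if "x \<in> hdeg S d" "d < i" for d i x by (rule S_unstable[OF that])
  show "schur_gens M \<subseteq> carrier S" by (rule schur_generated(1)[OF f2])
  show "carrier S \<subseteq> lin_span S (schur_gens M)" using schur_generated(2)[OF f2] by (rule equalityD1)
qed

end


section \<open>The multiplication of the monad\<close>

lemma listset_iff: "xs \<in> listset As \<longleftrightarrow> list_all2 (\<in>) xs As"
proof (induction As arbitrary: xs)
  case (Cons A As)
  then show ?case by (cases xs) (auto simp: set_Cons_def)
qed auto

lemma finite_listset: "(\<And>A. A \<in> set As \<Longrightarrow> finite A) \<Longrightarrow> finite (listset As)"
proof (induction As)
  case (Cons A As)
  have "listset (A # As) = (\<lambda>(x, xs). x # xs) ` (A \<times> listset As)" by (auto simp: set_Cons_def)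
  then show ?case using Cons by simp
qed simp

lemma prod_list_bit_zero: "(0::bit) \<in> set cs \<Longrightarrow> prod_list cs = 0"
  by (induction cs) auto

text \<open>The sum in \<open>plug\<close> runs over lists drawn from the supports, which shift
  under addition. A list leaving the support somewhere has coefficient zero, so larger finite sets
  do no harm and can be shared by two summands.\<close>

lemma plug_superset:
  assumes As: "list_all2 (\<lambda>F A. Poly_Mapping.keys F \<subseteq> A) Fs As" "\<And>A. A \<in> set As \<Longrightarrow> finite A"
  shows "plug P \<mu> Fs = (\<Sum>bs\<in>listset As. Poly_Mapping.single
       (opcomp P (map (length \<circ> snd) bs) \<mu> (map fst bs), concat (map snd bs))
       (prod_list (map2 Poly_Mapping.lookup Fs bs)))"
  unfolding plug_def
proof (rule sum.mono_neutral_left)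
  show "finite (listset As)" by (rule finite_listset) (rule As(2))
  show "listset (map Poly_Mapping.keys Fs) \<subseteq> listset As"
    using As(1) by (auto simp: listset_iff list_all2_conv_all_nth) blast
  show "\<forall>bs\<in>listset As - listset (map Poly_Mapping.keys Fs). Poly_Mapping.single
       (opcomp P (map (length \<circ> snd) bs) \<mu> (map fst bs), concat (map snd bs))
       (prod_list (map2 Poly_Mapping.lookup Fs bs)) = 0"
  proof
    fix bs assume "bs \<in> listset As - listset (map Poly_Mapping.keys Fs)"
    then obtain j where j: "j < length Fs" "length bs = length Fs" "bs ! j \<notin> Poly_Mapping.keys (Fs ! j)"
      using As(1) by (auto simp: listset_iff list_all2_conv_all_nth)
    then have "map2 Poly_Mapping.lookup Fs bs ! j = 0" by (simp add: in_keys_iff)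
    then have "0 \<in> set (map2 Poly_Mapping.lookup Fs bs)"
      using j by (metis length_map length_zip min.idem nth_mem)
    then show "Poly_Mapping.single
       (opcomp P (map (length \<circ> snd) bs) \<mu> (map fst bs), concat (map snd bs))
       (prod_list (map2 Poly_Mapping.lookup Fs bs)) = 0"
      by (simp add: prod_list_bit_zero)
  qed
qed

lemma plug_add:
  "plug P \<mu> (Fs @ (F + G) # Gs) = plug P \<mu> (Fs @ F # Gs) + plug P \<mu> (Fs @ G # Gs)"
proof -
  let ?A = "Poly_Mapping.keys F \<union> Poly_Mapping.keys G"
  let ?As = "map Poly_Mapping.keys Fs @ ?A # map Poly_Mapping.keys Gs"
  let ?b = "\<lambda>bs. (opcomp P (map (length \<circ> snd) bs) \<mu> (map fst bs), concat (map snd bs))"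
  have all: "list_all2 (\<lambda>F A. Poly_Mapping.keys F \<subseteq> A) (Fs @ H # Gs) ?As" if "Poly_Mapping.keys H \<subseteq> ?A" for H
    using that by (auto intro!: list_all2_appendI list_all2_refl simp: list_all2_map2)
  have fin: "A \<in> set ?As \<Longrightarrow> finite A" for A by auto
  have ps: "plug P \<mu> (Fs @ H # Gs) = (\<Sum>bs\<in>listset ?As.
      Poly_Mapping.single (?b bs) (prod_list (map2 Poly_Mapping.lookup (Fs @ H # Gs) bs)))"
    if "Poly_Mapping.keys H \<subseteq> ?A" for H
    by (rule plug_superset[OF all[OF that] fin])
  have len: "length bs = length Fs + Suc (length Gs)" if "bs \<in> listset ?As" for bs
    using that by (auto simp: listset_iff dest!: list_all2_lengthD)
  have pr: "prod_list (map2 Poly_Mapping.lookup (Fs @ (F + G) # Gs) bs) =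
      prod_list (map2 Poly_Mapping.lookup (Fs @ F # Gs) bs) + prod_list (map2 Poly_Mapping.lookup (Fs @ G # Gs) bs)"
    if A: "bs \<in> listset ?As" for bs
  proof -
    have "bs = take (length Fs) bs @ bs ! length Fs # drop (Suc (length Fs)) bs"
      using len[OF A] by (intro id_take_nth_drop) simp
    then obtain cs c ds where bs: "bs = cs @ c # ds" "length cs = length Fs" "length ds = length Gs"
      using len[OF A] by (metis add_Suc_right add_diff_cancel_left' append_eq_conv_conj length_append
          length_Cons length_take min.absorb2 le_add1 nat.inject)
    then show ?thesis by (simp add: lookup_add distrib_left distrib_right)
  qed
  have "plug P \<mu> (Fs @ (F + G) # Gs) = (\<Sum>bs\<in>listset ?As.
      Poly_Mapping.single (?b bs) (prod_list (map2 Poly_Mapping.lookup (Fs @ F # Gs) bs)) +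
      Poly_Mapping.single (?b bs) (prod_list (map2 Poly_Mapping.lookup (Fs @ G # Gs) bs)))"
    unfolding ps[of "F + G", OF keys_add] by (rule sum.cong[OF refl]) (simp only: pr single_add)
  also have "\<dots> = plug P \<mu> (Fs @ F # Gs) + plug P \<mu> (Fs @ G # Gs)"
    unfolding sum.distrib using ps[of F] ps[of G] by simp
  finally show ?thesis .
qed

lemma plug_single:
  "plug P \<mu> (map (\<lambda>b. Poly_Mapping.single b 1) bs) =
    symb (opcomp P (map (length \<circ> snd) bs) \<mu> (map fst bs)) (concat (map snd bs))"
proof -
  have "listset (map Poly_Mapping.keys (map (\<lambda>b. Poly_Mapping.single b (1::bit)) bs)) = {bs}"
    by (auto simp: listset_iff list_all2_conv_all_nth list_eq_iff_nth_eq)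
  moreover have "prod_list (map2 Poly_Mapping.lookup (map (\<lambda>b. Poly_Mapping.single b (1::bit)) bs) bs) = 1"
    by (induction bs) auto
  ultimately show ?thesis by (simp add: plug_def)
qed

section \<open>Permutations of blocks and of concatenated lists\<close>

lemma list_perm_permutes:
  assumes "mset L = mset [0..<n]"
  shows "list_perm L permutes {..<n}"
proof -
  have len: "length L = n" using assms by (metis size_mset length_upt diff_zero)
  have set: "set L = {..<n}" using assms by (metis mset_eq_setD atLeast_upt)
  have dist: "distinct L" using assms by (metis mset_eq_imp_distinct_iff distinct_upt)
  have "bij_betw (list_perm L) {..<n} {..<n}"
    using bij_betw_nth[OF dist refl set[symmetric]] len
    by (subst bij_betw_cong[of _ _ "(!) L"]) (auto simp: list_perm_def)
  then show ?thesis
    by (rule bij_imp_permutes) (simp add: list_perm_def len)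
qed

lemma permute_list_perm:
  assumes "length L = length ys"
  shows "permute_list (list_perm L) ys = map ((!) ys) L"
  using assms by (intro nth_equalityI) (simp_all add: permute_list_def list_perm_def)

lemma concat_idx_blocks: "concat (idx_blocks ks) = [0..<sum_list ks]"
proof (induction ks rule: rev_induct)
  case (snoc k ks)
  have "idx_blocks (ks @ [k]) = idx_blocks ks @ [[sum_list ks..<sum_list ks + k]]"
    by (simp add: idx_blocks_def)
  then show ?case using snoc by (simp add: upt_add_eq_append[of 0 "sum_list ks" k])
qed (simp add: idx_blocks_def)

lemma length_idx_blocks [simp]: "length (idx_blocks ks) = length ks"
  by (simp add: idx_blocks_def)

lemma nth_idx_blocks: "i < length ks \<Longrightarrow> length (idx_blocks ks ! i) = ks ! i"
  by (simp add: idx_blocks_def take_Suc_conv_app_nth)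

lemma map_idx_blocks: "map (map ((!) (concat xss))) (idx_blocks (map length xss)) = xss"
proof (rule nth_equalityI)
  fix i assume "i < length (map (map ((!) (concat xss))) (idx_blocks (map length xss)))"
  then have i: "i < length xss" by simp
  let ?a = "length (concat (take i xss))"
  have "concat xss = concat (take i xss @ xss ! i # drop (Suc i) xss)"
    using id_take_nth_drop[OF i] by simp
  then have c: "concat xss = concat (take i xss) @ xss ! i @ concat (drop (Suc i) xss)" by simp
  have "idx_blocks (map length xss) ! i = [?a..<?a + length (xss ! i)]"
    using i by (simp add: idx_blocks_def take_Suc_conv_app_nth take_map length_concat)
  moreover have "map ((!) (concat xss)) [?a..<?a + length (xss ! i)] = xss ! i"
    by (rule nth_equalityI) (simp_all add: c nth_append)
  ultimately show "map (map ((!) (concat xss))) (idx_blocks (map length xss)) ! i = xss ! i"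
    using i by simp
qed simp

lemma mset_concat_permute:
  assumes "\<sigma> permutes {..<length xss}"
  shows "mset (concat (permute_list \<sigma> xss)) = mset (concat xss)"
proof -
  have "mset (concat ys) = sum_mset (image_mset mset (mset ys))" for ys :: "'a list list"
    by (induction ys) simp_all
  then show ?thesis by (simp only: mset_permute_list[OF assms])
qed

text \<open>The permutation is given by a list of positions. Reading \<open>concat xss\<close> along
  the rearranged blocks of positions commutes with concatenation and with the rearrangement, and
  along one block it returns one entry of \<open>xss\<close>.\<close>

lemma block_perm:
  assumes \<sigma>: "\<sigma> permutes {..<length xss}"
  shows "block_perm \<sigma> (map length xss) permutes {..<length (concat xss)}"
    and "permute_list (block_perm \<sigma> (map length xss)) (concat xss) = concat (permute_list \<sigma> xss)"
proof -
  let ?B = "idx_blocks (map length xss)" and ?L = "concat (permute_list \<sigma> (idx_blocks (map length xss)))"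
  have m: "mset ?L = mset [0..<length (concat xss)]"
    using mset_concat_permute[of \<sigma> ?B] \<sigma> by (simp add: concat_idx_blocks length_concat)
  then show "block_perm \<sigma> (map length xss) permutes {..<length (concat xss)}"
    unfolding block_perm_def by (rule list_perm_permutes)
  have len: "length ?L = length (concat xss)" using m by (metis size_mset length_upt diff_zero)
  have "permute_list (block_perm \<sigma> (map length xss)) (concat xss) = map ((!) (concat xss)) ?L"
    unfolding block_perm_def by (rule permute_list_perm[OF len])
  also have "\<dots> = concat (map (map ((!) (concat xss))) (permute_list \<sigma> ?B))" by (rule map_concat)
  also have "map (map ((!) (concat xss))) (permute_list \<sigma> ?B) = permute_list \<sigma> (map (map ((!) (concat xss))) ?B)"
    by (rule permute_list_map[symmetric]) (use \<sigma> in simp)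
  also have "\<dots> = permute_list \<sigma> xss" by (simp only: map_idx_blocks)
  finally show "permute_list (block_perm \<sigma> (map length xss)) (concat xss) = concat (permute_list \<sigma> xss)" .
qed

lemma sum_perm:
  assumes \<tau>: "list_all2 (\<lambda>\<tau> xs. \<tau> permutes {..<length xs}) \<tau>s xss"
  shows "sum_perm \<tau>s (map length xss) permutes {..<length (concat xss)}"
    and "permute_list (sum_perm \<tau>s (map length xss)) (concat xss) = concat (map2 permute_list \<tau>s xss)"
proof -
  let ?B = "idx_blocks (map length xss)" and ?L = "concat (map2 permute_list \<tau>s (idx_blocks (map length xss)))"
  have lt: "length \<tau>s = length xss" using list_all2_lengthD[OF \<tau>] .
  have B: "list_all2 (\<lambda>\<tau> B. \<tau> permutes {..<length B}) \<tau>s ?B"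
    using \<tau> by (auto simp: list_all2_conv_all_nth nth_idx_blocks)
  have mc: "mset (concat (map2 permute_list \<tau>s Bs)) = mset (concat Bs)"
    if "list_all2 (\<lambda>\<tau> B. \<tau> permutes {..<length B}) \<tau>s Bs" for \<tau>s and Bs :: "nat list list"
    using that by (induction rule: list_all2_induct) simp_all
  have m: "mset ?L = mset [0..<length (concat xss)]"
    unfolding mc[OF B] by (simp add: concat_idx_blocks length_concat)
  then show "sum_perm \<tau>s (map length xss) permutes {..<length (concat xss)}"
    unfolding sum_perm_def by (rule list_perm_permutes)
  have len: "length ?L = length (concat xss)" using m by (metis size_mset length_upt diff_zero)
  have mm: "map (map f) (map2 permute_list \<tau>s Bs) = map2 permute_list \<tau>s (map (map f) Bs)"
    if "list_all2 (\<lambda>\<tau> B. \<tau> permutes {..<length B}) \<tau>s Bs" for \<tau>s and Bs :: "nat list list" and f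
    using that by (induction rule: list_all2_induct) (simp_all add: permute_list_map)
  have "permute_list (sum_perm \<tau>s (map length xss)) (concat xss) = map ((!) (concat xss)) ?L"
    unfolding sum_perm_def by (rule permute_list_perm[OF len])
  also have "\<dots> = concat (map (map ((!) (concat xss))) (map2 permute_list \<tau>s ?B))" by (rule map_concat)
  also have "map (map ((!) (concat xss))) (map2 permute_list \<tau>s ?B) = map2 permute_list \<tau>s xss"
    unfolding mm[OF B] by (simp only: map_idx_blocks)
  finally show "permute_list (sum_perm \<tau>s (map length xss)) (concat xss) = concat (map2 permute_list \<tau>s xss)" .
qed

text \<open>The slot holding \<open>z\<close> moves to a position that depends on the permutation
  alone, and the other entries do not see \<open>z\<close>. Additivity in a slot therefore survives
  permuting the list.\<close>

lemma permute_list_slot: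
  assumes \<sigma>: "\<sigma> permutes {..<length xs + Suc (length ys)}"
  obtains as bs where "\<And>z. permute_list \<sigma> (xs @ z # ys) = as @ z # bs"
    "length as + Suc (length bs) = length xs + Suc (length ys)" "set as \<subseteq> set xs \<union> set ys" "set bs \<subseteq> set xs \<union> set ys"
proof -
  let ?n = "length xs + Suc (length ys)"
  define j where "j = inv_into UNIV \<sigma> (length xs)"
  have \<sigma>j: "\<sigma> j = length xs" unfolding j_def using permutes_inverses(1)[OF \<sigma>] .
  have j: "j < ?n" using permutes_in_image[OF \<sigma>, of j] \<sigma>j by simp
  have ne: "\<sigma> i \<noteq> length xs" if "i \<noteq> j" for i
    using that \<sigma>j permutes_inj[OF \<sigma>] by (metis injD)
  \<comment> \<open>The other entries are read from \<open>xs @ ys\<close>, where positions beyond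
    the removed slot have moved down by one.\<close>
  define g where "g = (\<lambda>i. (xs @ ys) ! (if \<sigma> i < length xs then \<sigma> i else \<sigma> i - 1))"
  have g: "(xs @ z # ys) ! \<sigma> i = g i" if "i \<noteq> j" for i z
    using ne[OF that] by (auto simp: g_def nth_append nth_Cons' not_less)
  have gs: "g i \<in> set xs \<union> set ys" if "i \<noteq> j" "i < ?n" for i
  proof -
    have "\<sigma> i < ?n" using permutes_in_image[OF \<sigma>, of i] that by simp
    then have "(if \<sigma> i < length xs then \<sigma> i else \<sigma> i - 1) < length (xs @ ys)"
      using ne[OF that(1)] by auto
    then show ?thesis unfolding g_def using nth_mem by (metis set_append)
  qed
  have split: "[0..<?n] = [0..<j] @ j # [Suc j..<?n]"
    using j by (metis le_add_diff_inverse less_imp_le upt_add_eq_append upt_conv_Cons zero_le)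
  have "permute_list \<sigma> (xs @ z # ys) = map g [0..<j] @ z # map g [Suc j..<?n]" for z
  proof -
    have "permute_list \<sigma> (xs @ z # ys) = map (\<lambda>i. (xs @ z # ys) ! \<sigma> i) [0..<?n]"
      by (simp add: permute_list_def)
    also have "\<dots> = map (\<lambda>i. (xs @ z # ys) ! \<sigma> i) [0..<j] @ z # map (\<lambda>i. (xs @ z # ys) ! \<sigma> i) [Suc j..<?n]"
      unfolding split by (simp add: \<sigma>j)
    also have "map (\<lambda>i. (xs @ z # ys) ! \<sigma> i) [0..<j] = map g [0..<j]"
      by (rule map_cong[OF refl g]) simp
    also have "map (\<lambda>i. (xs @ z # ys) ! \<sigma> i) [Suc j..<?n] = map g [Suc j..<?n]"
      by (rule map_cong[OF refl g]) auto
    finally show ?thesis .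
  qed
  then show thesis
  proof (rule that)
    show "set (map g [0..<j]) \<subseteq> set xs \<union> set ys" "set (map g [Suc j..<?n]) \<subseteq> set xs \<union> set ys"
      unfolding set_map set_upt using j by (intro image_subsetI gs; auto)+
  qed (use j in auto)
qed

text \<open>With the operation fixed both sides are additive in every slot, so the entries can be
  replaced by generators one at a time.\<close>

lemma compat_ext:
  assumes f: "schur_compat P N V f" and g: "schur_compat P N V g" and N: "module F2 N" and V: "module F2 V"
    and X: "X \<subseteq> carrier N" "carrier N = lin_span N X"
    and eq: "\<And>ys. \<lbrakk>length ys = length xs; set ys \<subseteq> X\<rbrakk> \<Longrightarrow> f \<mu> ys = g \<mu> ys"
    and s: "(\<mu>, xs) \<in> symbols P N"
  shows "f \<mu> xs = g \<mu> xs"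
proof -
  have \<mu>: "\<mu> \<in> carrier (ops P (length xs))" and xs: "set xs \<subseteq> carrier N" using s by (simp_all add: symbols_iff)
  note F = multi_additiveD(2)[OF schur_compat_multi[OF f N \<mu>]]
  note G = multi_additiveD(2)[OF schur_compat_multi[OF g N \<mu>]]
  show ?thesis
    using N X xs
  proof (induction rule: span_list_induct1)
    case (zero xs ys)
    then show ?case using f2_map_zero[OF F N V] f2_map_zero[OF G N V] by simp
  next
    case (add xs x y ys)
    then show ?case using f2_mapD(2)[OF F] f2_mapD(2)[OF G] by simp
  qed (rule eq)
qed

section \<open>Plugging symbols into an operation\<close>

abbreviation plug_op :: "'p operad_data \<Rightarrow> 'p \<Rightarrow> ('p \<times> 'a list) list \<Rightarrow> 'p" where
  "plug_op P \<mu> bs \<equiv> opcomp P (map (length \<circ> snd) bs) \<mu> (map fst bs)"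

abbreviation plug_args :: "('p \<times> 'a list) list \<Rightarrow> 'a list" where
  "plug_args bs \<equiv> concat (map snd bs)"

context operad
begin

lemma op_list_symbols: "set bs \<subseteq> symbols P M \<Longrightarrow> op_list P (map (length \<circ> snd) bs) (map fst bs)"
  by (auto simp: op_list_def list_all2_map1 list_all2_map2 list_all2_same symbols_def)

lemma length_plug_args: "length (plug_args bs) = sum_list (map (length \<circ> snd) bs)"
  by (simp add: length_concat)

lemma opcomp_map_left:
  assumes "op_list P ks \<nu>s"
  shows "f2_map (ops P (length ks)) (ops P (sum_list ks)) (\<lambda>\<mu>. opcomp P ks \<mu> \<nu>s)"
  using opcomp_linear_left[OF assms] unfolding linear_maps_iff[OF ops_module ops_module]
  by (auto intro: f2_map_cong[OF _ _ ops_module])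

lemma opcomp_closed:
  assumes "op_list P ks \<nu>s" "\<mu> \<in> carrier (ops P (length ks))"
  shows "opcomp P ks \<mu> \<nu>s \<in> carrier (ops P (sum_list ks))"
  by (rule f2_mapD(1)[OF opcomp_map_left[OF assms(1)] assms(2)])

lemma opcomp_map_slot:
  assumes "\<mu> \<in> carrier (ops P (length ks))" "op_list P ks \<nu>s" "i < length ks"
  shows "f2_map (ops P (ks ! i)) (ops P (sum_list ks)) (\<lambda>\<nu>. opcomp P ks \<mu> (\<nu>s[i := \<nu>]))"
  using opcomp_linear_slot[OF assms] unfolding linear_maps_iff[OF ops_module ops_module]
  by (auto intro: f2_map_cong[OF _ _ ops_module])

lemma plug_op_closed:
  assumes "set bs \<subseteq> symbols P M" "\<mu> \<in> carrier (ops P (length bs))"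
  shows "plug_op P \<mu> bs \<in> carrier (ops P (length (plug_args bs)))"
  using opcomp_closed[OF op_list_symbols[OF assms(1)], of \<mu>] assms(2) by (simp add: length_plug_args)

lemma plug_args_closed: "set bs \<subseteq> symbols P M \<Longrightarrow> set (plug_args bs) \<subseteq> carrier M"
  by (induction bs) (auto simp: symbols_iff)

lemma plug_symbol:
  assumes "set bs \<subseteq> symbols P M" "\<mu> \<in> carrier (ops P (length bs))"
  shows "(plug_op P \<mu> bs, plug_args bs) \<in> symbols P M"
  using plug_op_closed[OF assms] plug_args_closed[OF assms(1)] by (simp add: symbols_iff)

lemma plug_zero: "plug P \<mu> (Fs @ 0 # Gs) = 0"
  using plug_add[of P \<mu> Fs 0 0 Gs] by simp

abbreviation singles :: "('a, 'm) umodule_scheme \<Rightarrow> (('p \<times> 'a list) \<Rightarrow>\<^sub>0 bit) set" where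
  "singles M \<equiv> (\<lambda>b. Poly_Mapping.single b 1) ` symbols P M"

lemma singles_closed: "singles M \<subseteq> carrier (free_space (symbols P M))"
  by auto

lemma singles_list:
  assumes "set Fs \<subseteq> singles M"
  obtains bs where "Fs = map (\<lambda>b. Poly_Mapping.single b 1) bs" "set bs \<subseteq> symbols P M"
proof -
  have "Fs \<in> map (\<lambda>b. Poly_Mapping.single b 1) ` lists (symbols P M)"
    using assms unfolding lists_image[symmetric] by (simp add: lists_eq_set)
  then show thesis using that by (auto simp: lists_eq_set)
qed

lemma plug_closed:
  assumes Fs: "set Fs \<subseteq> carrier (free_space (symbols P M))" and \<mu>: "\<mu> \<in> carrier (ops P (length Fs))"
  shows "plug P \<mu> Fs \<in> carrier (free_space (symbols P M))"
  using free_space_module singles_closed free_space_span Fs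
proof (induction rule: span_list_induct1)
  case (base Gs)
  then obtain bs where bs: "Gs = map (\<lambda>b. Poly_Mapping.single b 1) bs" "set bs \<subseteq> symbols P M"
    using singles_list by blast
  then show ?case using plug_symbol[OF bs(2), of \<mu>] \<mu> base(1) by (simp add: plug_single)
next
  case (zero xs ys)
  then show ?case by (simp add: plug_zero)
next
  case (add xs x y ys)
  then show ?case
    using f2_closed(2)[OF free_space_module, of "plug P \<mu> (xs @ x # ys)" "symbols P M" "plug P \<mu> (xs @ y # ys)"]
    by (simp add: plug_add)
qed

lemma plug_class_slot:
  assumes M: "module F2 M"
    and Fs: "set Fs \<subseteq> carrier (free_space (symbols P M))" and Gs: "set Gs \<subseteq> carrier (free_space (symbols P M))"
    and \<mu>: "\<mu> \<in> carrier (ops P (length Fs + Suc (length Gs)))"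
  shows "f2_map (free_space (symbols P M)) (schur P M) (\<lambda>F. schur_class P M (plug P \<mu> (Fs @ F # Gs)))"
proof (rule f2_mapI)
  fix F assume F: "F \<in> carrier (free_space (symbols P M))"
  have cl: "plug P \<mu> (Fs @ H # Gs) \<in> carrier (free_space (symbols P M))" if "H \<in> carrier (free_space (symbols P M))" for H
    using that Fs Gs \<mu> by (intro plug_closed) simp_all
  show "schur_class P M (plug P \<mu> (Fs @ F # Gs)) \<in> carrier (schur P M)"
    using f2_mapD(1)[OF schur_class_map[OF M] cl[OF F]] by simp
  fix G assume G: "G \<in> carrier (free_space (symbols P M))"
  show "schur_class P M (plug P \<mu> (Fs @ (F \<oplus>\<^bsub>free_space (symbols P M)\<^esub> G) # Gs)) =
      schur_class P M (plug P \<mu> (Fs @ F # Gs)) \<oplus>\<^bsub>schur P M\<^esub> schur_class P M (plug P \<mu> (Fs @ G # Gs))"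
    using f2_mapD(2)[OF schur_class_map[OF M] cl[OF F] cl[OF G]] by (simp add: plug_add)
qed

text \<open>Plugging generators into all slots but one gives a compatible function of the remaining
  slot; it therefore vanishes on the relators.\<close>

lemma plug_gen_compat:
  assumes M: "module F2 M" and cs: "set cs \<subseteq> symbols P M" and ds: "set ds \<subseteq> symbols P M"
    and \<mu>: "\<mu> \<in> carrier (ops P (length cs + Suc (length ds)))"
  shows "schur_compat P M (schur P M) (\<lambda>\<nu> xs. schur_gen P M (plug_op P \<mu> (cs @ (\<nu>, xs) # ds)) (plug_args (cs @ (\<nu>, xs) # ds)))"
proof (rule schur_compatI)
  note gen = schur_compatD[OF gen_compat[OF M]]
  fix \<nu> :: 'p and xs assume s: "(\<nu>, xs) \<in> symbols P M"
  have sym: "(plug_op P \<mu> (cs @ (\<nu>, xs) # ds), plug_args (cs @ (\<nu>, xs) # ds)) \<in> symbols P M"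
    if "(\<nu>, xs) \<in> symbols P M" for \<nu> xs
    using that cs ds \<mu> by (intro plug_symbol) simp_all
  show "schur_gen P M (plug_op P \<mu> (cs @ (\<nu>, xs) # ds)) (plug_args (cs @ (\<nu>, xs) # ds)) \<in> carrier (schur P M)"
    by (rule gen(1)[OF sym[OF s]])
  let ?ks = "map (length \<circ> snd) (cs @ (\<nu>, xs) # ds)" and ?\<nu>s = "\<lambda>\<nu>. map fst (cs @ (\<nu>, xs) # ds)"
  {
    fix \<nu>' assume s': "(\<nu>', xs) \<in> symbols P M"
    have ol: "op_list P ?ks (?\<nu>s \<nu>)" by (rule op_list_symbols[of _ M]) (use s cs ds in simp)
    have upd: "(?\<nu>s \<nu>)[length cs := \<rho>] = ?\<nu>s \<rho>" for \<rho> by (simp add: list_update_append)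
    have "f2_map (ops P (?ks ! length cs)) (ops P (sum_list ?ks)) (\<lambda>\<rho>. opcomp P ?ks \<mu> ((?\<nu>s \<nu>)[length cs := \<rho>]))"
      by (rule opcomp_map_slot[OF _ ol]) (use \<mu> in simp_all)
    then have sl: "f2_map (ops P (length xs)) (ops P (sum_list ?ks)) (\<lambda>\<rho>. opcomp P ?ks \<mu> (?\<nu>s \<rho>))"
      unfolding upd by (simp add: nth_append)
    have "plug_op P \<mu> (cs @ (\<nu> \<oplus>\<^bsub>ops P (length xs)\<^esub> \<nu>', xs) # ds) =
        plug_op P \<mu> (cs @ (\<nu>, xs) # ds) \<oplus>\<^bsub>ops P (length (plug_args (cs @ (\<nu>, xs) # ds)))\<^esub> plug_op P \<mu> (cs @ (\<nu>', xs) # ds)"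
      using f2_mapD(2)[OF sl, of \<nu> \<nu>'] s s' by (simp add: symbols_iff length_concat)
    then show "schur_gen P M (plug_op P \<mu> (cs @ (\<nu> \<oplus>\<^bsub>ops P (length xs)\<^esub> \<nu>', xs) # ds))
          (plug_args (cs @ (\<nu> \<oplus>\<^bsub>ops P (length xs)\<^esub> \<nu>', xs) # ds)) =
        schur_gen P M (plug_op P \<mu> (cs @ (\<nu>, xs) # ds)) (plug_args (cs @ (\<nu>, xs) # ds)) \<oplus>\<^bsub>schur P M\<^esub>
        schur_gen P M (plug_op P \<mu> (cs @ (\<nu>', xs) # ds)) (plug_args (cs @ (\<nu>', xs) # ds))"
      using gen(2)[of "plug_op P \<mu> (cs @ (\<nu>, xs) # ds)" "plug_args (cs @ (\<nu>, xs) # ds)" "plug_op P \<mu> (cs @ (\<nu>', xs) # ds)"]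
        sym[OF s] sym[OF s'] by simp
  }
  fix \<sigma> assume \<sigma>: "\<sigma> permutes {..<length xs}"
  \<comment> \<open>Inner equivariance acts on all plugged operations at once; the identity in every
    slot but one isolates the permutation of that slot.\<close>
  define \<tau>s where "\<tau>s = map (\<lambda>_. id) cs @ \<sigma> # map (\<lambda>_. id :: nat \<Rightarrow> nat) ds"
  let ?xss = "map snd (cs @ (\<nu>, xs) # ds)"
  have ks: "?ks = map length ?xss" by simp
  have lid: "list_all2 (\<lambda>\<tau> xs. \<tau> permutes {..<length xs}) (map (\<lambda>_. id) bs) (map snd bs)" for bs :: "('p \<times> 'a list) list"
    by (induction bs) (simp_all add: permutes_id permutes_id[unfolded id_def])
  have \<tau>: "list_all2 (\<lambda>\<tau> xs. \<tau> permutes {..<length xs}) \<tau>s ?xss"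
    unfolding \<tau>s_def map_append list.map using \<sigma> lid by (intro list_all2_appendI) simp_all
  have mapid: "map2 permute_list (map (\<lambda>_. id) bs) (map snd bs) = map snd bs" for bs :: "('p \<times> 'a list) list"
    by (induction bs) simp_all
  have xs: "permute_list (sum_perm \<tau>s ?ks) (concat ?xss) = plug_args (cs @ (\<nu>', permute_list \<sigma> xs) # ds)" for \<nu>' :: 'p
    unfolding ks sum_perm(2)[OF \<tau>] by (simp add: \<tau>s_def mapid zip_append)
  have mapact: "map (\<lambda>(k, \<tau>, \<nu>). opact P k \<tau> \<nu>) (zip (map (length \<circ> snd) bs) (zip (map (\<lambda>_. id) bs) (map fst bs))) = map fst bs"
    if "set bs \<subseteq> symbols P M" for bs
    using that by (induction bs) (auto simp: symbols_def opact_id)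
  have "opcomp P ?ks \<mu> (map (\<lambda>(k, \<tau>, \<nu>). opact P k \<tau> \<nu>) (zip ?ks (zip \<tau>s (?\<nu>s \<nu>)))) =
      opact P (sum_list ?ks) (sum_perm \<tau>s ?ks) (opcomp P ?ks \<mu> (?\<nu>s \<nu>))"
  proof (rule equivariance_inner)
    show "op_list P ?ks (?\<nu>s \<nu>)" by (rule op_list_symbols[of _ M]) (use s cs ds in simp)
    show "list_all2 (\<lambda>\<tau> k. \<tau> permutes {..<k}) \<tau>s ?ks"
      using \<tau> unfolding ks by (simp only: list_all2_map2[where f = length])
  qed (use \<mu> in simp)
  moreover have "map (\<lambda>(k, \<tau>, \<nu>). opact P k \<tau> \<nu>) (zip ?ks (zip \<tau>s (?\<nu>s \<nu>))) = ?\<nu>s (opact P (length xs) \<sigma> \<nu>)"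
    using mapact[OF cs] mapact[OF ds] by (simp add: \<tau>s_def zip_append)
  ultimately have op: "plug_op P \<mu> (cs @ (opact P (length xs) \<sigma> \<nu>, permute_list \<sigma> xs) # ds) =
      opact P (length (concat ?xss)) (sum_perm \<tau>s ?ks) (plug_op P \<mu> (cs @ (\<nu>, xs) # ds))"
    by (simp add: length_concat)
  show "schur_gen P M (plug_op P \<mu> (cs @ (opact P (length xs) \<sigma> \<nu>, permute_list \<sigma> xs) # ds))
        (plug_args (cs @ (opact P (length xs) \<sigma> \<nu>, permute_list \<sigma> xs) # ds)) =
      schur_gen P M (plug_op P \<mu> (cs @ (\<nu>, xs) # ds)) (plug_args (cs @ (\<nu>, xs) # ds))"
    unfolding op xs[symmetric]
    by (rule gen(4)[OF sym[OF s]]) (use sum_perm(1)[OF \<tau>] in \<open>simp add: ks\<close>)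
next
  note gen = schur_compatD[OF gen_compat[OF M]]
  fix \<nu> xs x y ys
  assume s: "(\<nu>, xs @ x # ys) \<in> symbols P M" and y: "y \<in> carrier M"
  \<comment> \<open>Regrouping the concatenated arguments around \<open>x\<close> turns an inner
    slot into an ordinary slot of one long symbol, where additivity is known.\<close>
  have "set (cs @ (\<nu>, xs @ x # ys) # ds) \<subseteq> symbols P M" using s cs ds by simp
  from plug_symbol[OF this, of \<mu>] \<mu>
  have "(plug_op P \<mu> (cs @ (\<nu>, xs @ x # ys) # ds), (plug_args cs @ xs) @ x # (ys @ plug_args ds)) \<in> symbols P M" by simp
  from gen(3)[OF this y]
  show "schur_gen P M (plug_op P \<mu> (cs @ (\<nu>, xs @ (x \<oplus>\<^bsub>M\<^esub> y) # ys) # ds)) (plug_args (cs @ (\<nu>, xs @ (x \<oplus>\<^bsub>M\<^esub> y) # ys) # ds)) =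
      schur_gen P M (plug_op P \<mu> (cs @ (\<nu>, xs @ x # ys) # ds)) (plug_args (cs @ (\<nu>, xs @ x # ys) # ds)) \<oplus>\<^bsub>schur P M\<^esub>
      schur_gen P M (plug_op P \<mu> (cs @ (\<nu>, xs @ y # ys) # ds)) (plug_args (cs @ (\<nu>, xs @ y # ys) # ds))"
    by simp
qed

end

text \<open>The function on lists that \<open>schur_mult\<close> lifts. Naming it lets its
  compatibility, and later its algebra axioms, be stated without the outer layer of S(P, -).\<close>

definition plug_mult :: "'p operad_data \<Rightarrow> ('a, 'm) umodule_scheme \<Rightarrow> 'p \<Rightarrow> ('p, 'a) schur list \<Rightarrow> ('p, 'a) schur" where
  "plug_mult P M \<mu> ts = the_elem ((\<lambda>Fs. schur_class P M (plug P \<mu> Fs)) ` listset ts)"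

abbreviation gen_list :: "'p operad_data \<Rightarrow> ('a, 'm) umodule_scheme \<Rightarrow> ('p \<times> 'a list) list \<Rightarrow> ('p, 'a) schur list" where
  "gen_list P M bs \<equiv> map (\<lambda>b. schur_gen P M (fst b) (snd b)) bs"

context operad
begin

text \<open>With basis symbols in all other slots, plugging is a compatible function of the
  remaining slot and kills relators. Additivity extends this to arbitrary entries in the other slots
  and to the whole span of the relators.\<close>

lemma plug_null:
  assumes M: "module F2 M"
    and Fs: "set Fs \<subseteq> carrier (free_space (symbols P M))" and Gs: "set Gs \<subseteq> carrier (free_space (symbols P M))"
    and \<mu>: "\<mu> \<in> carrier (ops P (length Fs + Suc (length Gs)))" and R: "R \<in> schur_null P M"
  shows "schur_class P M (plug P \<mu> (Fs @ R # Gs)) = \<zero>\<^bsub>schur P M\<^esub>"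
proof -
  let ?F = "free_space (symbols P M)"
  note rel = schur_relators_closed[OF M]
  have base: "schur_class P M (plug P \<mu> (Fs @ R # Gs)) = \<zero>\<^bsub>schur P M\<^esub>"
    if R: "R \<in> schur_relators P M" for R
  proof -
    \<comment> \<open>The generating set of the distinguished slot is the singleton of the relator,
      so the expansion into generators leaves that slot alone.\<close>
    let ?Xs = "replicate (length Fs) (singles M) @ {R} # replicate (length Gs) (singles M)"
    note f2_map_slot = plug_class_slot[OF M]
    have X: "X \<subseteq> carrier ?F" if "X \<in> set ?Xs" for X
      using that singles_closed[of M] R rel by auto
    have l: "list_all2 (\<lambda>z X. z \<in> lin_span ?F X) (Fs @ R # Gs) ?Xs"
    proof -
      have "list_all2 (\<lambda>z X. z \<in> lin_span ?F X) Hs (replicate (length Hs) (singles M))"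
        if "set Hs \<subseteq> carrier ?F" for Hs
        using that free_space_span[of "symbols P M"] by (auto simp: list_all2_conv_all_nth)
      from this[OF Fs] this[OF Gs] show ?thesis
        by (intro list_all2_appendI) (simp_all add: lin_span_base)
    qed
    show ?thesis
    proof (rule span_list_induct[OF free_space_module X l, where Q = "\<lambda>zs. schur_class P M (plug P \<mu> zs) = \<zero>\<^bsub>schur P M\<^esub>"])
      fix zs assume base: "list_all2 (\<in>) zs ?Xs"
      obtain Cs R' Ds where zs: "zs = Cs @ R' # Ds" "list_all2 (\<in>) Cs (replicate (length Fs) (singles M))"
          "R' \<in> {R}" "list_all2 (\<in>) Ds (replicate (length Gs) (singles M))"
        using base unfolding list_all2_append2 list_all2_Cons2 by blast
      have sub: "set Hs \<subseteq> X" if "list_all2 (\<in>) Hs (replicate n X)" for Hs n and X :: "(('p \<times> 'a list) \<Rightarrow>\<^sub>0 bit) set"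
        using that by (auto simp: list_all2_conv_all_nth set_conv_nth)
      obtain cs where cs: "Cs = map (\<lambda>b. Poly_Mapping.single b 1) cs" "set cs \<subseteq> symbols P M"
        using singles_list[OF sub[OF zs(2)]] .
      obtain ds where ds: "Ds = map (\<lambda>b. Poly_Mapping.single b 1) ds" "set ds \<subseteq> symbols P M"
        using singles_list[OF sub[OF zs(4)]] .
      have len: "length cs = length Fs" "length ds = length Gs"
        using list_all2_lengthD[OF zs(2)] list_all2_lengthD[OF zs(4)] cs(1) ds(1) by auto
      let ?h = "\<lambda>\<nu> xs. schur_gen P M (plug_op P \<mu> (cs @ (\<nu>, xs) # ds)) (plug_args (cs @ (\<nu>, xs) # ds))"
      note compat = plug_gen_compat[OF M cs(2) ds(2), of \<mu>]
      have h: "schur_compat P M (schur P M) ?h" by (rule compat) (use \<mu> len in simp)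
      have map: "f2_map ?F (schur P M) (\<lambda>H. schur_class P M (plug P \<mu> (Cs @ H # Ds)))"
        by (rule f2_map_slot) (use cs ds \<mu> len in auto)
      have "schur_class P M (plug P \<mu> (Cs @ H # Ds)) = lin_ext (schur P M) (\<lambda>(\<nu>, xs). ?h \<nu> xs) H"
        if "H \<in> carrier ?F" for H
      proof (rule f2_map_eq_on_span[OF map lin_ext_compat(1)[OF h schur_module[OF M]] free_space_module
            schur_module[OF M] singles_closed[of M]])
        fix H :: "('p \<times> 'a list) \<Rightarrow>\<^sub>0 bit" assume "H \<in> singles M"
        then obtain \<nu> xs where H: "H = symb \<nu> xs" and s: "(\<nu>, xs) \<in> symbols P M" by auto
        have "Cs @ H # Ds = map (\<lambda>b. Poly_Mapping.single b 1) (cs @ (\<nu>, xs) # ds)"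
          by (simp add: cs ds H)
        then have "schur_class P M (plug P \<mu> (Cs @ H # Ds)) = ?h \<nu> xs"
          by (simp only: plug_single schur_gen_def)
        also have "\<dots> = lin_ext (schur P M) (\<lambda>(\<nu>, xs). ?h \<nu> xs) H"
          unfolding H lin_ext_compat(2)[OF h schur_module[OF M] s]
          using schur_compatD(1)[OF h s] by (simp add: f2_smult[OF schur_module[OF M]] del: schur_simps)
        finally show "schur_class P M (plug P \<mu> (Cs @ H # Ds)) = lin_ext (schur P M) (\<lambda>(\<nu>, xs). ?h \<nu> xs) H" .
      qed (use that free_space_span[of "symbols P M"] in blast)
      from this[of R] lin_ext_relator[OF h schur_module[OF M] M R] R rel zs
      show "schur_class P M (plug P \<mu> zs) = \<zero>\<^bsub>schur P M\<^esub>" by auto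
    next
      fix xs ys
      show "schur_class P M (plug P \<mu> (xs @ \<zero>\<^bsub>?F\<^esub> # ys)) = \<zero>\<^bsub>schur P M\<^esub>"
        unfolding free_space_simps plug_zero using f2_map_zero[OF schur_class_map[OF M] free_space_module schur_space_module[OF M]] by simp
    next
      fix xs x y ys
      assume add: "length xs + Suc (length ys) = length ?Xs" "set xs \<subseteq> carrier ?F" "set ys \<subseteq> carrier ?F"
        "x \<in> carrier ?F" "y \<in> carrier ?F" "schur_class P M (plug P \<mu> (xs @ x # ys)) = \<zero>\<^bsub>schur P M\<^esub>"
        "schur_class P M (plug P \<mu> (xs @ y # ys)) = \<zero>\<^bsub>schur P M\<^esub>"
      have "f2_map ?F (schur P M) (\<lambda>F. schur_class P M (plug P \<mu> (xs @ F # ys)))"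
        by (rule f2_map_slot) (use add \<mu> in simp_all)
      from f2_mapD(2)[OF this add(4,5)] add(6,7) show "schur_class P M (plug P \<mu> (xs @ (x \<oplus>\<^bsub>?F\<^esub> y) # ys)) = \<zero>\<^bsub>schur P M\<^esub>"
        by (simp add: f2_zero[OF schur_space_module[OF M]] f2_closed[OF schur_space_module[OF M]])
    qed
  qed
  have "schur_class P M (plug P \<mu> (Fs @ R # Gs)) \<in> {\<zero>\<^bsub>schur P M\<^esub>}"
    by (rule f2_map_span[OF plug_class_slot[OF M Fs Gs \<mu>] free_space_module schur_module[OF M]
          submodule_zero[OF schur_module[OF M]] rel _ R[unfolded schur_null_def]])
       (auto simp: base)
  then show ?thesis by blast
qed

text \<open>Representatives are exchanged from left to right; \<open>Hs\<close> holds the slots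
  already exchanged, and a single exchange alters the result by a plugged null element.\<close>

lemma plug_class_cong:
  assumes M: "module F2 M"
    and FG: "list_all2 (\<lambda>F G. F \<in> carrier (free_space (symbols P M)) \<and> G \<in> carrier (free_space (symbols P M)) \<and>
      schur_class P M F = schur_class P M G) Fs Gs"
    and Hs: "set Hs \<subseteq> carrier (free_space (symbols P M))" and \<mu>: "\<mu> \<in> carrier (ops P (length Hs + length Fs))"
  shows "schur_class P M (plug P \<mu> (Hs @ Fs)) = schur_class P M (plug P \<mu> (Hs @ Gs))"
  using FG Hs \<mu>
proof (induction arbitrary: Hs rule: list_all2_induct)
  case (Cons F Fs G Gs)
  let ?F = "free_space (symbols P M)"
  have F: "F \<in> carrier ?F" and G: "G \<in> carrier ?F" and FG: "F + G \<in> schur_null P M"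
    using Cons.hyps(1) schur_class_eq[OF M] by auto
  have Fs: "set Fs \<subseteq> carrier ?F"
    using Cons.hyps(2) by (auto simp: list_all2_conv_all_nth set_conv_nth)
  have \<mu>: "\<mu> \<in> carrier (ops P (length Hs + Suc (length Fs)))" using Cons.prems(2) by simp
  note slot = plug_class_slot[OF M Cons.prems(1) Fs \<mu>]
  have "schur_class P M (plug P \<mu> (Hs @ F # Fs)) \<oplus>\<^bsub>schur P M\<^esub> schur_class P M (plug P \<mu> (Hs @ G # Fs)) = \<zero>\<^bsub>schur P M\<^esub>"
    using f2_mapD(2)[OF slot F G] plug_null[OF M Cons.prems(1) Fs \<mu> FG] by simp
  then have "schur_class P M (plug P \<mu> (Hs @ F # Fs)) = schur_class P M (plug P \<mu> (Hs @ G # Fs))"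
    using f2_eq_iff[OF schur_module[OF M] f2_mapD(1)[OF slot F] f2_mapD(1)[OF slot G]] by simp
  also have "\<dots> = schur_class P M (plug P \<mu> ((Hs @ [G]) @ Fs))" by simp
  also have "\<dots> = schur_class P M (plug P \<mu> ((Hs @ [G]) @ Gs))"
    by (rule Cons.IH) (use Cons.prems G in auto)
  finally show ?case by simp
qed simp

text \<open>Every list of representatives gives the same class and at least one such list exists, so
  \<open>the_elem\<close> sees a singleton.\<close>

lemma plug_mult_class:
  assumes M: "module F2 M" and Fs: "set Fs \<subseteq> carrier (free_space (symbols P M))"
    and \<mu>: "\<mu> \<in> carrier (ops P (length Fs))"
  shows "plug_mult P M \<mu> (map (schur_class P M) Fs) = schur_class P M (plug P \<mu> Fs)"
proof -
  let ?F = "free_space (symbols P M)"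
  note mem = f2_coset_mem[OF free_space_module schur_null_submodule[OF M], folded schur_class_def]
  have const: "schur_class P M (plug P \<mu> Gs) = schur_class P M (plug P \<mu> Fs)"
    if Gs: "Gs \<in> listset (map (schur_class P M) Fs)" for Gs
  proof -
    have "list_all2 (\<lambda>F G. F \<in> carrier ?F \<and> G \<in> carrier ?F \<and> schur_class P M F = schur_class P M G) Fs Gs"
    proof (rule list_all2_all_nthI)
      show len: "length Fs = length Gs"
        using Gs by (auto simp: listset_iff dest: list_all2_lengthD)
      have nth: "list_all2 (\<in>) Gs (map (schur_class P M) Fs)"
        using Gs by (simp only: listset_iff)
      fix i assume i: "i < length Fs"
      then have F: "Fs ! i \<in> carrier ?F" using Fs nth_mem by blast
      have G: "Gs ! i \<in> schur_class P M (Fs ! i)"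
        using list_all2_nthD[OF nth, of i] i len by simp
      show "Fs ! i \<in> carrier ?F \<and> Gs ! i \<in> carrier ?F \<and> schur_class P M (Fs ! i) = schur_class P M (Gs ! i)"
        using F mem(2)[OF F G] mem(3)[OF F G] by simp
    qed
    from plug_class_cong[OF M this, of "[]" \<mu>] \<mu> show ?thesis by simp
  qed
  have ne: "Fs \<in> listset (map (schur_class P M) Fs)"
    using Fs mem(1) by (auto simp: listset_iff list_all2_map2 list_all2_same)
  have "(\<lambda>Gs. schur_class P M (plug P \<mu> Gs)) ` listset (map (schur_class P M) Fs) =
      (\<lambda>_. schur_class P M (plug P \<mu> Fs)) ` listset (map (schur_class P M) Fs)"
    by (rule image_cong[OF refl]) (rule const)
  then show ?thesis unfolding plug_mult_def by (simp only: image_constant[OF ne] the_elem_eq)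
qed

lemma class_list:
  assumes "set ts \<subseteq> carrier (schur P M)"
  obtains Fs where "ts = map (schur_class P M) Fs" "set Fs \<subseteq> carrier (free_space (symbols P M))"
proof -
  have "ts \<in> map (schur_class P M) ` lists (carrier (free_space (symbols P M)))"
    using assms schur_carrier[of M] unfolding lists_image[symmetric] by (simp add: lists_eq_set)
  then show thesis using that by (auto simp: lists_eq_set)
qed

lemma plug_mult_gen:
  assumes M: "module F2 M" and bs: "set bs \<subseteq> symbols P M" and \<mu>: "\<mu> \<in> carrier (ops P (length bs))"
  shows "plug_mult P M \<mu> (gen_list P M bs) = schur_gen P M (plug_op P \<mu> bs) (plug_args bs)"
proof -
  let ?Fs = "map (\<lambda>b. Poly_Mapping.single b (1::bit)) bs"
  have "plug_mult P M \<mu> (map (schur_class P M) ?Fs) = schur_class P M (plug P \<mu> ?Fs)"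
    by (rule plug_mult_class[OF M]) (use bs \<mu> in auto)
  moreover have "map (schur_class P M) ?Fs = gen_list P M bs"
    by (simp add: schur_gen_def)
  ultimately show ?thesis by (simp only: plug_single schur_gen_def)
qed

lemma gens_list:
  assumes "set ts \<subseteq> schur_gens M"
  obtains bs where "ts = gen_list P M bs" "set bs \<subseteq> symbols P M"
proof -
  have "schur_gens M = (\<lambda>b. schur_gen P M (fst b) (snd b)) ` symbols P M" by force
  then have "ts \<in> map (\<lambda>b. schur_gen P M (fst b) (snd b)) ` lists (symbols P M)"
    using assms unfolding lists_image[symmetric] by (simp add: lists_eq_set)
  then show thesis using that by (auto simp: lists_eq_set)
qed

lemma plug_mult_slot:
  assumes M: "module F2 M" and ss: "set ss \<subseteq> carrier (schur P M)" and us: "set us \<subseteq> carrier (schur P M)"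
    and \<mu>: "\<mu> \<in> carrier (ops P (length ss + Suc (length us)))"
  shows "f2_map (schur P M) (schur P M) (\<lambda>t. plug_mult P M \<mu> (ss @ t # us))"
proof -
  obtain Fs where Fs: "ss = map (schur_class P M) Fs" "set Fs \<subseteq> carrier (free_space (symbols P M))"
    using class_list[OF ss] .
  obtain Gs where Gs: "us = map (schur_class P M) Gs" "set Gs \<subseteq> carrier (free_space (symbols P M))"
    using class_list[OF us] .
  have len: "length ss = length Fs" "length us = length Gs" using Fs Gs by simp_all
  have eq: "plug_mult P M \<mu> (ss @ schur_class P M H # us) = schur_class P M (plug P \<mu> (Fs @ H # Gs))"
    if "H \<in> carrier (free_space (symbols P M))" for H
    using plug_mult_class[OF M, of "Fs @ H # Gs" \<mu>] Fs Gs that \<mu> len by simp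
  note slot = plug_class_slot[OF M Fs(2) Gs(2) \<mu>[unfolded len]]
  show ?thesis
  proof (rule f2_mapI)
    fix t assume "t \<in> carrier (schur P M)"
    then obtain F where F: "t = schur_class P M F" "F \<in> carrier (free_space (symbols P M))"
      using schur_carrier[of M] by auto
    show "plug_mult P M \<mu> (ss @ t # us) \<in> carrier (schur P M)"
      unfolding F(1) eq[OF F(2)] by (rule f2_mapD(1)[OF slot F(2)])
    fix u assume "u \<in> carrier (schur P M)"
    then obtain G where G: "u = schur_class P M G" "G \<in> carrier (free_space (symbols P M))"
      using schur_carrier[of M] by auto
    have FG: "F \<oplus>\<^bsub>free_space (symbols P M)\<^esub> G \<in> carrier (free_space (symbols P M))"
      by (rule f2_closed(2)[OF free_space_module F(2) G(2)])
    have tu: "t \<oplus>\<^bsub>schur P M\<^esub> u = schur_class P M (F \<oplus>\<^bsub>free_space (symbols P M)\<^esub> G)"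
      unfolding F(1) G(1) using f2_mapD(2)[OF schur_class_map[OF M] F(2) G(2)] by simp
    show "plug_mult P M \<mu> (ss @ (t \<oplus>\<^bsub>schur P M\<^esub> u) # us) =
        plug_mult P M \<mu> (ss @ t # us) \<oplus>\<^bsub>schur P M\<^esub> plug_mult P M \<mu> (ss @ u # us)"
      unfolding tu eq[OF FG] unfolding F(1) G(1) eq[OF F(2)] eq[OF G(2)] by (rule f2_mapD(2)[OF slot F(2) G(2)])
  qed
qed

lemma plug_mult_closed:
  assumes M: "module F2 M" and ts: "set ts \<subseteq> carrier (schur P M)" and \<mu>: "\<mu> \<in> carrier (ops P (length ts))"
  shows "plug_mult P M \<mu> ts \<in> carrier (schur P M)"
proof -
  obtain Fs where Fs: "ts = map (schur_class P M) Fs" "set Fs \<subseteq> carrier (free_space (symbols P M))"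
    using class_list[OF ts] .
  have "plug P \<mu> Fs \<in> carrier (free_space (symbols P M))"
    by (rule plug_closed) (use Fs \<mu> in auto)
  then show ?thesis
    using plug_mult_class[OF M Fs(2), of \<mu>] Fs(1) \<mu> f2_mapD(1)[OF schur_class_map[OF M]] by simp
qed

lemma schur_list_induct [consumes 2, case_names gens zero add]:
  assumes M: "module F2 M" and ts: "set ts \<subseteq> carrier (schur P M)"
    and "\<And>bs. \<lbrakk>length bs = length ts; set bs \<subseteq> symbols P M\<rbrakk> \<Longrightarrow> Q (gen_list P M bs)"
    and "\<And>ss us. \<lbrakk>length ss + Suc (length us) = length ts; set ss \<subseteq> carrier (schur P M); set us \<subseteq> carrier (schur P M)\<rbrakk> \<Longrightarrow>
      Q (ss @ \<zero>\<^bsub>schur P M\<^esub> # us)"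
    and "\<And>ss t u us. \<lbrakk>length ss + Suc (length us) = length ts; set ss \<subseteq> carrier (schur P M); set us \<subseteq> carrier (schur P M);
      t \<in> carrier (schur P M); u \<in> carrier (schur P M); Q (ss @ t # us); Q (ss @ u # us)\<rbrakk> \<Longrightarrow>
      Q (ss @ (t \<oplus>\<^bsub>schur P M\<^esub> u) # us)"
  shows "Q ts"
  using schur_module[OF M] schur_generated[OF M] ts
proof (induction rule: span_list_induct1)
  case (base us)
  then obtain bs where "us = gen_list P M bs" "set bs \<subseteq> symbols P M" using gens_list by blast
  then show ?case using assms(3)[of bs] base(1) by simp
qed (use assms(4,5) in blast)+

text \<open>The substance is equivariance on generators: permuting the plugged symbols permutes
  their concatenated arguments by a block permutation, and the outer axiom of the operad produces
  the same block permutation on the composite operation.\<close>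

lemma plug_mult_compat:
  assumes M: "module F2 M"
  shows "schur_compat P (schur P M) (schur P M) (plug_mult P M)"
proof (rule schur_compatI)
  note S = schur_module[OF M]
  fix \<mu> \<nu> ts
  assume s: "(\<mu>, ts) \<in> symbols P (schur P M)"
  then have \<mu>: "\<mu> \<in> carrier (ops P (length ts))" and ts: "set ts \<subseteq> carrier (schur P M)" by (simp_all only: symbols_iff)
  show "plug_mult P M \<mu> ts \<in> carrier (schur P M)" by (rule plug_mult_closed[OF M ts \<mu>])
  note slot = plug_mult_slot[OF M]
  {
    assume "(\<nu>, ts) \<in> symbols P (schur P M)"
    then have \<nu>: "\<nu> \<in> carrier (ops P (length ts))" by (simp_all only: symbols_iff)
    \<comment> \<open>The arity of the addition depends on \<open>length ts\<close>. Freezing it,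
      and the sum formed with it, keeps both out of the induction predicate, in which
      \<open>ts\<close> varies.\<close>
    define n where "n = length ts"
    define \<rho> where "\<rho> = \<mu> \<oplus>\<^bsub>ops P n\<^esub> \<nu>"
    have \<rho>: "\<rho> \<in> carrier (ops P (length ts))"
      unfolding \<rho>_def n_def by (rule f2_closed(2)[OF ops_module \<mu> \<nu>])
    have "plug_mult P M \<rho> ts = plug_mult P M \<mu> ts \<oplus>\<^bsub>schur P M\<^esub> plug_mult P M \<nu> ts"
      using M ts
    proof (induction rule: schur_list_induct)
      case (gens bs)
      let ?ks = "map (length \<circ> snd) bs" and ?\<nu>s = "map fst bs"
      have ol: "op_list P ?ks ?\<nu>s" by (rule op_list_symbols[OF gens(2)])
      have "plug_op P \<rho> bs = plug_op P \<mu> bs \<oplus>\<^bsub>ops P (length (plug_args bs))\<^esub> plug_op P \<nu> bs"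
        using f2_mapD(2)[OF opcomp_map_left[OF ol], of \<mu> \<nu>] \<mu> \<nu> gens(1) by (simp add: length_concat \<rho>_def n_def)
      then show ?case
        using plug_mult_gen[OF M gens(2)] \<mu> \<nu> \<rho> gens(1) plug_symbol[OF gens(2)]
          schur_compatD(2)[OF gen_compat[OF M], of "plug_op P \<mu> bs" "plug_args bs" "plug_op P \<nu> bs"] by simp
    next
      case (zero ss us)
      have "plug_mult P M \<kappa> (ss @ \<zero>\<^bsub>schur P M\<^esub> # us) = \<zero>\<^bsub>schur P M\<^esub>" if "\<kappa> \<in> carrier (ops P (length ts))" for \<kappa>
        by (rule f2_map_zero[OF slot S S]) (use zero that in simp_all)
      then show ?case using \<mu> \<nu> \<rho> f2_zero(1)[OF S f2_closed(1)[OF S]] by (simp del: schur_simps)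
    next
      case (add ss t u us)
      have a: "plug_mult P M \<kappa> (ss @ (t \<oplus>\<^bsub>schur P M\<^esub> u) # us) =
          plug_mult P M \<kappa> (ss @ t # us) \<oplus>\<^bsub>schur P M\<^esub> plug_mult P M \<kappa> (ss @ u # us)"
        if "\<kappa> \<in> carrier (ops P (length ts))" for \<kappa>
        by (rule f2_mapD(2)[OF slot]) (use add that in simp_all)
      have c: "plug_mult P M \<kappa> (ss @ v # us) \<in> carrier (schur P M)"
        if "\<kappa> \<in> carrier (ops P (length ts))" "v \<in> {t, u}" for \<kappa> v
        by (rule f2_mapD(1)[OF slot]) (use add that in auto)
      show ?case
        unfolding a[OF \<rho>] a[OF \<mu>] a[OF \<nu>] add(6,7)
        using c \<mu> \<nu> f2_add[OF S] f2_closed(2)[OF S] by (simp del: schur_simps)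
    qed
    then show "plug_mult P M (\<mu> \<oplus>\<^bsub>ops P (length ts)\<^esub> \<nu>) ts =
        plug_mult P M \<mu> ts \<oplus>\<^bsub>schur P M\<^esub> plug_mult P M \<nu> ts" by (simp add: \<rho>_def n_def)
  }
  fix \<sigma> assume \<sigma>: "\<sigma> permutes {..<length ts}"
  define n where "n = length ts"
  define \<rho> where "\<rho> = opact P n \<sigma> \<mu>"
  have \<rho>: "\<rho> \<in> carrier (ops P (length ts))"
    unfolding \<rho>_def n_def by (rule opact_closed[OF \<sigma> \<mu>])
  \<comment> \<open>After permuting, the varying entry sits in another slot;
    \<open>permute_list_slot\<close> locates it and shows that its neighbours stay fixed.\<close>
  have slot': "f2_map (schur P M) (schur P M) (\<lambda>t. plug_mult P M \<rho> (permute_list \<sigma> (ss @ t # us)))"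
    if "length ss + Suc (length us) = length ts" "set ss \<subseteq> carrier (schur P M)" "set us \<subseteq> carrier (schur P M)" for ss us
  proof -
    have \<sigma>': "\<sigma> permutes {..<length ss + Suc (length us)}" using \<sigma> that(1) by simp
    obtain as bs where ab: "\<And>z. permute_list \<sigma> (ss @ z # us) = as @ z # bs"
      "length as + Suc (length bs) = length ss + Suc (length us)" "set as \<subseteq> set ss \<union> set us" "set bs \<subseteq> set ss \<union> set us"
      by (rule permute_list_slot[OF \<sigma>']) (rule that, assumption+)
    show ?thesis unfolding ab(1) by (rule slot) (use ab that \<rho> in auto)
  qed
  have "plug_mult P M \<rho> (permute_list \<sigma> ts) = plug_mult P M \<mu> ts"
    using M ts
  proof (induction rule: schur_list_induct)
    case (gens bs)
    let ?xss = "map snd bs"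
    have \<sigma>b: "\<sigma> permutes {..<length bs}" using \<sigma> gens(1) by simp
    have pb: "set (permute_list \<sigma> bs) \<subseteq> symbols P M" using gens(2) \<sigma>b by simp
    have ks: "map (length \<circ> snd) bs = map length ?xss" by simp
    have \<sigma>x: "\<sigma> permutes {..<length ?xss}" using \<sigma>b by simp
    note bp = block_perm[OF \<sigma>x, folded ks]
    have "opcomp P (permute_list \<sigma> (map (length \<circ> snd) bs)) \<rho> (permute_list \<sigma> (map fst bs)) =
        opact P (sum_list (map (length \<circ> snd) bs)) (block_perm \<sigma> (map (length \<circ> snd) bs)) (plug_op P \<mu> bs)"
      using equivariance_outer[of \<sigma> "map (length \<circ> snd) bs" \<mu> "map fst bs"] \<sigma>b \<mu> gens(1) op_list_symbols[OF gens(2)]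
      by (simp add: \<rho>_def n_def)
    then have op: "plug_op P \<rho> (permute_list \<sigma> bs) =
        opact P (length (plug_args bs)) (block_perm \<sigma> (map (length \<circ> snd) bs)) (plug_op P \<mu> bs)"
      using \<sigma>b by (simp add: permute_list_map length_plug_args)
    have ar: "plug_args (permute_list \<sigma> bs) = permute_list (block_perm \<sigma> (map (length \<circ> snd) bs)) (plug_args bs)"
      unfolding bp(2) by (simp add: permute_list_map[OF \<sigma>b])
    have "plug_mult P M \<rho> (permute_list \<sigma> (gen_list P M bs)) = plug_mult P M \<rho> (gen_list P M (permute_list \<sigma> bs))"
      by (simp add: permute_list_map[OF \<sigma>b])
    also have "\<dots> = schur_gen P M (plug_op P \<rho> (permute_list \<sigma> bs)) (plug_args (permute_list \<sigma> bs))"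
      by (rule plug_mult_gen[OF M pb]) (use \<rho> gens(1) in simp)
    also have "\<dots> = schur_gen P M (plug_op P \<mu> bs) (plug_args bs)"
      unfolding op ar
      by (rule schur_compatD(4)[OF gen_compat[OF M] plug_symbol[OF gens(2)] bp(1)]) (use \<mu> gens(1) in simp)
    also have "\<dots> = plug_mult P M \<mu> (gen_list P M bs)"
      by (rule plug_mult_gen[OF M gens(2), symmetric]) (use \<mu> gens(1) in simp)
    finally show ?case .
  next
    case (zero ss us)
    then show ?case
      using f2_map_zero[OF slot' S S, of ss us] f2_map_zero[OF slot S S, of ss us \<mu>] \<mu> by simp
  next
    case (add ss t u us)
    then show ?case
      using f2_mapD(2)[OF slot', of ss us t u] f2_mapD(2)[OF slot, of ss us \<mu> t u] \<mu> by simp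
  qed
  then show "plug_mult P M (opact P (length ts) \<sigma> \<mu>) (permute_list \<sigma> ts) = plug_mult P M \<mu> ts"
    by (simp add: \<rho>_def n_def)
next
  fix \<mu> ss t u us
  assume "(\<mu>, ss @ t # us) \<in> symbols P (schur P M)" "u \<in> carrier (schur P M)"
  then show "plug_mult P M \<mu> (ss @ (t \<oplus>\<^bsub>schur P M\<^esub> u) # us) =
      plug_mult P M \<mu> (ss @ t # us) \<oplus>\<^bsub>schur P M\<^esub> plug_mult P M \<mu> (ss @ u # us)"
    by (intro f2_mapD(2)[OF plug_mult_slot[OF M]]) (simp_all add: symbols_iff)
qed

lemma schur_mult_eq: "schur_mult P M = schur_lift P (schur P M) (schur_space P M) (plug_mult P M)"
  by (simp add: schur_mult_def plug_mult_def[abs_def])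

lemma schur_mult_map:
  assumes M: "module F2 M"
  shows "f2_map (schur P (schur P M)) (schur P M) (schur_mult P M)"
    and "schur_mult P M \<in> extensional (carrier (schur P (schur P M)))"
    and "(\<mu>, ts) \<in> symbols P (schur P M) \<Longrightarrow> schur_mult P M (schur_gen P (schur P M) \<mu> ts) = plug_mult P M \<mu> ts"
proof -
  have c: "schur_compat P (schur P M) (schur_space P M) (plug_mult P M)"
    using plug_mult_compat[OF M] by (simp add: schur_compat_def)
  show "f2_map (schur P (schur P M)) (schur P M) (schur_mult P M)"
    using schur_lift_map[OF c schur_space_module[OF M] schur_module[OF M]]
    by (simp add: schur_mult_eq f2_map_def)
  show "schur_mult P M \<in> extensional (carrier (schur P (schur P M)))"
    using schur_lift_extensional by (simp add: schur_mult_eq)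
  show "(\<mu>, ts) \<in> symbols P (schur P M) \<Longrightarrow> schur_mult P M (schur_gen P (schur P M) \<mu> ts) = plug_mult P M \<mu> ts"
    using schur_lift_gen[OF c schur_space_module[OF M] schur_module[OF M]] by (simp add: schur_mult_eq)
qed

end


section \<open>Algebras in terms of their operations\<close>

lemma schur_compat_map:
  assumes g: "schur_compat P N V g" and h: "f2_map M N h"
  shows "schur_compat P M V (\<lambda>\<mu> xs. g \<mu> (map h xs))"
proof (rule schur_compatI)
  note h' = f2_mapD[OF h]
  have sy: "(\<mu>, map h xs) \<in> symbols P N" if "(\<mu>, xs) \<in> symbols P M" for \<mu> xs
    using that h'(1) by (auto simp: symbols_iff)
  fix \<mu> \<nu> xs assume s: "(\<mu>, xs) \<in> symbols P M"
  show "g \<mu> (map h xs) \<in> carrier V" by (rule schur_compatD(1)[OF g sy[OF s]])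
  show "g (\<mu> \<oplus>\<^bsub>ops P (length xs)\<^esub> \<nu>) (map h xs) = g \<mu> (map h xs) \<oplus>\<^bsub>V\<^esub> g \<nu> (map h xs)" if "(\<nu>, xs) \<in> symbols P M"
    using schur_compatD(2)[OF g sy[OF s] sy[OF that]] by simp
  show "g (opact P (length xs) \<sigma> \<mu>) (map h (permute_list \<sigma> xs)) = g \<mu> (map h xs)" if "\<sigma> permutes {..<length xs}" for \<sigma>
    using schur_compatD(4)[OF g sy[OF s], of \<sigma>] that by (simp add: permute_list_map)
next
  note h' = f2_mapD[OF h]
  fix \<mu> xs x y ys assume s: "(\<mu>, xs @ x # ys) \<in> symbols P M" and y: "y \<in> carrier M"
  then have "(\<mu>, map h xs @ h x # map h ys) \<in> symbols P N"
    using h'(1) by (auto simp: symbols_iff)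
  from schur_compatD(3)[OF g this h'(1)[OF y]]
  show "g \<mu> (map h (xs @ (x \<oplus>\<^bsub>M\<^esub> y) # ys)) = g \<mu> (map h (xs @ x # ys)) \<oplus>\<^bsub>V\<^esub> g \<mu> (map h (xs @ y # ys))"
    using h'(2)[of x y] s y by (simp add: symbols_iff)
qed

text \<open>The structure of a \<open>P\<close>-algebra in \<open>\<U>\<close> on \<open>N\<close>, given by operations
  \<open>f \<mu> [x\<^sub>1, \<dots>, x\<^sub>n] = \<mu>(x\<^sub>1, \<dots>, x\<^sub>n)\<close> instead of a structure map.\<close>

definition op_alg :: "'p operad_data \<Rightarrow> ('a, 'm) umodule_scheme \<Rightarrow> ('p \<Rightarrow> 'a list \<Rightarrow> 'a) \<Rightarrow> bool" where
  "op_alg P N f \<longleftrightarrow> schur_compat P N N f \<and>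
    (\<forall>x\<in>carrier N. f (opunit P) [x] = x) \<and>
    (\<forall>\<mu> bs. \<mu> \<in> carrier (ops P (length bs)) \<longrightarrow> set bs \<subseteq> symbols P N \<longrightarrow>
      f (plug_op P \<mu> bs) (plug_args bs) = f \<mu> (map (\<lambda>b. f (fst b) (snd b)) bs)) \<and>
    (\<forall>\<mu> xs ds. \<mu> \<in> carrier (ops P (length xs)) \<longrightarrow> list_all2 (\<lambda>x e. x \<in> hdeg N e) xs ds \<longrightarrow>
      f \<mu> xs \<in> hdeg N (sum_list ds)) \<and>
    (\<forall>\<mu> xs i. (\<mu>, xs) \<in> symbols P N \<longrightarrow> Sq N i (f \<mu> xs) = cartan N f (Sq N) i \<mu> xs)"

lemma op_algD:
  assumes "op_alg P N f"
  shows "schur_compat P N N f"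
    and "x \<in> carrier N \<Longrightarrow> f (opunit P) [x] = x"
    and "\<lbrakk>\<mu> \<in> carrier (ops P (length bs)); set bs \<subseteq> symbols P N\<rbrakk> \<Longrightarrow>
      f (plug_op P \<mu> bs) (plug_args bs) = f \<mu> (map (\<lambda>b. f (fst b) (snd b)) bs)"
    and "\<lbrakk>\<mu> \<in> carrier (ops P (length xs)); list_all2 (\<lambda>x e. x \<in> hdeg N e) xs ds\<rbrakk> \<Longrightarrow> f \<mu> xs \<in> hdeg N (sum_list ds)"
    and "(\<mu>, xs) \<in> symbols P N \<Longrightarrow> Sq N i (f \<mu> xs) = cartan N f (Sq N) i \<mu> xs"
  using assms unfolding op_alg_def by blast+

context operad
begin

lemma schur_map_facts:
  assumes M: "module F2 M" and N: "module F2 N" and h: "f2_map M N h"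
  shows "f2_map (schur P M) (schur P N) (schur_map P M N h)"
    and "schur_map P M N h \<in> extensional (carrier (schur P M))"
    and "(\<mu>, xs) \<in> symbols P M \<Longrightarrow> schur_map P M N h (schur_gen P M \<mu> xs) = schur_gen P N \<mu> (map h xs)"
proof -
  note c = schur_compat_map[OF schur_gen_compat[OF N] h]
  show "f2_map (schur P M) (schur P N) (schur_map P M N h)"
    using schur_lift_map[OF c schur_space_module[OF N] M] by (simp add: schur_map_def f2_map_def)
  show "schur_map P M N h \<in> extensional (carrier (schur P M))"
    using schur_lift_extensional by (simp add: schur_map_def)
  show "(\<mu>, xs) \<in> symbols P M \<Longrightarrow> schur_map P M N h (schur_gen P M \<mu> xs) = schur_gen P N \<mu> (map h xs)"
    using schur_lift_gen[OF c schur_space_module[OF N] M] by (simp add: schur_map_def)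
qed

lemma gen_symbol:
  assumes "module F2 M" "\<mu> \<in> carrier (ops P (length bs))" "set bs \<subseteq> symbols P M"
  shows "(\<mu>, gen_list P M bs) \<in> symbols P (schur P M)"
  using assms gen_closed[OF assms(1)] by (auto simp: symbols_iff simp del: schur_simps)

text \<open>On a symbol, \<open>h\<close> applies an operation of \<open>N\<close> to the images of
  the arguments, and there the degree rule and the Cartan formula of \<open>N\<close> match those of
  S(P, M). The identity as \<phi> covers structure maps, a general \<phi> the extension from the
  generators of a free algebra.\<close>

lemma f2_map_of_op_alg:
  assumes N: "unstable_module N" and M: "unstable_module M" and alg: "op_alg P N f"
    and \<phi>: "\<phi> \<in> U_hom M N"
    and h: "f2_map (schur P M) N h" and hg: "\<And>\<mu> xs. (\<mu>, xs) \<in> symbols P M \<Longrightarrow> h (schur_gen P M \<mu> xs) = f \<mu> (map \<phi> xs)"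
  shows "x \<in> hdeg (schur P M) d \<Longrightarrow> h x \<in> hdeg N d"
    and "x \<in> carrier (schur P M) \<Longrightarrow> h (Sq (schur P M) i x) = Sq N i (h x)"
proof -
  interpret M: operad_unstable P M by (rule operad_unstable.intro[OF operad_axioms M])
  interpret N: unstable_module N by (rule N)
  note A = op_algD[OF alg]
  have \<phi>d: "\<phi> x \<in> hdeg N d" if "x \<in> hdeg M d" for x d using \<phi> that by (simp add: U_hom_def)
  have \<phi>S: "\<phi> (Sq M i x) = Sq N i (\<phi> x)" if "x \<in> carrier M" for x i using \<phi> that by (simp add: U_hom_def)
  have \<phi>m: "f2_map M N \<phi>" using \<phi> unfolding U_hom_def by (simp add: linear_maps_iff[OF M.f2 N.f2])
  have sy: "(\<mu>, map \<phi> xs) \<in> symbols P N" if "(\<mu>, xs) \<in> symbols P M" for \<mu> xs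
    using that f2_mapD(1)[OF \<phi>m] by (auto simp: symbols_iff)
  show "h x \<in> hdeg N d" if x: "x \<in> hdeg (schur P M) d"
  proof (rule f2_map_span[OF h M.S_f2 N.f2 N.hdeg_submodule M.hgens_closed _ x[unfolded M.S_hdeg]])
    show "h ` M.hgens d \<subseteq> hdeg N d"
    proof
      fix u assume "u \<in> h ` M.hgens d"
      then obtain \<mu> xs ds where u: "u = h (schur_gen P M \<mu> xs)" "(\<mu>, xs) \<in> symbols P M"
        "list_all2 (\<lambda>x e. x \<in> hdeg M e) xs ds" "sum_list ds = d"
        unfolding M.hgens_def by blast
      have "list_all2 (\<lambda>x e. x \<in> hdeg N e) (map \<phi> xs) ds"
        using u(3) \<phi>d by (auto simp: list_all2_conv_all_nth)
      then show "u \<in> hdeg N d"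
        using A(4)[of \<mu> "map \<phi> xs" ds] u hg[OF u(2)] by (simp add: symbols_iff)
    qed
  qed
  show "h (Sq (schur P M) i x) = Sq N i (h x)" if x: "x \<in> carrier (schur P M)"
  proof (rule schur_ext[OF M.f2 N.f2 f2_map_comp[OF M.S_Sq_map h] f2_map_comp[OF h N.Sq_map] _ x])
    fix \<mu> xs assume s: "(\<mu>, xs) \<in> symbols P M"
    have xs: "set xs \<subseteq> carrier M" and \<mu>: "\<mu> \<in> carrier (ops P (length xs))" using s by (simp_all add: symbols_iff)
    have set: "set (map2 (Sq M) ks xs) \<subseteq> carrier M" for ks
      by (rule map2_set_closed[OF _ xs]) (rule M.Sq_closed)
    have sk: "(\<mu>, map2 (Sq M) ks xs) \<in> symbols P M" if "ks \<in> comps (length xs) i" for ks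
      using that set[of ks] \<mu> unfolding symbols_iff comps_iff by simp
    have comm: "map \<phi> (map2 (Sq M) ks xs) = map2 (Sq N) ks (map \<phi> xs)" for ks
      using xs
    proof (induction xs arbitrary: ks)
      case (Cons x xs)
      then show ?case by (cases ks) (simp_all add: \<phi>S)
    qed simp
    have "h (Sq (schur P M) i (schur_gen P M \<mu> xs)) =
        finsum N (\<lambda>ks. h (schur_gen P M \<mu> (map2 (Sq M) ks xs))) (comps (length xs) i)"
      unfolding M.S_Sq_gen[OF s]
      by (rule f2_map_finsum[OF h M.S_f2 N.f2], rule gen_closed[OF M.f2 set])
         (use \<mu> in \<open>simp add: comps_iff\<close>)
    also have "\<dots> = cartan N f (Sq N) i \<mu> (map \<phi> xs)"
      unfolding cartan_def length_map
    proof (rule f2_finsum_cong[OF N.f2 refl])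
      fix ks assume ks: "ks \<in> comps (length xs) i"
      show eq: "h (schur_gen P M \<mu> (map2 (Sq M) ks xs)) = f \<mu> (map2 (Sq N) ks (map \<phi> xs))"
        unfolding hg[OF sk[OF ks]] comm ..
      show "f \<mu> (map2 (Sq N) ks (map \<phi> xs)) \<in> carrier N"
        unfolding comm[symmetric] by (rule schur_compatD(1)[OF A(1) sy[OF sk[OF ks]]])
    qed
    also have "\<dots> = Sq N i (h (schur_gen P M \<mu> xs))"
      unfolding hg[OF s] by (rule A(5)[OF sy[OF s], symmetric])
    finally show "h (Sq (schur P M) i (schur_gen P M \<mu> xs)) = Sq N i (h (schur_gen P M \<mu> xs))" .
  qed
qed

lemma id_U_hom:
  assumes "unstable_module N"
  shows "(\<lambda>x\<in>carrier N. x) \<in> U_hom N N"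
proof -
  interpret N: unstable_module N by (rule assms)
  have "f2_map N N (\<lambda>x\<in>carrier N. x)" by (rule f2_mapI) (simp_all add: f2_closed[OF N.f2])
  then show ?thesis
    using N.hdeg_closed N.Sq_closed by (auto simp: U_hom_def linear_maps_iff[OF N.f2 N.f2])
qed

text \<open>Both ways around the associativity square are compatible functions of \<mu> and
  \<open>ts\<close>, so they need comparing only when every entry is a generator. There one side
  operates with the composite and the other with the inner values, as in the composition axiom of
  \<open>op_alg\<close>.\<close>

lemma U_palgebraI:
  assumes N: "unstable_module N" and alg: "op_alg P N f"
    and ext: "struct_map N \<in> extensional (carrier (schur P N))"
    and map: "f2_map (schur P N) N (struct_map N)"
    and gen: "\<And>\<mu> xs. (\<mu>, xs) \<in> symbols P N \<Longrightarrow> struct_map N (schur_gen P N \<mu> xs) = f \<mu> xs"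
  shows "U_palgebra P N"
proof (intro U_palgebra.intro[OF N] U_palgebra_axioms.intro)
  interpret N: unstable_module N by (rule N)
  note A = op_algD[OF alg]
  note S = schur_module[OF N.f2]
  note SS = schur_module[OF S]
  have idm: "map (\<lambda>x\<in>carrier N. x) xs = xs" if "(\<mu>, xs) \<in> symbols P N" for \<mu> xs
    using that by (intro map_idI) (auto simp: symbols_iff)
  have gen': "struct_map N (schur_gen P N \<mu> xs) = f \<mu> (map (\<lambda>x\<in>carrier N. x) xs)" if "(\<mu>, xs) \<in> symbols P N" for \<mu> xs
    using gen[OF that] idm[OF that] by simp
  note U = f2_map_of_op_alg[OF N N alg id_U_hom[OF N] map gen']
  show "struct_map N \<in> U_hom (schur P N) N"
    unfolding U_hom_def linear_maps_iff[OF S N.f2] using map ext U by (simp del: schur_simps)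
  show "struct_map N (schur_unit P N x) = x" if "x \<in> carrier N" for x
    using that opunit_closed gen[of "opunit P" "[x]"] A(2) by (simp add: schur_unit_def symbols_iff)
  fix T assume T: "T \<in> carrier (schur P (schur P N))"
  note sm = schur_map_facts[OF S N.f2 map] and mm = schur_mult_map[OF N.f2]
  show "struct_map N (schur_mult P N T) = struct_map N (schur_map P (schur P N) N (struct_map N) T)"
  proof (rule schur_ext[OF S N.f2 f2_map_comp[OF mm(1) map] f2_map_comp[OF sm(1) map] _ T])
    fix \<mu> ts assume s: "(\<mu>, ts) \<in> symbols P (schur P N)"
    then have \<mu>: "\<mu> \<in> carrier (ops P (length ts))" and ts: "set ts \<subseteq> carrier (schur P N)" by (simp_all only: symbols_iff)
    have s': "(\<mu>, map (struct_map N) ts) \<in> symbols P N"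
      using \<mu> ts f2_mapD(1)[OF map] by (auto simp: symbols_iff simp del: schur_simps)
    have "struct_map N (plug_mult P N \<mu> ts) = f \<mu> (map (struct_map N) ts)"
    proof (rule compat_ext[OF schur_compat_comp[OF plug_mult_compat[OF N.f2] map] schur_compat_map[OF A(1) map] S N.f2
          schur_generated[OF N.f2] _ s])
      fix us assume us: "length us = length ts" "set us \<subseteq> schur_gens N"
      obtain bs where bs: "us = gen_list P N bs" "set bs \<subseteq> symbols P N" using gens_list[OF us(2)] .
      have \<mu>b: "\<mu> \<in> carrier (ops P (length bs))" using \<mu> us(1) bs(1) by simp
      have "struct_map N (plug_mult P N \<mu> us) = f (plug_op P \<mu> bs) (plug_args bs)"
        unfolding bs(1) plug_mult_gen[OF N.f2 bs(2) \<mu>b] by (rule gen[OF plug_symbol[OF bs(2) \<mu>b]])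
      also have "\<dots> = f \<mu> (map (\<lambda>b. f (fst b) (snd b)) bs)" by (rule A(3)[OF \<mu>b bs(2)])
      also have "map (\<lambda>b. f (fst b) (snd b)) bs = map (struct_map N) us"
        unfolding bs(1) map_map using bs(2) by (intro map_cong) (auto simp: gen)
      finally show "struct_map N (plug_mult P N \<mu> us) = f \<mu> (map (struct_map N) us)" .
    qed
    then show "struct_map N (schur_mult P N (schur_gen P (schur P N) \<mu> ts)) =
        struct_map N (schur_map P (schur P N) N (struct_map N) (schur_gen P (schur P N) \<mu> ts))"
      by (simp only: mm(3)[OF s] sm(3)[OF s] gen[OF s'])
  qed
qed

lemma U_hom_map:
  assumes "unstable_module M" "unstable_module N" "h \<in> U_hom M N"
  shows "f2_map M N h" "h \<in> extensional (carrier M)" "x \<in> hdeg M d \<Longrightarrow> h x \<in> hdeg N d"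
    "x \<in> carrier M \<Longrightarrow> h (Sq M i x) = Sq N i (h x)"
  using assms linear_maps_iff[OF unstable_module.f2[OF assms(1)] unstable_module.f2[OF assms(2)]]
  by (auto simp: U_hom_def)

lemma U_homI:
  assumes "unstable_module M" "unstable_module N" "f2_map M N h" "h \<in> extensional (carrier M)"
    "\<And>x d. x \<in> hdeg M d \<Longrightarrow> h x \<in> hdeg N d"
    "\<And>x i. x \<in> carrier M \<Longrightarrow> h (Sq M i x) = Sq N i (h x)"
  shows "h \<in> U_hom M N"
  using assms linear_maps_iff[OF unstable_module.f2[OF assms(1)] unstable_module.f2[OF assms(2)]]
  by (auto simp: U_hom_def)

lemma palg_struct:
  assumes N: "U_palgebra P N"
  shows "unstable_module N" "f2_map (schur P N) N (struct_map N)"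
    "struct_map N \<in> extensional (carrier (schur P N))"
proof -
  interpret U_palgebra P N by (rule N)
  interpret N: operad_unstable P N by (intro operad_unstable.intro operad_axioms unstable_module_axioms)
  show "unstable_module N" by (rule unstable_module_axioms)
  show "f2_map (schur P N) N (struct_map N)" "struct_map N \<in> extensional (carrier (schur P N))"
    using U_hom_map[OF N.schur_unstable unstable_module_axioms struct_hom] by blast+
qed

text \<open>The passage back to operations: the composition axiom is the associativity square
  evaluated at an outer symbol whose arguments are classes of symbols, and the Cartan axiom is the
  fact that the structure map commutes with the squares.\<close>

lemma palg_op_alg:
  assumes N: "U_palgebra P N"
  shows "op_alg P N (palg_op P N)"
proof -
  interpret U_palgebra P N by (rule N)
  interpret N: operad_unstable P N by (intro operad_unstable.intro operad_axioms unstable_module_axioms)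
  note U = U_hom_map[OF N.schur_unstable unstable_module_axioms struct_hom]
  note S = schur_module[OF f2]
  have compat: "schur_compat P N N (palg_op P N)"
    using schur_compat_comp[OF gen_compat[OF f2] U(1)] by (simp add: palg_op_def[abs_def])
  have unit: "palg_op P N (opunit P) [x] = x" if "x \<in> carrier N" for x
    using struct_unit[OF that] that by (simp add: palg_op_def schur_unit_def)
  have comp: "palg_op P N (plug_op P \<mu> bs) (plug_args bs) = palg_op P N \<mu> (map (\<lambda>b. palg_op P N (fst b) (snd b)) bs)"
    if \<mu>: "\<mu> \<in> carrier (ops P (length bs))" and bs: "set bs \<subseteq> symbols P N" for \<mu> bs
  proof -
    note s = gen_symbol[OF f2 \<mu> bs]
    have "schur_gen P (schur P N) \<mu> (gen_list P N bs) \<in> carrier (schur P (schur P N))"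
      using s by (intro gen_closed[OF S]) (simp_all only: symbols_iff)
    from struct_mult[OF this] show ?thesis
      unfolding schur_mult_map(3)[OF f2 s] schur_map_facts(3)[OF S f2 U(1) s] plug_mult_gen[OF f2 bs \<mu>]
      by (simp add: palg_op_def comp_def)
  qed
  have deg: "palg_op P N \<mu> xs \<in> hdeg N (sum_list ds)"
    if "\<mu> \<in> carrier (ops P (length xs))" "list_all2 (\<lambda>x e. x \<in> hdeg N e) xs ds" for \<mu> xs ds
    unfolding palg_op_def by (rule U(3)[OF N.gen_hdeg[OF that]])
  have cart: "Sq N i (palg_op P N \<mu> xs) = cartan N (palg_op P N) (Sq N) i \<mu> xs" if s: "(\<mu>, xs) \<in> symbols P N" for \<mu> xs i
  proof -
    have xs: "set xs \<subseteq> carrier N" and \<mu>: "\<mu> \<in> carrier (ops P (length xs))" using s by (simp_all add: symbols_iff)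
    have set: "set (map2 (Sq N) ks xs) \<subseteq> carrier N" for ks
      by (rule map2_set_closed[OF _ xs]) (rule Sq_closed)
    have "Sq N i (palg_op P N \<mu> xs) = struct_map N (Sq (schur P N) i (schur_gen P N \<mu> xs))"
      unfolding palg_op_def by (rule U(4)[symmetric]) (rule gen_closed[OF f2 xs \<mu>])
    also have "\<dots> = cartan N (palg_op P N) (Sq N) i \<mu> xs"
      unfolding N.S_Sq_gen[OF s] cartan_def palg_op_def
      by (rule f2_map_finsum[OF U(1) S f2], rule gen_closed[OF f2 set]) (use \<mu> in \<open>simp add: comps_iff\<close>)
    finally show ?thesis .
  qed
  show ?thesis unfolding op_alg_def using compat unit comp deg cart by simp
qed

text \<open>Both composites with the structure maps are additive on S(P, N), so it is enough to
  compare them on symbols, where they are operations.\<close>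

lemma palg_hom_iff:
  assumes N: "U_palgebra P N" and N': "U_palgebra P N'"
  shows "h \<in> palg_hom P N N' \<longleftrightarrow> h \<in> U_hom N N' \<and>
    (\<forall>\<mu> xs. (\<mu>, xs) \<in> symbols P N \<longrightarrow> h (palg_op P N \<mu> xs) = palg_op P N' \<mu> (map h xs))"
proof -
  note U = palg_struct[OF N] and U' = palg_struct[OF N']
  note f = unstable_module.f2[OF U(1)] and f' = unstable_module.f2[OF U'(1)]
  show ?thesis
  proof
    assume h: "h \<in> palg_hom P N N'"
    then have hU: "h \<in> U_hom N N'" and hs: "\<And>t. t \<in> carrier (schur P N) \<Longrightarrow> h (struct_map N t) = struct_map N' (schur_map P N N' h t)"
      by (simp_all add: palg_hom_def del: schur_simps)
    note hm = U_hom_map(1)[OF U(1) U'(1) hU]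
    have "h (palg_op P N \<mu> xs) = palg_op P N' \<mu> (map h xs)" if s: "(\<mu>, xs) \<in> symbols P N" for \<mu> xs
    proof -
      have "schur_gen P N \<mu> xs \<in> carrier (schur P N)" using s by (intro gen_closed[OF f]) (simp_all add: symbols_iff)
      then show ?thesis using hs schur_map_facts(3)[OF f f' hm s] by (simp add: palg_op_def del: schur_simps)
    qed
    then show "h \<in> U_hom N N' \<and> (\<forall>\<mu> xs. (\<mu>, xs) \<in> symbols P N \<longrightarrow> h (palg_op P N \<mu> xs) = palg_op P N' \<mu> (map h xs))"
      using hU by blast
  next
    assume h: "h \<in> U_hom N N' \<and> (\<forall>\<mu> xs. (\<mu>, xs) \<in> symbols P N \<longrightarrow> h (palg_op P N \<mu> xs) = palg_op P N' \<mu> (map h xs))"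
    then have hU: "h \<in> U_hom N N'" by blast
    note hm = U_hom_map(1)[OF U(1) U'(1) hU]
    note sm = schur_map_facts[OF f f' hm]
    have "h (struct_map N t) = struct_map N' (schur_map P N N' h t)" if t: "t \<in> carrier (schur P N)" for t
    proof (rule schur_ext[OF f f' f2_map_comp[OF U(2) hm] f2_map_comp[OF sm(1) U'(2)] _ t])
      fix \<mu> xs assume s: "(\<mu>, xs) \<in> symbols P N"
      then show "h (struct_map N (schur_gen P N \<mu> xs)) = struct_map N' (schur_map P N N' h (schur_gen P N \<mu> xs))"
        using h sm(3)[OF s] by (simp add: palg_op_def)
    qed
    then show "h \<in> palg_hom P N N'" using hU by (simp add: palg_hom_def del: schur_simps)
  qed
qed

end


section \<open>The free algebra\<close>

lemma finsum_comps_append: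
  assumes V: "module F2 V" and f: "\<And>ks. length ks = m + n \<Longrightarrow> f ks \<in> carrier V"
  shows "finsum V f (comps (m + n) i) =
    finsum V (\<lambda>k. finsum V (\<lambda>ks. finsum V (\<lambda>ls. f (ks @ ls)) (comps n (i - k))) (comps m k)) {..i}"
proof -
  have bij: "bij_betw (\<lambda>(k, ks, ls). ks @ ls) (SIGMA k:{..i}. comps m k \<times> comps n (i - k)) (comps (m + n) i)"
  proof (rule bij_betw_byWitness[where f' = "\<lambda>ks. (sum_list (take m ks), take m ks, drop m ks)"])
    have s: "sum_list (take m ks) + sum_list (drop m ks) = sum_list ks" for ks :: "nat list"
      by (metis append_take_drop_id sum_list_append)
    show "(\<lambda>ks. (sum_list (take m ks), take m ks, drop m ks)) ` comps (m + n) i \<subseteq> (SIGMA k:{..i}. comps m k \<times> comps n (i - k))"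
    proof
      fix p assume "p \<in> (\<lambda>ks. (sum_list (take m ks), take m ks, drop m ks)) ` comps (m + n) i"
      then obtain ks where p: "p = (sum_list (take m ks), take m ks, drop m ks)" and ks: "length ks = m + n" "sum_list ks = i"
        by (auto simp: comps_iff)
      show "p \<in> (SIGMA k:{..i}. comps m k \<times> comps n (i - k))"
        using s[of ks] ks unfolding p by (auto simp: comps_iff)
    qed
  qed (auto simp: comps_iff)
  have "finsum V f (comps (m + n) i) =
      finsum V (\<lambda>p. f ((\<lambda>(k, ks, ls). ks @ ls) p)) (SIGMA k:{..i}. comps m k \<times> comps n (i - k))"
    by (rule f2_finsum_reindex[OF V bij]) (simp add: f comps_iff)
  also have "\<dots> = finsum V (\<lambda>(k, ks, ls). f (ks @ ls)) (SIGMA k:{..i}. comps m k \<times> comps n (i - k))"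
    by (rule f2_finsum_cong[OF V refl]) (auto simp: f comps_iff)
  also have "\<dots> = finsum V (\<lambda>k. finsum V (\<lambda>(ks, ls). f (ks @ ls)) (comps m k \<times> comps n (i - k))) {..i}"
    by (rule f2_finsum_Sigma[OF V, symmetric]) (auto simp: f comps_iff)
  also have "\<dots> = finsum V (\<lambda>k. finsum V (\<lambda>ks. finsum V (\<lambda>ls. f (ks @ ls)) (comps n (i - k))) (comps m k)) {..i}"
    by (intro f2_finsum_cong[OF V refl] f2_finsum_Sigma[OF V, symmetric] f2_finsum_closed[OF V])
       (auto simp: f comps_iff)
  finally show ?thesis .
qed

text \<open>One list of exponents runs over the concatenated arguments of all symbols; it is cut at
  the block boundaries and each symbol receives its share, the operations staying the same.\<close>

fun split_map2 :: "('k \<Rightarrow> 'a \<Rightarrow> 'a) \<Rightarrow> 'k list \<Rightarrow> ('p \<times> 'a list) list \<Rightarrow> ('p \<times> 'a list) list" where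
  "split_map2 T js [] = []"
| "split_map2 T js (b # bs) =
    (fst b, map2 T (take (length (snd b)) js) (snd b)) # split_map2 T (drop (length (snd b)) js) bs"

lemma split_map2_facts:
  assumes "length js = length (plug_args bs)"
  shows "map fst (split_map2 T js bs) = map fst bs"
    and "map (length \<circ> snd) (split_map2 T js bs) = map (length \<circ> snd) bs"
    and "plug_args (split_map2 T js bs) = map2 T js (plug_args bs)"
proof -
  have "map fst (split_map2 T js bs) = map fst bs \<and> map (length \<circ> snd) (split_map2 T js bs) = map (length \<circ> snd) bs \<and>
      plug_args (split_map2 T js bs) = map2 T js (plug_args bs)"
    using assms
  proof (induction bs arbitrary: js)
    case (Cons b bs)
    let ?k = "length (snd b)"
    have l: "?k \<le> length js" "length (drop ?k js) = length (plug_args bs)" using Cons.prems by auto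
    have "map2 T js (snd b @ plug_args bs) = map2 T (take ?k js @ drop ?k js) (snd b @ plug_args bs)" by simp
    also have "\<dots> = map2 T (take ?k js) (snd b) @ map2 T (drop ?k js) (plug_args bs)"
      using l by (subst zip_append) simp_all
    finally show ?case using Cons.IH[OF l(2)] l(1) by simp
  qed simp
  then show "map fst (split_map2 T js bs) = map fst bs"
    "map (length \<circ> snd) (split_map2 T js bs) = map (length \<circ> snd) bs"
    "plug_args (split_map2 T js bs) = map2 T js (plug_args bs)" by blast+
qed

lemma split_map2_symbols:
  assumes "set bs \<subseteq> symbols P M" "length js = length (plug_args bs)" "\<And>k x. x \<in> carrier M \<Longrightarrow> T k x \<in> carrier M"
  shows "set (split_map2 T js bs) \<subseteq> symbols P M"
  using assms(1,2)
proof (induction bs arbitrary: js)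
  case (Cons b bs)
  have b: "set (snd b) \<subseteq> carrier M" "fst b \<in> carrier (ops P (length (snd b)))"
    using Cons.prems(1) by (cases b; simp add: symbols_iff)+
  have "set (map2 T (take (length (snd b)) js) (snd b)) \<subseteq> carrier M"
    by (rule map2_set_closed[OF _ b(1)]) (rule assms(3))
  then have "(fst b, map2 T (take (length (snd b)) js) (snd b)) \<in> symbols P M"
    using b(2) Cons.prems(2) unfolding symbols_iff by simp
  then show ?case using Cons by simp
qed simp

context operad_unstable
begin

text \<open>Distributing i over the symbols and then within each symbol over its arguments is the
  same as distributing i over all arguments at once. The function \<phi> is arbitrary so that the
  induction can absorb the first symbol into it.\<close>

lemma finsum_gen_Sq:
  assumes \<phi>: "multi_additive S V (length bs) \<phi>" and V: "module F2 V" and bs: "set bs \<subseteq> symbols P M"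
  shows "finsum V (\<lambda>ks. \<phi> (map2 (Sq S) ks (gen_list P M bs))) (comps (length bs) i) =
    finsum V (\<lambda>js. \<phi> (gen_list P M (split_map2 (Sq M) js bs))) (comps (length (plug_args bs)) i)"
  using \<phi> bs
proof (induction bs arbitrary: \<phi> i)
  case Nil
  then show ?case
    using finsum_comps_0[OF V, of "\<lambda>ks. \<phi> []"] multi_additiveD(1)[OF Nil(1), of "[]"] by simp
next
  case (Cons b bs)
  let ?n = "length (snd b)" and ?m = "length (plug_args bs)"
  let ?t = "\<lambda>ks. gen (fst b) (map2 (Sq M) ks (snd b))"
  let ?r = "\<lambda>ls. gen_list P M (split_map2 (Sq M) ls bs)"
  have b: "(fst b, snd b) \<in> symbols P M" and bs: "set bs \<subseteq> symbols P M" using Cons.prems(2) by auto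
  have bb: "set (snd b) \<subseteq> carrier M" "fst b \<in> carrier (ops P (length (snd b)))"
    using b unfolding symbols_iff by simp_all
  have \<phi>: "multi_additive S V (Suc (length bs)) \<phi>" using Cons.prems(1) by simp
  have gc: "set (gen_list P M cs) \<subseteq> carrier S" if "set cs \<subseteq> symbols P M" for cs
    using that gen_closed[OF f2] by (auto simp: symbols_iff simp del: schur_simps)
  have t: "?t ks \<in> carrier S" if "length ks = ?n" for ks
    by (rule gen_closed[OF f2 map2_set_closed[OF _ bb(1)]]) (use Sq_closed that bb(2) in simp_all)
  have r: "set (?r ls) \<subseteq> carrier S" "length (?r ls) = length bs" if "length ls = ?m" for ls
    using gc[OF split_map2_symbols[OF bs that Sq_closed]] arg_cong[OF split_map2_facts(1)[OF that, of "Sq M"], of length]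
    by simp_all
  have tr: "\<phi> (?t ks # ?r ls) \<in> carrier V" if "length ks = ?n" "length ls = ?m" for ks ls
    using t r that by (intro multi_additiveD(1)[OF \<phi>]) (simp_all del: schur_simps)
  have SqS: "Sq S k (gen (fst b) (snd b)) \<in> carrier S" for k
    by (rule f2_mapD(1)[OF S_Sq_map gen_closed[OF f2 bb]])
  have glS: "set (map2 (Sq S) ks (gen_list P M bs)) \<subseteq> carrier S" for ks
    by (rule map2_set_closed[OF _ gc[OF bs]]) (rule f2_mapD(1)[OF S_Sq_map])
  have "finsum V (\<lambda>ks. \<phi> (map2 (Sq S) ks (gen_list P M (b # bs)))) (comps (length (b # bs)) i) =
      finsum V (\<lambda>k. finsum V (\<lambda>ks. \<phi> (Sq S k (gen (fst b) (snd b)) # map2 (Sq S) ks (gen_list P M bs)))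
        (comps (length bs) (i - k))) {..i}"
  proof -
    have "\<phi> (map2 (Sq S) ks (gen_list P M (b # bs))) \<in> carrier V" if l: "length ks = Suc (length bs)" for ks
    proof -
      have "set (map2 (Sq S) ks (gen_list P M (b # bs))) \<subseteq> carrier S"
        by (rule map2_set_closed[OF _ gc[OF Cons.prems(2)]]) (rule f2_mapD(1)[OF S_Sq_map])
      then show ?thesis using l by (intro multi_additiveD(1)[OF \<phi>]) simp_all
    qed
    from finsum_comps_Suc[OF V this] show ?thesis by simp
  qed
  also have "\<dots> = finsum V (\<lambda>k. finsum V (\<lambda>ls. \<phi> (Sq S k (gen (fst b) (snd b)) # ?r ls)) (comps ?m (i - k))) {..i}"
  proof (rule f2_finsum_cong[OF V refl])
    fix k
    show "finsum V (\<lambda>ks. \<phi> (Sq S k (gen (fst b) (snd b)) # map2 (Sq S) ks (gen_list P M bs))) (comps (length bs) (i - k)) =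
        finsum V (\<lambda>ls. \<phi> (Sq S k (gen (fst b) (snd b)) # ?r ls)) (comps ?m (i - k))"
      by (rule Cons.IH[OF multi_additive_Cons[OF \<phi> SqS] bs])
    show "finsum V (\<lambda>ls. \<phi> (Sq S k (gen (fst b) (snd b)) # ?r ls)) (comps ?m (i - k)) \<in> carrier V"
      by (rule f2_finsum_closed[OF V], rule multi_additiveD(1)[OF \<phi>])
         (use r SqS in \<open>simp_all add: comps_iff del: schur_simps\<close>)
  qed
  also have "\<dots> = finsum V (\<lambda>k. finsum V (\<lambda>ls. finsum V (\<lambda>ks. \<phi> (?t ks # ?r ls)) (comps ?n k)) (comps ?m (i - k))) {..i}"
  proof (intro f2_finsum_cong[OF V refl] f2_finsum_closed[OF V])
    fix k ls assume "ls \<in> comps ?m (i - k)"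
    then have l: "length ls = ?m" by (simp add: comps_iff)
    have slot: "f2_map S V (\<lambda>t. \<phi> (t # ?r ls))"
      using multi_additiveD(2)[OF \<phi>, of "[]" "?r ls"] r[OF l] by simp
    show "\<phi> (Sq S k (gen (fst b) (snd b)) # ?r ls) = finsum V (\<lambda>ks. \<phi> (?t ks # ?r ls)) (comps ?n k)"
      unfolding S_Sq_gen[OF b] by (rule f2_map_finsum[OF slot S_f2 V]) (simp add: t comps_iff del: schur_simps)
  qed (simp_all add: tr comps_iff)
  also have "\<dots> = finsum V (\<lambda>k. finsum V (\<lambda>ks. finsum V (\<lambda>ls. \<phi> (?t ks # ?r ls)) (comps ?m (i - k))) (comps ?n k)) {..i}"
    by (intro f2_finsum_cong[OF V refl] f2_finsum_closed[OF V] f2_finsum_swap[OF V]) (simp_all add: tr comps_iff)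
  also have "\<dots> = finsum V (\<lambda>k. finsum V (\<lambda>ks. finsum V (\<lambda>ls. \<phi> (gen_list P M (split_map2 (Sq M) (ks @ ls) (b # bs))))
      (comps ?m (i - k))) (comps ?n k)) {..i}"
    by (intro f2_finsum_cong[OF V refl] f2_finsum_closed[OF V]) (simp_all add: tr comps_iff)
  also have "\<dots> = finsum V (\<lambda>js. \<phi> (gen_list P M (split_map2 (Sq M) js (b # bs)))) (comps (?n + ?m) i)"
  proof (rule finsum_comps_append[OF V, symmetric])
    fix js :: "nat list" assume "length js = ?n + ?m"
    then show "\<phi> (gen_list P M (split_map2 (Sq M) js (b # bs))) \<in> carrier V"
      using tr[of "take ?n js" "drop ?n js"] by simp
  qed
  finally show ?case by simp
qed

lemma plug_mult_cartan:
  assumes s: "(\<mu>, ts) \<in> symbols P S"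
  shows "Sq S i (plug_mult P M \<mu> ts) = cartan S (plug_mult P M) (Sq S) i \<mu> ts"
proof (rule compat_ext[OF schur_compat_comp[OF plug_mult_compat[OF f2] S_Sq_map]
      cartan_compat[OF S_f2 S_f2 S_f2 plug_mult_compat[OF f2] S_Sq_map] S_f2 S_f2 schur_generated[OF f2] _ s])
  fix us assume us: "length us = length ts" "set us \<subseteq> schur_gens M"
  obtain bs where bs: "us = gen_list P M bs" "set bs \<subseteq> symbols P M" using gens_list[OF us(2)] .
  have \<mu>: "\<mu> \<in> carrier (ops P (length bs))" using s us(1) bs(1) by (simp add: symbols_iff)
  have "cartan S (plug_mult P M) (Sq S) i \<mu> us =
      finsum S (\<lambda>js. plug_mult P M \<mu> (gen_list P M (split_map2 (Sq M) js bs))) (comps (length (plug_args bs)) i)"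
    unfolding cartan_def bs(1) length_map
    by (rule finsum_gen_Sq[OF schur_compat_multi[OF plug_mult_compat[OF f2] S_f2 \<mu>] S_f2 bs(2)])
  also have "\<dots> = finsum S (\<lambda>js. gen (plug_op P \<mu> bs) (map2 (Sq M) js (plug_args bs))) (comps (length (plug_args bs)) i)"
  proof (rule f2_finsum_cong[OF S_f2 refl])
    fix js assume "js \<in> comps (length (plug_args bs)) i"
    then have l: "length js = length (plug_args bs)" by (simp add: comps_iff)
    note f = split_map2_facts[OF l, of "Sq M"]
    have \<mu>': "\<mu> \<in> carrier (ops P (length (split_map2 (Sq M) js bs)))"
      using \<mu> arg_cong[OF f(1), of length] by simp
    have sy: "set (split_map2 (Sq M) js bs) \<subseteq> symbols P M" by (rule split_map2_symbols[OF bs(2) l Sq_closed])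
    show eq: "plug_mult P M \<mu> (gen_list P M (split_map2 (Sq M) js bs)) = gen (plug_op P \<mu> bs) (map2 (Sq M) js (plug_args bs))"
      unfolding plug_mult_gen[OF f2 sy \<mu>'] f ..
    show "gen (plug_op P \<mu> bs) (map2 (Sq M) js (plug_args bs)) \<in> carrier S"
      using schur_compatD(1)[OF gen_compat[OF f2] plug_symbol[OF sy \<mu>']] unfolding f .
  qed
  also have "\<dots> = Sq S i (gen (plug_op P \<mu> bs) (plug_args bs))"
    by (rule S_Sq_gen[OF plug_symbol[OF bs(2) \<mu>], symmetric])
  finally show "Sq S i (plug_mult P M \<mu> us) = cartan S (plug_mult P M) (Sq S) i \<mu> us"
    unfolding bs(1) plug_mult_gen[OF f2 bs(2) \<mu>] by simp
qed

lemma plug_mult_unit: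
  assumes t: "t \<in> carrier S"
  shows "plug_mult P M (opunit P) [t] = t"
proof (rule schur_ext[OF f2 S_f2 _ _ _ t])
  show "f2_map S S (\<lambda>t. plug_mult P M (opunit P) [t])"
    using plug_mult_slot[OF f2, of "[]" "[]" "opunit P"] opunit_closed by simp
  show "f2_map S S (\<lambda>t. t)" by (simp add: f2_map_def)
  fix \<mu> xs assume s: "(\<mu>, xs) \<in> symbols P M"
  have "plug_mult P M (opunit P) (gen_list P M [(\<mu>, xs)]) = gen (plug_op P (opunit P) [(\<mu>, xs)]) (plug_args [(\<mu>, xs)])"
    by (rule plug_mult_gen[OF f2]) (use s opunit_closed in simp_all)
  then show "plug_mult P M (opunit P) [gen \<mu> xs] = gen \<mu> xs"
    using s unit_left[of \<mu> "length xs"] by (simp add: symbols_iff)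
qed

text \<open>Homogeneous generators suffice in every slot. The degrees of their concatenated
  arguments, block by block, add up to the prescribed degrees of the slots, hence to the same
  total.\<close>

lemma plug_mult_degree:
  assumes \<mu>: "\<mu> \<in> carrier (ops P (length ts))" and ds: "list_all2 (\<lambda>t e. t \<in> hdeg S e) ts ds"
  shows "plug_mult P M \<mu> ts \<in> hdeg S (sum_list ds)"
proof (rule span_list_induct[OF S_f2, of "map hgens ds"])
  have len: "length ts = length ds" by (rule list_all2_lengthD[OF ds])
  show "X \<subseteq> carrier S" if "X \<in> set (map hgens ds)" for X using that hgens_closed by auto
  show "list_all2 (\<lambda>z X. z \<in> lin_span S X) ts (map hgens ds)"
    using ds by (simp add: list_all2_map2 S_hdeg del: schur_simps)
  note slot = plug_mult_slot[OF f2]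
  fix ss us assume l: "length ss + Suc (length us) = length (map hgens ds)" "set ss \<subseteq> carrier S" "set us \<subseteq> carrier S"
  have sl: "f2_map S S (\<lambda>t. plug_mult P M \<mu> (ss @ t # us))"
    by (rule slot) (use l \<mu> len in simp_all)
  show "plug_mult P M \<mu> (ss @ \<zero>\<^bsub>S\<^esub> # us) \<in> hdeg S (sum_list ds)"
    unfolding f2_map_zero[OF sl S_f2 S_f2] by (rule submodule_f2D(2)[OF S_f2 S_hdeg_submodule])
  fix t u assume "t \<in> carrier S" "u \<in> carrier S" "plug_mult P M \<mu> (ss @ t # us) \<in> hdeg S (sum_list ds)"
    "plug_mult P M \<mu> (ss @ u # us) \<in> hdeg S (sum_list ds)"
  then show "plug_mult P M \<mu> (ss @ (t \<oplus>\<^bsub>S\<^esub> u) # us) \<in> hdeg S (sum_list ds)"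
    unfolding f2_mapD(2)[OF sl \<open>t \<in> carrier S\<close> \<open>u \<in> carrier S\<close>] by (intro submodule_f2D(3)[OF S_f2 S_hdeg_submodule])
next
  have len: "length ts = length ds" by (rule list_all2_lengthD[OF ds])
  fix zs assume zs: "list_all2 (\<in>) zs (map hgens ds)"
  have "\<exists>bs ess. zs = gen_list P M bs \<and> set bs \<subseteq> symbols P M \<and> length bs = length ds \<and>
      list_all2 (\<lambda>x e. x \<in> hdeg M e) (plug_args bs) (concat ess) \<and> sum_list (concat ess) = sum_list ds"
    using zs
  proof (induction ds arbitrary: zs)
    case Nil
    then show ?case by (intro exI[of _ "[]"]) simp
  next
    case (Cons d ds)
    then obtain z zs' where z: "zs = z # zs'" "z \<in> hgens d" "list_all2 (\<in>) zs' (map hgens ds)"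
      by (auto simp: list_all2_Cons2)
    from Cons.IH[OF z(3)] obtain bs ess where bs: "zs' = gen_list P M bs" "set bs \<subseteq> symbols P M" "length bs = length ds"
      "list_all2 (\<lambda>x e. x \<in> hdeg M e) (plug_args bs) (concat ess)" "sum_list (concat ess) = sum_list ds" by blast
    from z(2) obtain \<nu> xs es where "z = gen \<nu> xs" "(\<nu>, xs) \<in> symbols P M"
      "list_all2 (\<lambda>x e. x \<in> hdeg M e) xs es" "sum_list es = d" unfolding hgens_def by blast
    then show ?case using bs z(1)
      by (intro exI[of _ "(\<nu>, xs) # bs"] exI[of _ "es # ess"]) (auto intro: list_all2_appendI)
  qed
  then obtain bs ess where bs: "zs = gen_list P M bs" "set bs \<subseteq> symbols P M" "length bs = length ds"
      "list_all2 (\<lambda>x e. x \<in> hdeg M e) (plug_args bs) (concat ess)" "sum_list (concat ess) = sum_list ds" by blast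
  have \<mu>': "\<mu> \<in> carrier (ops P (length bs))" using \<mu> len bs(3) by simp
  show "plug_mult P M \<mu> zs \<in> hdeg S (sum_list ds)"
    unfolding bs(1) plug_mult_gen[OF f2 bs(2) \<mu>'] bs(5)[symmetric]
    by (rule gen_hdeg[OF plug_op_closed[OF bs(2) \<mu>'] bs(4)])
qed

end

section \<open>Associativity of plugging\<close>

context operad
begin

lemma plug_mult_assoc_gens:
  assumes M: "module F2 M" and css: "\<And>c. c \<in> set css \<Longrightarrow> set (snd c) \<subseteq> symbols P M \<and> fst c \<in> carrier (ops P (length (snd c)))"
    and \<mu>: "\<mu> \<in> carrier (ops P (length css))"
  shows "schur_gen P M (plug_op P (plug_op P \<mu> css) (plug_args css)) (plug_args (plug_args css)) =
    schur_gen P M (plug_op P \<mu> (map (\<lambda>c. (plug_op P (fst c) (snd c), plug_args (snd c))) css))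
      (plug_args (map (\<lambda>c. (plug_op P (fst c) (snd c), plug_args (snd c))) css))"
proof -
  let ?jss = "map (\<lambda>c. map (length \<circ> snd) (snd c)) css" and ?\<xi>ss = "map (\<lambda>c. map fst (snd c)) css"
  let ?ks = "map (length \<circ> snd) css" and ?\<nu>s = "map fst css"
  let ?bs = "map (\<lambda>c. (plug_op P (fst c) (snd c), plug_args (snd c))) css"
  have "opcomp P (concat ?jss) (opcomp P ?ks \<mu> ?\<nu>s) (concat ?\<xi>ss) =
      opcomp P (map sum_list ?jss) \<mu> (map (\<lambda>(js, \<nu>, \<xi>s). opcomp P js \<nu> \<xi>s) (zip ?jss (zip ?\<nu>s ?\<xi>ss)))"
  proof (rule assoc)
    show "op_list P ?ks ?\<nu>s" unfolding op_list_def using css by (simp add: list_all2_map1 list_all2_map2 list_all2_same)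
    show "list_all2 (op_list P) ?jss ?\<xi>ss"
      unfolding list_all2_map1 list_all2_map2 list_all2_same
    proof
      fix c assume "c \<in> set css"
      from op_list_symbols[OF conjunct1[OF css[OF this]]]
      show "op_list P (map (length \<circ> snd) (snd c)) (map fst (snd c))" .
    qed
  qed (use \<mu> in simp_all)
  moreover have "map (\<lambda>(js, \<nu>, \<xi>s). opcomp P js \<nu> \<xi>s) (zip ?jss (zip ?\<nu>s ?\<xi>ss)) = map fst ?bs"
    by (induction css) simp_all
  moreover have "concat ?jss = map (length \<circ> snd) (plug_args css)" "concat ?\<xi>ss = map fst (plug_args css)"
    by (simp_all add: map_concat comp_def)
  moreover have "map sum_list ?jss = map (length \<circ> snd) ?bs"
    by (simp add: length_concat comp_def)
  moreover have "plug_args (plug_args css) = plug_args ?bs"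
    by (induction css) simp_all
  ultimately show ?thesis by (simp only:)
qed

text \<open>A double hybrid argument. The pairs in \<open>cs\<close> already have generators as
  arguments, those in \<open>ds\<close> do not yet; the next pair is reduced slot by slot and then
  joins \<open>cs\<close>. When \<open>ds\<close> is empty, the associativity axiom of the operad
  applies to symbols.\<close>

lemma plug_mult_assoc:
  assumes M: "module F2 M" and cs: "set cs \<subseteq> symbols P (schur P M)" "\<And>c. c \<in> set cs \<Longrightarrow> set (snd c) \<subseteq> schur_gens M"
    and ds: "set ds \<subseteq> symbols P (schur P M)" and \<mu>: "\<mu> \<in> carrier (ops P (length (cs @ ds)))"
  shows "plug_mult P M (plug_op P \<mu> (cs @ ds)) (plug_args (cs @ ds)) =
    plug_mult P M \<mu> (map (\<lambda>b. plug_mult P M (fst b) (snd b)) (cs @ ds))"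
  using cs ds \<mu>
proof (induction ds arbitrary: cs)
  case Nil
  have "\<exists>css. cs = map (\<lambda>c. (fst c, gen_list P M (snd c))) css \<and>
      (\<forall>c\<in>set css. set (snd c) \<subseteq> symbols P M \<and> fst c \<in> carrier (ops P (length (snd c))))"
    using Nil.prems(1,2)
  proof (induction cs)
    case (Cons c cs)
    then obtain css where css: "cs = map (\<lambda>c. (fst c, gen_list P M (snd c))) css"
      "\<forall>c\<in>set css. set (snd c) \<subseteq> symbols P M \<and> fst c \<in> carrier (ops P (length (snd c)))" by auto
    have "set (snd c) \<subseteq> schur_gens M" using Cons.prems(2)[of c] by simp
    then obtain bs where bs: "snd c = gen_list P M bs" "set bs \<subseteq> symbols P M" by (rule gens_list)
    moreover have "fst c \<in> carrier (ops P (length (snd c)))" using Cons.prems(1) by (cases c) (simp add: symbols_iff)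
    ultimately show ?case using css by (intro exI[of _ "(fst c, bs) # css"]) (simp add: prod_eq_iff)
  qed simp
  then obtain css where c: "cs = map (\<lambda>c. (fst c, gen_list P M (snd c))) css"
    and css: "\<And>c. c \<in> set css \<Longrightarrow> set (snd c) \<subseteq> symbols P M \<and> fst c \<in> carrier (ops P (length (snd c)))" by blast
  let ?bs = "map (\<lambda>c. (plug_op P (fst c) (snd c), plug_args (snd c))) css"
  have \<mu>: "\<mu> \<in> carrier (ops P (length css))" using Nil.prems(4) c by simp
  have op: "plug_op P \<mu> cs = plug_op P \<mu> css" unfolding c by (simp add: comp_def)
  have ar: "plug_args cs = gen_list P M (plug_args css)" unfolding c by (simp add: map_concat comp_def)
  have sy: "set (plug_args css) \<subseteq> symbols P M" using css by auto
  have opc: "plug_op P \<mu> css \<in> carrier (ops P (length (plug_args css)))"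
    using opcomp_closed[of "map (length \<circ> snd) css" "map fst css" \<mu>] css \<mu>
    by (simp add: op_list_def list_all2_map1 list_all2_map2 list_all2_same length_concat)
  have L: "plug_mult P M (plug_op P \<mu> cs) (plug_args cs) =
      schur_gen P M (plug_op P (plug_op P \<mu> css) (plug_args css)) (plug_args (plug_args css))"
    unfolding op ar by (rule plug_mult_gen[OF M sy opc])
  have "map (\<lambda>b. plug_mult P M (fst b) (snd b)) cs = gen_list P M ?bs"
    unfolding c map_map
  proof (rule map_cong[OF refl])
    fix x assume "x \<in> set css"
    then show "((\<lambda>b. plug_mult P M (fst b) (snd b)) \<circ> (\<lambda>c. (fst c, gen_list P M (snd c)))) x =
        ((\<lambda>b. schur_gen P M (fst b) (snd b)) \<circ> (\<lambda>c. (plug_op P (fst c) (snd c), plug_args (snd c)))) x"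
      using plug_mult_gen[OF M, of "snd x" "fst x"] css[of x] by simp
  qed
  moreover have "set ?bs \<subseteq> symbols P M"
    unfolding set_map
  proof (rule image_subsetI)
    fix c assume "c \<in> set css"
    from css[OF this] show "(plug_op P (fst c) (snd c), plug_args (snd c)) \<in> symbols P M"
      by (intro plug_symbol) blast+
  qed
  ultimately have R: "plug_mult P M \<mu> (map (\<lambda>b. plug_mult P M (fst b) (snd b)) cs) = schur_gen P M (plug_op P \<mu> ?bs) (plug_args ?bs)"
    using plug_mult_gen[OF M, of ?bs \<mu>] \<mu> by simp
  show ?case unfolding append_Nil2 L R by (rule plug_mult_assoc_gens[OF M css \<mu>])
next
  case (Cons d ds)
  note S = schur_module[OF M]
  let ?f = "\<lambda>b. plug_mult P M (fst b) (snd b)"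
  let ?d = "\<lambda>ts. (fst d, ts)"
  have dd: "fst d \<in> carrier (ops P (length (snd d)))" "set (snd d) \<subseteq> carrier (schur P M)"
    using Cons.prems(3) by (cases d; simp add: symbols_iff)+
  have ds: "set ds \<subseteq> symbols P (schur P M)" using Cons.prems(3) by simp
  have fc: "set (map ?f bs) \<subseteq> carrier (schur P M)" if "set bs \<subseteq> symbols P (schur P M)" for bs
    using that plug_mult_closed[OF M] by (auto simp: symbols_iff simp del: schur_simps)
  have ac: "set (plug_args bs) \<subseteq> carrier (schur P M)" if "set bs \<subseteq> symbols P (schur P M)" for bs
    by (rule plug_args_closed[OF that])
  have maps: "f2_map (schur P M) (schur P M) (\<lambda>t. plug_mult P M (plug_op P \<mu> (cs @ ?d (ss @ t # us) # ds)) (plug_args (cs @ ?d (ss @ t # us) # ds)))"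
    "f2_map (schur P M) (schur P M) (\<lambda>t. plug_mult P M \<mu> (map ?f (cs @ ?d (ss @ t # us) # ds)))"
    if l: "length ss + Suc (length us) = length (snd d)" "set ss \<subseteq> carrier (schur P M)" "set us \<subseteq> carrier (schur P M)" for ss us
  proof -
    let ?\<rho> = "plug_op P \<mu> (cs @ d # ds)"
    \<comment> \<open>A composite operation depends only on the lengths of the inner argument lists,
      so it stays fixed while one entry varies and both sides are additive in that entry.\<close>
    have op: "plug_op P \<mu> (cs @ ?d (ss @ t # us) # ds) = ?\<rho>" for t using l(1) by simp
    have \<rho>: "?\<rho> \<in> carrier (ops P (length (plug_args (cs @ d # ds))))"
      by (rule plug_op_closed[of _ "schur P M"]) (use Cons.prems in auto)
    have "f2_map (schur P M) (schur P M) (\<lambda>t. plug_mult P M ?\<rho> ((plug_args cs @ ss) @ t # (us @ plug_args ds)))"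
    proof (rule plug_mult_slot[OF M])
      show "?\<rho> \<in> carrier (ops P (length (plug_args cs @ ss) + Suc (length (us @ plug_args ds))))"
        using \<rho> l(1)[symmetric] by (simp add: ac_simps)
    qed (use l ac[OF ds] ac[OF Cons.prems(1)] in simp_all)
    then show "f2_map (schur P M) (schur P M) (\<lambda>t. plug_mult P M (plug_op P \<mu> (cs @ ?d (ss @ t # us) # ds)) (plug_args (cs @ ?d (ss @ t # us) # ds)))"
      unfolding op by simp
    have in1: "f2_map (schur P M) (schur P M) (\<lambda>t. plug_mult P M (fst d) (ss @ t # us))"
      by (rule plug_mult_slot[OF M]) (use l dd(1) in simp_all)
    have in2: "f2_map (schur P M) (schur P M) (\<lambda>t. plug_mult P M \<mu> (map ?f cs @ t # map ?f ds))"
      by (rule plug_mult_slot[OF M fc[OF Cons.prems(1)] fc[OF ds]]) (use Cons.prems(4) in simp)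
    show "f2_map (schur P M) (schur P M) (\<lambda>t. plug_mult P M \<mu> (map ?f (cs @ ?d (ss @ t # us) # ds)))"
      using f2_map_comp[OF in1 in2] by simp
  qed
  have "plug_mult P M (plug_op P \<mu> (cs @ ?d (snd d) # ds)) (plug_args (cs @ ?d (snd d) # ds)) =
      plug_mult P M \<mu> (map ?f (cs @ ?d (snd d) # ds))"
    using M dd(2)
  proof (induction rule: schur_list_induct)
    case (gens bs)
    let ?c = "?d (gen_list P M bs)"
    have gl: "set (gen_list P M bs) \<subseteq> schur_gens M"
      unfolding set_map
    proof (rule image_subsetI)
      fix b assume "b \<in> set bs"
      then show "schur_gen P M (fst b) (snd b) \<in> schur_gens M"
        using gens(2) by (intro CollectI exI[of _ "fst b"] exI[of _ "snd b"]) auto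
    qed
    have "set (gen_list P M bs) \<subseteq> carrier (schur P M)"
      using gl schur_generated(1)[OF M] by (rule order_trans)
    then have c: "?c \<in> symbols P (schur P M)"
      using dd(1) gens(1) unfolding symbols_iff by simp
    have IHg: "set (snd c) \<subseteq> schur_gens M" if "c \<in> set (cs @ [?c])" for c
    proof (cases "c = ?c")
      case True
      show ?thesis unfolding True snd_conv by (rule gl)
    next
      case False
      then show ?thesis using that by (intro Cons.prems(2)) simp
    qed
    have "plug_mult P M (plug_op P \<mu> ((cs @ [?c]) @ ds)) (plug_args ((cs @ [?c]) @ ds)) =
        plug_mult P M \<mu> (map ?f ((cs @ [?c]) @ ds))"
      by (rule Cons.IH[OF _ IHg ds]) (use Cons.prems(1,4) c in simp_all)
    then show ?case by (simp add: comp_def)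
  next
    case (zero ss us)
    show ?case using f2_map_zero[OF maps(1)[OF zero] S S] f2_map_zero[OF maps(2)[OF zero] S S] by (simp add: comp_def)
  next
    case (add ss t u us)
    show ?case
      using f2_mapD(2)[OF maps(1)[OF add(1-3)] add(4,5)] f2_mapD(2)[OF maps(2)[OF add(1-3)] add(4,5)] add(6,7)
      by (simp only:)
  qed
  then show ?case by (simp add: comp_def)
qed

end

context operad_unstable
begin

theorem plug_mult_op_alg: "op_alg P S (plug_mult P M)"
  unfolding op_alg_def
proof (intro conjI allI impI ballI)
  show "schur_compat P S S (plug_mult P M)" by (rule plug_mult_compat[OF f2])
  show "plug_mult P M (opunit P) [t] = t" if "t \<in> carrier S" for t by (rule plug_mult_unit[OF that])
  show "plug_mult P M (plug_op P \<mu> bs) (plug_args bs) = plug_mult P M \<mu> (map (\<lambda>b. plug_mult P M (fst b) (snd b)) bs)"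
    if "\<mu> \<in> carrier (ops P (length bs))" "set bs \<subseteq> symbols P S" for \<mu> bs
    using plug_mult_assoc[OF f2, of "[]" bs \<mu>] that by simp
  show "plug_mult P M \<mu> ts \<in> hdeg S (sum_list ds)"
    if "\<mu> \<in> carrier (ops P (length ts))" "list_all2 (\<lambda>t e. t \<in> hdeg S e) ts ds" for \<mu> ts ds
    by (rule plug_mult_degree[OF that])
  show "Sq S i (plug_mult P M \<mu> ts) = cartan S (plug_mult P M) (Sq S) i \<mu> ts" if "(\<mu>, ts) \<in> symbols P S" for \<mu> ts i
    by (rule plug_mult_cartan[OF that])
qed

end

subsection \<open>Records with the same underlying unstable module\<close>

text \<open>S(P, M) and the free algebra, a quotient module and the quotient algebra, an algebra and
  its image under \<open>forget\<close> are records of different types and cannot be equated.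
  Agreement of the relevant fields is enough to transfer results.\<close>

definition same_umodule :: "('a, 'm) umodule_scheme \<Rightarrow> ('a, 'n) umodule_scheme \<Rightarrow> bool" where
  "same_umodule N N' \<longleftrightarrow> carrier N' = carrier N \<and> add N' = add N \<and> zero N' = zero N \<and>
     smult N' = smult N \<and> hdeg N' = hdeg N \<and> Sq N' = Sq N"

lemma same_umoduleD:
  assumes "same_umodule N N'"
  shows "carrier N' = carrier N" "add N' = add N" "zero N' = zero N" "smult N' = smult N"
    "hdeg N' = hdeg N" "Sq N' = Sq N"
  using assms by (simp_all add: same_umodule_def)

lemma same_schur:
  assumes same: "same_umodule N N'"
  shows "symbols P N' = symbols P N" "schur_space P N' = schur_space P N" "schur_gen P N' = schur_gen P N"
    "schur P N' = schur P N" "schur_unit P N' = schur_unit P N" "schur_mult P N' = schur_mult P N"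
    "schur_map P N' K = schur_map P N K" "schur_map P L N' = schur_map P L N"
proof -
  note s = same_umoduleD[OF same]
  show 1: "symbols P N' = symbols P N" by (simp add: symbols_def s)
  have "schur_relators P N' = schur_relators P N" by (simp only: schur_relators_def 1 s)
  then have n: "schur_null P N' = schur_null P N" by (simp only: schur_null_def 1)
  show 2: "schur_space P N' = schur_space P N" by (simp only: schur_space_def n 1)
  have c: "schur_class P N' = schur_class P N" by (intro ext) (simp only: schur_class_def n 1)
  show 3: "schur_gen P N' = schur_gen P N" by (intro ext) (simp only: schur_gen_def c)
  have l: "schur_lift P N' V f = schur_lift P N V f" for V :: "(bit, 'v, 'w) module_scheme" and f
    by (simp only: schur_lift_def 2)
  have h: "schur_hdeg P N' = schur_hdeg P N"
    by (intro ext) (simp only: schur_hdeg_def 2 3 1 s)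
  have q: "schur_Sq P N' = schur_Sq P N"
    by (intro ext) (simp only: schur_Sq_def l 2 3 s)
  show "schur P N' = schur P N" by (simp only: schur_def 2 h q)
  then show "schur_mult P N' = schur_mult P N" by (simp only: schur_mult_def 2 c)
  show "schur_unit P N' = schur_unit P N" by (simp only: schur_unit_def s 3)
  show "schur_map P N' K = schur_map P N K" by (intro ext) (simp only: schur_map_def l)
  show "schur_map P L N' = schur_map P L N" by (intro ext) (simp only: schur_map_def 2 3)
qed

lemma same_finsum: "same_umodule N N' \<Longrightarrow> finsum N' f A = finsum N f A"
  by (rule finsum_record_cong) (simp_all add: same_umoduleD)

lemma same_homog:
  assumes same: "same_umodule N N'"
  shows "is_decomposition N' x c \<longleftrightarrow> is_decomposition N x c"
    and "homog_component N' d x = homog_component N d x" and "Sq0 N' x = Sq0 N x"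
proof -
  note s = same_umoduleD[OF same]
  show d: "is_decomposition N' x c \<longleftrightarrow> is_decomposition N x c" for x c
    unfolding is_decomposition_def s same_finsum[OF same] ..
  show h: "homog_component N' d x = homog_component N d x" for d x by (simp only: homog_component_def d)
  show "Sq0 N' x = Sq0 N x" by (simp only: Sq0_def h s same_finsum[OF same])
qed

lemma same_linear_maps:
  assumes same: "same_umodule N N'"
  shows "linear_maps N' V = linear_maps N V" "linear_maps W N' = linear_maps W N"
  by (simp_all only: linear_maps_def same_umoduleD[OF same])

lemma same_unstable:
  assumes same: "same_umodule N N'" and N: "unstable_module N"
  shows "unstable_module N'"
proof -
  interpret N: unstable_module N by (rule N)
  note s = same_umoduleD[OF same]
  have f2': "module F2 N'" by (rule f2_module_cong[OF N.f2 s(1-4)])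
  show ?thesis
  proof (intro unstable_module.intro[OF f2'] unstable_module_axioms.intro)
    show "submodule (hdeg N' d) F2 N'" for d
      unfolding submodule_cong[OF N.f2 s(1-4)] s by (rule N.hdeg_submodule)
    show "\<exists>!c. is_decomposition N' x c" if "x \<in> carrier N'" for x
      using N.grading that by (simp add: same_homog[OF same] s)
    show "restrict (Sq N' i) (carrier N') \<in> linear_maps N' N'" for i
      unfolding same_linear_maps[OF same] s by (rule N.Sq_linear)
  qed (use N.Sq_degree N.Sq_zero N.Adem N.unstable in \<open>simp_all add: s same_finsum[OF same]\<close>)
qed

lemma same_U_hom:
  assumes "same_umodule N N'"
  shows "U_hom N' K = U_hom N K" "U_hom L N' = U_hom L N"
  by (simp_all only: U_hom_def same_linear_maps[OF assms] same_umoduleD[OF assms])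

lemma same_op_alg:
  assumes same: "same_umodule N N'" and alg: "op_alg P N f"
  shows "op_alg P N' f"
proof -
  note s = same_umoduleD[OF same]
  have "schur_compat P N' N' f \<longleftrightarrow> schur_compat P N N f"
    by (simp only: schur_compat_def s same_schur(1)[OF same])
  moreover have "cartan N' f T i \<mu> xs = cartan N f T i \<mu> xs" for T :: "nat \<Rightarrow> 'a \<Rightarrow> 'a" and i \<mu> xs
    by (simp only: cartan_def same_finsum[OF same])
  ultimately show ?thesis
    using alg unfolding op_alg_def s same_schur(1)[OF same] by simp
qed

lemma same_f2_map:
  assumes "same_umodule N N'"
  shows "f2_map N' V h = f2_map N V h" "f2_map W N' k = f2_map W N k"
  by (simp_all only: f2_map_def same_umoduleD[OF assms])

text \<open>Both sides are additive, so only homogeneous elements matter; on these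
  \<open>Sq0\<close> is a single square in a degree that the map preserves.\<close>

lemma Sq0_hom:
  assumes M: "unstable_module M" and N: "unstable_module N"
    and h: "f2_map M N h" and hdeg: "\<And>x d. x \<in> hdeg M d \<Longrightarrow> h x \<in> hdeg N d"
    and hSq: "\<And>x i. x \<in> carrier M \<Longrightarrow> h (Sq M i x) = Sq N i (h x)"
    and x: "x \<in> carrier M"
  shows "h (Sq0 M x) = Sq0 N (h x)"
proof -
  interpret M: unstable_module M by (rule M)
  interpret N: unstable_module N by (rule N)
  show ?thesis
  proof (rule f2_map_eq_on_span[OF f2_map_comp[OF M.Sq0_map h] f2_map_comp[OF h N.Sq0_map] M.f2 N.f2 M.hdeg_Union_closed])
    fix y assume "y \<in> (\<Union>d. hdeg M d)"
    then obtain d where y: "y \<in> hdeg M d" by blast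
    then have "y \<in> carrier M" using M.hdeg_closed by blast
    then show "h (Sq0 M y) = Sq0 N (h y)"
      by (simp add: M.Sq0_hdeg[OF y] N.Sq0_hdeg[OF hdeg[OF y]] hSq)
  qed (use x M.homog_span in blast)
qed

section \<open>Operations transported along a surjection\<close>

context operad
begin

text \<open>Each axiom is an equation or a membership for finitely many arguments; lift these
  through \<open>p\<close>, use the axiom upstairs and push the result down.\<close>

lemma op_alg_transfer:
  assumes A: "module F2 A" and N: "module F2 N" and alg: "op_alg P A f"
    and p: "f2_map A N p" and surj: "carrier N = p ` carrier A"
    and deg: "\<And>d. hdeg N d = p ` hdeg A d" "\<And>d. hdeg A d \<subseteq> carrier A"
    and pSq: "\<And>x i. x \<in> carrier A \<Longrightarrow> p (Sq A i x) = Sq N i (p x)" and Sq: "\<And>x i. x \<in> carrier A \<Longrightarrow> Sq A i x \<in> carrier A"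
    and g: "\<And>\<mu> xs. (\<mu>, xs) \<in> symbols P A \<Longrightarrow> g \<mu> (map p xs) = p (f \<mu> xs)"
  shows "op_alg P N g"
proof -
  note F = op_algD[OF alg] and Fc = schur_compatD[OF op_algD(1)[OF alg]] and p' = f2_mapD[OF p]
  have lift: "\<exists>ys. xs = map p ys \<and> set ys \<subseteq> carrier A" if "set xs \<subseteq> carrier N" for xs
  proof -
    have "xs \<in> map p ` lists (carrier A)"
      using that unfolding lists_image[symmetric] surj by (simp add: lists_eq_set)
    then show ?thesis by (auto simp: lists_eq_set)
  qed
  have lifts: "\<exists>ys. xs = map p ys \<and> (\<mu>, ys) \<in> symbols P A" if "(\<mu>, xs) \<in> symbols P N" for \<mu> xs
    using lift[of xs] that by (auto simp: symbols_iff)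
  have compat: "schur_compat P N N g"
  proof (rule schur_compatI)
    fix \<mu> \<nu> xs assume "(\<mu>, xs) \<in> symbols P N"
    then obtain ys where xs: "xs = map p ys" and s: "(\<mu>, ys) \<in> symbols P A" using lifts by blast
    show "g \<mu> xs \<in> carrier N" unfolding xs g[OF s] by (rule p'(1)[OF Fc(1)[OF s]])
    show "g (\<mu> \<oplus>\<^bsub>ops P (length xs)\<^esub> \<nu>) xs = g \<mu> xs \<oplus>\<^bsub>N\<^esub> g \<nu> xs" if "(\<nu>, xs) \<in> symbols P N"
    proof -
      have s': "(\<nu>, ys) \<in> symbols P A" using that s by (simp add: symbols_iff xs)
      have s'': "(\<mu> \<oplus>\<^bsub>ops P (length ys)\<^esub> \<nu>, ys) \<in> symbols P A"
        using s s' f2_closed(2)[OF ops_module] by (simp add: symbols_iff xs)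
      show ?thesis
        unfolding xs length_map g[OF s] g[OF s'] g[OF s''] Fc(2)[OF s s'] by (rule p'(2)[OF Fc(1)[OF s] Fc(1)[OF s']])
    qed
    show "g (opact P (length xs) \<sigma> \<mu>) (permute_list \<sigma> xs) = g \<mu> xs"
      if \<sigma>: "\<sigma> permutes {..<length xs}" for \<sigma>
    proof -
      have \<sigma>': "\<sigma> permutes {..<length ys}" using \<sigma> by (simp add: xs)
      have s': "(opact P (length ys) \<sigma> \<mu>, permute_list \<sigma> ys) \<in> symbols P A"
        using s opact_closed[OF \<sigma>'] by (simp add: symbols_iff set_permute_list[OF \<sigma>'])
      show ?thesis
        unfolding xs length_map permute_list_map[OF \<sigma>'] g[OF s] g[OF s'] Fc(4)[OF s \<sigma>'] ..
    qed
  next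
    fix \<mu> xs x y ys assume s: "(\<mu>, xs @ x # ys) \<in> symbols P N" and y: "y \<in> carrier N"
    have "set xs \<subseteq> carrier N" "set ys \<subseteq> carrier N" "x \<in> carrier N" using s by (simp_all add: symbols_iff)
    then obtain xs' x' ys' y' where l: "xs = map p xs'" "x = p x'" "ys = map p ys'" "y = p y'"
      and c: "set xs' \<subseteq> carrier A" "x' \<in> carrier A" "set ys' \<subseteq> carrier A" "y' \<in> carrier A"
      using lift[of xs] lift[of ys] y surj by auto
    have sy: "(\<mu>, xs' @ z # ys') \<in> symbols P A" if "z \<in> carrier A" for z using s c that by (simp add: symbols_iff l)
    have xy: "x' \<oplus>\<^bsub>A\<^esub> y' \<in> carrier A" using c f2_closed(2)[OF A] by simp
    have m: "map p xs' @ p z # map p ys' = map p (xs' @ z # ys')" for z by simp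
    show "g \<mu> (xs @ (x \<oplus>\<^bsub>N\<^esub> y) # ys) = g \<mu> (xs @ x # ys) \<oplus>\<^bsub>N\<^esub> g \<mu> (xs @ y # ys)"
      unfolding l p'(2)[OF c(2,4), symmetric] m g[OF sy[OF xy]] g[OF sy[OF c(2)]] g[OF sy[OF c(4)]]
        Fc(3)[OF sy[OF c(2)] c(4)]
      by (rule p'(2)[OF Fc(1)[OF sy[OF c(2)]] Fc(1)[OF sy[OF c(4)]]])
  qed
  have unit: "g (opunit P) [x] = x" if x: "x \<in> carrier N" for x
  proof -
    obtain y where y: "x = p y" "y \<in> carrier A" using x surj by auto
    then show ?thesis using g[of "opunit P" "[y]"] F(2)[OF y(2)] opunit_closed by (simp add: symbols_iff)
  qed
  have comp: "g (plug_op P \<mu> bs) (plug_args bs) = g \<mu> (map (\<lambda>b. g (fst b) (snd b)) bs)"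
    if \<mu>: "\<mu> \<in> carrier (ops P (length bs))" and bs: "set bs \<subseteq> symbols P N" for \<mu> bs
  proof -
    have "\<exists>cs. bs = map (\<lambda>c. (fst c, map p (snd c))) cs \<and> set cs \<subseteq> symbols P A"
      using bs
    proof (induction bs)
      case (Cons b bs)
      then obtain cs where cs: "bs = map (\<lambda>c. (fst c, map p (snd c))) cs" "set cs \<subseteq> symbols P A" by auto
      obtain ys where "snd b = map p ys" "(fst b, ys) \<in> symbols P A" using lifts[of "fst b" "snd b"] Cons.prems by auto
      with cs show ?case by (intro exI[of _ "(fst b, ys) # cs"]) (simp add: prod_eq_iff)
    qed simp
    then obtain cs where b: "bs = map (\<lambda>c. (fst c, map p (snd c))) cs" and cs: "set cs \<subseteq> symbols P A" by blast
    have \<mu>': "\<mu> \<in> carrier (ops P (length cs))" using \<mu> b by simp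
    let ?f = "\<lambda>b. f (fst b) (snd b)"
    have op: "plug_op P \<mu> bs = plug_op P \<mu> cs" unfolding b by (simp add: comp_def)
    have ar: "plug_args bs = map p (plug_args cs)" unfolding b by (simp add: map_concat comp_def)
    have "set (map ?f cs) \<subseteq> carrier A"
      unfolding set_map
    proof (rule image_subsetI)
      fix c assume "c \<in> set cs"
      then show "f (fst c) (snd c) \<in> carrier A" using cs by (intro Fc(1)) auto
    qed
    then have sy: "(\<mu>, map ?f cs) \<in> symbols P A" using \<mu>' unfolding symbols_iff by simp
    have m: "map (\<lambda>b. g (fst b) (snd b)) bs = map p (map ?f cs)"
      unfolding b map_map
    proof (rule map_cong[OF refl])
      fix c assume "c \<in> set cs"
      then have "(fst c, snd c) \<in> symbols P A" using cs by auto
      from g[OF this] show "((\<lambda>b. g (fst b) (snd b)) \<circ> (\<lambda>c. (fst c, map p (snd c)))) c = (p \<circ> ?f) c" by simp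
    qed
    show ?thesis unfolding op ar m g[OF plug_symbol[OF cs \<mu>']] g[OF sy] F(3)[OF \<mu>' cs] ..
  qed
  have degree: "g \<mu> xs \<in> hdeg N (sum_list ds)"
    if \<mu>: "\<mu> \<in> carrier (ops P (length xs))" and ds: "list_all2 (\<lambda>x e. x \<in> hdeg N e) xs ds" for \<mu> xs ds
  proof -
    \<comment> \<open>An arbitrary lift of a homogeneous element may be inhomogeneous, so here the
      lifts are taken degree by degree, using that each \<open>hdeg N d\<close> is the image of
      \<open>hdeg A d\<close>.\<close>
    have "\<exists>ys. xs = map p ys \<and> list_all2 (\<lambda>x e. x \<in> hdeg A e) ys ds \<and> set ys \<subseteq> carrier A"
      using ds
    proof (induction rule: list_all2_induct)
      case (Cons x xs d ds)
      then obtain ys where ys: "xs = map p ys" "list_all2 (\<lambda>x e. x \<in> hdeg A e) ys ds" "set ys \<subseteq> carrier A" by blast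
      obtain y where "x = p y" "y \<in> hdeg A d" using Cons.hyps(1) deg(1) by auto
      then show ?case using ys deg(2) by (intro exI[of _ "y # ys"]) auto
    qed simp
    then obtain ys where ys: "xs = map p ys" "list_all2 (\<lambda>x e. x \<in> hdeg A e) ys ds" "set ys \<subseteq> carrier A" by blast
    have \<mu>': "\<mu> \<in> carrier (ops P (length ys))" using \<mu> ys(1) by simp
    then have "(\<mu>, ys) \<in> symbols P A" using ys(3) by (simp add: symbols_iff)
    from g[OF this] show ?thesis using F(4)[OF \<mu>' ys(2)] deg(1) ys(1) by simp
  qed
  have cart: "Sq N i (g \<mu> xs) = cartan N g (Sq N) i \<mu> xs" if s: "(\<mu>, xs) \<in> symbols P N" for \<mu> xs i
  proof -
    obtain ys where xs: "xs = map p ys" and sy: "(\<mu>, ys) \<in> symbols P A" using lifts[OF s] by blast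
    have ys: "set ys \<subseteq> carrier A" and \<mu>: "\<mu> \<in> carrier (ops P (length ys))" using sy by (simp_all add: symbols_iff)
    have set: "set (map2 (Sq A) ks ys) \<subseteq> carrier A" for ks
      by (rule map2_set_closed[OF _ ys]) (rule Sq)
    have sk: "(\<mu>, map2 (Sq A) ks ys) \<in> symbols P A" if "ks \<in> comps (length ys) i" for ks
      using that set[of ks] \<mu> unfolding symbols_iff comps_iff by simp
    have comm: "map p (map2 (Sq A) ks ys) = map2 (Sq N) ks (map p ys)" for ks
      using ys
    proof (induction ys arbitrary: ks)
      case (Cons y ys)
      then show ?case by (cases ks) (simp_all add: pSq)
    qed simp
    have "Sq N i (g \<mu> xs) = p (cartan A f (Sq A) i \<mu> ys)"
      unfolding xs g[OF sy] using pSq[OF Fc(1)[OF sy], of i] F(5)[OF sy, of i] by simp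
    also have "\<dots> = finsum N (\<lambda>ks. p (f \<mu> (map2 (Sq A) ks ys))) (comps (length ys) i)"
      unfolding cartan_def by (rule f2_map_finsum[OF p A N]) (rule Fc(1)[OF sk])
    also have "\<dots> = finsum N (\<lambda>ks. g \<mu> (map2 (Sq N) ks xs)) (comps (length ys) i)"
    proof (rule f2_finsum_cong[OF N refl])
      fix ks assume ks: "ks \<in> comps (length ys) i"
      show "p (f \<mu> (map2 (Sq A) ks ys)) = g \<mu> (map2 (Sq N) ks xs)"
        unfolding xs comm[symmetric] g[OF sk[OF ks]] ..
      then show "g \<mu> (map2 (Sq N) ks xs) \<in> carrier N" using p'(1)[OF Fc(1)[OF sk[OF ks]]] by simp
    qed
    finally show ?thesis unfolding cartan_def xs length_map .
  qed
  show ?thesis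
    unfolding op_alg_def
  proof (intro conjI allI impI ballI)
    show "schur_compat P N N g" by (rule compat)
  qed (rule unit comp degree cart, assumption+)+
qed

end


section \<open>Quotient algebras\<close>

text \<open>Stability under the squares does not make a subspace graded: a sum of two elements of
  different degrees on which all positive squares vanish spans a stable line. Homogeneity is
  therefore a separate assumption, and it is what gives the quotient its grading.\<close>

locale palg_ideal = operad P + U_palgebra P A
  for P :: "'p operad_data" and A :: "('p, 'a) palgebra" +
  fixes I
  assumes ideal: "U_P_ideal P A I"
    and ideal_homogeneous: "I \<subseteq> lin_span A (I \<inter> (\<Union>d. hdeg A d))"
begin

lemma ideal_submodule: "submodule I F2 A"
  using ideal by (simp add: U_P_ideal_def P_ideal_def)

lemma ideal_Sq: "x \<in> I \<Longrightarrow> Sq A i x \<in> I"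
  using ideal by (simp add: U_P_ideal_def)

lemma ideal_last:
  "\<lbrakk>\<mu> \<in> carrier (ops P (Suc (length as))); set as \<subseteq> carrier A; a \<in> I\<rbrakk> \<Longrightarrow> palg_op P A \<mu> (as @ [a]) \<in> I"
  using ideal by (simp add: U_P_ideal_def P_ideal_def)

lemma op_compat: "schur_compat P A A (palg_op P A)"
  using palg_op_alg[OF U_palgebra_axioms] by (rule op_algD(1))

lemma op_closed: "(\<mu>, xs) \<in> symbols P A \<Longrightarrow> palg_op P A \<mu> xs \<in> carrier A"
  by (rule schur_compatD(1)[OF op_compat])

text \<open>The definition of an ideal only concerns the last slot; the other slots follow by
  equivariance.\<close>

lemma ideal_slot:
  assumes \<mu>: "\<mu> \<in> carrier (ops P (length xs + Suc (length ys)))"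
    and xs: "set xs \<subseteq> carrier A" and ys: "set ys \<subseteq> carrier A" and a: "a \<in> I"
  shows "palg_op P A \<mu> (xs @ a # ys) \<in> I"
proof -
  have ac: "a \<in> carrier A" using a submodule_f2D(1)[OF f2 ideal_submodule] by blast
  have "mset ((xs @ ys) @ [a]) = mset (xs @ a # ys)" by simp
  then obtain \<sigma> where \<sigma>: "\<sigma> permutes {..<length (xs @ a # ys)}" "permute_list \<sigma> (xs @ a # ys) = (xs @ ys) @ [a]"
    by (rule mset_eq_permutation)
  let ?\<nu> = "opact P (length (xs @ a # ys)) \<sigma> \<mu>"
  have s: "(\<mu>, xs @ a # ys) \<in> symbols P A" using \<mu> xs ys ac by (simp add: symbols_iff)
  have "?\<nu> \<in> carrier (ops P (length (xs @ a # ys)))" by (rule opact_closed[OF \<sigma>(1)]) (use \<mu> in simp)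
  then have "palg_op P A ?\<nu> ((xs @ ys) @ [a]) \<in> I"
    using xs ys a by (intro ideal_last) simp_all
  then show ?thesis
    using schur_compatD(4)[OF op_compat s \<sigma>(1)] \<sigma>(2) by simp
qed

abbreviation coset :: "'a \<Rightarrow> 'a set" where "coset x \<equiv> I +>\<^bsub>A\<^esub> x"

abbreviation Q :: "'a set umodule" where "Q \<equiv> quot_umodule A I"

lemma Q_simps:
  "carrier Q = coset ` carrier A" "add Q = add (quot_space A I)" "zero Q = I"
  "smult Q = smult (quot_space A I)" "hdeg Q d = coset ` hdeg A d"
  "Sq Q i X = the_elem ((\<lambda>x. coset (Sq A i x)) ` X)"
  by (simp_all add: quot_umodule_def module.extend_def umodule.fields_def quot_space_simps)

lemma Q_f2: "module F2 Q"
  by (rule f2_module_cong[OF quot_space_module[OF f2 ideal_submodule]])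
     (simp_all add: quot_umodule_def module.extend_def umodule.fields_def)

lemma coset_map: "f2_map A Q coset"
  using quot_space_proj[OF f2 ideal_submodule] by (simp add: f2_map_def Q_simps quot_space_simps)

lemma coset_eq: "\<lbrakk>x \<in> carrier A; y \<in> carrier A\<rbrakk> \<Longrightarrow> coset x = coset y \<longleftrightarrow> x \<oplus>\<^bsub>A\<^esub> y \<in> I"
  by (rule f2_coset_eq[OF f2 ideal_submodule])

lemma coset_zero: "x \<in> I \<Longrightarrow> coset x = \<zero>\<^bsub>Q\<^esub>"
  using f2_coset_eq_zero[OF f2 ideal_submodule] submodule_f2D(1)[OF f2 ideal_submodule] by (auto simp: Q_simps)

lemma induced_elem:
  assumes h: "f2_map A V h" and V: "module F2 V" and z: "\<And>x. x \<in> I \<Longrightarrow> h x = \<zero>\<^bsub>V\<^esub>" and x: "x \<in> carrier A"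
  shows "the_elem (h ` coset x) = h x"
proof (rule the_elem_coset[OF f2 ideal_submodule x])
  fix y assume y: "y \<in> carrier A" and eq: "coset y = coset x"
  have "h y \<oplus>\<^bsub>V\<^esub> h x = \<zero>\<^bsub>V\<^esub>"
    using z[of "y \<oplus>\<^bsub>A\<^esub> x"] coset_eq[OF y x] eq f2_mapD(2)[OF h y x] by simp
  then show "h y = h x" using f2_eq_iff[OF V f2_mapD(1)[OF h y] f2_mapD(1)[OF h x]] by simp
qed

lemma induced_map:
  assumes k: "\<And>x. x \<in> carrier A \<Longrightarrow> k (coset x) = h x" and h: "f2_map A V h"
  shows "f2_map Q V k"
proof (rule f2_mapI)
  fix X Y assume "X \<in> carrier Q"
  then obtain x where x: "x \<in> carrier A" "X = coset x" by (auto simp: Q_simps)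
  then show "k X \<in> carrier V" using k f2_mapD(1)[OF h] by simp
  assume "Y \<in> carrier Q"
  then obtain y where y: "y \<in> carrier A" "Y = coset y" by (auto simp: Q_simps)
  have "X \<oplus>\<^bsub>Q\<^esub> Y = coset (x \<oplus>\<^bsub>A\<^esub> y)" using f2_mapD(2)[OF coset_map x(1) y(1)] x y by simp
  then show "k (X \<oplus>\<^bsub>Q\<^esub> Y) = k X \<oplus>\<^bsub>V\<^esub> k Y"
    using k f2_mapD(2)[OF h x(1) y(1)] x y f2_closed(2)[OF f2] by simp
qed

lemma Q_Sq:
  assumes x: "x \<in> carrier A"
  shows "Sq Q i (coset x) = coset (Sq A i x)"
  unfolding Q_simps by (rule induced_elem[OF f2_map_comp[OF Sq_map coset_map] Q_f2 _ x]) (intro coset_zero ideal_Sq)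

definition Q_proj :: "nat \<Rightarrow> 'a set \<Rightarrow> 'a set" where
  "Q_proj d X = the_elem ((\<lambda>x. coset (homog_component A d x)) ` X)"

text \<open>Homogeneity of the ideal is used at this point: it lets the component maps descend, and
  they become the projections that grade the quotient.\<close>

lemma ideal_homog:
  assumes x: "x \<in> I"
  shows "homog_component A d x \<in> I"
proof (rule f2_map_span[OF homog_map f2 f2 ideal_submodule _ _ subsetD[OF ideal_homogeneous x]])
  show "I \<inter> (\<Union>d. hdeg A d) \<subseteq> carrier A" using hdeg_closed by blast
  show "homog_component A d ` (I \<inter> (\<Union>d. hdeg A d)) \<subseteq> I"
    using submodule_f2D(2)[OF f2 ideal_submodule] by (auto simp: homog_hdeg)
qed

lemma Q_proj_coset: "x \<in> carrier A \<Longrightarrow> Q_proj d (coset x) = coset (homog_component A d x)"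
  unfolding Q_proj_def by (rule induced_elem[OF f2_map_comp[OF homog_map coset_map] Q_f2]) (intro coset_zero ideal_homog)

theorem Q_unstable: "unstable_module Q"
proof (rule unstable_moduleI[where p = Q_proj and G = "carrier Q"])
  have hc: "x \<in> carrier A" if "x \<in> hdeg A d" for x d using that hdeg_closed by blast
  show "module F2 Q" by (rule Q_f2)
  show "submodule (hdeg Q d) F2 Q" for d
    unfolding submodule_f2_iff[OF Q_f2]
  proof (intro conjI ballI)
    show "hdeg Q d \<subseteq> carrier Q" using hc by (auto simp: Q_simps)
    show "\<zero>\<^bsub>Q\<^esub> \<in> hdeg Q d"
      using f2_map_zero[OF coset_map f2 Q_f2] submodule_f2D(2)[OF f2 hdeg_submodule, of d]
      by (auto simp: Q_simps(5) intro!: image_eqI[OF sym])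
    fix X Y assume "X \<in> hdeg Q d" "Y \<in> hdeg Q d"
    then obtain x y where x: "X = coset x" "x \<in> hdeg A d" and y: "Y = coset y" "y \<in> hdeg A d" by (auto simp: Q_simps)
    have "X \<oplus>\<^bsub>Q\<^esub> Y = coset (x \<oplus>\<^bsub>A\<^esub> y)" using f2_mapD(2)[OF coset_map hc hc] x y by simp
    then show "X \<oplus>\<^bsub>Q\<^esub> Y \<in> hdeg Q d"
      using submodule_f2D(3)[OF f2 hdeg_submodule x(2) y(2)] by (simp add: Q_simps(5))
  qed
  have U: "(\<Union>d. hdeg Q d) \<subseteq> carrier Q" using hc by (auto simp: Q_simps)
  show "carrier Q \<subseteq> lin_span Q (\<Union>d. hdeg Q d)"
  proof
    fix X assume "X \<in> carrier Q"
    then obtain x where x: "x \<in> carrier A" "X = coset x" by (auto simp: Q_simps)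
    show "X \<in> lin_span Q (\<Union>d. hdeg Q d)"
      unfolding x(2)
      by (rule f2_map_span[OF coset_map f2 Q_f2 lin_span_submodule[OF Q_f2 U] hdeg_Union_closed _ subsetD[OF homog_span x(1)]])
         (auto simp: Q_simps intro!: lin_span_base)
  qed
  show "f2_map Q Q (Q_proj d)" for d
    by (rule induced_map[OF Q_proj_coset f2_map_comp[OF homog_map coset_map]])
  show "Q_proj d X = (if d = e then X else \<zero>\<^bsub>Q\<^esub>)" if X: "X \<in> hdeg Q e" for d e X
  proof -
    obtain x where x: "X = coset x" "x \<in> hdeg A e" using X by (auto simp: Q_simps(5))
    show ?thesis
      unfolding x(1) Q_proj_coset[OF hc[OF x(2)]] homog_hdeg[OF x(2)]
      using f2_map_zero[OF coset_map f2 Q_f2] by simp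
  qed
  show Sqm: "f2_map Q Q (Sq Q i)" for i
    by (rule induced_map[OF Q_Sq f2_map_comp[OF Sq_map coset_map]])
  show "Sq Q i X \<in> hdeg Q (d + i)" if "X \<in> hdeg Q d" for d i X
    using that Q_Sq[OF hc] Sq_degree by (auto simp: Q_simps(5))
  show "Sq Q i X = \<zero>\<^bsub>Q\<^esub>" if "X \<in> hdeg Q d" "d < i" for d i X
    using that Q_Sq[OF hc] unstable f2_map_zero[OF coset_map f2 Q_f2] by (auto simp: Q_simps(5))
  show "carrier Q \<subseteq> carrier Q" by simp
  show "carrier Q \<subseteq> lin_span Q (carrier Q)" by (rule subsetI) (rule lin_span_base)
  fix X assume "X \<in> carrier Q"
  then obtain x where x: "x \<in> carrier A" "X = coset x" by (auto simp: Q_simps)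
  show "Sq Q 0 X = X" unfolding x(2) Q_Sq[OF x(1)] Sq_zero[OF x(1)] ..
  fix n c
  have e1: "Sq Q i (Sq Q (n - i) X) = coset (Sq A i (Sq A (n - i) x))" for i
    unfolding x(2) Q_Sq[OF x(1)] by (rule Q_Sq[OF Sq_closed[OF x(1)]])
  have e2: "coset (vec_pair A n r (\<lambda>i. Sq A i (Sq A (n - i) x))) = vec_pair Q n r (\<lambda>i. coset (Sq A i (Sq A (n - i) x)))" for r
    by (rule f2_map_vec_pair[OF coset_map f2 Q_f2]) (intro Sq_closed x(1))
  show "vec_pair Q n (bm_left n c) (\<lambda>i. Sq Q i (Sq Q (n - i) X)) =
      vec_pair Q n (bm_right n c) (\<lambda>i. Sq Q i (Sq Q (n - i) X))"
    unfolding e1 e2[symmetric] bullett_macdonald[OF x(1)] ..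
qed

lemma op_coset_cong:
  assumes xy: "list_all2 (\<lambda>x y. x \<in> carrier A \<and> y \<in> carrier A \<and> coset x = coset y) xs ys"
    and zs: "set zs \<subseteq> carrier A" and \<mu>: "\<mu> \<in> carrier (ops P (length zs + length xs))"
  shows "coset (palg_op P A \<mu> (zs @ xs)) = coset (palg_op P A \<mu> (zs @ ys))"
  using xy zs \<mu>
proof (induction arbitrary: zs rule: list_all2_induct)
  case (Cons x xs y ys)
  have x: "x \<in> carrier A" and y: "y \<in> carrier A" and xy: "x \<oplus>\<^bsub>A\<^esub> y \<in> I" using Cons.hyps(1) coset_eq by auto
  have xs: "set xs \<subseteq> carrier A" using Cons.hyps(2) by (auto simp: list_all2_conv_all_nth set_conv_nth)
  have \<mu>: "\<mu> \<in> carrier (ops P (length zs + Suc (length xs)))" using Cons.prems(2) by simp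
  have slot: "f2_map A A (\<lambda>x. palg_op P A \<mu> (zs @ x # xs))"
    using \<mu> by (intro schur_compat_slot[OF op_compat f2 Cons.prems(1) xs]) simp
  have "palg_op P A \<mu> (zs @ x # xs) \<oplus>\<^bsub>A\<^esub> palg_op P A \<mu> (zs @ y # xs) \<in> I"
    using ideal_slot[OF \<mu> Cons.prems(1) xs xy] f2_mapD(2)[OF slot x y] by simp
  then have "coset (palg_op P A \<mu> (zs @ x # xs)) = coset (palg_op P A \<mu> ((zs @ [y]) @ xs))"
    using coset_eq[OF f2_mapD(1)[OF slot x] f2_mapD(1)[OF slot y]] by simp
  also have "\<dots> = coset (palg_op P A \<mu> ((zs @ [y]) @ ys))"
    by (rule Cons.IH) (use Cons.prems y in simp_all)
  finally show ?case by simp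
qed simp

text \<open>Operations on cosets through chosen representatives. The choice does not affect the
  coset of the value, because an ideal absorbs a change in any slot.\<close>

definition Q_op :: "'p \<Rightarrow> 'a set list \<Rightarrow> 'a set" where
  "Q_op \<mu> Xs = coset (palg_op P A \<mu> (map (\<lambda>X. SOME x. x \<in> carrier A \<and> coset x = X) Xs))"

lemma Q_op_coset:
  assumes s: "(\<mu>, xs) \<in> symbols P A"
  shows "Q_op \<mu> (map coset xs) = coset (palg_op P A \<mu> xs)"
proof -
  let ?r = "\<lambda>X. SOME x. x \<in> carrier A \<and> coset x = X"
  have xs: "set xs \<subseteq> carrier A" and \<mu>: "\<mu> \<in> carrier (ops P (length xs))" using s by (simp_all add: symbols_iff)
  have r: "?r (coset x) \<in> carrier A \<and> coset (?r (coset x)) = coset x" if "x \<in> carrier A" for x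
    by (rule someI[of _ x]) (use that in simp)
  have "list_all2 (\<lambda>x y. x \<in> carrier A \<and> y \<in> carrier A \<and> coset x = coset y) (map ?r (map coset xs)) xs"
    unfolding list_all2_map1 list_all2_same using xs r by blast
  from op_coset_cong[OF this, of "[]" \<mu>] \<mu> show ?thesis by (simp add: Q_op_def)
qed

lemma Q_op_alg: "op_alg P Q Q_op"
proof (rule op_alg_transfer[OF f2 Q_f2 palg_op_alg[OF U_palgebra_axioms] coset_map])
  show "carrier Q = coset ` carrier A" by (rule Q_simps(1))
  show "hdeg Q d = coset ` hdeg A d" for d by (rule Q_simps(5))
  show "hdeg A d \<subseteq> carrier A" for d by (rule hdeg_closed)
  show "coset (Sq A i x) = Sq Q i (coset x)" if "x \<in> carrier A" for x i by (rule Q_Sq[OF that, symmetric])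
  show "Sq A i x \<in> carrier A" if "x \<in> carrier A" for x i by (rule Sq_closed[OF that])
  show "Q_op \<mu> (map coset xs) = coset (palg_op P A \<mu> xs)" if "(\<mu>, xs) \<in> symbols P A" for \<mu> xs
    by (rule Q_op_coset[OF that])
qed

section \<open>The quotient algebra and its universal property\<close>

abbreviation QA :: "('p, 'a set) palgebra" where "QA \<equiv> quot_palgebra P A I"

abbreviation proj :: "'a \<Rightarrow> 'a set" where "proj \<equiv> quot_proj A I"

lemma QA_same: "same_umodule Q QA"
  by (simp add: same_umodule_def quot_palgebra_def umodule.extend_def)

lemma proj_eq: "x \<in> carrier A \<Longrightarrow> proj x = coset x"
  by (simp add: quot_proj_def)

lemma proj_map: "f2_map A Q proj"
  by (rule f2_map_cong[OF coset_map proj_eq f2])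

lemma proj_list: "(\<mu>, xs) \<in> symbols P A \<Longrightarrow> map proj xs = map coset xs"
  by (auto simp: symbols_iff proj_eq)

text \<open>A symbol with coset arguments lifts by lifting its arguments, and symbols span. The
  structure map of the quotient is described through lifts: this makes the set of its candidate
  values nonempty, and \<open>Q_lift_proj\<close> makes it a singleton.\<close>

lemma schur_proj_surj:
  assumes T: "T \<in> carrier (schur P Q)"
  shows "\<exists>s\<in>carrier (schur P A). schur_map P A Q proj s = T"
proof -
  note sm = schur_map_facts[OF f2 Q_f2 proj_map]
  note S = schur_module[OF f2] and SQ = schur_module[OF Q_f2]
  show ?thesis
    using SQ schur_generated(1)[OF Q_f2] T[unfolded schur_generated(2)[OF Q_f2]]
  proof (induction rule: lin_span_induct)
    case zero
    show ?case using f2_map_zero[OF sm(1) S SQ] f2_closed(1)[OF S] by blast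
  next
    case (base x)
    then obtain \<mu> Xs where x: "x = schur_gen P Q \<mu> Xs" and s: "(\<mu>, Xs) \<in> symbols P Q" by blast
    have "Xs \<in> map coset ` lists (carrier A)"
      using s unfolding lists_image[symmetric] by (simp add: symbols_iff lists_eq_set Q_simps(1))
    then obtain xs where xs: "Xs = map coset xs" "set xs \<subseteq> carrier A" by (auto simp: lists_eq_set)
    have sy: "(\<mu>, xs) \<in> symbols P A" using s xs by (simp add: symbols_iff)
    have "schur_map P A Q proj (schur_gen P A \<mu> xs) = x"
      unfolding sm(3)[OF sy] proj_list[OF sy] x xs(1) ..
    moreover have "schur_gen P A \<mu> xs \<in> carrier (schur P A)"
      using sy by (intro gen_closed[OF f2]) (simp_all add: symbols_iff)
    ultimately show ?case by blast
  next
    case (add x y)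
    then obtain s t where st: "s \<in> carrier (schur P A)" "schur_map P A Q proj s = x"
      "t \<in> carrier (schur P A)" "schur_map P A Q proj t = y" by blast
    then show ?case
      using f2_mapD(2)[OF sm(1) st(1,3)] f2_closed(2)[OF S st(1,3)] by (intro bexI[of _ "s \<oplus>\<^bsub>schur P A\<^esub> t"]) simp_all
  qed
qed

abbreviation Q_lift :: "('p, 'a set) schur \<Rightarrow> 'a set" where "Q_lift \<equiv> schur_lift P Q Q Q_op"

lemma Q_lift_proj:
  assumes t: "t \<in> carrier (schur P A)"
  shows "Q_lift (schur_map P A Q proj t) = proj (struct_map A t)"
proof -
  note sm = schur_map_facts[OF f2 Q_f2 proj_map]
  note qc = op_algD(1)[OF Q_op_alg]
  note st = palg_struct(2)[OF U_palgebra_axioms]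
  show ?thesis
  proof (rule schur_ext[OF f2 Q_f2 f2_map_comp[OF sm(1) lift_map[OF qc Q_f2 Q_f2]] f2_map_comp[OF st proj_map] _ t])
    fix \<mu> xs assume s: "(\<mu>, xs) \<in> symbols P A"
    have sq: "(\<mu>, map coset xs) \<in> symbols P Q" using s by (auto simp: symbols_iff Q_simps(1))
    have "Q_lift (schur_map P A Q proj (schur_gen P A \<mu> xs)) = Q_op \<mu> (map coset xs)"
      unfolding sm(3)[OF s] proj_list[OF s] by (rule schur_lift_gen[OF qc Q_f2 Q_f2 sq])
    also have "\<dots> = proj (palg_op P A \<mu> xs)" unfolding Q_op_coset[OF s] proj_eq[OF op_closed[OF s]] ..
    finally show "Q_lift (schur_map P A Q proj (schur_gen P A \<mu> xs)) = proj (struct_map A (schur_gen P A \<mu> xs))"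
      by (simp add: palg_op_def)
  qed
qed

lemma QA_struct:
  assumes T: "T \<in> carrier (schur P Q)"
  shows "struct_map QA T = Q_lift T"
proof -
  have "{proj (struct_map A s) | s. s \<in> carrier (schur P A) \<and> schur_map P A Q proj s = T} = {Q_lift T}"
  proof (intro equalityI subsetI)
    fix X assume "X \<in> {proj (struct_map A s) | s. s \<in> carrier (schur P A) \<and> schur_map P A Q proj s = T}"
    then obtain s where s: "X = proj (struct_map A s)" "s \<in> carrier (schur P A)" "schur_map P A Q proj s = T" by blast
    then show "X \<in> {Q_lift T}" using Q_lift_proj[OF s(2)] by simp
  next
    fix X assume "X \<in> {Q_lift T}"
    then have X: "X = Q_lift T" by simp
    obtain s where s: "s \<in> carrier (schur P A)" "schur_map P A Q proj s = T" using schur_proj_surj[OF T] by blast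
    then show "X \<in> {proj (struct_map A s) | s. s \<in> carrier (schur P A) \<and> schur_map P A Q proj s = T}"
      using Q_lift_proj[OF s(1)] X by (intro CollectI exI[of _ s]) simp
  qed
  then show ?thesis
    using T by (simp add: quot_palgebra_def umodule.extend_def palgebra.fields_def del: schur_simps)
qed

lemma QA_palgebra: "U_palgebra P QA"
proof (rule U_palgebraI[OF same_unstable[OF QA_same Q_unstable] same_op_alg[OF QA_same Q_op_alg]])
  note qc = op_algD(1)[OF Q_op_alg]
  show "struct_map QA \<in> extensional (carrier (schur P QA))"
    unfolding same_schur[OF QA_same]
    by (simp add: quot_palgebra_def umodule.extend_def palgebra.fields_def)
  have "f2_map (schur P Q) Q (struct_map QA)"
    by (rule f2_map_cong[OF lift_map[OF qc Q_f2 Q_f2] QA_struct schur_module[OF Q_f2]])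
  then show "f2_map (schur P QA) QA (struct_map QA)"
    unfolding same_schur[OF QA_same] same_f2_map(2)[OF QA_same] .
  fix \<mu> Xs assume "(\<mu>, Xs) \<in> symbols P QA"
  then have s: "(\<mu>, Xs) \<in> symbols P Q" by (simp only: same_schur[OF QA_same])
  then have "schur_gen P Q \<mu> Xs \<in> carrier (schur P Q)" by (intro gen_closed[OF Q_f2]) (simp_all add: symbols_iff)
  then show "struct_map QA (schur_gen P QA \<mu> Xs) = Q_op \<mu> Xs"
    unfolding same_schur[OF QA_same] by (simp only: QA_struct schur_lift_gen[OF qc Q_f2 Q_f2 s])
qed

lemma QA_op:
  assumes s: "(\<mu>, xs) \<in> symbols P A"
  shows "palg_op P QA \<mu> (map coset xs) = coset (palg_op P A \<mu> xs)"
proof -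
  have sq: "(\<mu>, map coset xs) \<in> symbols P Q" using s by (auto simp: symbols_iff Q_simps(1))
  then have "schur_gen P Q \<mu> (map coset xs) \<in> carrier (schur P Q)" by (intro gen_closed[OF Q_f2]) (simp_all add: symbols_iff)
  then show ?thesis
    unfolding palg_op_def[of P QA] same_schur[OF QA_same]
    by (simp only: QA_struct schur_lift_gen[OF op_algD(1)[OF Q_op_alg] Q_f2 Q_f2 sq] Q_op_coset[OF s])
qed

lemma proj_hom: "proj \<in> palg_hom P A QA"
  unfolding palg_hom_iff[OF U_palgebra_axioms QA_palgebra]
proof (intro conjI allI impI)
  show "proj \<in> U_hom A QA"
    unfolding same_U_hom[OF QA_same]
  proof (rule U_homI[OF unstable_module_axioms Q_unstable proj_map])
    show "proj \<in> extensional (carrier A)" by (simp add: quot_proj_def)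
    show "proj x \<in> hdeg Q d" if "x \<in> hdeg A d" for x d
      using that hdeg_closed[of d] proj_eq by (auto simp: Q_simps(5))
    show "proj (Sq A i x) = Sq Q i (proj x)" if "x \<in> carrier A" for x i
      using that by (simp add: proj_eq Sq_closed Q_Sq)
  qed
  show "proj (palg_op P A \<mu> xs) = palg_op P QA \<mu> (map proj xs)" if "(\<mu>, xs) \<in> symbols P A" for \<mu> xs
    unfolding proj_list[OF that] QA_op[OF that] by (rule proj_eq[OF op_closed[OF that]])
qed

lemma descend:
  assumes N: "U_palgebra P N" and h: "h \<in> palg_hom P A N" and z: "\<And>x. x \<in> I \<Longrightarrow> h x = \<zero>\<^bsub>N\<^esub>"
  shows "(\<lambda>X\<in>carrier QA. the_elem (h ` X)) \<in> palg_hom P QA N"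
    and "x \<in> carrier A \<Longrightarrow> (\<lambda>X\<in>carrier QA. the_elem (h ` X)) (coset x) = h x"
proof -
  note Nu = palg_struct(1)[OF N]
  have hh: "h \<in> U_hom A N" "\<And>\<mu> xs. (\<mu>, xs) \<in> symbols P A \<Longrightarrow> h (palg_op P A \<mu> xs) = palg_op P N \<mu> (map h xs)"
    using h unfolding palg_hom_iff[OF U_palgebra_axioms N] by blast+
  note hU = U_hom_map[OF unstable_module_axioms Nu hh(1)]
  let ?k = "\<lambda>X\<in>carrier QA. the_elem (h ` X)"
  have carr: "carrier QA = coset ` carrier A" using same_umoduleD(1)[OF QA_same] by (simp add: Q_simps)
  show k: "?k (coset x) = h x" if "x \<in> carrier A" for x
    using induced_elem[OF hU(1) unstable_module.f2[OF Nu] z that] that by (simp add: carr)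
  show "?k \<in> palg_hom P QA N"
    unfolding palg_hom_iff[OF QA_palgebra N]
  proof (intro conjI allI impI)
    show "?k \<in> U_hom QA N"
    proof (rule U_homI[OF same_unstable[OF QA_same Q_unstable] Nu])
      show "f2_map QA N ?k" unfolding same_f2_map[OF QA_same] by (rule induced_map[OF k hU(1)])
      show "?k \<in> extensional (carrier QA)" by simp
      show "?k X \<in> hdeg N d" if X: "X \<in> hdeg QA d" for X d
      proof -
        obtain x where x: "X = coset x" "x \<in> hdeg A d" using X by (auto simp: same_umoduleD[OF QA_same] Q_simps)
        then have "x \<in> carrier A" using hdeg_closed by blast
        from k[OF this] show ?thesis using hU(3)[OF x(2)] unfolding x(1) by simp
      qed
      show "?k (Sq QA i X) = Sq N i (?k X)" if X: "X \<in> carrier QA" for X i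
      proof -
        obtain x where x: "X = coset x" "x \<in> carrier A" using X by (auto simp: carr)
        have "Sq QA i X = coset (Sq A i x)" using Q_Sq[OF x(2)] x(1) by (simp only: same_umoduleD[OF QA_same])
        then show ?thesis using k[OF x(2)] k[OF Sq_closed[OF x(2)], of i] hU(4)[OF x(2), of i] x(1) by simp
      qed
    qed
    fix \<mu> Xs assume s: "(\<mu>, Xs) \<in> symbols P QA"
    have "Xs \<in> map coset ` lists (carrier A)"
      using s unfolding lists_image[symmetric] by (simp add: symbols_iff lists_eq_set carr)
    then obtain xs where xs: "Xs = map coset xs" "set xs \<subseteq> carrier A" by (auto simp: lists_eq_set)
    have sy: "(\<mu>, xs) \<in> symbols P A" using s xs by (simp add: symbols_iff)
    have m: "map ?k Xs = map h xs" unfolding xs(1) map_map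
    proof (rule map_cong[OF refl])
      fix x assume "x \<in> set xs"
      then have "x \<in> carrier A" using xs(2) by blast
      from k[OF this] show "(?k \<circ> coset) x = h x" by (simp only: comp_apply)
    qed
    show "?k (palg_op P QA \<mu> Xs) = palg_op P N \<mu> (map ?k Xs)"
      unfolding m unfolding xs(1) QA_op[OF sy] hh(2)[OF sy, symmetric] by (rule k[OF op_closed[OF sy]])
  qed
qed

end


section \<open>The ideal defining \<open>K\<^sub>P\<^sup>\<star>(M)\<close>\<close>

context operad
begin

lemma palg_op_compat: "U_palgebra P A \<Longrightarrow> schur_compat P A A (palg_op P A)"
  by (rule op_algD(1)[OF palg_op_alg])

lemma carrier_U_P_ideal:
  assumes A: "U_palgebra P A"
  shows "U_P_ideal P A (carrier A)"
proof -
  interpret A: U_palgebra P A by (rule A)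
  have "palg_op P A \<mu> (as @ [a]) \<in> carrier A"
    if "\<mu> \<in> carrier (ops P (Suc (length as)))" "set as \<subseteq> carrier A" "a \<in> carrier A" for \<mu> as a
    using that by (intro schur_compatD(1)[OF palg_op_compat[OF A]]) (simp add: symbols_iff)
  then show ?thesis
    unfolding U_P_ideal_def P_ideal_def using submodule_carrier[OF A.f2] A.Sq_closed by blast
qed

lemma gen_U_P_ideal_ideal:
  assumes A: "U_palgebra P A" and X: "X \<subseteq> carrier A"
  shows "U_P_ideal P A (gen_U_P_ideal P A X)"
proof -
  interpret A: U_palgebra P A by (rule A)
  let ?F = "{I. U_P_ideal P A I \<and> X \<subseteq> I}"
  \<comment> \<open>The whole algebra belongs to the family, so the intersection is not over the
    empty family and stays inside the carrier.\<close>
  have c: "carrier A \<in> ?F" using carrier_U_P_ideal[OF A] X by blast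
  have sub: "submodule I F2 A" if "I \<in> ?F" for I using that by (simp add: U_P_ideal_def P_ideal_def)
  have "submodule (\<Inter>?F) F2 A"
    unfolding submodule_f2_iff[OF A.f2]
  proof (intro conjI ballI)
    show "\<Inter>?F \<subseteq> carrier A" by (rule Inter_lower[OF c])
    show "\<zero>\<^bsub>A\<^esub> \<in> \<Inter>?F" by (rule InterI) (rule submodule_f2D(2)[OF A.f2 sub])
    show "x \<oplus>\<^bsub>A\<^esub> y \<in> \<Inter>?F" if "x \<in> \<Inter>?F" "y \<in> \<Inter>?F" for x y
      by (rule InterI, rule submodule_f2D(3)[OF A.f2 sub]) (use that in blast)+
  qed
  moreover have "palg_op P A \<mu> (as @ [a]) \<in> \<Inter>?F"
    if "\<mu> \<in> carrier (ops P (Suc (length as)))" "set as \<subseteq> carrier A" "a \<in> \<Inter>?F" for \<mu> as a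
  proof (rule InterI)
    fix I assume I: "I \<in> ?F"
    then have "P_ideal P A I" "a \<in> I" using that(3) by (auto simp: U_P_ideal_def)
    then show "palg_op P A \<mu> (as @ [a]) \<in> I" using that(1,2) unfolding P_ideal_def by blast
  qed
  moreover have "Sq A i x \<in> \<Inter>?F" if "x \<in> \<Inter>?F" for i x
  proof (rule InterI)
    fix I assume "I \<in> ?F"
    then show "Sq A i x \<in> I" using that by (auto simp: U_P_ideal_def)
  qed
  ultimately show ?thesis
    unfolding gen_U_P_ideal_def U_P_ideal_def[of P A "\<Inter>?F"] P_ideal_def[of P A "\<Inter>?F"] by blast
qed

lemma gen_U_P_ideal_base: "X \<subseteq> gen_U_P_ideal P A X"
  by (auto simp: gen_U_P_ideal_def)

lemma gen_U_P_ideal_least: "\<lbrakk>U_P_ideal P A I; X \<subseteq> I\<rbrakk> \<Longrightarrow> gen_U_P_ideal P A X \<subseteq> I"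
  by (auto simp: gen_U_P_ideal_def)

text \<open>Expand the arguments into homogeneous ones, with the last one a homogeneous element of
  \<open>I\<close>. The value then lies in \<open>I\<close> and is homogeneous, and the squares
  likewise preserve both properties.\<close>

lemma homogeneous_part_ideal:
  assumes A: "U_palgebra P A" and I: "U_P_ideal P A I"
  shows "U_P_ideal P A (lin_span A (I \<inter> (\<Union>d. hdeg A d)))"
proof -
  interpret A: U_palgebra P A by (rule A)
  let ?H = "\<Union>d. hdeg A d"
  let ?J = "lin_span A (I \<inter> ?H)"
  have HA: "?H \<subseteq> carrier A" "I \<inter> ?H \<subseteq> carrier A" using A.hdeg_Union_closed by blast+
  note J = lin_span_submodule[OF A.f2 HA(2)]
  have I': "palg_op P A \<mu> (as @ [a]) \<in> I"
    if "\<mu> \<in> carrier (ops P (Suc (length as)))" "set as \<subseteq> carrier A" "a \<in> I" for \<mu> as a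
    using I that by (simp add: U_P_ideal_def P_ideal_def)
  have "palg_op P A \<mu> (as @ [a]) \<in> ?J"
    if \<mu>: "\<mu> \<in> carrier (ops P (Suc (length as)))" and as: "set as \<subseteq> carrier A" and a: "a \<in> ?J" for \<mu> as a
  \<comment> \<open>The slots have different generating sets: homogeneous elements of the algebra in
    all but the last, homogeneous elements of \<open>I\<close> in the last.\<close>
  proof (rule span_list_induct[OF A.f2, of "replicate (length as) ?H @ [I \<inter> ?H]"])
    let ?Xs = "replicate (length as) ?H @ [I \<inter> ?H]"
    show "X \<subseteq> carrier A" if "X \<in> set ?Xs" for X using that HA by (auto split: if_splits)
    have "list_all2 (\<lambda>z X. z \<in> lin_span A X) as (replicate (length as) ?H)"
      unfolding list_all2_conv_all_nth
      by (simp add: subsetD[OF A.homog_span subsetD[OF as nth_mem]])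
    then show "list_all2 (\<lambda>z X. z \<in> lin_span A X) (as @ [a]) ?Xs"
      using a by (intro list_all2_appendI) simp_all
    fix xs ys assume l: "length xs + Suc (length ys) = length ?Xs" "set xs \<subseteq> carrier A" "set ys \<subseteq> carrier A"
    have slot: "f2_map A A (\<lambda>x. palg_op P A \<mu> (xs @ x # ys))"
      using \<mu> l(1) by (intro schur_compat_slot[OF palg_op_compat[OF A] A.f2 l(2,3)]) simp
    show "palg_op P A \<mu> (xs @ \<zero>\<^bsub>A\<^esub> # ys) \<in> ?J"
      unfolding f2_map_zero[OF slot A.f2 A.f2] by (rule submodule_f2D(2)[OF A.f2 J])
    fix x y assume "x \<in> carrier A" "y \<in> carrier A" "palg_op P A \<mu> (xs @ x # ys) \<in> ?J" "palg_op P A \<mu> (xs @ y # ys) \<in> ?J"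
    then show "palg_op P A \<mu> (xs @ (x \<oplus>\<^bsub>A\<^esub> y) # ys) \<in> ?J"
      unfolding f2_mapD(2)[OF slot \<open>x \<in> carrier A\<close> \<open>y \<in> carrier A\<close>] by (intro submodule_f2D(3)[OF A.f2 J])
  next
    fix zs assume zs: "list_all2 (\<in>) zs (replicate (length as) ?H @ [I \<inter> ?H])"
    then obtain bs b where z: "zs = bs @ [b]" "list_all2 (\<in>) bs (replicate (length as) ?H)" "b \<in> I" "b \<in> ?H"
      unfolding list_all2_append2 list_all2_Cons2 list_all2_Nil2 by blast
    have len: "length bs = length as" using list_all2_lengthD[OF z(2)] by simp
    have bs: "set bs \<subseteq> ?H" using z(2) by (auto simp: list_all2_conv_all_nth in_set_conv_nth)
    have "\<exists>ds. list_all2 (\<lambda>x e. x \<in> hdeg A e) zs ds"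
    proof -
      have "set zs \<subseteq> ?H" using bs z(1,4) by simp
      then show ?thesis by (induction zs) (auto simp: list_all2_Cons1)
    qed
    then obtain ds where "list_all2 (\<lambda>x e. x \<in> hdeg A e) zs ds" by blast
    then have "palg_op P A \<mu> zs \<in> hdeg A (sum_list ds)"
      using op_algD(4)[OF palg_op_alg[OF A], of \<mu> zs ds] \<mu> z(1) len by simp
    moreover have "palg_op P A \<mu> zs \<in> I"
      unfolding z(1) using \<mu> len bs HA(1) z(3) by (intro I') auto
    ultimately show "palg_op P A \<mu> zs \<in> ?J" by (intro lin_span_base) blast
  qed
  moreover have "Sq A i x \<in> ?J" if "x \<in> ?J" for i x
  proof (rule f2_map_span[OF A.Sq_map A.f2 A.f2 J HA(2) _ that])
    show "Sq A i ` (I \<inter> ?H) \<subseteq> ?J"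
      using I A.Sq_degree by (fastforce simp: U_P_ideal_def intro!: lin_span_base)
  qed
  ultimately show ?thesis
    unfolding U_P_ideal_def P_ideal_def using J by blast
qed

section \<open>The star relation\<close>

lemma star_commutes:
  assumes N: "U_palgebra P N" and star: "star \<in> op_invariants P 2" and x: "x \<in> carrier N" and y: "y \<in> carrier N"
  shows "palg_op P N star [x, y] = palg_op P N star [y, x]"
proof -
  let ?\<sigma> = "Transposition.transpose 0 (1::nat)"
  have \<sigma>: "?\<sigma> permutes {..<2}" by (rule permutes_swap_id) simp_all
  have s: "(star, [y, x]) \<in> symbols P N" using star x y by (simp add: op_invariants_def symbols_iff numeral_2_eq_2)
  have "permute_list ?\<sigma> [y, x] = [x, y]"
    by (simp add: permute_list_def upt_rec transpose_def)
  then show ?thesis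
    using schur_compatD(4)[OF palg_op_compat[OF N] s, of ?\<sigma>] \<sigma> star by (simp add: op_invariants_def numeral_2_eq_2)
qed

lemma star_defect_map:
  assumes N: "U_palgebra P N" and star: "star \<in> op_invariants P 2"
  shows "f2_map N N (\<lambda>t. Sq0 N t \<oplus>\<^bsub>N\<^esub> palg_op P N star [t, t])"
proof (rule f2_mapI)
  interpret N: U_palgebra P N by (rule N)
  let ?s = "\<lambda>x y. palg_op P N star [x, y]"
  have st: "star \<in> carrier (ops P (Suc (Suc 0)))" using star by (simp add: op_invariants_def numeral_2_eq_2)
  have l: "f2_map N N (\<lambda>x. ?s x y)" if "y \<in> carrier N" for y
    using schur_compat_slot[OF palg_op_compat[OF N] N.f2, of "[]" "[y]" star] st that by simp
  have r: "f2_map N N (\<lambda>y. ?s x y)" if "x \<in> carrier N" for x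
    using schur_compat_slot[OF palg_op_compat[OF N] N.f2, of "[x]" "[]" star] st that by simp
  note q = f2_mapD[OF N.Sq0_map]
  fix x y assume x: "x \<in> carrier N"
  show "Sq0 N x \<oplus>\<^bsub>N\<^esub> ?s x x \<in> carrier N" by (intro f2_closed(2)[OF N.f2] q f2_mapD(1)[OF l] x)
  assume y: "y \<in> carrier N"
  have xy: "x \<oplus>\<^bsub>N\<^esub> y \<in> carrier N" by (rule f2_closed(2)[OF N.f2 x y])
  have c: "?s u v \<in> carrier N" if "u \<in> carrier N" "v \<in> carrier N" for u v by (rule f2_mapD(1)[OF l that(1)]) (rule that(2))
  have "?s (x \<oplus>\<^bsub>N\<^esub> y) (x \<oplus>\<^bsub>N\<^esub> y) = (?s x x \<oplus>\<^bsub>N\<^esub> ?s x y) \<oplus>\<^bsub>N\<^esub> (?s y x \<oplus>\<^bsub>N\<^esub> ?s y y)"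
    using f2_mapD(2)[OF l[OF xy] x y] f2_mapD(2)[OF r[OF x] x y] f2_mapD(2)[OF r[OF y] x y] by simp
  \<comment> \<open>Commutativity makes the two mixed terms equal, and equal terms cancel in
    characteristic two.\<close>
  also have "?s y x = ?s x y" by (rule star_commutes[OF N star y x])
  also have "(?s x x \<oplus>\<^bsub>N\<^esub> ?s x y) \<oplus>\<^bsub>N\<^esub> (?s x y \<oplus>\<^bsub>N\<^esub> ?s y y) = ?s x x \<oplus>\<^bsub>N\<^esub> ?s y y"
    using c x y by (simp add: f2_simps[OF N.f2])
  finally show "Sq0 N (x \<oplus>\<^bsub>N\<^esub> y) \<oplus>\<^bsub>N\<^esub> ?s (x \<oplus>\<^bsub>N\<^esub> y) (x \<oplus>\<^bsub>N\<^esub> y) =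
      (Sq0 N x \<oplus>\<^bsub>N\<^esub> ?s x x) \<oplus>\<^bsub>N\<^esub> (Sq0 N y \<oplus>\<^bsub>N\<^esub> ?s y y)"
    using q x y c by (simp add: f2_add[OF N.f2] f2_closed[OF N.f2])
qed

text \<open>As \<open>t \<mapsto> Sq\<^sub>0 t + \<star>(t, t)\<close> is additive, the ideal is generated by homogeneous
  elements, although \<open>t\<close> is not assumed to be homogeneous.\<close>

lemma star_gen_homogeneous:
  assumes N: "U_palgebra P N" and star: "star \<in> op_invariants P 2"
  defines "I \<equiv> gen_U_P_ideal P N {Sq0 N t \<oplus>\<^bsub>N\<^esub> palg_op P N star [t, t] | t. t \<in> carrier N}"
  shows "palg_ideal P N I"
proof (intro palg_ideal.intro palg_ideal_axioms.intro operad_axioms N)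
  interpret N: U_palgebra P N by (rule N)
  let ?X = "{Sq0 N t \<oplus>\<^bsub>N\<^esub> palg_op P N star [t, t] | t. t \<in> carrier N}"
  let ?H = "\<Union>d. hdeg N d"
  let ?J = "lin_span N (I \<inter> ?H)"
  note D = star_defect_map[OF N star]
  have X: "?X \<subseteq> carrier N" using f2_mapD(1)[OF D] by blast
  show I: "U_P_ideal P N I" unfolding I_def by (rule gen_U_P_ideal_ideal[OF N X])
  have HN: "I \<inter> ?H \<subseteq> carrier N" using N.hdeg_Union_closed by blast
  have star2: "star \<in> carrier (ops P (length [t, t]))" for t :: 'b
    using star by (simp add: op_invariants_def numeral_2_eq_2)
  have base: "Sq0 N t \<oplus>\<^bsub>N\<^esub> palg_op P N star [t, t] \<in> ?J" if t: "t \<in> hdeg N d" for t d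
  proof (rule lin_span_base, rule IntI)
    have tc: "t \<in> carrier N" using t N.hdeg_closed by blast
    show "Sq0 N t \<oplus>\<^bsub>N\<^esub> palg_op P N star [t, t] \<in> I"
      using gen_U_P_ideal_base[of ?X N] tc unfolding I_def by blast
    \<comment> \<open>For t of degree d both terms of the generator have degree 2d: the star product
      by additivity of degrees, Sq^d t because the square raises the degree by d.\<close>
    have "palg_op P N star [t, t] \<in> hdeg N (d + d)"
      using op_algD(4)[OF palg_op_alg[OF N] star2, of t "[d, d]"] t by simp
    moreover have "Sq0 N t \<in> hdeg N (d + d)" unfolding N.Sq0_hdeg[OF t] by (rule N.Sq_degree[OF t])
    ultimately have "Sq0 N t \<oplus>\<^bsub>N\<^esub> palg_op P N star [t, t] \<in> hdeg N (d + d)"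
      by (intro submodule_f2D(3)[OF N.f2 N.hdeg_submodule])
    then show "Sq0 N t \<oplus>\<^bsub>N\<^esub> palg_op P N star [t, t] \<in> ?H" by blast
  qed
  have "Sq0 N t \<oplus>\<^bsub>N\<^esub> palg_op P N star [t, t] \<in> ?J" if "t \<in> carrier N" for t
    by (rule f2_map_span[OF D N.f2 N.f2 lin_span_submodule[OF N.f2 HN] N.hdeg_Union_closed _ subsetD[OF N.homog_span that]])
       (use base in blast)
  \<comment> \<open>The span of the homogeneous elements of \<open>I\<close> is itself an ideal and
    now contains all generators, so minimality of \<open>I\<close> puts \<open>I\<close> inside
    it.\<close>
  then have "?X \<subseteq> ?J" by blast
  then show "I \<subseteq> ?J"
    using gen_U_P_ideal_least[OF homogeneous_part_ideal[OF N I]] unfolding I_def by blast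
qed

lemma hom_kernel_ideal:
  assumes A: "U_palgebra P A" and N: "U_palgebra P N" and h: "h \<in> palg_hom P A N"
  shows "U_P_ideal P A {x \<in> carrier A. h x = \<zero>\<^bsub>N\<^esub>}"
proof -
  interpret A: U_palgebra P A by (rule A)
  interpret N: U_palgebra P N by (rule N)
  have hh: "h \<in> U_hom A N" "\<And>\<mu> xs. (\<mu>, xs) \<in> symbols P A \<Longrightarrow> h (palg_op P A \<mu> xs) = palg_op P N \<mu> (map h xs)"
    using h unfolding palg_hom_iff[OF A N] by blast+
  note hU = U_hom_map[OF A.unstable_module_axioms N.unstable_module_axioms hh(1)]
  let ?K = "{x \<in> carrier A. h x = \<zero>\<^bsub>N\<^esub>}"
  have "submodule ?K F2 A"
    unfolding submodule_f2_iff[OF A.f2]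
    using f2_map_zero[OF hU(1) A.f2 N.f2] f2_mapD(2)[OF hU(1)]
    by (simp add: f2_closed[OF A.f2] f2_zero[OF N.f2] f2_closed[OF N.f2] subset_iff)
  moreover have "palg_op P A \<mu> (as @ [a]) \<in> ?K"
    if \<mu>: "\<mu> \<in> carrier (ops P (Suc (length as)))" and as: "set as \<subseteq> carrier A" and a: "a \<in> ?K" for \<mu> as a
  proof -
    have s: "(\<mu>, as @ [a]) \<in> symbols P A" using \<mu> as a by (simp add: symbols_iff)
    have "palg_op P N \<mu> (map h (as @ [a])) = \<zero>\<^bsub>N\<^esub>"
      by (rule schur_compat_zero[OF palg_op_compat[OF N] N.f2 N.f2])
         (use \<mu> as a f2_mapD(1)[OF hU(1)] in \<open>auto simp: f2_closed[OF N.f2]\<close>)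
    then show ?thesis using hh(2)[OF s] schur_compatD(1)[OF palg_op_compat[OF A] s] by simp
  qed
  moreover have "Sq A i x \<in> ?K" if "x \<in> ?K" for i x
    using that hU(4)[of x i] A.Sq_closed f2_map_zero[OF N.Sq_map N.f2 N.f2] by simp
  ultimately show ?thesis unfolding U_P_ideal_def P_ideal_def by blast
qed

text \<open>The kernel of a morphism is an ideal stable under the squares, so by minimality only the
  generators need checking. The two terms of a generator have the same image, and their sum is
  zero.\<close>

lemma star_ideal_kernel:
  assumes A: "U_palgebra P A" and N: "star_unstable_palgebra P star N" and h: "h \<in> palg_hom P A N"
    and star: "star \<in> op_invariants P 2"
    and x: "x \<in> gen_U_P_ideal P A {Sq0 A t \<oplus>\<^bsub>A\<^esub> palg_op P A star [t, t] | t. t \<in> carrier A}"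
  shows "h x = \<zero>\<^bsub>N\<^esub>"
proof -
  interpret A: U_palgebra P A by (rule A)
  interpret N: star_unstable_palgebra P star N by (rule N)
  note NU = N.U_palgebra_axioms
  have hh: "h \<in> U_hom A N" "\<And>\<mu> xs. (\<mu>, xs) \<in> symbols P A \<Longrightarrow> h (palg_op P A \<mu> xs) = palg_op P N \<mu> (map h xs)"
    using h unfolding palg_hom_iff[OF A NU] by blast+
  note hU = U_hom_map[OF A.unstable_module_axioms N.unstable_module_axioms hh(1)]
  have "h (Sq0 A t \<oplus>\<^bsub>A\<^esub> palg_op P A star [t, t]) = \<zero>\<^bsub>N\<^esub>" if t: "t \<in> carrier A" for t
  proof -
    have s: "(star, [t, t]) \<in> symbols P A" using star t by (simp add: op_invariants_def symbols_iff numeral_2_eq_2)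
    have "h (Sq0 A t) = Sq0 N (h t)"
      by (rule Sq0_hom[OF A.unstable_module_axioms N.unstable_module_axioms hU(1,3,4) t])
    also have "\<dots> = palg_op P N star [h t, h t]" by (rule N.star_unstable[OF f2_mapD(1)[OF hU(1) t]])
    also have "\<dots> = h (palg_op P A star [t, t])" using hh(2)[OF s] by simp
    finally show ?thesis
      using f2_mapD(2)[OF hU(1) f2_mapD(1)[OF A.Sq0_map t] schur_compatD(1)[OF palg_op_compat[OF A] s]]
        f2_self[OF N.f2] f2_mapD(1)[OF hU(1) schur_compatD(1)[OF palg_op_compat[OF A] s]] by simp
  qed
  then have "{Sq0 A t \<oplus>\<^bsub>A\<^esub> palg_op P A star [t, t] | t. t \<in> carrier A} \<subseteq> {x \<in> carrier A. h x = \<zero>\<^bsub>N\<^esub>}"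
    using f2_mapD(1)[OF star_defect_map[OF A star]] by blast
  from gen_U_P_ideal_least[OF hom_kernel_ideal[OF A NU h] this] x show ?thesis by blast
qed

text \<open>The projection commutes with \<open>Sq0\<close> and with the operations. The two sides
  of the star condition at a coset are therefore cosets of elements whose sum is a generator of the
  ideal.\<close>

lemma star_quotient:
  assumes A: "U_palgebra P A" and star: "star \<in> op_invariants P 2"
  shows "star_unstable_palgebra P star
    (quot_palgebra P A (gen_U_P_ideal P A {Sq0 A t \<oplus>\<^bsub>A\<^esub> palg_op P A star [t, t] | t. t \<in> carrier A}))"
proof -
  let ?X = "{Sq0 A t \<oplus>\<^bsub>A\<^esub> palg_op P A star [t, t] | t. t \<in> carrier A}"
  interpret palg_ideal P A "gen_U_P_ideal P A ?X" by (rule star_gen_homogeneous[OF A star])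
  show ?thesis
  proof (intro star_unstable_palgebra.intro star_unstable_palgebra_axioms.intro QA_palgebra)
    fix X assume "X \<in> carrier QA"
    then obtain t where t: "t \<in> carrier A" "X = coset t" using same_umoduleD(1)[OF QA_same] by (auto simp: Q_simps)
    have s: "(star, [t, t]) \<in> symbols P A" using star t by (simp add: op_invariants_def symbols_iff numeral_2_eq_2)
    have hd: "coset x \<in> hdeg Q d" if "x \<in> hdeg A d" for x d using that by (simp add: Q_simps)
    have "Sq0 QA X = Sq0 Q X" by (rule same_homog(3)[OF QA_same])
    also have "\<dots> = coset (Sq0 A t)"
      unfolding t(2) by (rule Sq0_hom[OF unstable_module_axioms Q_unstable coset_map hd Q_Sq[symmetric] t(1), symmetric])
    also have "\<dots> = coset (palg_op P A star [t, t])"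
      using gen_U_P_ideal_base[of ?X A] t(1)
      by (subst coset_eq[OF f2_mapD(1)[OF Sq0_map t(1)] op_closed[OF s]]) blast
    also have "\<dots> = palg_op P QA star [X, X]"
      using QA_op[OF s] t(2) by simp
    finally show "Sq0 QA X = palg_op P QA star [X, X]" .
  qed
qed

end


section \<open>The adjunction\<close>

lemma forget_same: "same_umodule N (forget N)"
  by (simp add: same_umodule_def forget_def umodule.truncate_def)

lemma free_same: "same_umodule (schur P M) (free_palgebra P M)"
  by (simp add: same_umodule_def free_palgebra_def umodule.extend_def)

lemma free_struct: "struct_map (free_palgebra P M) = schur_mult P M"
  by (simp add: free_palgebra_def umodule.extend_def palgebra.fields_def)

context operad_unstable
begin

abbreviation "FA \<equiv> free_palgebra P M"

lemma free_palgebra: "U_palgebra P FA"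
proof (rule U_palgebraI[OF same_unstable[OF free_same schur_unstable] same_op_alg[OF free_same plug_mult_op_alg]])
  show "struct_map FA \<in> extensional (carrier (schur P FA))"
    unfolding same_schur[OF free_same] free_struct by (rule schur_mult_map(2)[OF f2])
  show "f2_map (schur P FA) FA (struct_map FA)"
    unfolding same_schur[OF free_same] free_struct same_f2_map(2)[OF free_same] by (rule schur_mult_map(1)[OF f2])
  show "struct_map FA (schur_gen P FA \<mu> ts) = plug_mult P M \<mu> ts" if "(\<mu>, ts) \<in> symbols P FA" for \<mu> ts
    using that unfolding same_schur[OF free_same] free_struct by (rule schur_mult_map(3)[OF f2])
qed

lemma free_op: "(\<mu>, ts) \<in> symbols P S \<Longrightarrow> palg_op P FA \<mu> ts = plug_mult P M \<mu> ts"
  unfolding palg_op_def same_schur[OF free_same] free_struct by (rule schur_mult_map(3)[OF f2])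

lemma unit_eq: "x \<in> carrier M \<Longrightarrow> schur_unit P M x = gen (opunit P) [x]"
  by (simp add: schur_unit_def)

lemma unit_closed: "x \<in> carrier M \<Longrightarrow> schur_unit P M x \<in> carrier S"
  unfolding unit_eq using opunit_closed by (intro gen_closed[OF f2]) simp_all

text \<open>By the right unit axiom, plugging units into \<mu> returns \<mu>. Hence the image of M
  generates the free algebra under the operations, and morphisms out of it are determined
  there.\<close>

lemma gen_from_units:
  assumes s: "(\<mu>, xs) \<in> symbols P M"
  shows "gen \<mu> xs = palg_op P FA \<mu> (map (schur_unit P M) xs)"
proof -
  let ?bs = "map (\<lambda>x. (opunit P, [x])) xs"
  have xs: "set xs \<subseteq> carrier M" and \<mu>: "\<mu> \<in> carrier (ops P (length xs))" using s by (simp_all add: symbols_iff)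
  have bs: "set ?bs \<subseteq> symbols P M" using xs opunit_closed by (auto simp: symbols_iff)
  have \<mu>b: "\<mu> \<in> carrier (ops P (length ?bs))" using \<mu> by simp
  have u: "map (schur_unit P M) xs = gen_list P M ?bs"
    using xs by (auto simp: unit_eq)
  have "plug_op P \<mu> ?bs = opcomp P (replicate (length xs) 1) \<mu> (replicate (length xs) (opunit P))"
    by (simp add: comp_def map_replicate_const)
  then have op: "plug_op P \<mu> ?bs = \<mu>" using unit_right[OF \<mu>] by simp
  have ar: "plug_args ?bs = xs" by (induction xs) simp_all
  have "palg_op P FA \<mu> (map (schur_unit P M) xs) = plug_mult P M \<mu> (gen_list P M ?bs)"
    unfolding u by (rule free_op[OF gen_symbol[OF f2 \<mu>b bs]])
  also have "\<dots> = gen \<mu> xs" unfolding plug_mult_gen[OF f2 bs \<mu>b] op ar ..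
  finally show ?thesis ..
qed

lemma unit_map: "f2_map M S (schur_unit P M)"
proof (rule f2_map_cong[OF _ unit_eq f2])
  show "f2_map M S (\<lambda>x. gen (opunit P) [x])"
    using schur_compat_slot[OF gen_compat[OF f2] f2, of "[]" "[]" "opunit P"] opunit_closed by simp
qed

lemma unit_U_hom: "schur_unit P M \<in> U_hom M S"
proof (rule U_homI[OF unstable_module_axioms schur_unstable unit_map])
  show "schur_unit P M \<in> extensional (carrier M)" by (simp add: schur_unit_def)
  show "schur_unit P M x \<in> hdeg S d" if x: "x \<in> hdeg M d" for x d
  proof -
    have xc: "x \<in> carrier M" using x hdeg_closed by blast
    have "gen (opunit P) [x] \<in> hdeg S (sum_list [d])" by (rule gen_hdeg) (use x opunit_closed in simp_all)
    then show ?thesis using unit_eq[OF xc] by simp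
  qed
  show "schur_unit P M (Sq M i x) = Sq S i (schur_unit P M x)" if x: "x \<in> carrier M" for x i
  proof -
    have s: "(opunit P, [x]) \<in> symbols P M" using x opunit_closed by (simp add: symbols_iff)
    have c: "comps (Suc 0) i = {[i]}" by (auto simp: comps_def length_Suc_conv)
    have "Sq S i (gen (opunit P) [x]) = finsum S (\<lambda>ks. gen (opunit P) (map2 (Sq M) ks [x])) {[i]}"
      using S_Sq_gen[OF s, of i] by (simp add: c del: schur_simps)
    also have "\<dots> = gen (opunit P) (map2 (Sq M) [i] [x])"
      by (rule f2_finsum_single[OF S_f2]) (use x opunit_closed Sq_closed in \<open>auto intro!: gen_closed[OF f2] simp del: schur_simps\<close>)
    finally show ?thesis using x by (simp add: unit_eq Sq_closed del: schur_simps)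
  qed
qed

lemma hom_on_gen:
  assumes N: "U_palgebra P N" and h: "h \<in> palg_hom P FA N" and s: "(\<mu>, xs) \<in> symbols P M"
  shows "h (gen \<mu> xs) = palg_op P N \<mu> (map (\<lambda>x. h (schur_unit P M x)) xs)"
proof -
  have "set (map (schur_unit P M) xs) \<subseteq> carrier S"
    using s unit_closed by (auto simp: symbols_iff simp del: schur_simps)
  then have "(\<mu>, map (schur_unit P M) xs) \<in> symbols P FA"
    using s unfolding same_schur[OF free_same] by (simp add: symbols_iff del: schur_simps)
  then show ?thesis
    unfolding gen_from_units[OF s] using h unfolding palg_hom_iff[OF free_palgebra N] by (simp add: comp_def)
qed

lemma hom_U_hom:
  assumes N: "U_palgebra P N" and h: "h \<in> palg_hom P FA N"
  shows "h \<in> U_hom S N"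
  using h unfolding palg_hom_iff[OF free_palgebra N] same_U_hom[OF free_same] by blast

lemma hom_unique:
  assumes N: "U_palgebra P N" and h: "h \<in> palg_hom P FA N" and k: "k \<in> palg_hom P FA N"
    and eq: "\<And>x. x \<in> carrier M \<Longrightarrow> h (schur_unit P M x) = k (schur_unit P M x)" and t: "t \<in> carrier S"
  shows "h t = k t"
proof -
  note Nu = palg_struct(1)[OF N]
  note hU = U_hom_map(1)[OF schur_unstable Nu hom_U_hom[OF N h]] and kU = U_hom_map(1)[OF schur_unstable Nu hom_U_hom[OF N k]]
  show ?thesis
  proof (rule schur_ext[OF f2 unstable_module.f2[OF Nu] hU kU _ t])
    fix \<mu> xs assume s: "(\<mu>, xs) \<in> symbols P M"
    then have "map (\<lambda>x. h (schur_unit P M x)) xs = map (\<lambda>x. k (schur_unit P M x)) xs"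
      using eq by (auto simp: symbols_iff)
    then show "h (gen \<mu> xs) = k (gen \<mu> xs)"
      unfolding hom_on_gen[OF N h s] hom_on_gen[OF N k s] by (rule arg_cong)
  qed
qed

definition free_ext :: "('p, 'b) palgebra \<Rightarrow> ('a \<Rightarrow> 'b) \<Rightarrow> ('p, 'a) schur \<Rightarrow> 'b" where
  "free_ext N \<phi> = schur_lift P M N (\<lambda>\<mu> xs. palg_op P N \<mu> (map \<phi> xs))"

text \<open>The map is prescribed on symbols. That it commutes with the operations is checked on
  lists of generators, where the free algebra composes symbols and the composition axiom of
  \<open>N\<close> does the same with values.\<close>

lemma free_ext:
  assumes N: "U_palgebra P N" and \<phi>: "\<phi> \<in> U_hom M N"
  shows "free_ext N \<phi> \<in> palg_hom P FA N"
    and "(\<mu>, xs) \<in> symbols P M \<Longrightarrow> free_ext N \<phi> (gen \<mu> xs) = palg_op P N \<mu> (map \<phi> xs)"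
    and "x \<in> carrier M \<Longrightarrow> free_ext N \<phi> (schur_unit P M x) = \<phi> x"
proof -
  interpret N: U_palgebra P N by (rule N)
  note alg = palg_op_alg[OF N]
  note \<phi>U = U_hom_map[OF unstable_module_axioms N.unstable_module_axioms \<phi>]
  note c = schur_compat_map[OF op_algD(1)[OF alg] \<phi>U(1)]
  show g: "free_ext N \<phi> (gen \<mu> xs) = palg_op P N \<mu> (map \<phi> xs)" if "(\<mu>, xs) \<in> symbols P M" for \<mu> xs
    unfolding free_ext_def by (rule schur_lift_gen[OF c N.f2 f2 that])
  show "free_ext N \<phi> (schur_unit P M x) = \<phi> x" if x: "x \<in> carrier M"
  proof -
    have "(opunit P, [x]) \<in> symbols P M" using x opunit_closed by (simp add: symbols_iff)
    from g[OF this] show ?thesis using op_algD(2)[OF alg f2_mapD(1)[OF \<phi>U(1) x]] unit_eq[OF x] by simp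
  qed
  have m: "f2_map S N (free_ext N \<phi>)" unfolding free_ext_def by (rule lift_map[OF c N.f2 f2])
  note U = f2_map_of_op_alg[OF N.unstable_module_axioms unstable_module_axioms alg \<phi> m g]
  show "free_ext N \<phi> \<in> palg_hom P FA N"
    unfolding palg_hom_iff[OF free_palgebra N] same_U_hom[OF free_same]
  proof (intro conjI allI impI)
    show "free_ext N \<phi> \<in> U_hom S N"
      by (rule U_homI[OF schur_unstable N.unstable_module_axioms m])
         (use U schur_lift_extensional in \<open>simp_all add: free_ext_def\<close>)
    fix \<mu> ts assume "(\<mu>, ts) \<in> symbols P FA"
    then have s: "(\<mu>, ts) \<in> symbols P S" by (simp only: same_schur[OF free_same])
    show "free_ext N \<phi> (palg_op P FA \<mu> ts) = palg_op P N \<mu> (map (free_ext N \<phi>) ts)"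
      unfolding free_op[OF s]
    proof (rule compat_ext[OF schur_compat_comp[OF plug_mult_compat[OF f2] m]
          schur_compat_map[OF op_algD(1)[OF alg] m] S_f2 N.f2 schur_generated[OF f2] _ s])
      fix us assume us: "length us = length ts" "set us \<subseteq> schur_gens M"
      obtain bs where bs: "us = gen_list P M bs" "set bs \<subseteq> symbols P M" using gens_list[OF us(2)] .
      have \<mu>: "\<mu> \<in> carrier (ops P (length bs))" using s us(1) bs(1) by (simp add: symbols_iff)
      let ?cs = "map (\<lambda>b. (fst b, map \<phi> (snd b))) bs"
      have cs: "set ?cs \<subseteq> symbols P N"
      proof (rule subsetI)
        fix c assume "c \<in> set ?cs"
        then obtain b where b: "b \<in> set bs" "c = (fst b, map \<phi> (snd b))" by auto
        have "(fst b, snd b) \<in> symbols P M" using b(1) bs(2) by auto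
        then show "c \<in> symbols P N"
          unfolding b(2) symbols_iff using f2_mapD(1)[OF \<phi>U(1)] by auto
      qed
      have \<mu>c: "\<mu> \<in> carrier (ops P (length ?cs))" using \<mu> by simp
      have op: "plug_op P \<mu> ?cs = plug_op P \<mu> bs" by (simp add: comp_def)
      have ar: "plug_args ?cs = map \<phi> (plug_args bs)" by (simp add: map_concat comp_def)
      have "free_ext N \<phi> (plug_mult P M \<mu> us) = palg_op P N (plug_op P \<mu> ?cs) (plug_args ?cs)"
        unfolding bs(1) plug_mult_gen[OF f2 bs(2) \<mu>] g[OF plug_symbol[OF bs(2) \<mu>]] op ar ..
      also have "\<dots> = palg_op P N \<mu> (map (\<lambda>b. palg_op P N (fst b) (snd b)) ?cs)"
        by (rule op_algD(3)[OF alg \<mu>c cs])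
      also have "map (\<lambda>b. palg_op P N (fst b) (snd b)) ?cs = map (free_ext N \<phi>) us"
        unfolding bs(1) map_map
      proof (rule map_cong[OF refl])
        fix b assume "b \<in> set bs"
        then have "(fst b, snd b) \<in> symbols P M" using bs(2) by auto
        from g[OF this] show "((\<lambda>b. palg_op P N (fst b) (snd b)) \<circ> (\<lambda>b. (fst b, map \<phi> (snd b)))) b =
            (free_ext N \<phi> \<circ> (\<lambda>b. gen (fst b) (snd b))) b" by simp
      qed
      finally show "free_ext N \<phi> (plug_mult P M \<mu> us) = palg_op P N \<mu> (map (free_ext N \<phi>) us)" .
    qed
  qed
qed

end

section \<open>Identities and composites of morphisms\<close>

context operad
begin

lemma U_hom_id:
  assumes "unstable_module M"
  shows "(\<lambda>x\<in>carrier M. x) \<in> U_hom M M"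
proof -
  interpret unstable_module M by (rule assms)
  show ?thesis
  proof (rule U_homI[OF assms assms])
    show "f2_map M M (\<lambda>x\<in>carrier M. x)" by (rule f2_mapI) (simp_all add: f2_closed[OF f2])
    show "(\<lambda>x\<in>carrier M. x) x \<in> hdeg M d" if "x \<in> hdeg M d" for x d
      using that subsetD[OF hdeg_closed that] by simp
  qed (simp_all add: Sq_closed)
qed

lemma U_hom_compose:
  assumes M: "unstable_module M" and N: "unstable_module N" and L: "unstable_module L"
    and f: "f \<in> U_hom M N" and g: "g \<in> U_hom N L"
  shows "compose (carrier M) g f \<in> U_hom M L"
proof -
  interpret M: unstable_module M by (rule M)
  note F = U_hom_map[OF M N f] and G = U_hom_map[OF N L g]
  have c: "compose (carrier M) g f x = g (f x)" if "x \<in> carrier M" for x using that by (simp add: compose_def)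
  show ?thesis
  proof (rule U_homI[OF M L f2_map_cong[OF f2_map_comp[OF F(1) G(1)] c M.f2]])
    show "compose (carrier M) g f x \<in> hdeg L d" if "x \<in> hdeg M d" for x d
      unfolding c[OF subsetD[OF M.hdeg_closed that]] by (rule G(3)[OF F(3)[OF that]])
    show "compose (carrier M) g f (Sq M i x) = Sq L i (compose (carrier M) g f x)" if x: "x \<in> carrier M" for x i
      unfolding c[OF x] c[OF M.Sq_closed[OF x]] F(4)[OF x] by (rule G(4)[OF f2_mapD(1)[OF F(1) x]])
  qed (simp_all add: compose_extensional)
qed

lemma palg_hom_U_hom: "\<lbrakk>U_palgebra P A; U_palgebra P B; f \<in> palg_hom P A B\<rbrakk> \<Longrightarrow> f \<in> U_hom A B"
  using palg_hom_iff by blast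

lemma palg_hom_id:
  assumes A: "U_palgebra P A"
  shows "(\<lambda>x\<in>carrier A. x) \<in> palg_hom P A A"
  unfolding palg_hom_iff[OF A A]
proof (intro conjI allI impI)
  show "(\<lambda>x\<in>carrier A. x) \<in> U_hom A A" by (rule U_hom_id[OF palg_struct(1)[OF A]])
  fix \<mu> xs assume s: "(\<mu>, xs) \<in> symbols P A"
  then have "map (\<lambda>x\<in>carrier A. x) xs = xs" by (intro map_idI) (auto simp: symbols_iff)
  then show "(\<lambda>x\<in>carrier A. x) (palg_op P A \<mu> xs) = palg_op P A \<mu> (map (\<lambda>x\<in>carrier A. x) xs)"
    using schur_compatD(1)[OF palg_op_compat[OF A] s] by simp
qed

lemma palg_hom_compose:
  assumes A: "U_palgebra P A" and B: "U_palgebra P B" and C: "U_palgebra P C"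
    and f: "f \<in> palg_hom P A B" and g: "g \<in> palg_hom P B C"
  shows "compose (carrier A) g f \<in> palg_hom P A C"
  unfolding palg_hom_iff[OF A C]
proof (intro conjI allI impI)
  note U = palg_struct(1)[OF A] palg_struct(1)[OF B] palg_struct(1)[OF C]
  note fU = palg_hom_U_hom[OF A B f] and gU = palg_hom_U_hom[OF B C g]
  show "compose (carrier A) g f \<in> U_hom A C" by (rule U_hom_compose[OF U fU gU])
  fix \<mu> xs assume s: "(\<mu>, xs) \<in> symbols P A"
  have sB: "(\<mu>, map f xs) \<in> symbols P B"
    using s f2_mapD(1)[OF U_hom_map(1)[OF U(1,2) fU]] by (auto simp: symbols_iff)
  have "map (compose (carrier A) g f) xs = map g (map f xs)"
    using s by (auto simp: symbols_iff compose_def)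
  moreover have "f (palg_op P A \<mu> xs) = palg_op P B \<mu> (map f xs)"
    using f s unfolding palg_hom_iff[OF A B] by blast
  moreover have "g (palg_op P B \<mu> (map f xs)) = palg_op P C \<mu> (map g (map f xs))"
    using g sB unfolding palg_hom_iff[OF B C] by blast
  ultimately show "compose (carrier A) g f (palg_op P A \<mu> xs) = palg_op P C \<mu> (map (compose (carrier A) g f) xs)"
    using schur_compatD(1)[OF palg_op_compat[OF A] s] by (simp only: compose_eq)
qed

end

section \<open>The functor and the adjunction for a fixed commutative operation\<close>

locale star_operad = operad P for P :: "'p operad_data" +
  fixes star :: 'p
  assumes star: "star \<in> op_invariants P 2"
begin

abbreviation "K M \<equiv> K_obj P star M"
abbreviation "\<pi> M \<equiv> K_proj P star M"
abbreviation "FA M \<equiv> free_palgebra P M"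

context
  fixes M :: "'a umodule"
  assumes M: "unstable_module M"
begin

interpretation M: operad_unstable P M
  by (intro operad_unstable.intro operad_axioms M)

interpretation I: palg_ideal P "FA M" "star_ideal P star M"
  unfolding star_ideal_def Let_def by (rule star_gen_homogeneous[OF M.free_palgebra star])

lemma FA_carrier: "carrier (FA M) = carrier (schur P M)"
  by (rule same_umoduleD(1)[OF free_same])

lemma K_star_unstable: "star_unstable_palgebra P star (K M)"
  unfolding K_obj_def star_ideal_def Let_def by (rule star_quotient[OF M.free_palgebra star])

lemma K_palgebra: "U_palgebra P (K M)"
  unfolding K_obj_def by (rule I.QA_palgebra)

lemma K_proj_hom: "\<pi> M \<in> palg_hom P (FA M) (K M)"
  unfolding K_obj_def K_proj_def by (rule I.proj_hom)

lemma K_proj_closed: "t \<in> carrier (schur P M) \<Longrightarrow> \<pi> M t \<in> carrier (K M)"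
  using f2_mapD(1)[OF U_hom_map(1)[OF palg_struct(1)[OF M.free_palgebra] palg_struct(1)[OF K_palgebra]
        palg_hom_U_hom[OF M.free_palgebra K_palgebra K_proj_hom]]]
  by (simp add: FA_carrier del: schur_simps)

lemma K_cases:
  assumes "X \<in> carrier (K M)"
  obtains t where "t \<in> carrier (schur P M)" "X = \<pi> M t"
proof -
  obtain t where "t \<in> carrier (FA M)" "X = star_ideal P star M +>\<^bsub>FA M\<^esub> t"
    using assms same_umoduleD(1)[OF I.QA_same] by (auto simp: K_obj_def I.Q_simps)
  then show ?thesis using that by (simp add: FA_carrier K_proj_def I.proj_eq del: schur_simps)
qed

text \<open>Images of a coset under two maps can be exchanged when the maps agree on the carrier of
  S(P, M); this requires the coset to lie inside that carrier.\<close>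

lemma K_subset:
  assumes "X \<in> carrier (K M)"
  shows "X \<subseteq> carrier (schur P M)"
proof
  fix y assume y: "y \<in> X"
  obtain t where t: "t \<in> carrier (schur P M)" "X = \<pi> M t" using K_cases[OF assms] .
  have tA: "t \<in> carrier (FA M)" unfolding FA_carrier by (rule t(1))
  have "y \<in> star_ideal P star M +>\<^bsub>FA M\<^esub> t" using y t(2) by (simp only: K_proj_def I.proj_eq[OF tA])
  from f2_coset_mem(2)[OF I.f2 I.ideal_submodule tA this] show "y \<in> carrier (schur P M)" unfolding FA_carrier .
qed

lemma K_descend:
  assumes N: "star_unstable_palgebra P star N" and h: "h \<in> palg_hom P (FA M) N"
  shows "(\<lambda>X\<in>carrier (K M). the_elem (h ` X)) \<in> palg_hom P (K M) N"
    and "t \<in> carrier (schur P M) \<Longrightarrow> (\<lambda>X\<in>carrier (K M). the_elem (h ` X)) (\<pi> M t) = h t"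
proof -
  have NU: "U_palgebra P N" using N by (simp add: star_unstable_palgebra_def)
  have z: "h x = \<zero>\<^bsub>N\<^esub>" if "x \<in> star_ideal P star M" for x
    using that unfolding star_ideal_def Let_def by (rule star_ideal_kernel[OF M.free_palgebra N h star])
  show "(\<lambda>X\<in>carrier (K M). the_elem (h ` X)) \<in> palg_hom P (K M) N"
    unfolding K_obj_def by (rule I.descend(1)[OF NU h z])
  show "(\<lambda>X\<in>carrier (K M). the_elem (h ` X)) (\<pi> M t) = h t" if "t \<in> carrier (schur P M)"
  proof -
    have tA: "t \<in> carrier (FA M)" unfolding FA_carrier by (rule that)
    show ?thesis using I.descend(2)[OF NU h z tA] unfolding K_obj_def K_proj_def I.proj_eq[OF tA] .
  qed
qed

text \<open>Every element of K(M) is the projection of one of the free algebra, and on the free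
  algebra a morphism is determined by the units. All identities between morphisms out of K(M) below
  are reduced to units in this way.\<close>

lemma K_hom_ext:
  assumes N: "U_palgebra P N" and g: "g \<in> palg_hom P (K M) N" and h: "h \<in> palg_hom P (K M) N"
    and eq: "\<And>x. x \<in> carrier M \<Longrightarrow> g (\<pi> M (schur_unit P M x)) = h (\<pi> M (schur_unit P M x))"
  shows "g = h"
proof (rule extensionalityI)
  note U = U_hom_map(2)[OF palg_struct(1)[OF K_palgebra] palg_struct(1)[OF N] palg_hom_U_hom[OF K_palgebra N]]
  show "g \<in> extensional (carrier (K M))" "h \<in> extensional (carrier (K M))" by (rule U[OF g] U[OF h])+
  fix X assume "X \<in> carrier (K M)"
  then obtain t where t: "t \<in> carrier (schur P M)" "X = \<pi> M t" by (rule K_cases)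
  note c = palg_hom_compose[OF M.free_palgebra K_palgebra N K_proj_hom]
  have e: "compose (carrier (FA M)) k (\<pi> M) s = k (\<pi> M s)" if "s \<in> carrier (schur P M)" for k :: "_ \<Rightarrow> 'c" and s
    using that by (simp add: compose_def FA_carrier del: schur_simps)
  have "compose (carrier (FA M)) g (\<pi> M) t = compose (carrier (FA M)) h (\<pi> M) t"
    by (rule M.hom_unique[OF N c[OF g] c[OF h] _ t(1)]) (simp only: e[OF M.unit_closed] eq)
  then show "g X = h X" unfolding e[OF t(1)] t(2) .
qed

lemma K_unit_closed: "x \<in> carrier M \<Longrightarrow> \<pi> M (schur_unit P M x) \<in> carrier (K M)"
  by (rule K_proj_closed[OF M.unit_closed])

lemma K_unit_hom: "compose (carrier M) (\<pi> M) (schur_unit P M) \<in> U_hom M (K M)"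
  by (rule U_hom_compose[OF M M.schur_unstable palg_struct(1)[OF K_palgebra] M.unit_U_hom
        M.hom_U_hom[OF K_palgebra K_proj_hom]])

lemma K_adjunct_hom:
  assumes N: "U_palgebra P N" and g: "g \<in> palg_hom P (K M) N"
  shows "K_adjunct P star M g \<in> U_hom M N"
proof -
  have "K_adjunct P star M g = compose (carrier M) g (compose (carrier M) (\<pi> M) (schur_unit P M))"
    by (auto simp: K_adjunct_def compose_def)
  then show ?thesis
    using U_hom_compose[OF M palg_struct(1)[OF K_palgebra] palg_struct(1)[OF N] K_unit_hom
        palg_hom_U_hom[OF K_palgebra N g]] by simp
qed

lemma K_adjunct_bij:
  assumes N: "star_unstable_palgebra P star N"
  shows "bij_betw (K_adjunct P star M) (palg_hom P (K M) N) (U_hom M (forget N))"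
  unfolding same_U_hom(2)[OF forget_same]
proof (rule bij_betwI')
  have NU: "U_palgebra P N" using N by (simp add: star_unstable_palgebra_def)
  show "K_adjunct P star M g \<in> U_hom M N" if "g \<in> palg_hom P (K M) N" for g
    by (rule K_adjunct_hom[OF NU that])
  show "K_adjunct P star M g = K_adjunct P star M h \<longleftrightarrow> g = h"
    if g: "g \<in> palg_hom P (K M) N" and h: "h \<in> palg_hom P (K M) N" for g h
  proof
    assume eq: "K_adjunct P star M g = K_adjunct P star M h"
    show "g = h"
    proof (rule K_hom_ext[OF NU g h])
      fix x assume "x \<in> carrier M"
      then show "g (\<pi> M (schur_unit P M x)) = h (\<pi> M (schur_unit P M x))"
        using fun_cong[OF eq, of x] by (simp add: K_adjunct_def)
    qed
  qed simp
  show "\<exists>g\<in>palg_hom P (K M) N. \<phi> = K_adjunct P star M g" if \<phi>: "\<phi> \<in> U_hom M N" for \<phi>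
  proof (rule bexI)
    note fe = M.free_ext[OF NU \<phi>]
    \<comment> \<open>The preimage of \<phi>: extend it to the free algebra, then pass to the
      quotient, which is possible because \<open>N\<close> satisfies the star condition.\<close>
    let ?g = "\<lambda>X\<in>carrier (K M). the_elem (M.free_ext N \<phi> ` X)"
    show "?g \<in> palg_hom P (K M) N" by (rule K_descend(1)[OF N fe(1)])
    show "\<phi> = K_adjunct P star M ?g"
    proof (rule extensionalityI)
      show "\<phi> \<in> extensional (carrier M)" by (rule U_hom_map(2)[OF M palg_struct(1)[OF NU] \<phi>])
      show "K_adjunct P star M ?g \<in> extensional (carrier M)" unfolding K_adjunct_def by (rule restrict_extensional)
      fix x assume x: "x \<in> carrier M"
      have "K_adjunct P star M ?g x = ?g (\<pi> M (schur_unit P M x))"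
        unfolding K_adjunct_def by (rule restrict_apply'[OF x])
      also have "\<dots> = \<phi> x" unfolding K_descend(2)[OF N fe(1) M.unit_closed[OF x]] by (rule fe(3)[OF x])
      finally show "\<phi> x = K_adjunct P star M ?g x" ..
    qed
  qed
qed

end

text \<open>The map is recognised as the factorisation through K(M) of the free extension of M
  \<rightarrow> M' \<rightarrow> K(M'). Well-definedness on cosets and the morphism property are
  then instances of the universal properties.\<close>

lemma K_map_hom:
  fixes M :: "'a umodule" and M' :: "'b umodule"
  assumes M: "unstable_module M" and M': "unstable_module M'" and f: "f \<in> U_hom M M'"
  shows "K_map P star M M' f \<in> palg_hom P (K M) (K M')"
    and "x \<in> carrier M \<Longrightarrow> K_map P star M M' f (\<pi> M (schur_unit P M x)) = \<pi> M' (schur_unit P M' (f x))"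
proof -
  interpret M: operad_unstable P M by (intro operad_unstable.intro operad_axioms M)
  interpret M': operad_unstable P M' by (intro operad_unstable.intro operad_axioms M')
  note K' = K_palgebra[OF M']
  let ?\<phi> = "compose (carrier M) (compose (carrier M') (\<pi> M') (schur_unit P M')) f"
  have \<phi>: "?\<phi> \<in> U_hom M (K M')"
    by (rule U_hom_compose[OF M M' palg_struct(1)[OF K'] f K_unit_hom[OF M']])
  note fe = M.free_ext[OF K' \<phi>]
  note fm = U_hom_map(1)[OF M M' f]
  have \<phi>x: "?\<phi> x = \<pi> M' (schur_unit P M' (f x))" if "x \<in> carrier M" for x
    using that f2_mapD(1)[OF fm that] by (simp add: compose_def)
  have h: "M.free_ext (K M') ?\<phi> t = \<pi> M' (schur_map P M M' f t)" if t: "t \<in> carrier (schur P M)" for t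
  proof (rule schur_ext[OF M.f2 unstable_module.f2[OF palg_struct(1)[OF K']] _ _ _ t])
    note sm = schur_map_facts[OF M.f2 M'.f2 fm]
    show "f2_map (schur P M) (K M') (M.free_ext (K M') ?\<phi>)"
      by (rule U_hom_map(1)[OF M.schur_unstable palg_struct(1)[OF K'] M.hom_U_hom[OF K' fe(1)]])
    show "f2_map (schur P M) (K M') (\<lambda>t. \<pi> M' (schur_map P M M' f t))"
      by (rule f2_map_comp[OF sm(1)
            U_hom_map(1)[OF M'.schur_unstable palg_struct(1)[OF K'] M'.hom_U_hom[OF K' K_proj_hom[OF M']]]])
    fix \<mu> xs assume s: "(\<mu>, xs) \<in> symbols P M"
    have s': "(\<mu>, map f xs) \<in> symbols P M'" using s f2_mapD(1)[OF fm] by (auto simp: symbols_iff)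
    have "map ?\<phi> xs = map (\<lambda>x. \<pi> M' (schur_unit P M' x)) (map f xs)"
      unfolding map_map using s \<phi>x by (intro map_cong) (auto simp: symbols_iff)
    then show "M.free_ext (K M') ?\<phi> (schur_gen P M \<mu> xs) = \<pi> M' (schur_map P M M' f (schur_gen P M \<mu> xs))"
      unfolding fe(2)[OF s] sm(3)[OF s] M'.hom_on_gen[OF K' K_proj_hom[OF M'] s'] by (rule arg_cong)
  qed
  \<comment> \<open>The free extension agrees with the projection after S(P, f) on the carrier only,
    so the images are compared coset by coset.\<close>
  have eq: "K_map P star M M' f = (\<lambda>X\<in>carrier (K M). the_elem (M.free_ext (K M') ?\<phi> ` X))"
    unfolding K_map_def
  proof (rule restrict_ext)
    fix X assume X: "X \<in> carrier (K M)"
    have "(\<lambda>t. \<pi> M' (schur_map P M M' f t)) ` X = M.free_ext (K M') ?\<phi> ` X"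
      by (rule image_cong[OF refl]) (rule h[OF subsetD[OF K_subset[OF M X]], symmetric])
    then show "the_elem ((\<lambda>t. \<pi> M' (schur_map P M M' f t)) ` X) = the_elem (M.free_ext (K M') ?\<phi> ` X)"
      by (rule arg_cong)
  qed
  note d = K_descend[OF M K_star_unstable[OF M'] fe(1)]
  show "K_map P star M M' f \<in> palg_hom P (K M) (K M')" unfolding eq by (rule d(1))
  show "K_map P star M M' f (\<pi> M (schur_unit P M x)) = \<pi> M' (schur_unit P M' (f x))" if x: "x \<in> carrier M"
    unfolding eq d(2)[OF M.unit_closed[OF x]] fe(3)[OF x] by (rule \<phi>x[OF x])
qed

lemma K_map_id:
  fixes M :: "'a umodule"
  assumes M: "unstable_module M"
  shows "K_map P star M M (\<lambda>x\<in>carrier M. x) = (\<lambda>X\<in>carrier (K M). X)"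
  by (rule K_hom_ext[OF M K_palgebra[OF M] K_map_hom(1)[OF M M U_hom_id[OF M]] palg_hom_id[OF K_palgebra[OF M]]])
     (simp add: K_map_hom(2)[OF M M U_hom_id[OF M]] K_unit_closed[OF M])

text \<open>Both sides are morphisms out of K(M), and on a unit both give the unit of the image of x
  under f and then g.\<close>

lemma K_map_compose:
  fixes M :: "'a umodule" and M' :: "'b umodule" and M'' :: "'c umodule"
  assumes M: "unstable_module M" and M': "unstable_module M'" and M'': "unstable_module M''"
    and f: "f \<in> U_hom M M'" and g: "g \<in> U_hom M' M''"
  shows "K_map P star M M'' (compose (carrier M) g f) =
    compose (carrier (K M)) (K_map P star M' M'' g) (K_map P star M M' f)"
proof (rule K_hom_ext[OF M K_palgebra[OF M'']])
  note gf = U_hom_compose[OF M M' M'' f g]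
  show "K_map P star M M'' (compose (carrier M) g f) \<in> palg_hom P (K M) (K M'')" by (rule K_map_hom(1)[OF M M'' gf])
  show "compose (carrier (K M)) (K_map P star M' M'' g) (K_map P star M M' f) \<in> palg_hom P (K M) (K M'')"
    by (rule palg_hom_compose[OF K_palgebra[OF M] K_palgebra[OF M'] K_palgebra[OF M'']
          K_map_hom(1)[OF M M' f] K_map_hom(1)[OF M' M'' g]])
  fix x assume x: "x \<in> carrier M"
  then have "f x \<in> carrier M'" by (rule f2_mapD(1)[OF U_hom_map(1)[OF M M' f]])
  then show "K_map P star M M'' (compose (carrier M) g f) (\<pi> M (schur_unit P M x)) =
      compose (carrier (K M)) (K_map P star M' M'' g) (K_map P star M M' f) (\<pi> M (schur_unit P M x))"
    unfolding compose_eq[OF K_unit_closed[OF M x]] K_map_hom(2)[OF M M'' gf x] K_map_hom(2)[OF M M' f x] compose_eq[OF x]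
    by (rule K_map_hom(2)[OF M' M'' g, symmetric])
qed

lemma K_adjunct_natural_left:
  fixes M :: "'a umodule" and M' :: "'b umodule"
  assumes M: "unstable_module M" and M': "unstable_module M'" and f: "f \<in> U_hom M M'"
  shows "K_adjunct P star M (compose (carrier (K M)) g (K_map P star M M' f)) =
    compose (carrier M) (K_adjunct P star M' g) f"
  unfolding K_adjunct_def compose_def[of "carrier M"]
proof (rule restrict_ext)
  fix x assume x: "x \<in> carrier M"
  then have "f x \<in> carrier M'" by (rule f2_mapD(1)[OF U_hom_map(1)[OF M M' f]])
  then show "compose (carrier (K M)) g (K_map P star M M' f) (\<pi> M (schur_unit P M x)) =
      (\<lambda>x\<in>carrier M'. g (\<pi> M' (schur_unit P M' x))) (f x)"
    by (simp add: compose_eq[OF K_unit_closed[OF M x]] K_map_hom(2)[OF M M' f x])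
qed

lemma K_adjunct_natural_right:
  fixes M :: "'a umodule"
  assumes M: "unstable_module M"
  shows "K_adjunct P star M (compose (carrier (K M)) h g) = compose (carrier M) h (K_adjunct P star M g)"
  unfolding K_adjunct_def compose_def[of "carrier M"]
  by (rule restrict_ext) (simp add: compose_eq[OF K_unit_closed[OF M]])

end

theorem proposition6p7:
  fixes P :: "'p operad_data" and star :: 'p
  assumes "operad P" and "star \<in> op_invariants P 2"
  shows
    "(\<forall>M :: 'a umodule. unstable_module M \<longrightarrow> star_unstable_palgebra P star (K_obj P star M))
   \<and> ((\<forall>(M :: 'a umodule) (M' :: 'b umodule). unstable_module M \<and> unstable_module M' \<longrightarrow>
         (\<forall>f \<in> U_hom M M'. K_map P star M M' f \<in> palg_hom P (K_obj P star M) (K_obj P star M')))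
     \<and> (\<forall>M :: 'a umodule. unstable_module M \<longrightarrow>
         K_map P star M M (\<lambda>x\<in>carrier M. x) = (\<lambda>X\<in>carrier (K_obj P star M). X))
     \<and> (\<forall>(M :: 'a umodule) (M' :: 'b umodule) (M'' :: 'c umodule).
         unstable_module M \<and> unstable_module M' \<and> unstable_module M'' \<longrightarrow>
         (\<forall>f \<in> U_hom M M'. \<forall>g \<in> U_hom M' M''.
            K_map P star M M'' (compose (carrier M) g f) =
            compose (carrier (K_obj P star M)) (K_map P star M' M'' g) (K_map P star M M' f))))
   \<and> ((\<forall>(M :: 'a umodule) (N :: ('p, 'd) palgebra).
         unstable_module M \<and> star_unstable_palgebra P star N \<longrightarrow>
         bij_betw (K_adjunct P star M) (palg_hom P (K_obj P star M) N) (U_hom M (forget N)))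
     \<and> (\<forall>(M :: 'a umodule) (M' :: 'b umodule) (N :: ('p, 'd) palgebra).
         unstable_module M \<and> unstable_module M' \<and> star_unstable_palgebra P star N \<longrightarrow>
         (\<forall>f \<in> U_hom M M'. \<forall>g \<in> palg_hom P (K_obj P star M') N.
            K_adjunct P star M (compose (carrier (K_obj P star M)) g (K_map P star M M' f)) =
            compose (carrier M) (K_adjunct P star M' g) f))
     \<and> (\<forall>(M :: 'a umodule) (N :: ('p, 'd) palgebra) (N' :: ('p, 'e) palgebra).
         unstable_module M \<and> star_unstable_palgebra P star N \<and> star_unstable_palgebra P star N' \<longrightarrow>
         (\<forall>g \<in> palg_hom P (K_obj P star M) N. \<forall>h \<in> palg_hom P N N'.
            K_adjunct P star M (compose (carrier (K_obj P star M)) h g) =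
            compose (carrier M) h (K_adjunct P star M g))))"
proof -
  interpret star_operad P star
    using assms by (intro star_operad.intro star_operad_axioms.intro)
  show ?thesis
    by (intro conjI allI impI ballI; (elim conjE)?)
       (rule K_star_unstable K_map_hom(1) K_map_id K_map_compose K_adjunct_bij
          K_adjunct_natural_left K_adjunct_natural_right; assumption)+
qed

end
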